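(* Let $\mathcal P,\mathcal H,\mathcal M,\mathcal Q$ and $\mathcal A,\mathcal K,\mathcal D,\mathcal B$ satisfy the assumptions listed in the context, and let $T>0$. Let $f\in H^1(0,T;\mathcal M)$, $g\in W(0,T;\mathcal P^*,\mathcal P_{\ker}^* )$, $h\in H^2(0,T;\mathcal Q^* )$. Let $p(0)=p_0(0)\in\mathcal P$ with $\mathcal B p_0(0)=h(0)$, let $m(0)\in\mathcal M$, and assume there exists $p^\star\in\mathcal H_{\ker}$ with $$(p^\star,q_{\ker})_{\mathcal H}=\big\langle g(0)-(\mathcal L+\mathcal A)p_0(0)-\mathcal B^-\dot h(0)+\mathcal K^*\mathcal D^{-1}f(0),\,q_{\ker}\big\rangle\qquad\text{for all }q_{\ker}\in\mathcal P_{\ker}.$$ For $\varepsilon>0$ let $(p,m,\lambda)$ be the (mild) solution of $$\dot p+\mathcal A p-\mathcal K^*m+\mathcal B^*\lambda=g\ \text{ in }\mathcal P^*,\qquad \varepsilon\dot m+\mathcal K p+\mathcal D m=f\ \text{ in }\mathcal M^*,\qquad \mathcal B p=h\ \text{ in }\mathcal Q^*$$ with initial values $p(0),m(0)$, and let $(p_0,m_0,\lambda_0)$ be the solution of $$\dot p_0+\mathcal A p_0-\mathcal K^*m_0+\mathcal B^*\lambda_0=g\ \text{ in }\mathcal P^*,\qquad \mathcal K p_0+\mathcal D m_0=f\ \text{ in }\mathcal M^*,\qquad \mathcal B p_0=h\ \text{ in }\mathcal Q^*$$ with initial value $p_0(0)$. Then for $0\le t\le T$ $$\|(p-p_0)(t)\|_{\mathcal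 H}^2+\varepsilon\|(m-m_0)(t)\|_{\mathcal M}^2+c_{\mathcal D}\int_0^t\|(m-m_0)(s)\|_{\mathcal M}^2\,ds\ \lesssim\ \varepsilon\,e^{2C_{\mathcal A}t}\,\|m(0)-m_0(0)\|_{\mathcal M}^2+\varepsilon^2\,e^{4C_{\mathcal A}t}\,\widetilde C_{\rm data},$$ where the constant $\widetilde C_{\rm data}$ depends only on the initial data, $\|p^\star\|_{\mathcal H_{\ker}}^2$, $\|f\|_{H^1(0,T;\mathcal M)}^2$, $\|g\|_{W(0,T;\mathcal P^*,\mathcal P_{\ker}^* )}^2$ and $\|h\|_{H^2(0,T;\mathcal Q^* )}^2$.
   Context: Spaces: $\mathcal P,\mathcal H,\mathcal M,\mathcal Q$ are real Hilbert spaces; $\mathcal P\hookrightarrow\mathcal H\cong\mathcal H^*\hookrightarrow\mathcal P^*$ is a Gelfand triple with dense embeddings; $\mathcal M$ is identified with its dual, $\mathcal M\cong\mathcal M^*$. $H^k(0,T;X)$, $L^2(0,T;X)$ are Sobolev–Bochner spaces; dots denote time derivatives. Operators: $\mathcal A:\mathcal H\to\mathcal H^*$, $\mathcal K:\mathcal P\to\mathcal M^*$, $\mathcal D:\mathcal M\to\mathcal M^*$, $\mathcal B:\mathcal P\to\mathcal Q^*$ are linear and bounded with operator norms $C_{\mathcal A},C_{\mathcal K},C_{\mathcal D},C_{\mathcal B}$. $\mathcal D$ is elliptic: $c_{\mathcal D}\|m\|_{\mathcal M}^2\le\langle\mathcal D m,m\rangle$ for all $m\in\mathcal M$, with $c_{\mathcal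 D}>0$. $\mathcal B$ is inf-sup stable: $\inf_{\mu\in\mathcal Q\setminus\{0\}}\sup_{q\in\mathcal P\setminus\{0\}}\frac{\langle\mathcal B q,\mu\rangle}{\|q\|_{\mathcal P}\|\mu\|_{\mathcal Q}}=\beta>0$. With $\mathcal P_{\ker}:=\ker\mathcal B\subseteq\mathcal P$ there is $c_{\mathcal K}>0$ with $c_{\mathcal K}\|q\|_{\mathcal P}\le\|\mathcal K q\|_{\mathcal M^*}$ for all $q\in\mathcal P_{\ker}$. $\mathcal H_{\ker}$ is the closure of $\mathcal P_{\ker}$ in $\mathcal H$. $\mathcal B^-:\mathcal Q^*\to\mathcal P$ is the bounded right inverse of $\mathcal B$ with values in $\mathcal P_{\ker}^\perp$ (so $\|\mathcal B^-\mu\|_{\mathcal P}\le\beta^{-1}\|\mu\|_{\mathcal Q^*}$). $\mathcal L:=\mathcal K^*\mathcal D^{-1}\mathcal K:\mathcal P\to\mathcal P^*$. An identity in $\mathcal P_{\ker}^*$ means that it is tested with elements of $\mathcal P_{\ker}$ only. $g\in W(0,T;\mathcal P^*,\mathcal P_{\ker}^* )$ means $g\in L^2(0,T;\mathcal P^* )$ and $g$, viewed as $\mathcal P_{\ker}^*$-valued (by restriction to $\mathcal P_{\ker}$), has a weak derivative $\dot g\in L^2(0,T;\mathcal P_{\ker}^* )$; the norm is the corresponding graph norm, and $g(0)$ is understood in $\mathcal P_{\ker}^*$. Mild solution of the $\varepsilon$-system: let $(\bar p,\bar m)\in H^1(0,T;\mathcal P_{\ker})\times H^1(0,T;\mathcal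 M)$ be the unique (pointwise in time) solution of $(\mathcal A+C_{\mathcal A}\,\mathrm{id})\bar p-\mathcal K^*\bar m=g$ in $\mathcal P_{\ker}^*$, $\mathcal K\bar p+\mathcal D\bar m=0$ in $\mathcal M^*$ ($\mathrm{id}$ is the Riesz identification $\mathcal H\cong\mathcal H^*$). For $\gamma>0$ let $A_\gamma(q,n):=(-\gamma\mathcal A q+\mathcal K^*n,\,-\mathcal K q-\gamma^{-1}\mathcal D n)$ on $\mathcal H_{\ker}\times\mathcal M$ with domain $\mathcal P_{\ker}\times\{n\in\mathcal M:\exists\,n^\star\in\mathcal H_{\ker},\ (n^\star,q)_{\mathcal H}=\langle\mathcal K^*n,q\rangle\ \forall q\in\mathcal P_{\ker}\}$ (identifying $\mathcal K^*n$ with $n^\star$, and functionals on $\mathcal H_{\ker}$ and $\mathcal M$ with elements); it generates a $C_0$-semigroup. $(p,m)$ is the mild solution if $x:=(\varepsilon^{-1/2}(p-\bar p-\mathcal B^-h),\,m-\bar m)$ is $\mathcal H_{\ker}\times\mathcal M$-valued and is the mild solution, i.e. is given by the variation-of-constants formula, of $\dot x=\varepsilon^{-1/2}A_{\sqrt\varepsilon}x+F$ with $F=\big(\varepsilon^{-1/2}(C_{\mathcal A}\bar p-\dot{\bar p}-\mathcal A\mathcal B^-h-\mathcal B^-\dot h),\ \varepsilon^{-1}(f-\mathcal K\mathcal B^-h)-\dot{\bar m}\big)$ and the corresponding initial value. The multiplier $\lambda$ (existing in a distributional sense) plays no role in the claim. Solution of the limit system: $p_0\in L^2(0,T;\mathcal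 P)\cap C([0,T],\mathcal H)$, $m_0\in L^2(0,T;\mathcal M)$, with the first equation holding in $\mathcal P_{\ker}^*$ (distributional time derivative; $\lambda_0$ drops out), the second and third equations for a.e. $t$, and the initial condition. It exists and is unique; under the hypotheses $p_0\in H^1(0,T;\mathcal P)\cap C^1([0,T],\mathcal H)$ and $m_0\in H^1(0,T;\mathcal M)$, so $m_0(0)$ is well defined. Notation: $a\lesssim b$ means $a\le c\,b$ with a generic constant $c>0$, which here depends only on $T$ and on the spaces and operators, but not on $\varepsilon$, $t$, the right-hand sides or the initial data. Likewise $\widetilde C_{\rm data}$ is independent of $\varepsilon$ and $t$. *)

theory Defs
  imports "HOL-Analysis.Analysis"
begin

section \<open>Sobolev--Bochner spaces on a bounded interval\<close>

text \<open>
  The library's Bochner integral requires a second countable codomain. The Hilbert spaces here need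
  not be separable and their duals are types of bounded linear functionals, so the Bochner integral
  is restated for arbitrary normed spaces; strong measurability takes the place of Borel
  measurability. All measures used below are complete (restrictions of \<^const>\<open>lebesgue\<close>).
\<close>

definition strongly_measurable :: "'a measure \<Rightarrow> ('a \<Rightarrow> 'b::real_normed_vector) \<Rightarrow> bool" where
  "strongly_measurable M u \<longleftrightarrow>
     (\<exists>s. (\<forall>i::nat. simple_function M (s i)) \<and> (AE t in M. (\<lambda>i. s i t) \<longlonglongrightarrow> u t))"

definition has_strong_integral ::
    "'a measure \<Rightarrow> ('a \<Rightarrow> 'b::real_normed_vector) \<Rightarrow> 'b \<Rightarrow> bool" where
  "has_strong_integral M u I \<longleftrightarrow> strongly_measurable M u \<and>
     (\<exists>s. (\<forall>i::nat. Bochner_Integration.simple_bochner_integrable M (s i)) \<and>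
          (\<lambda>i. \<integral>\<^sup>+t. ennreal (norm (u t - s i t)) \<partial>M) \<longlonglongrightarrow> 0 \<and>
          (\<lambda>i. Bochner_Integration.simple_bochner_integral M (s i)) \<longlonglongrightarrow> I)"

definition L2 :: "real \<Rightarrow> (real \<Rightarrow> 'b::real_normed_vector) \<Rightarrow> bool" where
  "L2 T u \<longleftrightarrow> strongly_measurable (lebesgue_on {0..T}) u \<and>
     (\<integral>\<^sup>+t. ennreal ((norm (u t))\<^sup>2) \<partial>lebesgue_on {0..T}) < \<infinity>"

definition L2_sqnorm :: "real \<Rightarrow> (real \<Rightarrow> 'b::real_normed_vector) \<Rightarrow> real" where
  "L2_sqnorm T u = (LINT t|lebesgue_on {0..T}. (norm (u t))\<^sup>2)"

definition test_function :: "real \<Rightarrow> (real \<Rightarrow> real) \<Rightarrow> bool" where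
  "test_function T \<phi> \<longleftrightarrow> (\<forall>k x. (deriv ^^ k) \<phi> differentiable (at x)) \<and>
     (\<exists>a b. 0 < a \<and> b < T \<and> (\<forall>x. x \<notin> {a..b} \<longrightarrow> \<phi> x = 0))"

definition is_weak_deriv ::
    "real \<Rightarrow> (real \<Rightarrow> 'b::real_normed_vector) \<Rightarrow> (real \<Rightarrow> 'b) \<Rightarrow> bool" where
  "is_weak_deriv T u v \<longleftrightarrow> (\<forall>\<phi>. test_function T \<phi> \<longrightarrow>
     (\<exists>I. has_strong_integral (lebesgue_on {0..T}) (\<lambda>t. deriv \<phi> t *\<^sub>R u t) I \<and>
          has_strong_integral (lebesgue_on {0..T}) (\<lambda>t. \<phi> t *\<^sub>R v t) (- I)))"

definition H1 :: "real \<Rightarrow> (real \<Rightarrow> 'b::real_normed_vector) \<Rightarrow> bool" where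
  "H1 T u \<longleftrightarrow> L2 T u \<and> (\<exists>v. L2 T v \<and> is_weak_deriv T u v)"

text \<open>
  The weak derivative is unique up to null sets; \<open>wderiv\<close> picks one representative. In the same way
  \<open>crep\<close> is the continuous representative of a class of functions modulo null sets (unique on
  \<open>{0..T}\<close>). Elements of Lebesgue and Sobolev spaces are passed around as arbitrary representatives,
  and every point value of such an element is a value of its continuous representative.
\<close>

definition wderiv :: "real \<Rightarrow> (real \<Rightarrow> 'b::real_normed_vector) \<Rightarrow> real \<Rightarrow> 'b" where
  "wderiv T u = (SOME v. L2 T v \<and> is_weak_deriv T u v)"

definition crep :: "real \<Rightarrow> (real \<Rightarrow> 'b::real_normed_vector) \<Rightarrow> real \<Rightarrow> 'b" where
  "crep T u = (SOME v. continuous_on {0..T} v \<and> (AE t in lebesgue_on {0..T}. v t = u t))"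

definition H1_sqnorm :: "real \<Rightarrow> (real \<Rightarrow> 'b::real_normed_vector) \<Rightarrow> real" where
  "H1_sqnorm T u = L2_sqnorm T u + L2_sqnorm T (wderiv T u)"

definition H2 :: "real \<Rightarrow> (real \<Rightarrow> 'b::real_normed_vector) \<Rightarrow> bool" where
  "H2 T u \<longleftrightarrow> H1 T u \<and> H1 T (wderiv T u)"

definition H2_sqnorm :: "real \<Rightarrow> (real \<Rightarrow> 'b::real_normed_vector) \<Rightarrow> real" where
  "H2_sqnorm T u = L2_sqnorm T u + L2_sqnorm T (wderiv T u) + L2_sqnorm T (wderiv T (wderiv T u))"

section \<open>Semigroups and mild solutions on a closed subspace\<close>

text \<open>The values of \<open>S t\<close> outside of \<open>X\<close> and for negative \<open>t\<close> are irrelevant.\<close>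

definition C0_semigroup_on ::
    "'a::real_normed_vector set \<Rightarrow> (real \<Rightarrow> 'a \<Rightarrow> 'a) \<Rightarrow> bool" where
  "C0_semigroup_on X S \<longleftrightarrow>
     (\<forall>t\<ge>0. (\<forall>x\<in>X. S t x \<in> X) \<and>
            (\<forall>x\<in>X. \<forall>y\<in>X. S t (x + y) = S t x + S t y) \<and>
            (\<forall>x\<in>X. \<forall>a. S t (a *\<^sub>R x) = a *\<^sub>R S t x) \<and>
            (\<exists>C. \<forall>x\<in>X. norm (S t x) \<le> C * norm x)) \<and>
     (\<forall>x\<in>X. S 0 x = x) \<and>
     (\<forall>s\<ge>0. \<forall>t\<ge>0. \<forall>x\<in>X. S (s + t) x = S s (S t x)) \<and>
     (\<forall>x\<in>X. ((\<lambda>t. S t x) \<longlongrightarrow> x) (at_right 0))"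

definition generator_on ::
    "'a::real_normed_vector set \<Rightarrow> (real \<Rightarrow> 'a \<Rightarrow> 'a) \<Rightarrow> ('a \<times> 'a) set" where
  "generator_on X S =
     {(x, y). x \<in> X \<and> y \<in> X \<and> ((\<lambda>t. (1 / t) *\<^sub>R (S t x - x)) \<longlongrightarrow> y) (at_right 0)}"

text \<open>
  \<open>x\<close> is the mild solution on \<open>[0, T]\<close> of \<open>x' = G x + F\<close>, \<open>x 0 = x0\<close>, where the unbounded
  operator \<open>G\<close> on \<open>X\<close> is given by its graph.
\<close>

definition is_mild_solution ::
    "'a::real_normed_vector set \<Rightarrow> ('a \<times> 'a) set \<Rightarrow> real \<Rightarrow> (real \<Rightarrow> 'a) \<Rightarrow> 'a \<Rightarrow> (real \<Rightarrow> 'a) \<Rightarrow> bool"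
  where
  "is_mild_solution X G T F x0 x \<longleftrightarrow>
     (\<exists>S. C0_semigroup_on X S \<and> generator_on X S = G \<and>
        (\<forall>t\<in>{0..T}. x t \<in> X \<and>
           has_strong_integral (lebesgue_on {0..t}) (\<lambda>s. S (t - s) (F s)) (x t - S t x0)))"

section \<open>Operators\<close>

text \<open>
  The dual of a real normed space \<open>'a\<close> is \<open>'a \<Rightarrow>\<^sub>L real\<close>, and the pairing is application. The Riesz
  identification of a Hilbert space with its dual is \<^const>\<open>blinfun_inner_right\<close>. The embedding of
  \<open>'p\<close> into \<open>'h\<close> is the map \<open>\<iota>\<close>.
\<close>

definition dual_op ::
    "('a::real_normed_vector \<Rightarrow>\<^sub>L ('b::real_normed_vector \<Rightarrow>\<^sub>L real)) \<Rightarrow> 'b \<Rightarrow> ('a \<Rightarrow>\<^sub>L real)" where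
  "dual_op K n = Blinfun (\<lambda>q. K q n)"

text \<open>
  The element of the closed subspace \<open>S\<close> that is identified with the restriction of the functional
  \<open>\<phi>\<close> to \<open>S\<close>.
\<close>

definition riesz_rep :: "'a::real_inner set \<Rightarrow> ('a \<Rightarrow> real) \<Rightarrow> 'a" where
  "riesz_rep S \<phi> = (THE y. y \<in> S \<and> (\<forall>z\<in>S. y \<bullet> z = \<phi> z))"

definition orth_proj :: "'a::real_inner set \<Rightarrow> 'a \<Rightarrow> 'a" where
  "orth_proj S x = riesz_rep S (\<lambda>z. x \<bullet> z)"

definition Pker :: "('p::real_inner \<Rightarrow>\<^sub>L ('q::real_inner \<Rightarrow>\<^sub>L real)) \<Rightarrow> 'p set" where
  "Pker B = {q. B q = 0}"

definition Hker ::
    "('p::real_inner \<Rightarrow>\<^sub>L 'h::real_inner) \<Rightarrow> ('p \<Rightarrow>\<^sub>L ('q::real_inner \<Rightarrow>\<^sub>L real)) \<Rightarrow> 'h set" where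
  "Hker \<iota> B = closure (\<iota> ` Pker B)"

text \<open>
  A functional on the closed subspace \<open>Pker B\<close> is represented by its composition with the orthogonal
  projection onto \<open>Pker B\<close>. This is a linear isometry of the dual of \<open>Pker B\<close> into the dual of
  \<open>'p\<close>, and \<open>ker_restrict B \<phi>\<close> represents the restriction of \<open>\<phi>\<close> to \<open>Pker B\<close>.
\<close>

definition ker_restrict ::
    "('p::real_inner \<Rightarrow>\<^sub>L ('q::real_inner \<Rightarrow>\<^sub>L real)) \<Rightarrow> ('p \<Rightarrow>\<^sub>L real) \<Rightarrow> ('p \<Rightarrow>\<^sub>L real)" where
  "ker_restrict B \<phi> = Blinfun (\<lambda>q. \<phi> (orth_proj (Pker B) q))"

definition W ::
    "real \<Rightarrow> ('p::real_inner \<Rightarrow>\<^sub>L ('q::real_inner \<Rightarrow>\<^sub>L real)) \<Rightarrow> (real \<Rightarrow> ('p \<Rightarrow>\<^sub>L real)) \<Rightarrow> bool" where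
  "W T B g \<longleftrightarrow> L2 T g \<and> H1 T (\<lambda>t. ker_restrict B (g t))"

definition W_sqnorm ::
    "real \<Rightarrow> ('p::real_inner \<Rightarrow>\<^sub>L ('q::real_inner \<Rightarrow>\<^sub>L real)) \<Rightarrow> (real \<Rightarrow> ('p \<Rightarrow>\<^sub>L real)) \<Rightarrow> real" where
  "W_sqnorm T B g = L2_sqnorm T g + L2_sqnorm T (wderiv T (\<lambda>t. ker_restrict B (g t)))"

definition right_inv ::
    "('p::real_inner \<Rightarrow>\<^sub>L ('q::real_inner \<Rightarrow>\<^sub>L real)) \<Rightarrow> ('q \<Rightarrow>\<^sub>L real) \<Rightarrow> 'p" where
  "right_inv B \<mu> = (THE q. q \<in> orthogonal_comp (Pker B) \<and> B q = \<mu>)"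

definition Lop ::
    "('p::real_inner \<Rightarrow>\<^sub>L ('m::real_inner \<Rightarrow>\<^sub>L real)) \<Rightarrow> ('m \<Rightarrow>\<^sub>L ('m \<Rightarrow>\<^sub>L real)) \<Rightarrow> 'p \<Rightarrow> ('p \<Rightarrow>\<^sub>L real)"
  where
  "Lop K D p = dual_op K (inv (blinfun_apply D) (K p))"

text \<open>
  Extended reals make the infimum over an empty set \<open>\<infinity>\<close> and the supremum over an empty set \<open>-\<infinity>\<close>.
\<close>

definition inf_sup_const ::
    "('p::real_inner \<Rightarrow>\<^sub>L ('q::real_inner \<Rightarrow>\<^sub>L real)) \<Rightarrow> ereal" where
  "inf_sup_const B = (INF \<mu>\<in>UNIV - {0}. SUP q\<in>UNIV - {0}. ereal (B q \<mu> / (norm q * norm \<mu>)))"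

definition gelfand_embedding :: "('p::{real_inner,banach} \<Rightarrow>\<^sub>L 'h::{real_inner,banach}) \<Rightarrow> bool" where
  "gelfand_embedding \<iota> \<longleftrightarrow> inj (blinfun_apply \<iota>) \<and> closure (range (blinfun_apply \<iota>)) = UNIV"

text \<open>There is no condition on \<open>A\<close> beyond being a bounded operator.\<close>

definition admissible ::
    "('p::{real_inner,banach} \<Rightarrow>\<^sub>L 'h::{real_inner,banach}) \<Rightarrow> ('h \<Rightarrow>\<^sub>L ('h \<Rightarrow>\<^sub>L real)) \<Rightarrow>
     ('p \<Rightarrow>\<^sub>L ('m::{real_inner,banach} \<Rightarrow>\<^sub>L real)) \<Rightarrow> ('m \<Rightarrow>\<^sub>L ('m \<Rightarrow>\<^sub>L real)) \<Rightarrow>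
     ('p \<Rightarrow>\<^sub>L ('q::{real_inner,banach} \<Rightarrow>\<^sub>L real)) \<Rightarrow> real \<Rightarrow> bool" where
  "admissible \<iota> A K D B c\<^sub>D \<longleftrightarrow>
     gelfand_embedding \<iota> \<and>
     0 < c\<^sub>D \<and> (\<forall>m. c\<^sub>D * (norm m)\<^sup>2 \<le> D m m) \<and>
     0 < inf_sup_const B \<and>
     (\<exists>c\<^sub>K>0. \<forall>q\<in>Pker B. c\<^sub>K * norm q \<le> norm (K q))"

section \<open>The two systems\<close>

definition A_graph ::
    "('p::{real_inner,banach} \<Rightarrow>\<^sub>L 'h::{real_inner,banach}) \<Rightarrow> ('h \<Rightarrow>\<^sub>L ('h \<Rightarrow>\<^sub>L real)) \<Rightarrow>
     ('p \<Rightarrow>\<^sub>L ('m::{real_inner,banach} \<Rightarrow>\<^sub>L real)) \<Rightarrow> ('m \<Rightarrow>\<^sub>L ('m \<Rightarrow>\<^sub>L real)) \<Rightarrow>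
     ('p \<Rightarrow>\<^sub>L ('q::{real_inner,banach} \<Rightarrow>\<^sub>L real)) \<Rightarrow> real \<Rightarrow> (('h \<times> 'm) \<times> ('h \<times> 'm)) set" where
  "A_graph \<iota> A K D B \<gamma> =
     {((\<iota> q, n),
       (riesz_rep (Hker \<iota> B) (\<lambda>w. - \<gamma> * A (\<iota> q) w + n' \<bullet> w),
        riesz_rep UNIV (\<lambda>\<mu>. - K q \<mu> - (1 / \<gamma>) * D n \<mu>))) |q n n'.
      q \<in> Pker B \<and> n' \<in> Hker \<iota> B \<and> (\<forall>q'\<in>Pker B. n' \<bullet> \<iota> q' = dual_op K n q')}"

text \<open>
  The auxiliary pair used to shift the system. Its components are taken to be the continuous
  representatives.
\<close>

definition is_shift ::
    "('p::{real_inner,banach} \<Rightarrow>\<^sub>L 'h::{real_inner,banach}) \<Rightarrow> ('h \<Rightarrow>\<^sub>L ('h \<Rightarrow>\<^sub>L real)) \<Rightarrow>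
     ('p \<Rightarrow>\<^sub>L ('m::{real_inner,banach} \<Rightarrow>\<^sub>L real)) \<Rightarrow> ('m \<Rightarrow>\<^sub>L ('m \<Rightarrow>\<^sub>L real)) \<Rightarrow>
     ('p \<Rightarrow>\<^sub>L ('q::{real_inner,banach} \<Rightarrow>\<^sub>L real)) \<Rightarrow> real \<Rightarrow> (real \<Rightarrow> ('p \<Rightarrow>\<^sub>L real)) \<Rightarrow>
     (real \<Rightarrow> 'p) \<Rightarrow> (real \<Rightarrow> 'm) \<Rightarrow> bool" where
  "is_shift \<iota> A K D B T g pb mb \<longleftrightarrow>
     H1 T pb \<and> continuous_on {0..T} pb \<and> (\<forall>t\<in>{0..T}. pb t \<in> Pker B) \<and>
     H1 T mb \<and> continuous_on {0..T} mb \<and>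
     (AE t in lebesgue_on {0..T}.
        (\<forall>q\<in>Pker B. A (\<iota> (pb t)) (\<iota> q) + norm A * (\<iota> (pb t) \<bullet> \<iota> q) - dual_op K (mb t) q = g t q) \<and>
        K (pb t) + D (mb t) = 0)"

text \<open>
  The right-hand side of the shifted system. Both components are functionals, on \<open>Hker \<iota> B\<close> and on
  \<open>'m\<close> respectively, identified with elements of these spaces.
\<close>

definition shifted_rhs ::
    "('p::{real_inner,banach} \<Rightarrow>\<^sub>L 'h::{real_inner,banach}) \<Rightarrow> ('h \<Rightarrow>\<^sub>L ('h \<Rightarrow>\<^sub>L real)) \<Rightarrow>
     ('p \<Rightarrow>\<^sub>L ('m::{real_inner,banach} \<Rightarrow>\<^sub>L real)) \<Rightarrow>
     ('p \<Rightarrow>\<^sub>L ('q::{real_inner,banach} \<Rightarrow>\<^sub>L real)) \<Rightarrow> real \<Rightarrow> real \<Rightarrow>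
     (real \<Rightarrow> 'm) \<Rightarrow> (real \<Rightarrow> ('q \<Rightarrow>\<^sub>L real)) \<Rightarrow> (real \<Rightarrow> 'p) \<Rightarrow> (real \<Rightarrow> 'm) \<Rightarrow> real \<Rightarrow> 'h \<times> 'm" where
  "shifted_rhs \<iota> A K B T \<epsilon> f h pb mb t =
     (riesz_rep (Hker \<iota> B) (\<lambda>w. (1 / sqrt \<epsilon>) *
        (norm A * (\<iota> (pb t) \<bullet> w) - \<iota> (wderiv T pb t) \<bullet> w
         - A (\<iota> (right_inv B (h t))) w - \<iota> (right_inv B (wderiv T h t)) \<bullet> w)),
      riesz_rep UNIV (\<lambda>\<mu>. (1 / \<epsilon>) * (f t \<bullet> \<mu> - K (right_inv B (h t)) \<mu>) - wderiv T mb t \<bullet> \<mu>))"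

text \<open>
  The mild solution of the system with \<open>\<epsilon> > 0\<close> and initial values \<open>p_in\<close>, \<open>m_in\<close>. It takes its values
  in \<open>'h \<times> 'm\<close>; the constraint is encoded in the first component of the shifted unknown being
  \<open>Hker \<iota> B\<close>-valued.
\<close>

definition eps_mild_solution ::
    "('p::{real_inner,banach} \<Rightarrow>\<^sub>L 'h::{real_inner,banach}) \<Rightarrow> ('h \<Rightarrow>\<^sub>L ('h \<Rightarrow>\<^sub>L real)) \<Rightarrow>
     ('p \<Rightarrow>\<^sub>L ('m::{real_inner,banach} \<Rightarrow>\<^sub>L real)) \<Rightarrow> ('m \<Rightarrow>\<^sub>L ('m \<Rightarrow>\<^sub>L real)) \<Rightarrow>
     ('p \<Rightarrow>\<^sub>L ('q::{real_inner,banach} \<Rightarrow>\<^sub>L real)) \<Rightarrow> real \<Rightarrow> real \<Rightarrow>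
     (real \<Rightarrow> 'm) \<Rightarrow> (real \<Rightarrow> ('p \<Rightarrow>\<^sub>L real)) \<Rightarrow> (real \<Rightarrow> ('q \<Rightarrow>\<^sub>L real)) \<Rightarrow> 'p \<Rightarrow> 'm \<Rightarrow>
     (real \<Rightarrow> 'h) \<Rightarrow> (real \<Rightarrow> 'm) \<Rightarrow> bool" where
  "eps_mild_solution \<iota> A K D B T \<epsilon> f g h p_in m_in p m \<longleftrightarrow>
     (\<exists>pb mb. is_shift \<iota> A K D B T g pb mb \<and>
        is_mild_solution (Hker \<iota> B \<times> UNIV)
          {(x, (1 / sqrt \<epsilon>) *\<^sub>R y) |x y. (x, y) \<in> A_graph \<iota> A K D B (sqrt \<epsilon>)}
          T (shifted_rhs \<iota> A K B T \<epsilon> f h pb mb)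
          ((1 / sqrt \<epsilon>) *\<^sub>R \<iota> (p_in - pb 0 - right_inv B (crep T h 0)), m_in - mb 0)
          (\<lambda>t. ((1 / sqrt \<epsilon>) *\<^sub>R (p t - \<iota> (pb t) - \<iota> (right_inv B (crep T h t))), m t - mb t)))"

text \<open>
  The solution of the limit system with initial value \<open>p_in\<close>. Here \<open>p0\<close> is the continuous
  \<open>'h\<close>-valued function and \<open>v\<close> is the same element regarded in the square integrable \<open>'p\<close>-valued
  functions; \<open>m0\<close> is an arbitrary representative. The first equation holds in the sense of
  distributions on the open interval and is tested with elements of \<open>Pker B\<close>.
\<close>

definition limit_solution ::
    "('p::{real_inner,banach} \<Rightarrow>\<^sub>L 'h::{real_inner,banach}) \<Rightarrow> ('h \<Rightarrow>\<^sub>L ('h \<Rightarrow>\<^sub>L real)) \<Rightarrow>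
     ('p \<Rightarrow>\<^sub>L ('m::{real_inner,banach} \<Rightarrow>\<^sub>L real)) \<Rightarrow> ('m \<Rightarrow>\<^sub>L ('m \<Rightarrow>\<^sub>L real)) \<Rightarrow>
     ('p \<Rightarrow>\<^sub>L ('q::{real_inner,banach} \<Rightarrow>\<^sub>L real)) \<Rightarrow> real \<Rightarrow>
     (real \<Rightarrow> 'm) \<Rightarrow> (real \<Rightarrow> ('p \<Rightarrow>\<^sub>L real)) \<Rightarrow> (real \<Rightarrow> ('q \<Rightarrow>\<^sub>L real)) \<Rightarrow> 'p \<Rightarrow>
     (real \<Rightarrow> 'h) \<Rightarrow> (real \<Rightarrow> 'm) \<Rightarrow> bool" where
  "limit_solution \<iota> A K D B T f g h p_in p0 m0 \<longleftrightarrow>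
     continuous_on {0..T} p0 \<and> L2 T m0 \<and>
     (\<exists>v. L2 T v \<and> (AE t in lebesgue_on {0..T}. p0 t = \<iota> (v t)) \<and>
        (AE t in lebesgue_on {0..T}. K (v t) + D (m0 t) = blinfun_inner_right (f t)) \<and>
        (AE t in lebesgue_on {0..T}. B (v t) = h t)) \<and>
     (\<forall>q\<in>Pker B. \<forall>\<phi>. test_function T \<phi> \<longrightarrow>
        - (LINT t|lebesgue_on {0..T}. (p0 t \<bullet> \<iota> q) * deriv \<phi> t)
        + (LINT t|lebesgue_on {0..T}. (A (p0 t) (\<iota> q) - dual_op K (m0 t) q) * \<phi> t)
        = (LINT t|lebesgue_on {0..T}. g t q * \<phi> t)) \<and>
     p0 0 = \<iota> p_in"

end

theory Submission
  imports Defs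
begin

text \<open>
  For \<open>\<epsilon> > 0\<close> the limit \<open>m\<^sub>0\<close> satisfies the second equation of the \<open>\<epsilon>\<close>-system up to the residual
  \<open>\<epsilon> m\<^sub>0'\<close>. Subtract the two systems and test with \<open>(p - p\<^sub>0, m - m\<^sub>0)\<close>: the two terms with \<open>K\<close> cancel, the
  multipliers disappear because \<open>p - p\<^sub>0\<close> takes its values in the closure of the kernel of \<open>B\<close>, and
  ellipticity of \<open>D\<close> leaves
  \<open>d/dt (|p - p\<^sub>0|\<^sup>2 + \<epsilon> |m - m\<^sub>0|\<^sup>2) + 2 c\<^sub>D |m - m\<^sub>0|\<^sup>2 \<le> 2 |A| |p - p\<^sub>0|\<^sup>2 - 2 \<epsilon> (m\<^sub>0', m - m\<^sub>0)\<close>.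
  Young's inequality bounds the last term by \<open>c\<^sub>D |m - m\<^sub>0|\<^sup>2 + \<epsilon>\<^sup>2 |m\<^sub>0'|\<^sup>2 / c\<^sub>D\<close>, and Gronwall's inequality
  gives the claim with the integral of \<open>\<epsilon>\<^sup>2 |m\<^sub>0'|\<^sup>2 / c\<^sub>D\<close> as the error. Two points need work.

  The first is the bound of \<open>m\<^sub>0'\<close> in \<open>L\<^sup>2\<close> by the data. Eliminating \<open>m\<^sub>0 = D\<^sup>-\<^sup>1 (f - K p\<^sub>0)\<close> and lifting the
  constraint by the right inverse of \<open>B\<close> turns the limit system into a parabolic equation on the kernel of
  \<open>B\<close> with the elliptic operator \<open>L = K\<^sup>* D\<^sup>-\<^sup>1 K\<close>. The assumption on \<open>p\<^sup>*\<close> says that the time derivative of its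
  solution starts in \<open>'h\<close>, so the energy estimate for difference quotients in time is uniform
  (\<open>initial_speed\<close>, \<open>steklov_difference_bound\<close>). It yields continuous representatives and bounds for
  difference quotients, which is all that is used of \<open>m\<^sub>0'\<close> later (\<open>limit_regularity\<close>).

  The second is that the mild solution is not differentiable, and \<open>K\<^sup>* m\<close> need not be defined for it. The
  generator is dissipative up to \<open>|A|\<close>, which gives an energy inequality along orbits
  (\<open>energy_inequality\<close>) although the orbits have no derivatives. Moving averages of the
  limit solution lie in the domain of the generator and satisfy the evolution equation with the residual
  (\<open>limit_solution_averages\<close>). Along a short time step, the difference of the mild solution and such an
  average is the orbit of its current value plus an increment that has a right derivative, and this
  suffices for a differential inequality with one-sided derivatives, hence for Gronwall's inequality
  (\<open>comparison\<close>). The averaging parameter tends to zero in the integrated estimate.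

  Spaces of functions with values in a nonseparable Hilbert space are treated with the gauge integral; the
  test functions that reduce weak derivatives to primitives are built from \<open>exp (- 1 / x)\<close>.
\<close>

section \<open>Hilbert spaces\<close>

text \<open>Minimising the quadratic functional \<open>|y|\<^sup>2 / 2 - \<phi> y\<close> over the closed subspace produces the representing
  element; the Euler equation of the minimiser is the claim.\<close>

lemma riesz_exists:
  fixes S :: "'a::{real_inner,banach} set"
  assumes S: "subspace S" "closed S" and \<phi>: "bounded_linear \<phi>"
  shows "\<exists>y\<in>S. \<forall>z\<in>S. y \<bullet> z = \<phi> z"
proof -
  interpret \<phi>: bounded_linear \<phi> by (rule \<phi>)
  obtain C where C: "\<And>x. \<bar>\<phi> x\<bar> \<le> norm x * C"
    using \<phi>.bounded by (auto simp: real_norm_def)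
  define J where "J y = (norm y)\<^sup>2 / 2 - \<phi> y" for y
  have J_lower: "- (C\<^sup>2) / 2 \<le> J y" for y
  proof -
    have "0 \<le> (norm y - C)\<^sup>2" by simp
    then show ?thesis using C[of y] unfolding J_def by (simp add: power2_diff field_simps abs_le_iff)
  qed
  have bdd: "bdd_below (J ` S)" using J_lower by (auto intro!: bdd_belowI[of _ "- (C\<^sup>2) / 2"])
  have ne: "S \<noteq> {}" using S(1) subspace_0 by blast
  define I where "I = Inf (J ` S)"
  have I_le: "I \<le> J y" if "y \<in> S" for y
    unfolding I_def using bdd that by (auto intro: cInf_lower)
  have "\<exists>y\<in>S. J y < I + 1 / real (Suc n)" for n
  proof -
    have "Inf (J ` S) < I + 1 / real (Suc n)" unfolding I_def by simp
    then show ?thesis using cInf_lessD[of "J ` S"] ne by fastforce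
  qed
  then obtain y where y: "\<And>n. y n \<in> S" "\<And>n. J (y n) < I + 1 / real (Suc n)" by metis
  \<comment> \<open>the parallelogram law makes every minimising sequence a Cauchy sequence\<close>
  have par: "(norm (a - b))\<^sup>2 / 4 = J a + J b - 2 * J ((1/2) *\<^sub>R (a + b))" for a b
  proof -
    have "(norm ((1/2) *\<^sub>R (a + b)))\<^sup>2 = (norm (a + b))\<^sup>2 / 4"
      by (simp add: power_mult_distrib power2_eq_square)
    moreover have "(norm (a + b))\<^sup>2 + (norm (a - b))\<^sup>2 = 2 * (norm a)\<^sup>2 + 2 * (norm b)\<^sup>2"
      by (simp add: power2_norm_eq_inner inner_simps inner_commute)
    ultimately show ?thesis unfolding J_def
      by (simp add: \<phi>.scaleR \<phi>.add field_simps)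
  qed
  have diff: "(norm (y m - y n))\<^sup>2 \<le> 4 / real (Suc m) + 4 / real (Suc n)" for m n
  proof -
    have "(1/2) *\<^sub>R (y m + y n) \<in> S" using y S by (simp add: subspace_add subspace_scale)
    then have "I \<le> J ((1/2) *\<^sub>R (y m + y n))" by (rule I_le)
    then show ?thesis using par[of "y m" "y n"] y(2)[of m] y(2)[of n] by simp
  qed
  have "Cauchy y"
  proof (rule metric_CauchyI)
    fix e :: real assume e: "e > 0"
    obtain M :: nat where "8 / e\<^sup>2 < real M" using reals_Archimedean2 by blast
    then have M: "8 / real (Suc M) < e\<^sup>2" using e by (simp add: field_simps) (smt (verit) zero_less_power)
    have "dist (y m) (y n) < e" if "m \<ge> M" "n \<ge> M" for m n
    proof -
      have "4 / real (Suc m) \<le> 4 / real (Suc M)" "4 / real (Suc n) \<le> 4 / real (Suc M)"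
        using that by (auto intro!: divide_left_mono)
      then have "(norm (y m - y n))\<^sup>2 < e\<^sup>2" using diff[of m n] M by simp
      then show ?thesis using e by (simp add: dist_norm power_less_imp_less_base)
    qed
    then show "\<exists>M. \<forall>m\<ge>M. \<forall>n\<ge>M. dist (y m) (y n) < e" by blast
  qed
  then obtain l where l: "y \<longlonglongrightarrow> l" using Cauchy_convergent convergent_def by blast
  have lS: "l \<in> S" using S(2) y(1) l closed_sequentially by blast
  have "(\<lambda>n. J (y n)) \<longlonglongrightarrow> J l" unfolding J_def
    by (intro tendsto_intros l \<phi>.tendsto) auto
  moreover have "(\<lambda>n. I + 1 / real (Suc n)) \<longlonglongrightarrow> I + 0"
    by (intro tendsto_intros LIMSEQ_inverse_real_of_nat[unfolded inverse_eq_divide])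
  ultimately have "J l \<le> I + 0"
    using y(2) by (intro LIMSEQ_le) (auto intro: less_imp_le)
  then have min: "J l \<le> J z" if "z \<in> S" for z using I_le[OF that] by simp
  have "l \<bullet> z = \<phi> z" if z: "z \<in> S" for z
  proof -
    define k where "k = l \<bullet> z - \<phi> z"
    have "0 \<le> t * k + t\<^sup>2 * (norm z)\<^sup>2 / 2" for t
    proof -
      have "J (l + t *\<^sub>R z) = J l + t * k + t\<^sup>2 * (norm z)\<^sup>2 / 2"
      proof -
        have "(norm (l + t *\<^sub>R z))\<^sup>2 = (norm l)\<^sup>2 + 2 * t * (l \<bullet> z) + t\<^sup>2 * (norm z)\<^sup>2"
          by (simp only: power2_norm_eq_inner)
             (simp add: inner_simps inner_commute power2_eq_square algebra_simps)
        then show ?thesis unfolding J_def k_def by (simp add: \<phi>.add \<phi>.scaleR field_simps)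
      qed
      moreover have "J l \<le> J (l + t *\<^sub>R z)" using z lS S by (intro min) (simp add: subspace_add subspace_scale)
      ultimately show ?thesis by simp
    qed
    \<comment> \<open>the quadratic polynomial in \<open>t\<close> is negative at \<open>- k / (|z|\<^sup>2 + 1)\<close> unless \<open>k = 0\<close>\<close>
    then have *: "0 \<le> (- k / N) * k + (- k / N)\<^sup>2 * (norm z)\<^sup>2 / 2" for N by blast
    define N where "N = (norm z)\<^sup>2 + 1"
    have N: "N > 0" "(norm z)\<^sup>2 \<le> N" unfolding N_def by (auto simp: add_nonneg_pos)
    have "(- k / N) * k + (- k / N)\<^sup>2 * (norm z)\<^sup>2 / 2 \<le> - (k\<^sup>2 / N) + (k / N)\<^sup>2 * N / 2"
      using mult_left_mono[OF N(2), of "(k / N)\<^sup>2"] by (simp add: power2_eq_square)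
    also have "\<dots> = - (k\<^sup>2 / N) / 2" using N by (simp add: power2_eq_square field_simps)
    finally have "k\<^sup>2 / N \<le> 0" using *[of N] by simp
    then have "k = 0" using N by (simp add: divide_le_0_iff)
    then show ?thesis unfolding k_def by simp
  qed
  with lS show ?thesis by blast
qed

lemma riesz_unique:
  fixes S :: "'a::real_inner set"
  assumes "subspace S" "y \<in> S" "y' \<in> S" "\<And>z. z \<in> S \<Longrightarrow> y \<bullet> z = y' \<bullet> z"
  shows "y = y'"
proof -
  have "y - y' \<in> S" using assms by (simp add: subspace_diff)
  then have "(y - y') \<bullet> (y - y') = 0" using assms(4)[of "y - y'"] by (simp add: inner_diff_left)
  then show ?thesis by simp
qed

lemma riesz_rep_eqI:
  fixes S :: "'a::real_inner set"
  assumes "subspace S" "y \<in> S" "\<And>z. z \<in> S \<Longrightarrow> y \<bullet> z = \<phi> z"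
  shows "riesz_rep S \<phi> = y"
  unfolding riesz_rep_def
  by (rule the_equality) (use assms in \<open>auto intro!: riesz_unique[of S]\<close>)

lemma riesz_rep:
  fixes S :: "'a::{real_inner,banach} set"
  assumes "subspace S" "closed S" "bounded_linear \<phi>"
  shows riesz_rep_in: "riesz_rep S \<phi> \<in> S"
    and riesz_rep_inner: "\<And>z. z \<in> S \<Longrightarrow> riesz_rep S \<phi> \<bullet> z = \<phi> z"
proof -
  obtain y where y: "y \<in> S" "\<forall>z\<in>S. y \<bullet> z = \<phi> z" using riesz_exists[OF assms] by blast
  then have "riesz_rep S \<phi> = y" using assms(1) by (intro riesz_rep_eqI) auto
  with y show "riesz_rep S \<phi> \<in> S" "\<And>z. z \<in> S \<Longrightarrow> riesz_rep S \<phi> \<bullet> z = \<phi> z" by auto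
qed

lemma orth_proj:
  fixes S :: "'a::{real_inner,banach} set"
  assumes S: "subspace S" "closed S"
  shows orth_proj_in: "orth_proj S x \<in> S"
    and orth_proj_inner: "\<And>z. z \<in> S \<Longrightarrow> orth_proj S x \<bullet> z = x \<bullet> z"
    and orth_proj_id: "x \<in> S \<Longrightarrow> orth_proj S x = x"
    and bounded_linear_orth_proj: "bounded_linear (orth_proj S)"
proof -
  have bl: "bounded_linear (\<lambda>z. x \<bullet> z)" for x :: 'a by (rule bounded_linear_inner_right)
  show in_S: "orth_proj S x \<in> S" for x
    unfolding orth_proj_def by (rule riesz_rep_in[OF S bl])
  show inner: "orth_proj S x \<bullet> z = x \<bullet> z" if "z \<in> S" for x z
    unfolding orth_proj_def by (rule riesz_rep_inner[OF S bl that])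
  show "orth_proj S x = x" if "x \<in> S"
    by (rule riesz_unique[OF S(1) in_S that]) (rule inner)
  show "bounded_linear (orth_proj S)"
  proof (rule bounded_linear_intro[where K = 1])
    show "orth_proj S (x + y) = orth_proj S x + orth_proj S y" for x y
      by (rule riesz_unique[OF S(1) in_S])
         (auto simp: inner inner_add_left intro!: subspace_add S in_S)
    show "orth_proj S (r *\<^sub>R x) = r *\<^sub>R orth_proj S x" for r x
      by (rule riesz_unique[OF S(1) in_S])
         (auto simp: inner intro!: subspace_scale S in_S)
    show "norm (orth_proj S x) \<le> norm x * 1" for x
    proof -
      have "(norm (orth_proj S x))\<^sup>2 = x \<bullet> orth_proj S x"
        using inner[OF in_S, of x x] by (simp add: power2_norm_eq_inner)
      also have "\<dots> \<le> norm x * norm (orth_proj S x)" by (rule norm_cauchy_schwarz)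
      finally show ?thesis by (cases "orth_proj S x = 0") (auto simp: power2_eq_square)
    qed
  qed
qed

text \<open>The inverse of the Riesz isomorphism of a Hilbert space onto its dual.\<close>

definition riesz :: "('a::{real_inner,banach} \<Rightarrow>\<^sub>L real) \<Rightarrow> 'a" where
  "riesz \<phi> = riesz_rep UNIV (blinfun_apply \<phi>)"

lemma riesz_inner:
  fixes \<phi> :: "'a::{real_inner,banach} \<Rightarrow>\<^sub>L real"
  shows "riesz \<phi> \<bullet> z = \<phi> z"
  unfolding riesz_def by (rule riesz_rep_inner) (auto intro: blinfun.bounded_linear_right)

lemma riesz_eqI:
  fixes \<phi> :: "'a::{real_inner,banach} \<Rightarrow>\<^sub>L real"
  shows "(\<And>z. y \<bullet> z = \<phi> z) \<Longrightarrow> riesz \<phi> = y"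
  unfolding riesz_def by (rule riesz_rep_eqI) auto

lemma bounded_linear_riesz: "bounded_linear (riesz :: ('a::{real_inner,banach} \<Rightarrow>\<^sub>L real) \<Rightarrow> 'a)"
proof (rule bounded_linear_intro[where K = 1])
  show "riesz (\<phi> + \<psi>) = riesz \<phi> + riesz \<psi>" for \<phi> \<psi> :: "'a \<Rightarrow>\<^sub>L real"
    by (rule riesz_eqI) (simp add: inner_add_left riesz_inner blinfun.add_left)
  show "riesz (r *\<^sub>R \<phi>) = r *\<^sub>R riesz \<phi>" for r and \<phi> :: "'a \<Rightarrow>\<^sub>L real"
    by (rule riesz_eqI) (simp add: riesz_inner blinfun.scaleR_left)
  show "norm (riesz \<phi>) \<le> norm \<phi> * 1" for \<phi> :: "'a \<Rightarrow>\<^sub>L real"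
  proof -
    have "(norm (riesz \<phi>))\<^sup>2 = \<phi> (riesz \<phi>)" by (simp add: power2_norm_eq_inner riesz_inner)
    also have "\<dots> \<le> norm \<phi> * norm (riesz \<phi>)"
      using norm_blinfun[of \<phi> "riesz \<phi>"] by simp
    finally show ?thesis by (cases "riesz \<phi> = 0") (auto simp: power2_eq_square)
  qed
qed

lemma norm_riesz_le:
  fixes \<phi> :: "'a::{real_inner,banach} \<Rightarrow>\<^sub>L real"
  shows "norm (riesz \<phi>) \<le> norm \<phi>"
proof -
  have "(norm (riesz \<phi>))\<^sup>2 = \<phi> (riesz \<phi>)" by (simp add: power2_norm_eq_inner riesz_inner)
  also have "\<dots> \<le> norm \<phi> * norm (riesz \<phi>)"
    using norm_blinfun[of \<phi> "riesz \<phi>"] by simp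
  finally show ?thesis by (cases "riesz \<phi> = 0") (auto simp: power2_eq_square)
qed

lemma riesz_inner_right [simp]: "riesz (blinfun_inner_right x) = x"
  by (rule riesz_eqI) simp

text \<open>Lax and Milgram: solving \<open>D x = \<xi>\<close> means finding the fixed point of the contraction
  \<open>x \<mapsto> x - \<rho> (R D x - R \<xi>)\<close>, with the Riesz isomorphism \<open>R\<close> and small \<open>\<rho>\<close>.\<close>

lemma lax_milgram_surj:
  fixes D :: "'m::{real_inner,banach} \<Rightarrow>\<^sub>L ('m \<Rightarrow>\<^sub>L real)"
  assumes c: "0 < c" and D: "\<And>m. c * (norm m)\<^sup>2 \<le> D m m"
  shows "\<exists>x. D x = \<xi>"
proof -
  define C where "C = norm D + c"
  have C: "C > 0" "norm D \<le> C" "c \<le> C" unfolding C_def using c norm_ge_zero[of D] by linarith+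
  define \<rho> where "\<rho> = c / C\<^sup>2"
  define f where "f x = x - \<rho> *\<^sub>R (riesz (D x) - riesz \<xi>)" for x
  interpret R: bounded_linear "riesz :: ('m \<Rightarrow>\<^sub>L real) \<Rightarrow> 'm" by (rule bounded_linear_riesz)
  have key: "(norm (x - \<rho> *\<^sub>R riesz (D x)))\<^sup>2 \<le> (1 - c\<^sup>2 / C\<^sup>2) * (norm x)\<^sup>2" for x
  proof -
    have n: "norm (riesz (D x)) \<le> C * norm x"
      using norm_riesz_le[of "D x"] norm_blinfun[of D x] C mult_right_mono[of "norm D" C "norm x"]
      by (smt (verit) norm_ge_zero)
    have "(norm (x - \<rho> *\<^sub>R riesz (D x)))\<^sup>2 = (norm x)\<^sup>2 - 2 * \<rho> * D x x + \<rho>\<^sup>2 * (norm (riesz (D x)))\<^sup>2"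
      by (simp only: power2_norm_eq_inner)
         (simp add: inner_simps inner_commute[of x "riesz (D x)"] riesz_inner power2_eq_square
          algebra_simps)
    also have "\<dots> \<le> (norm x)\<^sup>2 - 2 * \<rho> * (c * (norm x)\<^sup>2) + \<rho>\<^sup>2 * (C * norm x)\<^sup>2"
      using n D[of x] c C by (intro add_mono diff_mono mult_left_mono power_mono) (auto simp: \<rho>_def)
    also have "\<dots> = (1 - c\<^sup>2 / C\<^sup>2) * (norm x)\<^sup>2"
      using C unfolding \<rho>_def by (simp add: field_simps power2_eq_square)
    finally show ?thesis .
  qed
  define k where "k = sqrt (1 - c\<^sup>2 / C\<^sup>2)"
  have cC: "0 \<le> 1 - c\<^sup>2 / C\<^sup>2" "1 - c\<^sup>2 / C\<^sup>2 < 1" using c C by (auto simp: power_mono)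
  then have k: "0 \<le> k" "k < 1" unfolding k_def by auto
  have "dist (f x) (f y) \<le> k * dist x y" for x y
  proof -
    have "f x - f y = (x - y) - \<rho> *\<^sub>R riesz (D (x - y))"
      unfolding f_def by (simp add: R.diff blinfun.diff_right algebra_simps)
    then have "(norm (f x - f y))\<^sup>2 \<le> (k * norm (x - y))\<^sup>2"
      using key[of "x - y"] real_sqrt_pow2[OF cC(1)] unfolding k_def power_mult_distrib by simp
    then have "norm (f x - f y) \<le> k * norm (x - y)" by (rule power2_le_imp_le) (use k in simp)
    then show ?thesis by (simp only: dist_norm)
  qed
  then have "\<exists>!x. f x = x" using k by (intro banach_fix_type[of k]) auto
  then obtain x where "f x = x" by blast
  then have "riesz (D x) = riesz \<xi>" unfolding f_def using c C by (simp add: \<rho>_def)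
  then have "D x = \<xi>" by (intro blinfun_eqI) (metis riesz_inner)
  then show ?thesis by blast
qed

lemma lax_milgram:
  fixes D :: "'m::{real_inner,banach} \<Rightarrow>\<^sub>L ('m \<Rightarrow>\<^sub>L real)"
  assumes c: "0 < c" and D: "\<And>m. c * (norm m)\<^sup>2 \<le> D m m"
  shows lax_milgram_inv: "D (inv (blinfun_apply D) \<xi>) = \<xi>"
    and lax_milgram_inv_eq: "inv (blinfun_apply D) (D x) = x"
    and lax_milgram_bounded: "bounded_linear (inv (blinfun_apply D))"
proof -
  have low: "c * norm x \<le> norm (D x)" for x
  proof -
    have "c * (norm x)\<^sup>2 \<le> norm (D x) * norm x"
      using D[of x] norm_blinfun[of "D x" x] by simp
    then show ?thesis by (cases "x = 0") (auto simp: power2_eq_square)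
  qed
  have "inj (blinfun_apply D)"
  proof (rule injI)
    fix x y assume "D x = D y"
    then show "x = y" using low[of "x - y"] c by (simp add: blinfun.diff_right mult_le_0_iff)
  qed
  moreover have "surj (blinfun_apply D)"
    unfolding surj_def using lax_milgram_surj[OF c D] by metis
  ultimately show r: "D (inv (blinfun_apply D) \<xi>) = \<xi>" and l: "inv (blinfun_apply D) (D x) = x" for \<xi> x
    by (auto simp: surj_f_inv_f)
  show "bounded_linear (inv (blinfun_apply D))"
  proof (rule bounded_linear_intro[where K = "1 / c"])
    show "inv (blinfun_apply D) (x + y) = inv (blinfun_apply D) x + inv (blinfun_apply D) y" for x y
      by (metis r l blinfun.add_right)
    show "inv (blinfun_apply D) (a *\<^sub>R x) = a *\<^sub>R inv (blinfun_apply D) x" for a x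
      by (metis r l blinfun.scaleR_right)
    show "norm (inv (blinfun_apply D) x) \<le> norm x * (1 / c)" for x
      using low[of "inv (blinfun_apply D) x"] c by (simp add: r field_simps)
  qed
qed

section \<open>Operators and their adjoints\<close>

lemma dual_op_apply [simp]: "dual_op K n q = K q n"
  unfolding dual_op_def
  by (subst bounded_linear_Blinfun_apply)
     (auto intro: bounded_linear_compose[OF blinfun.bounded_linear_left blinfun.bounded_linear_right])

lemma bounded_linear_dual_op: "bounded_linear (dual_op K)"
proof (rule bounded_linear_intro[where K = "norm K"])
  show "dual_op K (x + y) = dual_op K x + dual_op K y" for x y
    by (rule blinfun_eqI) (simp add: blinfun.add_right blinfun.add_left)
  show "dual_op K (r *\<^sub>R x) = r *\<^sub>R dual_op K x" for r x
    by (rule blinfun_eqI) (simp add: blinfun.scaleR_right blinfun.scaleR_left)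
  show "norm (dual_op K x) \<le> norm x * norm K" for x
  proof (rule norm_blinfun_bound)
    show "norm (dual_op K x q) \<le> norm x * norm K * norm q" for q
      using norm_blinfun[of "K q" x] norm_blinfun[of K q] mult_right_mono[of "norm (K q)" "norm K * norm q" "norm x"]
      by (simp add: mult_ac)
  qed simp
qed

lemma subspace_Pker: "subspace (Pker B)"
  unfolding Pker_def subspace_def by (auto simp: blinfun.zero_right blinfun.add_right blinfun.scaleR_right)

lemma closed_Pker: "closed (Pker B)"
proof -
  have "Pker B = blinfun_apply B -` {0}" unfolding Pker_def by auto
  then show ?thesis by (simp add: continuous_closed_vimage linear_continuous_at blinfun.bounded_linear_right)
qed

lemma subspace_closure:
  fixes S :: "'a::real_normed_vector set"
  assumes "subspace S"
  shows "subspace (closure S)"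
proof (intro subspaceI)
  show "0 \<in> closure S" using assms subspace_0 closure_subset by blast
next
  fix x y assume "x \<in> closure S" "y \<in> closure S"
  then obtain f g where "\<And>n. f n \<in> S" "f \<longlonglongrightarrow> x" "\<And>n. g n \<in> S" "g \<longlonglongrightarrow> y"
    unfolding closure_sequential by blast
  then show "x + y \<in> closure S"
    unfolding closure_sequential using assms
    by (intro exI[of _ "\<lambda>n. f n + g n"]) (auto intro: tendsto_add subspace_add)
next
  fix c x assume "x \<in> closure S"
  then obtain f where "\<And>n. f n \<in> S" "f \<longlonglongrightarrow> x"
    unfolding closure_sequential by blast
  then show "c *\<^sub>R x \<in> closure S"
    unfolding closure_sequential using assms
    by (intro exI[of _ "\<lambda>n. c *\<^sub>R f n"]) (auto intro: tendsto_scaleR subspace_scale)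
qed

lemma subspace_Hker: "subspace (Hker \<iota> B)"
  unfolding Hker_def
  by (intro subspace_closure linear_subspace_image subspace_Pker bounded_linear.linear
      blinfun.bounded_linear_right)

lemma closed_Hker: "closed (Hker \<iota> B)"
  unfolding Hker_def by simp

lemma image_Pker_Hker:
  fixes \<iota> :: "'p::real_inner \<Rightarrow>\<^sub>L 'h::real_inner"
  shows "q \<in> Pker B \<Longrightarrow> \<iota> q \<in> Hker \<iota> B"
  unfolding Hker_def by (intro subsetD[OF closure_subset] imageI)

lemma ker_restrict_apply:
  fixes B :: "'p::{real_inner,banach} \<Rightarrow>\<^sub>L ('q::real_inner \<Rightarrow>\<^sub>L real)"
  shows "ker_restrict B \<phi> q = \<phi> (orth_proj (Pker B) q)"
  unfolding ker_restrict_def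
  by (subst bounded_linear_Blinfun_apply)
     (auto intro: bounded_linear_compose[OF blinfun.bounded_linear_right]
        bounded_linear_orth_proj subspace_Pker closed_Pker)

lemma ker_restrict_Pker:
  fixes B :: "'p::{real_inner,banach} \<Rightarrow>\<^sub>L ('q::real_inner \<Rightarrow>\<^sub>L real)"
  shows "q \<in> Pker B \<Longrightarrow> ker_restrict B \<phi> q = \<phi> q"
  by (simp add: ker_restrict_apply orth_proj_id subspace_Pker closed_Pker)

text \<open>The inf-sup condition makes \<open>B B\<^sup>*\<close> elliptic, so that \<open>\<mu> = B q\<close> is solved by
  \<open>q = B\<^sup>* \<nu>\<close>, and the range of \<open>B\<^sup>*\<close> is orthogonal to the kernel of \<open>B\<close>.\<close>

lemma inf_sup_lower_bound:
  fixes B :: "'p::{real_inner,banach} \<Rightarrow>\<^sub>L ('q::{real_inner,banach} \<Rightarrow>\<^sub>L real)"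
  assumes "0 < inf_sup_const B"
  shows "\<exists>\<beta>>0. \<forall>\<mu>. \<beta> * norm \<mu> \<le> norm (dual_op B \<mu>)"
proof -
  obtain b where b: "0 < b" "ereal b < inf_sup_const B"
    using ereal_dense2[OF assms] by (auto simp: zero_ereal_def)
  have "b * norm \<mu> \<le> norm (dual_op B \<mu>)" if "\<mu> \<noteq> 0" for \<mu>
  proof -
    have "ereal b < (SUP q\<in>UNIV - {0}. ereal (B q \<mu> / (norm q * norm \<mu>)))"
      using less_INF_D[OF b(2)[unfolded inf_sup_const_def], of \<mu>] that by simp
    then obtain q where q: "q \<noteq> 0" "b < B q \<mu> / (norm q * norm \<mu>)"
      unfolding less_SUP_iff by auto
    then have "b * norm \<mu> * norm q < B q \<mu>" using that by (simp add: field_simps)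
    also have "\<dots> \<le> norm (dual_op B \<mu>) * norm q" using norm_blinfun[of "dual_op B \<mu>" q] by simp
    finally show ?thesis using q by (simp add: less_imp_le)
  qed
  then show ?thesis using b(1) by (metis mult_zero_right norm_ge_zero norm_zero)
qed

lemma right_inv:
  fixes B :: "'p::{real_inner,banach} \<Rightarrow>\<^sub>L ('q::{real_inner,banach} \<Rightarrow>\<^sub>L real)"
  assumes "0 < inf_sup_const B"
  shows B_right_inv: "\<And>\<mu>. B (right_inv B \<mu>) = \<mu>"
    and bounded_linear_right_inv: "bounded_linear (right_inv B)"
proof -
  obtain \<beta> where \<beta>: "\<beta> > 0" "\<And>\<mu>. \<beta> * norm \<mu> \<le> norm (dual_op B \<mu>)"
    using inf_sup_lower_bound[OF assms] by blast
  define N where "N = Blinfun (\<lambda>\<nu>. B (riesz (dual_op B \<nu>)))"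
  have N: "N \<nu> = B (riesz (dual_op B \<nu>))" for \<nu>
    unfolding N_def
    by (subst bounded_linear_Blinfun_apply)
       (auto intro!: bounded_linear_compose[OF blinfun.bounded_linear_right]
         bounded_linear_compose[OF bounded_linear_riesz] bounded_linear_dual_op)
  have norm_riesz: "norm \<phi> \<le> norm (riesz \<phi>)" for \<phi> :: "'p \<Rightarrow>\<^sub>L real"
    by (rule norm_blinfun_bound) (auto simp: riesz_inner[symmetric] Cauchy_Schwarz_ineq2)
  have ell: "\<beta>\<^sup>2 * (norm \<nu>)\<^sup>2 \<le> N \<nu> \<nu>" for \<nu>
  proof -
    have "N \<nu> \<nu> = (norm (riesz (dual_op B \<nu>)))\<^sup>2"
      unfolding N by (simp add: power2_norm_eq_inner riesz_inner)
    moreover have "\<beta> * norm \<nu> \<le> norm (riesz (dual_op B \<nu>))"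
      using \<beta>(2)[of \<nu>] norm_riesz[of "dual_op B \<nu>"] by simp
    ultimately show ?thesis using \<beta>(1) power_mono[of "\<beta> * norm \<nu>" _ 2] by (simp add: power_mult_distrib)
  qed
  have \<beta>2: "0 < \<beta>\<^sup>2" using \<beta>(1) by simp
  note LM = lax_milgram[OF \<beta>2 ell]
  have eq: "right_inv B \<mu> = riesz (dual_op B (inv (blinfun_apply N) \<mu>))" for \<mu>
    unfolding right_inv_def
  proof (rule the_equality, intro conjI)
    show "riesz (dual_op B (inv (blinfun_apply N) \<mu>)) \<in> orthogonal_comp (Pker B)"
      unfolding orthogonal_comp_def
      by (auto simp: orthogonal_def Pker_def inner_commute[of _ "riesz _"] riesz_inner)
    show 1: "B (riesz (dual_op B (inv (blinfun_apply N) \<mu>))) = \<mu>"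
      using LM(1)[of \<mu>] unfolding N .
    fix q assume q: "q \<in> orthogonal_comp (Pker B) \<and> B q = \<mu>"
    define r where "r = riesz (dual_op B (inv (blinfun_apply N) \<mu>))"
    have "q - r \<in> Pker B" using q 1 unfolding r_def Pker_def by (simp add: blinfun.diff_right)
    moreover have "r \<in> orthogonal_comp (Pker B)"
      unfolding orthogonal_comp_def r_def
      by (auto simp: orthogonal_def Pker_def inner_commute[of _ "riesz _"] riesz_inner)
    ultimately have "(q - r) \<bullet> q = 0" "(q - r) \<bullet> r = 0" using q by (auto simp: orthogonal_comp_def orthogonal_def)
    then have "(q - r) \<bullet> (q - r) = 0" by (simp add: inner_diff_right)
    then show "q = r" by simp
  qed
  show "B (right_inv B \<mu>) = \<mu>" for \<mu> using LM(1)[of \<mu>] unfolding N eq .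
  show "bounded_linear (right_inv B)" unfolding eq[abs_def]
    by (intro bounded_linear_compose[OF bounded_linear_riesz]
      bounded_linear_compose[OF bounded_linear_dual_op] LM(3))
qed

lemma Lop_apply: "Lop K D u q = K q (inv (blinfun_apply D) (K u))"
  unfolding Lop_def by simp

lemma bounded_linear_Lop:
  fixes D :: "'m::{real_inner,banach} \<Rightarrow>\<^sub>L ('m \<Rightarrow>\<^sub>L real)"
  assumes "0 < c" "\<And>m. c * (norm m)\<^sup>2 \<le> D m m"
  shows "bounded_linear (Lop K D)"
  unfolding Lop_def[abs_def]
  by (intro bounded_linear_compose[OF bounded_linear_dual_op]
     bounded_linear_compose[OF lax_milgram_bounded[OF assms]] blinfun.bounded_linear_right)

text \<open>With \<open>m = D\<^sup>-\<^sup>1 K q\<close> the quadratic form of the operator is \<open>D m m\<close>, and \<open>K q = D m\<close> is bounded below on \<open>Y\<close>.\<close>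

lemma Lop_coercive:
  fixes K :: "'p::{real_inner,banach} \<Rightarrow>\<^sub>L ('m::{real_inner,banach} \<Rightarrow>\<^sub>L real)" and D :: "'m \<Rightarrow>\<^sub>L ('m \<Rightarrow>\<^sub>L real)"
  assumes c: "0 < c" "\<And>m. c * (norm m)\<^sup>2 \<le> D m m"
    and cK: "cK > 0" "\<And>q. q \<in> Y \<Longrightarrow> cK * norm q \<le> norm (K q)"
  shows "\<exists>\<alpha>>0. \<forall>q\<in>Y. \<alpha> * (norm q)\<^sup>2 \<le> Lop K D q q"
proof -
  define C where "C = norm D + 1"
  have C: "C > 0" "norm D \<le> C" unfolding C_def by (auto simp: add_nonneg_pos)
  have "c * (cK / C)\<^sup>2 * (norm q)\<^sup>2 \<le> Lop K D q q" if q: "q \<in> Y" for q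
  proof -
    define m where "m = inv (blinfun_apply D) (K q)"
    have Dm: "D m = K q" unfolding m_def by (rule lax_milgram_inv[OF c])
    have "cK * norm q \<le> norm (D m)" using cK(2)[OF q] by (simp add: Dm)
    also have "\<dots> \<le> C * norm m"
      using norm_blinfun[of D m] mult_right_mono[OF C(2), of "norm m"] by simp
    finally have "cK / C * norm q \<le> norm m" using C by (simp add: field_simps)
    then have "(cK / C * norm q)\<^sup>2 \<le> (norm m)\<^sup>2" using cK C by (intro power_mono) auto
    then have "c * ((cK / C)\<^sup>2 * (norm q)\<^sup>2) \<le> c * (norm m)\<^sup>2" using c(1) mult_left_mono[of "(cK / C * norm q)\<^sup>2" "(norm m)\<^sup>2" c]
      by (simp only: power_mult_distrib)
    also have "\<dots> \<le> D m m" by (rule c)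
    also have "\<dots> = Lop K D q q" unfolding Lop_apply m_def[symmetric] Dm ..
    finally show ?thesis by (simp add: mult_ac)
  qed
  moreover have "c * (cK / C)\<^sup>2 > 0" using c cK C by simp
  ultimately show ?thesis by blast
qed

section \<open>Strongly measurable functions and the gauge integral\<close>

lemma lebesgue_interval [simp]: "{a..b::real} \<in> sets lebesgue"
  by simp

lemma AE_lebesgue_on_iff_negligible:
  "(AE t in lebesgue_on {a..b::real}. P t) \<longleftrightarrow> (\<exists>N. negligible N \<and> (\<forall>t\<in>{a..b} - N. P t))"
proof -
  have "(AE t in lebesgue_on {a..b}. P t) \<longleftrightarrow> (AE t in lebesgue. t \<in> {a..b} \<longrightarrow> P t)"
    by (rule AE_restrict_space_iff) simp
  also have "\<dots> \<longleftrightarrow> {t. \<not> (t \<in> {a..b} \<longrightarrow> P t)} \<in> null_sets lebesgue"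
    unfolding completion.AE_iff_null_sets by simp
  also have "\<dots> \<longleftrightarrow> negligible {t. \<not> (t \<in> {a..b} \<longrightarrow> P t)}"
    by (simp add: negligible_iff_null_sets)
  also have "\<dots> \<longleftrightarrow> (\<exists>N. negligible N \<and> (\<forall>t\<in>{a..b} - N. P t))"
  proof
    assume "\<exists>N. negligible N \<and> (\<forall>t\<in>{a..b} - N. P t)"
    then obtain N where "negligible N" "\<forall>t\<in>{a..b} - N. P t" by blast
    then show "negligible {t. \<not> (t \<in> {a..b} \<longrightarrow> P t)}"
      by (elim negligible_subset) auto
  qed (auto intro!: exI[of _ "{t. \<not> (t \<in> {a..b} \<longrightarrow> P t)}"])
  finally show ?thesis .
qed

lemma measurable_on_norm_borel:
  assumes "u measurable_on S" "S \<in> sets lebesgue"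
  shows "(\<lambda>t. norm (u t)) \<in> borel_measurable (lebesgue_on S)"
proof -
  have "(norm \<circ> u) measurable_on S"
    by (rule measurable_on_compose_continuous_0[OF assms(1)]) (auto intro: continuous_intros)
  then show ?thesis using measurable_on_imp_borel_measurable_lebesgue[OF _ assms(2)] by (simp add: o_def)
qed

lemma measurable_on_cong:
  assumes "u measurable_on S" "\<And>t. t \<in> S \<Longrightarrow> u t = v t"
  shows "v measurable_on S"
  using measurable_on_spike[OF assms(1), of "{}" v] assms(2) by auto

lemma measurable_on_subset:
  fixes u :: "'a::euclidean_space \<Rightarrow> 'b::real_normed_vector"
  assumes "u measurable_on S" "S' \<subseteq> S" "S' \<in> sets lebesgue"
  shows "u measurable_on S'"
proof -
  have "(\<lambda>x. if x \<in> S' then (if x \<in> S then u x else 0) else 0) measurable_on UNIV"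
    using assms(3) measurable_on_UNIV[of S u, THEN iffD2, OF assms(1)] by (rule measurable_on_restrict[rotated])
  also have "(\<lambda>x. if x \<in> S' then (if x \<in> S then u x else 0) else 0) = (\<lambda>x. if x \<in> S' then u x else 0)"
    using assms(2) by (auto simp: fun_eq_iff)
  finally show ?thesis by (simp add: measurable_on_UNIV)
qed

lemma continuous_on_imp_measurable_on:
  fixes u :: "real \<Rightarrow> 'b::real_normed_vector"
  assumes "continuous_on {a..b} u"
  shows "u measurable_on {a..b}"
proof (cases "a \<le> b")
  case True
  have "continuous_on UNIV (\<lambda>x. u (max a (min b x)))"
    by (rule continuous_on_compose2[OF assms]) (use True in \<open>auto intro!: continuous_intros\<close>)
  then have "(\<lambda>x. if x \<in> {a..b} then u (max a (min b x)) else 0) measurable_on UNIV"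
    by (intro measurable_on_restrict continuous_imp_measurable_on) simp_all
  then have "(\<lambda>x. u (max a (min b x))) measurable_on {a..b}" by (simp only: measurable_on_UNIV)
  then show ?thesis by (rule measurable_on_cong) auto
next
  case False
  then have "{a..b} = {}" by simp
  then show ?thesis by (simp add: measurable_on_UNIV[symmetric])
qed

text \<open>Almost everywhere limits stay measurable for an arbitrary normed codomain: on an interval
  almost everywhere convergence implies convergence of the integrals of \<open>min 1 (norm _)\<close>, hence a
  diagonal sequence of continuous approximants has a subsequence that converges almost
  everywhere.\<close>

lemma measurable_on_interval_limit:
  fixes f :: "nat \<Rightarrow> real \<Rightarrow> 'b::real_normed_vector"
  assumes f: "\<And>n. f n measurable_on {a..b}" and N: "negligible N"
    and lim: "\<And>t. t \<in> {a..b} - N \<Longrightarrow> (\<lambda>n. f n t) \<longlonglongrightarrow> g t"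
  shows "g measurable_on {a..b}"
proof (cases "{a..b} = {}")
  case True
  then show ?thesis by (simp add: measurable_on_UNIV[symmetric])
next
  case ne: False
  let ?S = "{a..b}"
  have "\<exists>M F. negligible M \<and> (\<forall>k. continuous_on UNIV (F k)) \<and>
      (\<forall>t. t \<notin> M \<longrightarrow> (\<lambda>k. F k t) \<longlonglongrightarrow> (if t \<in> ?S then f n t else 0))" for n
    using f[of n] unfolding measurable_on_def by blast
  then obtain M F where M: "\<And>n. negligible (M n)" and F: "\<And>n k. continuous_on UNIV (F n k)"
    and Flim: "\<And>n t. t \<notin> M n \<Longrightarrow> (\<lambda>k. F n k t) \<longlonglongrightarrow> (if t \<in> ?S then f n t else 0)"
    by metis
  define d where "d n k t = min 1 (norm (f n t - F n k t))" for n k t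
  have d_int: "d n k integrable_on ?S" for n k
  proof (rule measurable_bounded_by_integrable_imp_integrable_real[of _ _ "\<lambda>_. 1"])
    have "(\<lambda>t. f n t - F n k t) measurable_on ?S"
      by (intro measurable_on_diff f continuous_on_imp_measurable_on continuous_on_subset[OF F]) auto
    then show "d n k \<in> borel_measurable (lebesgue_on ?S)"
      unfolding d_def using measurable_on_norm_borel[of _ ?S] by (intro borel_measurable_min) auto
  qed (auto simp: d_def)
  have "(\<lambda>k. integral ?S (d n k)) \<longlonglongrightarrow> 0" for n
  proof -
    let ?e = "\<lambda>k t. if t \<in> M n then 0 else d n k t"
    have eq: "integral ?S (d n k) = integral ?S (?e k)" for k
      by (rule integral_spike[OF M[of n]]) auto
    have "(\<lambda>k. integral ?S (?e k)) \<longlonglongrightarrow> integral ?S (\<lambda>_. 0::real)"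
    proof (rule dominated_convergence(2)[where h = "\<lambda>_. 1"])
      show "?e k integrable_on ?S" for k
        by (rule integrable_spike[OF d_int M[of n]]) auto
      show "(\<lambda>k. ?e k t) \<longlonglongrightarrow> 0" if "t \<in> ?S" for t
      proof (cases "t \<in> M n")
        case False
        have "(\<lambda>k. f n t - F n k t) \<longlonglongrightarrow> f n t - f n t"
          using Flim[OF False] that by (intro tendsto_diff tendsto_const) simp
        then have "(\<lambda>k. min 1 (norm (f n t - F n k t))) \<longlonglongrightarrow> min 1 (norm (f n t - f n t))"
          by (intro tendsto_min tendsto_const tendsto_norm)
        then show ?thesis using False by (simp add: d_def)
      qed simp
    qed (auto simp: d_def)
    then show ?thesis unfolding eq by simp
  qed
  then have "\<forall>\<^sub>F k in sequentially. integral ?S (d n k) < 1 / real (Suc n)" for n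
    by (rule order_tendstoD(2)) simp
  then have "\<exists>k. integral ?S (d n k) < 1 / real (Suc n)" for n
    using eventually_happens'[OF sequentially_bot] by blast
  then obtain \<kappa> where \<kappa>: "\<And>n. integral ?S (d n (\<kappa> n)) < 1 / real (Suc n)" by metis
  have d_nonneg: "0 \<le> d n k t" for n k t unfolding d_def by simp
  have leb: "integrable (lebesgue_on ?S) (d n (\<kappa> n))" for n
    by (intro absolutely_integrable_imp_integrable nonnegative_absolutely_integrable_1 d_int d_nonneg) simp
  have "(\<lambda>n. \<integral>t. norm (d n (\<kappa> n) t) \<partial>lebesgue_on ?S) \<longlonglongrightarrow> 0"
  proof (rule tendsto_sandwich[of "\<lambda>_. 0" _ _ "\<lambda>n. 1 / real (Suc n)"])
    have "(\<integral>t. norm (d n (\<kappa> n) t) \<partial>lebesgue_on ?S) = integral ?S (d n (\<kappa> n))" for n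
      unfolding lebesgue_integral_eq_integral[OF leb[of n] lebesgue_interval, symmetric]
      by (simp only: real_norm_def abs_of_nonneg[OF d_nonneg])
    then have "(\<integral>t. norm (d n (\<kappa> n) t) \<partial>lebesgue_on ?S) \<le> 1 / real (Suc n)" for n
      using \<kappa>[of n] by (simp only: less_imp_le)
    then show "\<forall>\<^sub>F n in sequentially. (\<integral>t. norm (d n (\<kappa> n) t) \<partial>lebesgue_on ?S) \<le> 1 / real (Suc n)"
      by (intro always_eventually allI)
    show "(\<lambda>n. 1 / real (Suc n)) \<longlonglongrightarrow> 0" by (rule LIMSEQ_inverse_real_of_nat[unfolded inverse_eq_divide])
  qed auto
  from tendsto_L1_AE_subseq[OF leb this] obtain r where r: "strict_mono (r::nat\<Rightarrow>nat)"
    and "AE t in lebesgue_on ?S. (\<lambda>n. d (r n) (\<kappa> (r n)) t) \<longlonglongrightarrow> 0" by blast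
  then obtain N' where N': "negligible N'"
    and dlim: "\<And>t. t \<in> ?S - N' \<Longrightarrow> (\<lambda>n. d (r n) (\<kappa> (r n)) t) \<longlonglongrightarrow> 0"
    unfolding AE_lebesgue_on_iff_negligible by blast
  define c where "c n t = max 0 (1 - real n * setdist {t} ?S)" for n :: nat and t :: real
  define G where "G n t = c n t *\<^sub>R F (r n) (\<kappa> (r n)) t" for n t
  show ?thesis
    unfolding measurable_on_def
  proof (intro exI conjI allI impI)
    show "negligible (N \<union> N')" using N N' by simp
    show "continuous_on UNIV (G n)" for n
      unfolding G_def c_def by (intro continuous_intros F continuous_on_setdist)
    fix t assume t: "t \<notin> N \<union> N'"
    show "(\<lambda>n. G n t) \<longlonglongrightarrow> (if t \<in> ?S then g t else 0)"
    proof (cases "t \<in> ?S")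
      case True
      have "\<forall>\<^sub>F n in sequentially. d (r n) (\<kappa> (r n)) t < 1"
        by (rule order_tendstoD(2)[OF dlim]) (use t True in auto)
      then have ev: "\<forall>\<^sub>F n in sequentially. d (r n) (\<kappa> (r n)) t = norm (f (r n) t - F (r n) (\<kappa> (r n)) t)"
        by eventually_elim (auto simp: d_def)
      have "(\<lambda>n. norm (f (r n) t - F (r n) (\<kappa> (r n)) t)) \<longlonglongrightarrow> 0"
        by (rule Lim_transform_eventually[OF dlim ev]) (use t True in auto)
      then have 1: "(\<lambda>n. f (r n) t - F (r n) (\<kappa> (r n)) t) \<longlonglongrightarrow> 0"
        by (simp only: tendsto_norm_zero_iff)
      have 2: "(\<lambda>n. f (r n) t) \<longlonglongrightarrow> g t"
        using LIMSEQ_subseq_LIMSEQ[OF lim r, of t] t True by (simp add: o_def)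
      have "(\<lambda>n. F (r n) (\<kappa> (r n)) t) \<longlonglongrightarrow> g t"
        using tendsto_diff[OF 2 1] by simp
      moreover have "c n t = 1" for n using True by (simp add: c_def setdist_eq_0_sing_1 setdist_sing_in_set)
      ultimately show ?thesis using True by (simp add: G_def)
    next
      case False
      have "G n t = 0" if "n > nat \<lceil>1 / setdist {t} ?S\<rceil>" for n
      proof -
        have "setdist {t} ?S \<noteq> 0"
          using False ne setdist_eq_0_sing_1[of t ?S] by (simp add: closure_closed)
        then have pos: "setdist {t} ?S > 0" by (simp add: order_less_le setdist_pos_le)
        have "1 / setdist {t} ?S < real n" using that by linarith
        then have "1 - real n * setdist {t} ?S < 0" using pos by (simp add: field_simps)
        then show ?thesis by (simp add: G_def c_def)
      qed
      then have "\<forall>\<^sub>F n in sequentially. G n t = 0"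
        unfolding eventually_sequentially by (meson less_le_trans lessI)
      then show ?thesis using False tendsto_eventually[of "\<lambda>n. G n t" 0] by auto
    qed
  qed
qed


lemma simple_function_measurable_on:
  fixes s :: "real \<Rightarrow> 'b::real_normed_vector"
  assumes "simple_function (lebesgue_on {a..b}) s"
  shows "s measurable_on {a..b}"
proof -
  let ?S = "{a..b}"
  have fin: "finite (s ` ?S)" using assms simple_functionD(1) by fastforce
  have meas: "s -` {y} \<inter> ?S \<in> sets lebesgue" for y
    using simple_functionD(2)[OF assms, of "{y}"] by (simp add: sets_restrict_space_iff)
  have "(\<lambda>t. \<Sum>y\<in>s ` ?S. indicat_real (s -` {y} \<inter> ?S) t *\<^sub>R y) measurable_on ?S"
    by (intro measurable_on_sum fin measurable_on_scaleR measurable_on_const lebesgue_interval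
        measurable_on_subset[OF indicator_measurable_on[OF meas]]) simp
  then show ?thesis
  proof (rule measurable_on_cong)
    fix t assume t: "t \<in> ?S"
    have "(\<Sum>y\<in>s ` ?S. indicat_real (s -` {y} \<inter> ?S) t *\<^sub>R y) = (\<Sum>y\<in>{s t}. indicat_real (s -` {y} \<inter> ?S) t *\<^sub>R y)"
      by (rule sum.mono_neutral_right[OF fin]) (use t in \<open>auto simp: indicator_def\<close>)
    also have "\<dots> = s t" using t by simp
    finally show "(\<Sum>y\<in>s ` ?S. indicat_real (s -` {y} \<inter> ?S) t *\<^sub>R y) = s t" .
  qed
qed

lemma strongly_measurable_imp_measurable_on:
  fixes u :: "real \<Rightarrow> 'b::real_normed_vector"
  assumes "strongly_measurable (lebesgue_on {a..b}) u"
  shows "u measurable_on {a..b}"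
proof -
  obtain s where s: "\<And>i::nat. simple_function (lebesgue_on {a..b}) (s i)"
    and "AE t in lebesgue_on {a..b}. (\<lambda>i. s i t) \<longlonglongrightarrow> u t"
    using assms unfolding strongly_measurable_def by blast
  then obtain N where N: "negligible N" and lim: "\<And>t. t \<in> {a..b} - N \<Longrightarrow> (\<lambda>i. s i t) \<longlonglongrightarrow> u t"
    unfolding AE_lebesgue_on_iff_negligible by blast
  show ?thesis by (rule measurable_on_interval_limit[OF simple_function_measurable_on[OF s] N lim])
qed

text \<open>Bochner integrability. The integral that goes with it is the gauge integral, which makes sense for every
  Banach space, separable or not.\<close>

definition bint :: "real \<Rightarrow> real \<Rightarrow> (real \<Rightarrow> 'b::banach) \<Rightarrow> bool" where
  "bint a b u \<longleftrightarrow> u measurable_on {a..b} \<and> (\<lambda>t. norm (u t)) integrable_on {a..b}"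

lemma bint_norm: "bint a b u \<Longrightarrow> (\<lambda>t. norm (u t)) integrable_on {a..b}"
  unfolding bint_def by simp

lemma bintI:
  assumes "u measurable_on {a..b}" "k integrable_on {a..b}" "\<And>t. t \<in> {a..b} \<Longrightarrow> norm (u t) \<le> k t"
  shows "bint a b u"
  unfolding bint_def
  using measurable_bounded_by_integrable_imp_integrable_real[OF measurable_on_norm_borel[OF assms(1)] assms(2)] assms
  by simp

lemma bint_spike:
  assumes "bint a b u" "negligible N" "\<And>t. t \<in> {a..b} - N \<Longrightarrow> v t = u t"
  shows "bint a b v"
  using assms unfolding bint_def
  by (auto intro: measurable_on_spike[of u _ N v] integrable_spike[of "\<lambda>t. norm (u t)" _ N "\<lambda>t. norm (v t)"])

lemma bint_add: "bint a b u \<Longrightarrow> bint a b v \<Longrightarrow> bint a b (\<lambda>t. u t + v t)"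
  by (rule bintI[of _ _ _ "\<lambda>t. norm (u t) + norm (v t)"])
     (auto simp: bint_def intro: measurable_on_add integrable_add norm_triangle_ineq)

lemma bint_diff: "bint a b u \<Longrightarrow> bint a b v \<Longrightarrow> bint a b (\<lambda>t. u t - v t)"
  by (rule bintI[of _ _ _ "\<lambda>t. norm (u t) + norm (v t)"])
     (auto simp: bint_def intro: measurable_on_diff integrable_add norm_triangle_ineq4)

lemma bint_linear:
  assumes "bounded_linear f" "bint a b u"
  shows "bint a b (\<lambda>t. f (u t))"
proof -
  interpret f: bounded_linear f by (rule assms)
  obtain C where C: "\<And>x. norm (f x) \<le> norm x * C" using f.bounded by blast
  have "(f \<circ> u) measurable_on {a..b}"
    using assms(2) unfolding bint_def
    by (intro measurable_on_compose_continuous_0[of u]) (auto simp: f.zero intro: f.continuous_on continuous_on_id)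
  then show ?thesis
    using assms(2) C unfolding bint_def
    by (intro bintI[of _ _ _ "\<lambda>t. norm (u t) * C", unfolded bint_def]) (auto simp: o_def intro: integrable_on_mult_left)
qed

lemma bint_Pair: "bint a b u \<Longrightarrow> bint a b v \<Longrightarrow> bint a b (\<lambda>t. (u t, v t))"
  by (rule bintI[of _ _ _ "\<lambda>t. norm (u t) + norm (v t)"])
     (auto simp: bint_def intro: measurable_on_Pair integrable_add norm_Pair_le)

lemma bint_continuous: "continuous_on {a..b} u \<Longrightarrow> bint a b u"
  unfolding bint_def
  by (auto intro: continuous_on_imp_measurable_on integrable_continuous_real continuous_on_norm)

lemma bint_scaleR:
  assumes \<psi>: "continuous_on {a..b} \<psi>" and u: "bint a b u"
  shows "bint a b (\<lambda>t. \<psi> t *\<^sub>R u t)"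
proof -
  have "bounded (\<psi> ` {a..b})" using compact_continuous_image[OF \<psi> compact_Icc] compact_imp_bounded by blast
  then obtain C where C: "\<And>t. t \<in> {a..b} \<Longrightarrow> \<bar>\<psi> t\<bar> \<le> C" unfolding bounded_iff real_norm_def by blast
  show ?thesis
  proof (rule bintI)
    show "(\<lambda>t. \<psi> t *\<^sub>R u t) measurable_on {a..b}"
      using u unfolding bint_def by (intro measurable_on_scaleR[OF continuous_on_imp_measurable_on[OF \<psi>]]) simp
    show "(\<lambda>t. C * norm (u t)) integrable_on {a..b}"
      using bint_norm[OF u] by (rule integrable_on_mult_right)
    show "norm (\<psi> t *\<^sub>R u t) \<le> C * norm (u t)" if "t \<in> {a..b}" for t
      using C[OF that] by (simp add: mult_right_mono)
  qed
qed

lemma bint_subinterval: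
  assumes "bint a b u" "{c..d} \<subseteq> {a..b}"
  shows "bint c d u"
  using assms unfolding bint_def
  by (auto intro: measurable_on_subset integrable_on_subinterval)

subsection \<open>Approximation by continuous functions\<close>

text \<open>The radial retraction onto the ball of radius \<open>R\<close>; it makes dominated convergence applicable to
  the continuous approximants of a measurable function.\<close>

definition radial :: "real \<Rightarrow> 'b::real_normed_vector \<Rightarrow> 'b" where
  "radial R x = (1 / max 1 (norm x / R)) *\<^sub>R x"

lemma continuous_on_radial: "R > 0 \<Longrightarrow> continuous_on A (radial R)"
  unfolding radial_def by (intro continuous_intros) auto

lemma norm_radial: "R > 0 \<Longrightarrow> norm (radial R x) \<le> R"
  unfolding radial_def by (auto simp: max_def field_simps)

lemma norm_radial_diff: "R > 0 \<Longrightarrow> norm (x - radial R x) \<le> norm x"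
proof -
  assume R: "R > 0"
  define m where "m = max 1 (norm x / R)"
  have m: "1 \<le> m" unfolding m_def by simp
  have "x - radial R x = (1 - 1 / m) *\<^sub>R x" unfolding radial_def m_def by (simp add: algebra_simps)
  then have "norm (x - radial R x) = (1 - 1 / m) * norm x" using m by simp
  also have "\<dots> \<le> 1 * norm x" using m by (intro mult_right_mono) auto
  finally show ?thesis by simp
qed

lemma radial_id: "norm x \<le> R \<Longrightarrow> R > 0 \<Longrightarrow> radial R x = x"
  unfolding radial_def by (simp add: max_def)

lemma bint_approx_continuous:
  fixes u :: "real \<Rightarrow> 'b::banach"
  assumes u: "bint a b u" and e: "e > 0"
  shows "\<exists>v. continuous_on UNIV v \<and> bint a b (\<lambda>t. u t - v t) \<and> integral {a..b} (\<lambda>t. norm (u t - v t)) < e"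
proof -
  let ?S = "{a..b}"
  have um: "u measurable_on ?S" and un: "(\<lambda>t. norm (u t)) integrable_on ?S" using u unfolding bint_def by auto
  have rm: "(\<lambda>t. radial R (u t)) measurable_on ?S" if "R > 0" for R
    using measurable_on_compose_continuous_0[OF um continuous_on_radial[OF that]] by (simp add: o_def radial_def)
  have d1: "bint a b (\<lambda>t. u t - radial R (u t))" if "R > 0" for R
    using bintI[OF measurable_on_diff[OF um rm[OF that]] un] norm_radial_diff[OF that] by blast
  have "(\<lambda>n. integral ?S (\<lambda>t. norm (u t - radial (real (Suc n)) (u t)))) \<longlonglongrightarrow> integral ?S (\<lambda>t. 0::real)"
  proof (rule dominated_convergence(2)[OF _ un])
    show "(\<lambda>t. norm (u t - radial (real (Suc n)) (u t))) integrable_on ?S" for n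
      using d1 by (simp add: bint_def)
    show "norm (norm (u t - radial (real (Suc n)) (u t))) \<le> norm (u t)" for n t
      using norm_radial_diff[of "real (Suc n)" "u t"] by simp
    fix t
    obtain k :: nat where k: "norm (u t) \<le> real k" using real_arch_simple by blast
    have "norm (u t - radial (real (Suc n)) (u t)) = 0" if "n \<ge> k" for n
      using k that by (subst radial_id) auto
    then show "(\<lambda>n. norm (u t - radial (real (Suc n)) (u t))) \<longlonglongrightarrow> 0"
      by (intro tendsto_eventually) (auto simp: eventually_sequentially)
  qed
  then have "\<forall>\<^sub>F n in sequentially. integral ?S (\<lambda>t. norm (u t - radial (real (Suc n)) (u t))) < e / 2"
    using e by (intro order_tendstoD(2)[of _ 0]) auto
  then obtain n where "integral ?S (\<lambda>t. norm (u t - radial (real (Suc n)) (u t))) < e / 2"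
    using eventually_happens'[OF sequentially_bot] by blast
  then obtain R where R: "R > 0" "integral ?S (\<lambda>t. norm (u t - radial R (u t))) < e / 2"
    by (rule that[rotated]) simp
  obtain M F where M: "negligible M" and F: "\<And>k::nat. continuous_on UNIV (F k)"
    and Flim: "\<And>t. t \<notin> M \<Longrightarrow> (\<lambda>k. F k t) \<longlonglongrightarrow> (if t \<in> ?S then u t else 0)"
    using um unfolding measurable_on_def by blast
  have G: "continuous_on UNIV (\<lambda>t. radial R (F k t))" for k
    by (rule continuous_on_compose2[OF continuous_on_radial[OF R(1), of UNIV] F]) simp
  have d2: "bint a b (\<lambda>t. radial R (u t) - radial R (F k t))" for k
  proof (rule bintI[of _ _ _ "\<lambda>_. 2 * R"])
    show "(\<lambda>t. radial R (u t) - radial R (F k t)) measurable_on ?S"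
      by (intro measurable_on_diff rm R continuous_on_imp_measurable_on continuous_on_subset[OF G]) auto
    show "norm (radial R (u t) - radial R (F k t)) \<le> 2 * R" for t
      using norm_triangle_ineq4[of "radial R (u t)" "radial R (F k t)"] norm_radial[OF R(1), of "u t"]
        norm_radial[OF R(1), of "F k t"] by linarith
  qed auto
  let ?e = "\<lambda>k t. if t \<in> M then 0 else norm (radial R (u t) - radial R (F k t))"
  have "(\<lambda>k. integral ?S (?e k)) \<longlonglongrightarrow> integral ?S (\<lambda>_. 0::real)"
  proof (rule dominated_convergence(2)[where h = "\<lambda>_. 2 * R"])
    show "?e k integrable_on ?S" for k
      using bint_norm[OF d2[of k]] by (rule integrable_spike[OF _ M]) auto
    show "norm (?e k t) \<le> 2 * R" for k t
      using norm_triangle_ineq4[of "radial R (u t)" "radial R (F k t)"] norm_radial[OF R(1), of "u t"]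
        norm_radial[OF R(1), of "F k t"] R by (cases "t \<in> M") auto
    show "(\<lambda>k. ?e k t) \<longlonglongrightarrow> 0" if "t \<in> ?S" for t
    proof (cases "t \<in> M")
      case False
      have "isCont (radial R) (u t)"
        using continuous_on_radial[OF R(1), of "UNIV :: 'b set"] by (simp add: continuous_on_eq_continuous_at)
      moreover have "(\<lambda>k. F k t) \<longlonglongrightarrow> u t" using Flim[OF False] that by simp
      ultimately have "(\<lambda>k. radial R (F k t)) \<longlonglongrightarrow> radial R (u t)"
        by (rule isCont_tendsto_compose)
      then have "(\<lambda>k. norm (radial R (u t) - radial R (F k t))) \<longlonglongrightarrow> norm (radial R (u t) - radial R (u t))"
        by (intro tendsto_intros)
      then show ?thesis using False by simp
    qed simp
  qed auto
  then have "\<forall>\<^sub>F k in sequentially. integral ?S (?e k) < e / 2"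
    using e by (intro order_tendstoD(2)[of _ 0]) auto
  then obtain k where "integral ?S (?e k) < e / 2" using eventually_happens'[OF sequentially_bot] by blast
  then have k: "integral ?S (\<lambda>t. norm (radial R (u t) - radial R (F k t))) < e / 2"
    using integral_spike[OF M, of ?S "\<lambda>t. norm (radial R (u t) - radial R (F k t))" "?e k"] by simp
  have d3: "bint a b (\<lambda>t. u t - radial R (F k t))"
    using bint_add[OF d1[OF R(1)] d2[of k]] by simp
  have "integral ?S (\<lambda>t. norm (u t - radial R (F k t)))
      \<le> integral ?S (\<lambda>t. norm (u t - radial R (u t)) + norm (radial R (u t) - radial R (F k t)))"
    by (intro integral_le integrable_add bint_norm d1 d2 d3 R) (use norm_triangle_ineq in \<open>smt (verit) add_diff_eq diff_add_cancel\<close>)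
  also have "\<dots> = integral ?S (\<lambda>t. norm (u t - radial R (u t))) + integral ?S (\<lambda>t. norm (radial R (u t) - radial R (F k t)))"
    by (intro integral_add bint_norm d1 d2 R)
  finally show ?thesis using R(2) k G[of k] d3 by (intro exI[of _ "\<lambda>t. radial R (F k t)"]) auto
qed

text \<open>For a fine tagged division the Riemann sums of \<open>u\<close> and of a continuous approximant differ by at
  most a Riemann sum of the norm of their difference, so the Riemann sums of \<open>u\<close> are Cauchy.\<close>

lemma bint_integrable:
  fixes u :: "real \<Rightarrow> 'b::banach"
  assumes u: "bint a b u"
  shows "u integrable_on {a..b}"
  unfolding box_real(2)[symmetric] integrable_Cauchy
proof (intro allI impI)
  fix e :: real assume e: "e > 0"
  obtain v where v: "continuous_on UNIV v" "bint a b (\<lambda>t. u t - v t)" "integral {a..b} (\<lambda>t. norm (u t - v t)) < e / 8"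
    using bint_approx_continuous[OF u, of "e / 8"] e by auto
  define k where "k t = norm (u t - v t)" for t
  have "v integrable_on {a..b}" by (intro integrable_continuous_real continuous_on_subset[OF v(1)]) auto
  then have "(v has_integral integral {a..b} v) (cbox a b)" "(k has_integral integral {a..b} k) (cbox a b)"
    using bint_norm[OF v(2)] unfolding k_def by (auto simp: integrable_integral)
  then obtain d1 d2 where d1: "gauge d1" "\<And>p. p tagged_division_of (cbox a b) \<Longrightarrow> d1 fine p \<Longrightarrow>
        norm ((\<Sum>(x,K)\<in>p. measure lborel K *\<^sub>R v x) - integral {a..b} v) < e / 8"
    and d2: "gauge d2" "\<And>p. p tagged_division_of (cbox a b) \<Longrightarrow> d2 fine p \<Longrightarrow>
        norm ((\<Sum>(x,K)\<in>p. measure lborel K *\<^sub>R k x) - integral {a..b} k) < e / 8"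
    using e unfolding has_integral by (metis divide_pos_pos zero_less_numeral)
  have *: "norm ((\<Sum>(x,K)\<in>p. measure lborel K *\<^sub>R u x) - integral {a..b} v) < 3 * e / 8"
    if p: "p tagged_division_of (cbox a b)" "(\<lambda>x. d1 x \<inter> d2 x) fine p" for p
  proof -
    have "d1 fine p" "d2 fine p" using p(2) by (auto simp: fine_Int)
    note 1 = d1(2)[OF p(1) this(1)] and 2 = d2(2)[OF p(1) this(2)]
    have "(\<Sum>(x,K)\<in>p. measure lborel K *\<^sub>R u x) - (\<Sum>(x,K)\<in>p. measure lborel K *\<^sub>R v x) = (\<Sum>(x,K)\<in>p. measure lborel K *\<^sub>R (u x - v x))"
      by (simp add: sum_subtractf[symmetric] case_prod_unfold scaleR_diff_right)
    also have "norm \<dots> \<le> (\<Sum>(x,K)\<in>p. measure lborel K *\<^sub>R k x)"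
      by (intro sum_norm_le) (auto simp: k_def case_prod_unfold)
    finally have "norm ((\<Sum>(x,K)\<in>p. measure lborel K *\<^sub>R u x) - (\<Sum>(x,K)\<in>p. measure lborel K *\<^sub>R v x)) < e / 8 + e / 8"
      using 2 v(3) unfolding k_def[symmetric] real_norm_def by linarith
    then show ?thesis
      using 1 norm_triangle_ineq[of "(\<Sum>(x,K)\<in>p. measure lborel K *\<^sub>R u x) - (\<Sum>(x,K)\<in>p. measure lborel K *\<^sub>R v x)"
          "(\<Sum>(x,K)\<in>p. measure lborel K *\<^sub>R v x) - integral {a..b} v"] by simp
  qed
  show "\<exists>\<gamma>. gauge \<gamma> \<and> (\<forall>\<D>1 \<D>2. \<D>1 tagged_division_of (cbox a b) \<and> \<gamma> fine \<D>1 \<and>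
            \<D>2 tagged_division_of (cbox a b) \<and> \<gamma> fine \<D>2 \<longrightarrow>
            norm ((\<Sum>(x,K)\<in>\<D>1. measure lborel K *\<^sub>R u x) - (\<Sum>(x,K)\<in>\<D>2. measure lborel K *\<^sub>R u x)) < e)"
  proof (intro exI[of _ "\<lambda>x. d1 x \<inter> d2 x"] conjI allI impI)
    fix \<D>1 \<D>2 assume as: "\<D>1 tagged_division_of (cbox a b) \<and> (\<lambda>x. d1 x \<inter> d2 x) fine \<D>1 \<and>
            \<D>2 tagged_division_of (cbox a b) \<and> (\<lambda>x. d1 x \<inter> d2 x) fine \<D>2"
    show "norm ((\<Sum>(x,K)\<in>\<D>1. measure lborel K *\<^sub>R u x) - (\<Sum>(x,K)\<in>\<D>2. measure lborel K *\<^sub>R u x)) < e"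
      using *[of \<D>1] *[of \<D>2] as e
        norm_triangle_ineq4[of "(\<Sum>(x,K)\<in>\<D>1. measure lborel K *\<^sub>R u x) - integral {a..b} v"
          "(\<Sum>(x,K)\<in>\<D>2. measure lborel K *\<^sub>R u x) - integral {a..b} v"] by simp
  qed (auto simp: gauge_Int d1 d2)
qed

lemma bint_integral_norm_le: "bint a b u \<Longrightarrow> norm (integral {a..b} u) \<le> integral {a..b} (\<lambda>t. norm (u t))"
  by (rule integral_norm_bound_integral) (auto intro: bint_integrable bint_norm)


subsection \<open>The integral notions of the problem\<close>

lemma has_integral_simple_bochner:
  fixes s :: "real \<Rightarrow> 'b::banach"
  assumes "Bochner_Integration.simple_bochner_integrable (lebesgue_on {a..b}) s"
  shows "(s has_integral Bochner_Integration.simple_bochner_integral (lebesgue_on {a..b}) s) {a..b}"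
proof -
  let ?S = "{a..b}"
  have sf: "simple_function (lebesgue_on ?S) s"
    using assms by (auto elim: Bochner_Integration.simple_bochner_integrable.cases)
  have fin: "finite (s ` ?S)" using sf simple_functionD(1) by fastforce
  have meas: "{t \<in> ?S. s t = y} \<in> sets (lebesgue_on ?S)" for y
    using simple_functionD(2)[OF sf, of "{y}"] by (simp add: vimage_def Int_def conj_commute)
  have ind: "(indicat_real {t \<in> ?S. s t = y} has_integral measure (lebesgue_on ?S) {t \<in> ?S. s t = y}) ?S" for y
  proof -
    have fm: "emeasure (lebesgue_on ?S) {t \<in> ?S. s t = y} < \<infinity>"
      using finite_measure.emeasure_finite[OF finite_measure_lebesgue_on[OF lmeasurable_interval(1)[of a b, unfolded box_real]], of "{t \<in> ?S. s t = y}"]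
      by (simp add: less_top)
    have "integrable (lebesgue_on ?S) (indicat_real {t \<in> ?S. s t = y})"
      using meas fm by (intro integrable_real_indicator)
    from has_integral_integral_lebesgue_on[OF this] show ?thesis
      using meas fm by (simp add: integral_indicator Int_absorb2 subset_iff)
  qed
  have "((\<lambda>t. \<Sum>y\<in>s ` ?S. indicat_real {t \<in> ?S. s t = y} t *\<^sub>R y) has_integral
      (\<Sum>y\<in>s ` ?S. measure (lebesgue_on ?S) {t \<in> ?S. s t = y} *\<^sub>R y)) ?S"
    by (intro has_integral_sum fin has_integral_scaleR_left ind)
  moreover have "(\<Sum>y\<in>s ` ?S. indicat_real {t \<in> ?S. s t = y} t *\<^sub>R y) = s t" if t: "t \<in> ?S" for t
  proof -
    have "(\<Sum>y\<in>s ` ?S. indicat_real {t \<in> ?S. s t = y} t *\<^sub>R y) = (\<Sum>y\<in>{s t}. indicat_real {t \<in> ?S. s t = y} t *\<^sub>R y)"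
      by (rule sum.mono_neutral_right[OF fin]) (use t in \<open>auto simp: indicator_def\<close>)
    also have "\<dots> = s t" using t by simp
    finally show ?thesis .
  qed
  ultimately show ?thesis
    unfolding Bochner_Integration.simple_bochner_integral_def space_lebesgue_on by (rule has_integral_eq[rotated])
qed

lemma integrable_on_of_nn_integral:
  fixes k :: "real \<Rightarrow> real"
  assumes "k \<in> borel_measurable (lebesgue_on {a..b})" "\<And>t. 0 \<le> k t"
    and fin: "(\<integral>\<^sup>+t. ennreal (k t) \<partial>lebesgue_on {a..b}) < \<infinity>"
  shows "k integrable_on {a..b}"
    and "(LINT t|lebesgue_on {a..b}. k t) = integral {a..b} k"
    and "(\<integral>\<^sup>+t. ennreal (k t) \<partial>lebesgue_on {a..b}) = ennreal (integral {a..b} k)"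
proof -
  have i: "integrable (lebesgue_on {a..b}) k"
    using assms by (intro integrableI_nonneg) auto
  then show "k integrable_on {a..b}" by (intro integrable_on_lebesgue_on) auto
  show *: "(LINT t|lebesgue_on {a..b}. k t) = integral {a..b} k"
    using i by (intro lebesgue_integral_eq_integral) auto
  show "(\<integral>\<^sup>+t. ennreal (k t) \<partial>lebesgue_on {a..b}) = ennreal (integral {a..b} k)"
    using nn_integral_eq_integral[OF i] assms(2) * by simp
qed

text \<open>The two integrals agree on simple functions, and both are continuous with respect to the \<open>L\<^sup>1\<close> distance.\<close>

lemma has_strong_integral_imp_has_integral:
  fixes u :: "real \<Rightarrow> 'b::banach"
  assumes "has_strong_integral (lebesgue_on {a..b}) u I"
  shows "bint a b u" "(u has_integral I) {a..b}"
proof -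
  let ?M = "lebesgue_on {a..b}"
  obtain s where sm: "strongly_measurable ?M u"
    and s: "\<And>i::nat. Bochner_Integration.simple_bochner_integrable ?M (s i)"
    and lim: "(\<lambda>i. \<integral>\<^sup>+t. ennreal (norm (u t - s i t)) \<partial>?M) \<longlonglongrightarrow> 0"
    and I: "(\<lambda>i. Bochner_Integration.simple_bochner_integral ?M (s i)) \<longlonglongrightarrow> I"
    using assms unfolding has_strong_integral_def by blast
  have um: "u measurable_on {a..b}" by (rule strongly_measurable_imp_measurable_on[OF sm])
  have ssf: "simple_function ?M (s i)" for i
    using s[of i] by (auto elim: Bochner_Integration.simple_bochner_integrable.cases)
  have smeas: "s i measurable_on {a..b}" for i
    by (rule simple_function_measurable_on[OF ssf])
  have sb: "bint a b (s i)" for i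
  proof -
    have "finite (s i ` {a..b})" using ssf[of i] simple_functionD(1) by fastforce
    then have "bounded (s i ` {a..b})" by (rule finite_imp_bounded)
    then obtain C where "\<forall>t\<in>{a..b}. norm (s i t) \<le> C" unfolding bounded_iff by blast
    then show ?thesis by (intro bintI[OF smeas, of "\<lambda>_. C"]) auto
  qed
  define e where "e i = integral {a..b} (\<lambda>t. norm (u t - s i t))" for i
  have dm: "(\<lambda>t. norm (u t - s i t)) \<in> borel_measurable ?M" for i
    by (intro measurable_on_norm_borel measurable_on_diff um smeas) simp
  have "\<forall>\<^sub>F i in sequentially. (\<integral>\<^sup>+t. ennreal (norm (u t - s i t)) \<partial>?M) < \<infinity>"
    using lim by (rule order_tendstoD(2)) simp
  then have ev: "\<forall>\<^sub>F i in sequentially. bint a b (\<lambda>t. u t - s i t) \<and> (\<integral>\<^sup>+t. ennreal (norm (u t - s i t)) \<partial>?M) = ennreal (e i)"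
  proof eventually_elim
    case (elim i)
    show ?case
      using integrable_on_of_nn_integral[OF dm _ elim] measurable_on_diff[OF um smeas[of i]]
      unfolding bint_def e_def by simp
  qed
  then obtain i where "bint a b (\<lambda>t. u t - s i t)" using eventually_happens'[OF sequentially_bot] by blast
  from bint_add[OF this sb[of i]] show u: "bint a b u" by simp
  have "(\<lambda>i. ennreal (e i)) \<longlonglongrightarrow> 0"
    by (rule Lim_transform_eventually[OF lim]) (use ev in eventually_elim, simp)
  then have e0: "e \<longlonglongrightarrow> 0"
    unfolding ennreal_0[symmetric]
    by (subst (asm) tendsto_ennreal_iff) (auto simp: e_def intro!: always_eventually integral_nonneg bint_norm bint_diff u sb)
  have "norm (integral {a..b} (s i) - integral {a..b} u) \<le> e i" for i
  proof -
    have "integral {a..b} u - integral {a..b} (s i) = integral {a..b} (\<lambda>t. u t - s i t)"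
      by (intro integral_diff[symmetric] bint_integrable u sb)
    then show ?thesis
      using bint_integral_norm_le[OF bint_diff[OF u sb[of i]]] unfolding e_def by (simp add: norm_minus_commute)
  qed
  then have "(\<lambda>i. integral {a..b} (s i)) \<longlonglongrightarrow> integral {a..b} u"
    by (intro LIM_zero_cancel[OF Lim_null_comparison[OF _ e0]]) auto
  moreover have "integral {a..b} (s i) = Bochner_Integration.simple_bochner_integral ?M (s i)" for i
    using has_integral_simple_bochner[OF s[of i]] by (rule integral_unique)
  ultimately have "integral {a..b} u = I" using I LIMSEQ_unique by simp
  then show "(u has_integral I) {a..b}" using bint_integrable[OF u] by (simp add: has_integral_iff)
qed

lemma L2_imp:
  fixes u :: "real \<Rightarrow> 'b::banach"
  assumes "L2 T u"
  shows L2_bint: "bint 0 T u"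
    and L2_integrable: "(\<lambda>t. (norm (u t))\<^sup>2) integrable_on {0..T}"
    and L2_sqnorm_eq: "L2_sqnorm T u = integral {0..T} (\<lambda>t. (norm (u t))\<^sup>2)"
proof -
  have um: "u measurable_on {0..T}"
    using assms strongly_measurable_imp_measurable_on unfolding L2_def by blast
  have "(\<lambda>t. (norm (u t))\<^sup>2) \<in> borel_measurable (lebesgue_on {0..T})"
    using measurable_on_norm_borel[OF um] by simp
  note * = integrable_on_of_nn_integral[OF this]
  show i: "(\<lambda>t. (norm (u t))\<^sup>2) integrable_on {0..T}"
    and "L2_sqnorm T u = integral {0..T} (\<lambda>t. (norm (u t))\<^sup>2)"
    using * assms unfolding L2_def L2_sqnorm_def by auto
  show "bint 0 T u"
  proof (rule bintI[OF um])
    show "(\<lambda>t. 1 + (norm (u t))\<^sup>2) integrable_on {0..T}" by (intro integrable_add i) auto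
    show "norm (u t) \<le> 1 + (norm (u t))\<^sup>2" for t
      using zero_le_power2[of "norm (u t) - 1"] norm_ge_zero[of "u t"]
      by (simp only: power2_diff one_power2 mult_1_right)
  qed
qed

lemma L2_sqnorm_nonneg: "0 \<le> L2_sqnorm T u"
  unfolding L2_sqnorm_def by (rule integral_nonneg_AE) simp

section \<open>Steklov averages\<close>

definition steklov :: "real \<Rightarrow> (real \<Rightarrow> 'b::banach) \<Rightarrow> real \<Rightarrow> 'b" where
  "steklov \<eta> u t = (1 / \<eta>) *\<^sub>R integral {t..t + \<eta>} u"

lemma integral_shift_interval:
  fixes u :: "real \<Rightarrow> 'b::banach"
  shows "integral {a..b} (\<lambda>t. u (t + c)) = integral {a + c..b + c} u"
  using integral_shift_Icc_real[of a b u c] by (simp add: o_def add.commute)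

lemma integrable_shift_interval:
  fixes u :: "real \<Rightarrow> 'b::banach"
  assumes "u integrable_on {a + c..b + c}"
  shows "(\<lambda>t. u (t + c)) integrable_on {a..b}"
  using assms integrable_on_shift_Icc_real[of u c a b] by (simp add: o_def add.commute)

lemma continuous_on_integral_moving:
  fixes u :: "real \<Rightarrow> 'b::banach"
  assumes u: "u integrable_on {0..T}" and "0 \<le> \<eta>"
  shows "continuous_on {0..T - \<eta>} (\<lambda>t. integral {t..t + \<eta>} u)"
proof -
  have c: "continuous_on {0..T} (\<lambda>x. integral {0..x} u)"
    by (rule indefinite_integral_continuous_1[OF u])
  have "continuous_on {0..T - \<eta>} (\<lambda>t. integral {0..t + \<eta>} u - integral {0..t} u)"
    using assms(2) by (intro continuous_on_diff continuous_on_compose2[OF c]) (auto intro!: continuous_intros)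
  moreover have "integral {0..t + \<eta>} u - integral {0..t} u = integral {t..t + \<eta>} u" if "t \<in> {0..T - \<eta>}" for t
    using Henstock_Kurzweil_Integration.integral_combine[of 0 t "t + \<eta>" u] that assms
      integrable_on_subinterval[OF u, of 0 "t + \<eta>"] by (simp add: algebra_simps)
  ultimately show ?thesis by (rule continuous_on_eq) 
qed

lemma continuous_on_steklov:
  fixes u :: "real \<Rightarrow> 'b::banach"
  assumes "u integrable_on {0..T}" and "0 \<le> \<eta>"
  shows "continuous_on {0..T - \<eta>} (steklov \<eta> u)"
  unfolding steklov_def by (intro continuous_intros continuous_on_integral_moving assms)

lemma steklov_const_diff:
  fixes u :: "real \<Rightarrow> 'b::banach"
  assumes "\<eta> > 0" "u integrable_on {t..t + \<eta>}"
  shows "steklov \<eta> u t - c = steklov \<eta> (\<lambda>s. u s - c) t"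
proof -
  have "integral {t..t + \<eta>} (\<lambda>s. u s - c) = integral {t..t + \<eta>} u - \<eta> *\<^sub>R c"
    using assms by (subst integral_diff) auto
  then show ?thesis using assms(1) by (simp add: steklov_def scaleR_diff_right)
qed

lemma norm_steklov_le:
  fixes u :: "real \<Rightarrow> 'b::banach"
  assumes "\<eta> > 0" "u integrable_on {t..t + \<eta>}" "\<And>s. s \<in> {t..t + \<eta>} \<Longrightarrow> norm (u s) \<le> C"
  shows "norm (steklov \<eta> u t) \<le> C"
proof -
  have "norm (integral {t..t + \<eta>} u) \<le> integral {t..t + \<eta>} (\<lambda>_. C)"
    using assms by (intro integral_norm_bound_integral) auto
  then show ?thesis using assms(1) by (simp add: steklov_def field_simps)
qed

lemma steklov_linear:
  assumes "bounded_linear f" "u integrable_on {t..t + \<eta>}"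
  shows "steklov \<eta> (\<lambda>s. f (u s)) t = f (steklov \<eta> u t)"
proof -
  interpret f: bounded_linear f by (rule assms)
  show ?thesis
    unfolding steklov_def f.scaleR using integral_linear[OF assms(2,1)] by (simp add: o_def)
qed

lemma steklov_add:
  assumes "u integrable_on {t..t + \<eta>}" "v integrable_on {t..t + \<eta>}"
  shows "steklov \<eta> (\<lambda>s. u s + v s) t = steklov \<eta> u t + steklov \<eta> v t"
  unfolding steklov_def using assms by (simp add: integral_add scaleR_add_right)

lemma steklov_diff:
  assumes "u integrable_on {t..t + \<eta>}" "v integrable_on {t..t + \<eta>}"
  shows "steklov \<eta> (\<lambda>s. u s - v s) t = steklov \<eta> u t - steklov \<eta> v t"
  unfolding steklov_def using assms by (simp add: integral_diff scaleR_diff_right)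

lemma steklov_has_vector_derivative:
  fixes u :: "real \<Rightarrow> 'b::banach"
  assumes u: "continuous_on {0..T} u" and \<eta>: "0 < \<eta>" and t: "t \<in> {0..T - \<eta>}"
  shows "(steklov \<eta> u has_vector_derivative (1 / \<eta>) *\<^sub>R (u (t + \<eta>) - u t)) (at t within {0..T - \<eta>})"
proof -
  have d: "((\<lambda>x. integral {0..x} u) has_vector_derivative u s) (at s within {0..T})" if "s \<in> {0..T}" for s
    by (rule integral_has_vector_derivative[OF u that])
  have "((\<lambda>x. integral {0..x} u) \<circ> (\<lambda>x. x + \<eta>) has_vector_derivative 1 *\<^sub>R u (t + \<eta>)) (at t within {0..T - \<eta>})"
  proof (rule vector_diff_chain_within)
    show "((\<lambda>x. x + \<eta>) has_vector_derivative 1) (at t within {0..T - \<eta>})"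
      by (auto intro!: derivative_eq_intros)
    show "((\<lambda>x. integral {0..x} u) has_vector_derivative u (t + \<eta>)) (at (t + \<eta>) within (\<lambda>x. x + \<eta>) ` {0..T - \<eta>})"
      by (rule has_vector_derivative_within_subset[OF d]) (use t \<eta> in auto)
  qed
  then have *: "((\<lambda>x. (1 / \<eta>) *\<^sub>R (integral {0..x + \<eta>} u - integral {0..x} u)) has_vector_derivative
      (1 / \<eta>) *\<^sub>R (u (t + \<eta>) - u t)) (at t within {0..T - \<eta>})"
    using \<eta> t unfolding o_def scaleR_one
    by (intro bounded_linear.has_vector_derivative[OF bounded_linear_scaleR_right] has_vector_derivative_diff
        has_vector_derivative_within_subset[OF d]) auto
  show ?thesis
  proof (rule has_vector_derivative_transform[OF t _ *])
    fix x assume "x \<in> {0..T - \<eta>}"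
    then have "integral {0..x + \<eta>} u = integral {0..x} u + integral {x..x + \<eta>} u"
      using Henstock_Kurzweil_Integration.integral_combine[of 0 x "x + \<eta>" u] \<eta>
        integrable_continuous_real[OF continuous_on_subset[OF u, of "{0..x + \<eta>}"]] by simp
    then show "steklov \<eta> u x = (1 / \<eta>) *\<^sub>R (integral {0..x + \<eta>} u - integral {0..x} u)"
      unfolding steklov_def by simp
  qed
qed

text \<open>The primitive \<open>P\<close> of a nonnegative \<open>k\<close> is nondecreasing, so the integral of
  \<open>P (t + \<eta>) - P t\<close> telescopes to at most \<open>\<eta>\<close> times the total mass.\<close>

lemma integral_moving_le:
  fixes k :: "real \<Rightarrow> real"
  assumes k: "k integrable_on {0..T}" "\<And>t. t \<in> {0..T} \<Longrightarrow> 0 \<le> k t" and \<eta>: "0 \<le> \<eta>" "\<eta> \<le> T"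
  shows "integral {0..T - \<eta>} (\<lambda>t. integral {t..t + \<eta>} k) \<le> \<eta> * integral {0..T} k"
proof -
  define P where "P x = integral {0..x} k" for x
  have c: "continuous_on {0..T} P" unfolding P_def by (rule indefinite_integral_continuous_1[OF k(1)])
  have ki: "k integrable_on {a..b}" if "{a..b} \<subseteq> {0..T}" for a b
    using integrable_on_subinterval[OF k(1) that] .
  have P_bounds: "0 \<le> P x \<and> P x \<le> P T" if "x \<in> {0..T}" for x
  proof -
    have 1: "k integrable_on {0..x}" using that by (intro ki) auto
    have "0 \<le> integral {0..x} k" using that k(2) by (intro integral_nonneg 1) auto
    moreover have "integral {0..x} k \<le> integral {0..T} k"
      using that k(2) by (intro integral_subset_le 1 k(1)) auto
    ultimately show ?thesis unfolding P_def by simp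
  qed
  have Pi: "P integrable_on {a..b}" if "{a..b} \<subseteq> {0..T}" for a b
    by (intro integrable_continuous_real continuous_on_subset[OF c that])
  have sh: "(\<lambda>t. P (t + \<eta>)) integrable_on {0..T - \<eta>}"
    by (rule integrable_shift_interval, rule Pi) (use \<eta> in auto)
  have "integral {0..T - \<eta>} (\<lambda>t. integral {t..t + \<eta>} k) = integral {0..T - \<eta>} (\<lambda>t. P (t + \<eta>) - P t)"
  proof (rule integral_cong)
    fix t assume t: "t \<in> {0..T - \<eta>}"
    then show "integral {t..t + \<eta>} k = P (t + \<eta>) - P t"
      using Henstock_Kurzweil_Integration.integral_combine[of 0 t "t + \<eta>" k] \<eta> ki[of 0 "t + \<eta>"]
      unfolding P_def by (simp add: algebra_simps)
  qed
  also have "\<dots> = integral {\<eta>..T} P - integral {0..T - \<eta>} P"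
    using integral_shift_interval[of 0 "T - \<eta>" P \<eta>] by (simp add: integral_diff[OF sh Pi] \<eta>)
  also have "\<dots> = integral {T - \<eta>..T} P - integral {0..\<eta>} P"
    using Henstock_Kurzweil_Integration.integral_combine[of 0 \<eta> T P] Henstock_Kurzweil_Integration.integral_combine[of 0 "T - \<eta>" T P] \<eta> Pi[of 0 T]
    by simp
  also have "\<dots> \<le> integral {T - \<eta>..T} (\<lambda>_. P T) - integral {0..\<eta>} (\<lambda>_. 0)"
    using P_bounds \<eta> by (intro diff_mono integral_le Pi) auto
  also have "\<dots> = \<eta> * P T" using \<eta> by simp
  finally show ?thesis unfolding P_def .
qed

text \<open>Averaging does not increase the \<open>L\<^sup>1\<close> norm, so it suffices to consider the dense subset of continuous
  functions.\<close>

lemma steklov_tendsto_L1: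
  fixes u :: "real \<Rightarrow> 'b::banach"
  assumes u: "bint 0 T u" and T: "T > 0" and e: "e > 0"
  shows "\<forall>\<^sub>F \<eta> in at_right 0. \<eta> < T \<and> bint 0 (T - \<eta>) (\<lambda>t. steklov \<eta> u t - u t) \<and>
    integral {0..T - \<eta>} (\<lambda>t. norm (steklov \<eta> u t - u t)) < e"
proof -
  define r where "r = e / (4 * (T + 1))"
  have r: "r > 0" "r * T \<le> e / 4" unfolding r_def using e T by (auto simp: field_simps)
  obtain v where v: "continuous_on UNIV v" and uv: "bint 0 T (\<lambda>t. u t - v t)"
    and small: "integral {0..T} (\<lambda>t. norm (u t - v t)) < e / 4"
    using bint_approx_continuous[OF u, of "e / 4"] e by auto
  have "uniformly_continuous_on {0..T} v"
    by (rule compact_uniformly_continuous) (auto intro: continuous_on_subset[OF v])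
  then obtain d where d: "d > 0" "\<And>s t. s \<in> {0..T} \<Longrightarrow> t \<in> {0..T} \<Longrightarrow> dist s t < d \<Longrightarrow> dist (v s) (v t) < r"
    unfolding uniformly_continuous_on_def using r(1) by metis
  have ui: "u integrable_on {0..T}" and vi: "v integrable_on {0..T}"
    by (intro bint_integrable u, intro integrable_continuous_real continuous_on_subset[OF v(1)]) simp
  have ev: "\<forall>\<^sub>F \<eta> in at_right 0. 0 < \<eta> \<and> \<eta> < min d T"
    using d(1) T by (intro eventually_at_rightI[of 0 "min d T"]) auto
  then show ?thesis
  proof eventually_elim
    case (elim \<eta>)
    then have \<eta>: "0 < \<eta>" "\<eta> < d" "\<eta> < T" by auto
    let ?S = "{0..T - \<eta>}"
    define k where "k t = norm (u t - v t)" for t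
    have ki: "k integrable_on {0..T}" unfolding k_def by (rule bint_norm[OF uv])
    have kiS: "k integrable_on ?S" by (rule integrable_on_subinterval[OF ki]) (use \<eta> in auto)
    have b1: "bint 0 (T - \<eta>) (\<lambda>t. steklov \<eta> u t - u t)"
      by (intro bint_diff bint_continuous continuous_on_steklov ui bint_subinterval[OF u]) (use \<eta> in auto)
    have mi: "(\<lambda>t. integral {t..t + \<eta>} k) integrable_on ?S"
      by (intro integrable_continuous_real continuous_on_integral_moving ki) (use \<eta> in auto)
    have pw: "norm (steklov \<eta> u t - u t) \<le> (1 / \<eta>) * integral {t..t + \<eta>} k + r + k t" if t: "t \<in> ?S" for t
    proof -
      have sub: "{t..t + \<eta>} \<subseteq> {0..T}" using t \<eta> by auto
      have uit: "u integrable_on {t..t + \<eta>}" and vit: "v integrable_on {t..t + \<eta>}"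
        using integrable_on_subinterval[OF ui sub] integrable_on_subinterval[OF vi sub] by auto
      have "norm (steklov \<eta> v t - v t) \<le> r"
        unfolding steklov_const_diff[OF \<eta>(1) vit]
      proof (rule norm_steklov_le)
        show "norm (v s - v t) \<le> r" if "s \<in> {t..t + \<eta>}" for s
          using d(2)[of s t] that t \<eta> by (auto simp: dist_norm)
      qed (use \<eta> vit in \<open>auto intro: integrable_diff\<close>)
      moreover have "norm (steklov \<eta> (\<lambda>s. u s - v s) t) \<le> (1 / \<eta>) * integral {t..t + \<eta>} k"
        using bint_integral_norm_le[OF bint_subinterval[OF uv sub]] \<eta>
        unfolding steklov_def k_def by (simp add: field_simps)
      moreover have "steklov \<eta> u t - u t = steklov \<eta> (\<lambda>s. u s - v s) t + (steklov \<eta> v t - v t) + (v t - u t)"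
        by (simp add: steklov_diff[OF uit vit])
      moreover have "norm (v t - u t) = k t" by (simp add: k_def norm_minus_commute)
      ultimately show ?thesis
        using norm_triangle_ineq[of "steklov \<eta> (\<lambda>s. u s - v s) t + (steklov \<eta> v t - v t)" "v t - u t"]
          norm_triangle_ineq[of "steklov \<eta> (\<lambda>s. u s - v s) t" "steklov \<eta> v t - v t"] by simp
    qed
    have "integral ?S (\<lambda>t. norm (steklov \<eta> u t - u t)) \<le> integral ?S (\<lambda>t. (1 / \<eta>) * integral {t..t + \<eta>} k + r + k t)"
      using pw by (intro integral_le bint_norm[OF b1] integrable_add integrable_on_mult_right mi kiS) auto
    also have "\<dots> = (1 / \<eta>) * integral ?S (\<lambda>t. integral {t..t + \<eta>} k) + r * (T - \<eta>) + integral ?S k"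
    proof (rule integral_unique)
      have "((\<lambda>_. r) has_integral r * (T - \<eta>)) ?S"
        using has_integral_const_real[of r 0 "T - \<eta>"] \<eta> by (simp add: mult.commute)
      then show "((\<lambda>t. (1 / \<eta>) * integral {t..t + \<eta>} k + r + k t) has_integral
          (1 / \<eta>) * integral ?S (\<lambda>t. integral {t..t + \<eta>} k) + r * (T - \<eta>) + integral ?S k) ?S"
        by (intro has_integral_add has_integral_mult_right integrable_integral mi kiS)
    qed
    also have "(1 / \<eta>) * integral ?S (\<lambda>t. integral {t..t + \<eta>} k) \<le> integral {0..T} k"
      using integral_moving_le[OF ki, of \<eta>] \<eta> by (simp add: k_def field_simps)
    also have "integral ?S k \<le> integral {0..T} k"
      using \<eta> by (intro integral_subset_le kiS ki) (auto simp: k_def)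
    also have "r * (T - \<eta>) \<le> r * T" using r(1) \<eta> by simp
    finally have "integral ?S (\<lambda>t. norm (steklov \<eta> u t - u t)) < e"
      using small r(2) e unfolding k_def[symmetric] by simp
    then show ?case using b1 \<eta> by simp
  qed
qed

lemma steklov_tendsto:
  fixes u :: "real \<Rightarrow> 'b::banach"
  assumes u: "continuous_on {0..T} u" and t: "0 \<le> t" "t < T"
  shows "((\<lambda>\<eta>. steklov \<eta> u t) \<longlongrightarrow> u t) (at_right 0)"
proof (rule tendstoI)
  fix e :: real assume e: "e > 0"
  have "uniformly_continuous_on {0..T} u" using compact_uniformly_continuous[OF u] by simp
  then obtain d where d: "d > 0" "\<And>r s. r \<in> {0..T} \<Longrightarrow> s \<in> {0..T} \<Longrightarrow> dist r s < d \<Longrightarrow> dist (u r) (u s) < e / 2"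
    unfolding uniformly_continuous_on_def using e half_gt_zero by metis
  have "\<forall>\<^sub>F \<eta> in at_right 0. 0 < \<eta> \<and> \<eta> < min d (T - t)"
    using d(1) t by (intro eventually_at_rightI[of 0 "min d (T - t)"]) auto
  then show "\<forall>\<^sub>F \<eta> in at_right 0. dist (steklov \<eta> u t) (u t) < e"
  proof eventually_elim
    case (elim \<eta>)
    have ui: "u integrable_on {t..t + \<eta>}"
      by (intro integrable_continuous_real continuous_on_subset[OF u]) (use elim t in auto)
    have "norm (steklov \<eta> u t - u t) \<le> e / 2"
      unfolding steklov_const_diff[OF conjunct1[OF elim] ui]
    proof (rule norm_steklov_le)
      show "norm (u s - u t) \<le> e / 2" if "s \<in> {t..t + \<eta>}" for s
        using d(2)[of s t] that t elim by (auto simp: dist_norm)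
    qed (use elim ui in \<open>auto intro: integrable_diff\<close>)
    then show ?case using e by (simp add: dist_norm)
  qed
qed

lemma integral_Cauchy_Schwarz_one:
  fixes k :: "real \<Rightarrow> real"
  assumes k: "k integrable_on {a..b}" "(\<lambda>t. (k t)\<^sup>2) integrable_on {a..b}" and ab: "a \<le> b"
  shows "(integral {a..b} k)\<^sup>2 \<le> (b - a) * integral {a..b} (\<lambda>t. (k t)\<^sup>2)"
proof (cases "a = b")
  case False
  define I where "I = integral {a..b} k"
  define m where "m = I / (b - a)"
  have ba: "b - a > 0" using False ab by simp
  have "0 \<le> integral {a..b} (\<lambda>t. (k t)\<^sup>2 - (2 * m) * k t + m\<^sup>2)"
  proof (rule integral_nonneg)
    show "(\<lambda>t. (k t)\<^sup>2 - (2 * m) * k t + m\<^sup>2) integrable_on {a..b}"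
      by (intro integrable_add integrable_diff k integrable_on_mult_right integrable_const_ivl)
    show "0 \<le> (k t)\<^sup>2 - (2 * m) * k t + m\<^sup>2" for t
      using zero_le_power2[of "k t - m"] by (simp add: power2_diff mult_ac)
  qed
  also have "\<dots> = integral {a..b} (\<lambda>t. (k t)\<^sup>2) - 2 * m * I + m\<^sup>2 * (b - a)"
  proof (rule integral_unique)
    have "((\<lambda>_. m\<^sup>2) has_integral m\<^sup>2 * (b - a)) {a..b}"
      using has_integral_const_real[of "m\<^sup>2" a b] ab by (simp add: mult.commute)
    then show "((\<lambda>t. (k t)\<^sup>2 - (2 * m) * k t + m\<^sup>2) has_integral
        integral {a..b} (\<lambda>t. (k t)\<^sup>2) - 2 * m * I + m\<^sup>2 * (b - a)) {a..b}"
      unfolding I_def by (intro has_integral_add has_integral_diff has_integral_mult_right integrable_integral k)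
  qed
  also have "\<dots> = integral {a..b} (\<lambda>t. (k t)\<^sup>2) - I\<^sup>2 / (b - a)"
  proof -
    have "m * I = I\<^sup>2 / (b - a)" unfolding m_def by (simp add: power2_eq_square)
    moreover have "m\<^sup>2 * (b - a) = I\<^sup>2 / (b - a)" using ba unfolding m_def by (simp add: power2_eq_square)
    ultimately show ?thesis by simp
  qed
  finally show ?thesis using ba by (simp add: I_def field_simps)
qed simp

text \<open>The Cauchy-Schwarz inequality on \<open>[s, t]\<close> bounds a single difference; integrated in time, this bound
  controls the difference quotients through \<open>integral_moving_le\<close>.\<close>

lemma primitive_bounds:
  fixes w :: "real \<Rightarrow> 'b::banach"
  assumes w: "bint 0 T w" "(\<lambda>t. (norm (w t))\<^sup>2) integrable_on {0..T}"
    and U: "\<And>s t. 0 \<le> s \<Longrightarrow> s \<le> t \<Longrightarrow> t \<le> T \<Longrightarrow> U t - U s = integral {s..t} w"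
  shows primitive_diff_sq_le: "\<And>s t. 0 \<le> s \<Longrightarrow> s \<le> t \<Longrightarrow> t \<le> T \<Longrightarrow>
        (norm (U t - U s))\<^sup>2 \<le> (t - s) * integral {s..t} (\<lambda>r. (norm (w r))\<^sup>2)"
    and primitive_diff_sq_le': "\<And>s t. 0 \<le> s \<Longrightarrow> s \<le> t \<Longrightarrow> t \<le> T \<Longrightarrow>
        (norm (U t - U s))\<^sup>2 \<le> (t - s) * integral {0..T} (\<lambda>r. (norm (w r))\<^sup>2)"
    and primitive_continuous: "continuous_on {0..T} U"
    and primitive_integral_diff_sq_le: "\<And>\<delta>. 0 \<le> \<delta> \<Longrightarrow> \<delta> \<le> T \<Longrightarrow>
        integral {0..T - \<delta>} (\<lambda>t. (norm (U (t + \<delta>) - U t))\<^sup>2) \<le> \<delta>\<^sup>2 * integral {0..T} (\<lambda>r. (norm (w r))\<^sup>2)"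
proof -
  let ?q = "\<lambda>r. (norm (w r))\<^sup>2"
  show 1: "(norm (U t - U s))\<^sup>2 \<le> (t - s) * integral {s..t} ?q" if st: "0 \<le> s" "s \<le> t" "t \<le> T" for s t
  proof -
    have sub: "{s..t} \<subseteq> {0..T}" using st by auto
    have "(norm (U t - U s))\<^sup>2 \<le> (integral {s..t} (\<lambda>r. norm (w r)))\<^sup>2"
      unfolding U[OF st] by (intro power_mono bint_integral_norm_le bint_subinterval[OF w(1) sub]) simp
    also have "\<dots> \<le> (t - s) * integral {s..t} ?q"
      by (intro integral_Cauchy_Schwarz_one integrable_on_subinterval[OF w(2) sub]
          bint_norm[OF bint_subinterval[OF w(1) sub]] st)
    finally show ?thesis .
  qed
  show "(norm (U t - U s))\<^sup>2 \<le> (t - s) * integral {0..T} ?q" if st: "0 \<le> s" "s \<le> t" "t \<le> T" for s t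
  proof -
    have "integral {s..t} ?q \<le> integral {0..T} ?q"
      using st by (intro integral_subset_le w(2) integrable_on_subinterval[OF w(2)]) auto
    then show ?thesis using 1[OF st] mult_left_mono[of _ _ "t - s"] st by (meson diff_ge_0_iff_ge order_trans)
  qed
  have "continuous_on {0..T} (\<lambda>t. U 0 + integral {0..t} w)"
    by (intro continuous_intros indefinite_integral_continuous_1 bint_integrable w(1))
  then show c: "continuous_on {0..T} U"
  proof (rule continuous_on_eq)
    show "U 0 + integral {0..t} w = U t" if "t \<in> {0..T}" for t
      using U[of 0 t] that by (metis add.commute atLeastAtMost_iff diff_add_cancel order_refl)
  qed
  show "integral {0..T - \<delta>} (\<lambda>t. (norm (U (t + \<delta>) - U t))\<^sup>2) \<le> \<delta>\<^sup>2 * integral {0..T} ?q"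
    if \<delta>: "0 \<le> \<delta>" "\<delta> \<le> T" for \<delta>
  proof -
    have "integral {0..T - \<delta>} (\<lambda>t. (norm (U (t + \<delta>) - U t))\<^sup>2) \<le> integral {0..T - \<delta>} (\<lambda>t. \<delta> * integral {t..t + \<delta>} ?q)"
    proof (rule integral_le)
      show "(\<lambda>t. (norm (U (t + \<delta>) - U t))\<^sup>2) integrable_on {0..T - \<delta>}"
        using \<delta> by (intro integrable_continuous_real continuous_intros continuous_on_compose2[OF c]) (auto intro!: continuous_intros)
      show "(\<lambda>t. \<delta> * integral {t..t + \<delta>} ?q) integrable_on {0..T - \<delta>}"
        by (intro integrable_continuous_real continuous_intros continuous_on_integral_moving w(2) \<delta>)
      show "(norm (U (t + \<delta>) - U t))\<^sup>2 \<le> \<delta> * integral {t..t + \<delta>} ?q" if "t \<in> {0..T - \<delta>}" for t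
        using 1[of t "t + \<delta>"] that \<delta> by auto
    qed
    also have "\<dots> = \<delta> * integral {0..T - \<delta>} (\<lambda>t. integral {t..t + \<delta>} ?q)" by simp
    also have "\<dots> \<le> \<delta> * (\<delta> * integral {0..T} ?q)"
      by (intro mult_left_mono integral_moving_le w(2) \<delta>) auto
    finally show ?thesis by (simp add: power2_eq_square mult_ac)
  qed
qed

section \<open>Smooth test functions\<close>

definition flat_exp :: "nat \<Rightarrow> real \<Rightarrow> real" where
  "flat_exp k x = (if x > 0 then exp (- 1 / x) / x ^ k else 0)"

text \<open>These functions are closed under differentiation up to linear combinations, which gives
  smoothness of \<open>flat_exp 0\<close> without formulas for the higher derivatives.\<close>

lemma flat_exp_DERIV:
  "(flat_exp k has_real_derivative (flat_exp (k + 2) x - real k * flat_exp (Suc k) x)) (at x)"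
proof -
  consider "x > 0" | "x < 0" | "x = 0" by linarith
  then show ?thesis
  proof cases
    case 1
    have "((\<lambda>x. exp (- 1 / x) / x ^ k) has_real_derivative
        (exp (- 1 / x) / x ^ (k + 2) - real k * (exp (- 1 / x) / x ^ Suc k))) (at x)"
      using 1 by (auto intro!: derivative_eq_intros simp: divide_simps power2_eq_square)
        (cases k; simp add: algebra_simps)
    then have "(flat_exp k has_real_derivative
        (exp (- 1 / x) / x ^ (k + 2) - real k * (exp (- 1 / x) / x ^ Suc k))) (at x)"
    proof (rule has_field_derivative_transform_within_open[of _ _ _ "{0<..}"])
      show "exp (- 1 / y) / y ^ k = flat_exp k y" if "y \<in> {0<..}" for y
        using that by (simp add: flat_exp_def)
    qed (use 1 in auto)
    then show ?thesis using 1 by (simp add: flat_exp_def)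
  next
    case 2
    have "((\<lambda>_. 0) has_real_derivative 0) (at x)" by simp
    then have "(flat_exp k has_real_derivative 0) (at x)"
      by (rule has_field_derivative_transform_within_open[of _ _ _ "{..<0}"]) (use 2 in \<open>auto simp: flat_exp_def\<close>)
    then show ?thesis using 2 by (simp add: flat_exp_def)
  next
    case 3
    have "((\<lambda>h::real. inverse h ^ Suc k / exp (inverse h)) \<longlongrightarrow> 0) (at_right 0)"
      by (rule filterlim_compose[OF tendsto_power_div_exp_0 filterlim_inverse_at_top_right])
    moreover have "\<forall>\<^sub>F h in at_right 0. inverse h ^ Suc k / exp (inverse h) = (flat_exp k (0 + h) - flat_exp k 0) / h"
      by (rule eventually_at_rightI[of 0 1]) (auto simp: flat_exp_def exp_minus field_simps)
    ultimately have r: "((\<lambda>h. (flat_exp k (0 + h) - flat_exp k 0) / h) \<longlongrightarrow> 0) (at_right 0)"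
      by (rule Lim_transform_eventually)
    have "\<forall>\<^sub>F h in at_left 0. 0 = (flat_exp k (0 + h) - flat_exp k 0) / h"
      by (rule eventually_at_leftI[of "-1" 0]) (auto simp: flat_exp_def)
    then have l: "((\<lambda>h. (flat_exp k (0 + h) - flat_exp k 0) / h) \<longlongrightarrow> 0) (at_left 0)"
      by (rule Lim_transform_eventually[OF tendsto_const])
    have "(flat_exp k has_real_derivative 0) (at 0)"
      unfolding DERIV_def using l r by (rule filterlim_split_at)
    then show ?thesis using 3 by (simp add: flat_exp_def)
  qed
qed

text \<open>The span contains a bump function and is closed under differentiation, so its members are smooth.\<close>

inductive bump_span :: "real \<Rightarrow> real \<Rightarrow> real \<Rightarrow> (real \<Rightarrow> real) \<Rightarrow> bool" for n a b where
  base: "bump_span n a b (\<lambda>x. c * (flat_exp i (n * (x - a)) * flat_exp j (n * (b - x))))"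
| add: "bump_span n a b f \<Longrightarrow> bump_span n a b g \<Longrightarrow> bump_span n a b (\<lambda>x. f x + g x)"

lemma bump_span_DERIV:
  assumes "bump_span n a b f"
  shows "\<exists>g. bump_span n a b g \<and> (\<forall>x. (f has_real_derivative g x) (at x))"
  using assms
proof induction
  case (base c i j)
  let ?e = "\<lambda>i j c x. c * (flat_exp i (n * (x - a)) * flat_exp j (n * (b - x)))"
  let ?g = "\<lambda>x. (?e (i + 2) j (c * n) x + ?e (Suc i) j (- c * n * real i) x)
    + (?e i (j + 2) (- c * n) x + ?e i (Suc j) (c * n * real j) x)"
  have "bump_span n a b ?g" by (intro bump_span.intros)
  moreover have "(?e i j c has_real_derivative ?g x) (at x)" for x
  proof -
    have 1: "((\<lambda>x. flat_exp i (n * (x - a))) has_real_derivative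
        (flat_exp (i + 2) (n * (x - a)) - real i * flat_exp (Suc i) (n * (x - a))) * n) (at x)"
      by (rule DERIV_chain2[OF flat_exp_DERIV]) (auto intro!: derivative_eq_intros)
    have 2: "((\<lambda>x. flat_exp j (n * (b - x))) has_real_derivative
        (flat_exp (j + 2) (n * (b - x)) - real j * flat_exp (Suc j) (n * (b - x))) * (- n)) (at x)"
      by (rule DERIV_chain2[OF flat_exp_DERIV]) (auto intro!: derivative_eq_intros)
    show ?thesis
      using DERIV_cmult[OF DERIV_mult[OF 1 2], of c] by (rule DERIV_cong) (simp add: algebra_simps)
  qed
  ultimately show ?case by blast
next
  case (add f g)
  then obtain f' g' where "bump_span n a b f'" "bump_span n a b g'"
    "\<And>x. (f has_real_derivative f' x) (at x)" "\<And>x. (g has_real_derivative g' x) (at x)" by blast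
  then show ?case by (intro exI[of _ "\<lambda>x. f' x + g' x"]) (auto intro: bump_span.add DERIV_add)
qed

lemma bump_span_smooth:
  assumes "bump_span n a b f"
  shows "(deriv ^^ k) f differentiable (at x)"
proof -
  have "bump_span n a b ((deriv ^^ k) f)"
  proof (induction k)
    case (Suc k)
    then obtain g where g: "bump_span n a b g" "\<And>x. ((deriv ^^ k) f has_real_derivative g x) (at x)"
      using bump_span_DERIV by blast
    then have "deriv ((deriv ^^ k) f) = g" by (intro ext DERIV_imp_deriv)
    then show ?case using g(1) by simp
  qed (simp add: assms)
  then show ?thesis using bump_span_DERIV real_differentiable_def by blast
qed

definition bump :: "real \<Rightarrow> real \<Rightarrow> real \<Rightarrow> real \<Rightarrow> real" where
  "bump n a b x = flat_exp 0 (n * (x - a)) * flat_exp 0 (n * (b - x))"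

lemma bump_span_bump: "bump_span n a b (bump n a b)"
  using bump_span.base[of n a b 1 0 0] by (simp add: bump_def[abs_def])

lemma continuous_on_bump: "continuous_on S (bump n a b)"
proof -
  have "bump n a b differentiable (at x)" for x
    using bump_span_smooth[OF bump_span_bump, of 0] by simp
  then show ?thesis
    by (intro continuous_at_imp_continuous_on ballI differentiable_imp_continuous_within)
qed

lemma bump_bounds: "0 \<le> bump n a b x" "bump n a b x \<le> 1"
  unfolding bump_def flat_exp_def by (auto intro!: mult_le_one)

lemma bump_zero: "n > 0 \<Longrightarrow> x \<notin> {a<..<b} \<Longrightarrow> bump n a b x = 0"
  unfolding bump_def flat_exp_def by (auto simp: not_less zero_less_mult_iff)

lemma bump_tendsto: "(\<lambda>n. bump (real (Suc n)) a b x) \<longlonglongrightarrow> indicat_real {a<..<b} x"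
proof (cases "x \<in> {a<..<b}")
  case True
  have *: "(\<lambda>n. exp (- 1 / (real (Suc n) * y))) \<longlonglongrightarrow> 1" for y :: real
  proof -
    have "(\<lambda>n. - (1 / y) * (1 / real (Suc n))) \<longlonglongrightarrow> - (1 / y) * 0"
      by (intro tendsto_mult tendsto_const LIMSEQ_inverse_real_of_nat[unfolded inverse_eq_divide])
    then have "(\<lambda>n. exp (- (1 / y) * (1 / real (Suc n)))) \<longlonglongrightarrow> exp 0"
      by (intro tendsto_exp) simp
    then show ?thesis by (simp add: mult.commute)
  qed
  have "(\<lambda>n. exp (- 1 / (real (Suc n) * (x - a))) * exp (- 1 / (real (Suc n) * (b - x)))) \<longlonglongrightarrow> 1 * 1"
    by (intro tendsto_mult *)
  moreover have "bump (real (Suc n)) a b x = exp (- 1 / (real (Suc n) * (x - a))) * exp (- 1 / (real (Suc n) * (b - x)))" for n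
    using True unfolding bump_def flat_exp_def by (auto simp: zero_less_mult_iff)
  ultimately show ?thesis using True by simp
next
  case False
  then show ?thesis by (simp add: bump_zero)
qed

text \<open>The difference of a primitive of a bump and of its translate is a compactly supported smooth
  approximation of a trapezoid.\<close>

definition ramp :: "real \<Rightarrow> real \<Rightarrow> real \<Rightarrow> real \<Rightarrow> real" where
  "ramp n a b x = integral {0..x} (bump n a b)"

lemma ramp_DERIV:
  assumes "n > 0" "0 < a"
  shows "(ramp n a b has_real_derivative bump n a b x) (at x)"
proof (cases "x < a")
  case True
  have "((\<lambda>_. 0) has_real_derivative 0) (at x)" by simp
  then have "(ramp n a b has_real_derivative 0) (at x)"
  proof (rule has_field_derivative_transform_within_open[of _ _ _ "{..<a}"])
    show "0 = ramp n a b y" if "y \<in> {..<a}" for y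
    proof -
      have "integral {0..y} (bump n a b) = integral {0..y} (\<lambda>_. 0)"
        by (rule integral_cong) (use that assms in \<open>auto intro!: bump_zero\<close>)
      then show ?thesis by (simp add: ramp_def)
    qed
  qed (use True in auto)
  then show ?thesis using True assms by (simp add: bump_zero)
next
  case False
  have "((\<lambda>x. integral {0..x} (bump n a b)) has_real_derivative bump n a b x) (at x within {0..x + 1})"
    by (rule integral_has_real_derivative[OF continuous_on_bump]) (use False assms in auto)
  moreover have "at x within {0..x + 1} = at x"
    by (rule at_within_interior) (use False assms in auto)
  ultimately show ?thesis by (simp add: ramp_def[abs_def])
qed

lemma ramp_mono: "x \<le> y \<Longrightarrow> ramp n a b x \<le> ramp n a b y"
  unfolding ramp_def by (intro integral_subset_le) (auto intro: integrable_continuous_real continuous_on_bump bump_bounds)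

lemma ramp_low: "n > 0 \<Longrightarrow> 0 < a \<Longrightarrow> x \<le> a \<Longrightarrow> ramp n a b x = 0"
proof -
  assume "n > 0" "0 < a" "x \<le> a"
  then have "integral {0..x} (bump n a b) = integral {0..x} (\<lambda>_. 0)"
    by (intro integral_cong bump_zero) auto
  then show ?thesis by (simp add: ramp_def)
qed

lemma ramp_high: "n > 0 \<Longrightarrow> 0 < a \<Longrightarrow> a \<le> b \<Longrightarrow> b \<le> x \<Longrightarrow> ramp n a b x = ramp n a b b"
proof -
  assume *: "n > 0" "0 < a" "a \<le> b" "b \<le> x"
  have "integral {b..x} (bump n a b) = integral {b..x} (\<lambda>_. 0)"
    using * by (intro integral_cong bump_zero) auto
  moreover have "integral {0..b} (bump n a b) + integral {b..x} (bump n a b) = integral {0..x} (bump n a b)"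
    using * by (intro Henstock_Kurzweil_Integration.integral_combine) (auto intro: integrable_continuous_real continuous_on_bump)
  ultimately show ?thesis by (simp add: ramp_def)
qed

lemma ramp_tendsto:
  assumes "0 < a" "a \<le> b" "0 \<le> x"
  shows "(\<lambda>n. ramp (real (Suc n)) a b x) \<longlonglongrightarrow> max 0 (min (b - a) (x - a))"
proof -
  have "(\<lambda>n. integral {0..x} (bump (real (Suc n)) a b)) \<longlonglongrightarrow> integral {0..x} (indicat_real {a<..<b})"
    by (rule dominated_convergence(2)[where h = "\<lambda>_. 1"])
       (auto intro!: integrable_continuous_real continuous_on_bump bump_tendsto simp: bump_bounds simp del: of_nat_Suc)
  moreover have "integral {0..x} (indicat_real {a<..<b}) = max 0 (min (b - a) (x - a))"
  proof -
    have "integral {0..x} (indicat_real {a<..<b}) = integral {0..x} (\<lambda>t. if t \<in> {a..min b x} then 1 else (0::real))"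
      by (rule integral_spike[of "{a, b}"]) (auto simp: indicator_def)
    also have "\<dots> = integral {a..min b x} (\<lambda>_. 1)"
      using assms by (simp only: integral_restrict_Int) (auto intro!: arg_cong2[of _ _ _ _ integral])
    also have "\<dots> = max 0 (min (b - a) (x - a))"
      by (cases "a \<le> min b x") (auto simp: min_def max_def)
    finally show ?thesis .
  qed
  ultimately show ?thesis unfolding ramp_def by simp
qed

definition trapezoid_test :: "real \<Rightarrow> real \<Rightarrow> real \<Rightarrow> real \<Rightarrow> real \<Rightarrow> real" where
  "trapezoid_test n s t \<eta> x = ramp n s (s + \<eta>) x - ramp n s (s + \<eta>) (x - (t - s))"

lemma trapezoid_test:
  assumes n: "n > 0" and st: "0 < s" "s \<le> t" "0 < \<eta>" "t + \<eta> < T"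
  shows trapezoid_test_deriv: "deriv (trapezoid_test n s t \<eta>) x = bump n s (s + \<eta>) x - bump n t (t + \<eta>) x"
    and test_function_trapezoid: "test_function T (trapezoid_test n s t \<eta>)"
proof -
  let ?\<psi> = "trapezoid_test n s t \<eta>"
  have sh: "bump n s (s + \<eta>) (x - (t - s)) = bump n t (t + \<eta>) x" for x
    unfolding bump_def by (simp add: algebra_simps)
  have D: "(?\<psi> has_real_derivative (bump n s (s + \<eta>) x - bump n t (t + \<eta>) x)) (at x)" for x
  proof -
    have "((\<lambda>x. ramp n s (s + \<eta>) (x - (t - s))) has_real_derivative bump n s (s + \<eta>) (x - (t - s)) * 1) (at x)"
      by (rule DERIV_chain2[OF ramp_DERIV]) (use n st in \<open>auto intro!: derivative_eq_intros\<close>)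
    from DERIV_diff[OF ramp_DERIV this] n st show ?thesis
      unfolding trapezoid_test_def[abs_def] by (simp add: sh)
  qed
  show d: "deriv ?\<psi> x = bump n s (s + \<eta>) x - bump n t (t + \<eta>) x" for x
    using D by (rule DERIV_imp_deriv)
  have d': "deriv ?\<psi> = (\<lambda>x. bump n s (s + \<eta>) x - bump n t (t + \<eta>) x)"
    using d by (rule ext)
  have lin: "(deriv ^^ k) (\<lambda>x. bump n s (s + \<eta>) x - bump n t (t + \<eta>) x)
      = (\<lambda>x. (deriv ^^ k) (bump n s (s + \<eta>)) x - (deriv ^^ k) (bump n t (t + \<eta>)) x)" for k
  proof (induction k)
    case (Suc k)
    have "deriv (\<lambda>x. (deriv ^^ k) (bump n s (s + \<eta>)) x - (deriv ^^ k) (bump n t (t + \<eta>)) x) x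
      = deriv ((deriv ^^ k) (bump n s (s + \<eta>))) x - deriv ((deriv ^^ k) (bump n t (t + \<eta>))) x" for x
      using bump_span_smooth[OF bump_span_bump] by (intro deriv_diff) (auto simp: field_differentiable_def real_differentiable_def)
    then show ?case using Suc.IH by auto
  qed simp
  show "test_function T ?\<psi>"
    unfolding test_function_def
  proof (intro conjI allI)
    fix k x
    show "(deriv ^^ k) ?\<psi> differentiable at x"
    proof (cases k)
      case 0
      then show ?thesis using D real_differentiable_def by auto
    next
      case (Suc k')
      have "(deriv ^^ k) ?\<psi> = (deriv ^^ k') (deriv ?\<psi>)" by (simp only: Suc funpow_Suc_right o_apply)
      also have "\<dots> = (\<lambda>x. (deriv ^^ k') (bump n s (s + \<eta>)) x - (deriv ^^ k') (bump n t (t + \<eta>)) x)"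
        by (simp only: d' lin)
      finally show ?thesis
        using bump_span_smooth[OF bump_span_bump] by (simp add: differentiable_diff)
    qed
  next
    have "?\<psi> x = 0" if "x \<notin> {s..t + \<eta>}" for x
    proof (cases "x < s")
      case True
      then show ?thesis using n st by (simp add: trapezoid_test_def ramp_low)
    next
      case False
      then have "x > t + \<eta>" using that by auto
      then show ?thesis
        using n st ramp_high[of n s "s + \<eta>" x] ramp_high[of n s "s + \<eta>" "x - (t - s)"]
        by (simp add: trapezoid_test_def)
    qed
    then show "\<exists>a b. 0 < a \<and> b < T \<and> (\<forall>x. x \<notin> {a..b} \<longrightarrow> ?\<psi> x = 0)"
      using st by blast
  qed
qed

section \<open>Weak derivatives\<close>

lemma bint_dominated_convergence:
  fixes u :: "real \<Rightarrow> 'b::banach"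
  assumes u: "bint a b u" and \<alpha>: "\<And>n. continuous_on {a..b} (\<alpha> n)"
    and bound: "\<And>n t. t \<in> {a..b} \<Longrightarrow> \<bar>\<alpha> n t\<bar> \<le> C"
    and lim: "\<And>t. t \<in> {a..b} \<Longrightarrow> (\<lambda>n. \<alpha> n t) \<longlonglongrightarrow> \<beta> t"
  shows "bint a b (\<lambda>t. \<beta> t *\<^sub>R u t)"
    and "(\<lambda>n. integral {a..b} (\<lambda>t. \<alpha> n t *\<^sub>R u t)) \<longlonglongrightarrow> integral {a..b} (\<lambda>t. \<beta> t *\<^sub>R u t)"
proof -
  have au: "bint a b (\<lambda>t. \<alpha> n t *\<^sub>R u t)" for n by (rule bint_scaleR[OF \<alpha> u])
  have bb: "\<bar>\<beta> t\<bar> \<le> C" if "t \<in> {a..b}" for t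
    using LIMSEQ_le_const2[OF tendsto_rabs[OF lim[OF that]]] bound[OF that] by blast
  show bu: "bint a b (\<lambda>t. \<beta> t *\<^sub>R u t)"
  proof (rule bintI)
    show "(\<lambda>t. \<beta> t *\<^sub>R u t) measurable_on {a..b}"
      by (rule measurable_on_interval_limit[of "\<lambda>n t. \<alpha> n t *\<^sub>R u t" a b "{}"])
         (use au lim in \<open>auto simp: bint_def intro: tendsto_intros\<close>)
    show "(\<lambda>t. C * norm (u t)) integrable_on {a..b}" by (intro integrable_on_mult_right bint_norm u)
    show "norm (\<beta> t *\<^sub>R u t) \<le> C * norm (u t)" if "t \<in> {a..b}" for t
      using bb[OF that] by (simp add: mult_right_mono)
  qed
  have d: "bint a b (\<lambda>t. \<alpha> n t *\<^sub>R u t - \<beta> t *\<^sub>R u t)" for n by (rule bint_diff[OF au bu])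
  have "(\<lambda>n. integral {a..b} (\<lambda>t. norm (\<alpha> n t *\<^sub>R u t - \<beta> t *\<^sub>R u t))) \<longlonglongrightarrow> integral {a..b} (\<lambda>_. 0::real)"
  proof (rule dominated_convergence(2)[where h = "\<lambda>t. 2 * C * norm (u t)"])
    show "(\<lambda>t. norm (\<alpha> n t *\<^sub>R u t - \<beta> t *\<^sub>R u t)) integrable_on {a..b}" for n by (rule bint_norm[OF d])
    show "(\<lambda>t. 2 * C * norm (u t)) integrable_on {a..b}" by (intro integrable_on_mult_right bint_norm u)
    show "norm (norm (\<alpha> n t *\<^sub>R u t - \<beta> t *\<^sub>R u t)) \<le> 2 * C * norm (u t)" if "t \<in> {a..b}" for n t
    proof -
      have "\<bar>\<alpha> n t - \<beta> t\<bar> \<le> 2 * C" using bound[OF that, of n] bb[OF that] by linarith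
      then show ?thesis by (simp add: scaleR_diff_left[symmetric] mult_right_mono)
    qed
    show "(\<lambda>n. norm (\<alpha> n t *\<^sub>R u t - \<beta> t *\<^sub>R u t)) \<longlonglongrightarrow> 0" if "t \<in> {a..b}" for t
    proof -
      have "(\<lambda>n. norm (\<alpha> n t *\<^sub>R u t - \<beta> t *\<^sub>R u t)) \<longlonglongrightarrow> norm (\<beta> t *\<^sub>R u t - \<beta> t *\<^sub>R u t)"
        by (intro tendsto_intros lim[OF that])
      then show ?thesis by simp
    qed
  qed
  then have z: "(\<lambda>n. integral {a..b} (\<lambda>t. norm (\<alpha> n t *\<^sub>R u t - \<beta> t *\<^sub>R u t))) \<longlonglongrightarrow> 0" by simp
  have "norm (integral {a..b} (\<lambda>t. \<alpha> n t *\<^sub>R u t) - integral {a..b} (\<lambda>t. \<beta> t *\<^sub>R u t))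
      \<le> integral {a..b} (\<lambda>t. norm (\<alpha> n t *\<^sub>R u t - \<beta> t *\<^sub>R u t))" for n
    using bint_integral_norm_le[OF d[of n]] integral_diff[OF bint_integrable[OF au] bint_integrable[OF bu], of n] by simp
  then show "(\<lambda>n. integral {a..b} (\<lambda>t. \<alpha> n t *\<^sub>R u t)) \<longlonglongrightarrow> integral {a..b} (\<lambda>t. \<beta> t *\<^sub>R u t)"
    by (intro LIM_zero_cancel[OF Lim_null_comparison[OF _ z]]) auto
qed

text \<open>The weak derivative with the gauge integral in place of the strong integral.\<close>

definition weak_pair :: "real \<Rightarrow> (real \<Rightarrow> 'b::banach) \<Rightarrow> (real \<Rightarrow> 'b) \<Rightarrow> bool" where
  "weak_pair T u v \<longleftrightarrow> (\<forall>\<phi>. test_function T \<phi> \<longrightarrow>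
     (\<exists>I. ((\<lambda>t. deriv \<phi> t *\<^sub>R u t) has_integral I) {0..T} \<and> ((\<lambda>t. \<phi> t *\<^sub>R v t) has_integral - I) {0..T}))"

lemma is_weak_deriv_imp_weak_pair: "is_weak_deriv T u v \<Longrightarrow> weak_pair T u v"
  unfolding is_weak_deriv_def weak_pair_def using has_strong_integral_imp_has_integral(2) by blast

text \<open>The derivative of a trapezoid is a difference of two indicator functions, so testing with smoothed trapezoids
  compares the averages of \<open>u\<close> over two intervals.\<close>

lemma weak_pair_trapezoid:
  fixes u v :: "real \<Rightarrow> 'b::banach"
  assumes w: "weak_pair T u v" and u: "bint 0 T u" and v: "bint 0 T v"
    and st: "0 < s" "s \<le> t" "0 < \<eta>" "t + \<eta> < T"
  shows "integral {t..t + \<eta>} u - integral {s..s + \<eta>} u =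
    integral {0..T} (\<lambda>x. (max 0 (min \<eta> (x - s)) - max 0 (min \<eta> (x - t))) *\<^sub>R v x)"
proof -
  let ?\<psi> = "\<lambda>n. trapezoid_test (real (Suc n)) s t \<eta>"
  have int_bump: "(\<lambda>n. integral {0..T} (\<lambda>x. bump (real (Suc n)) r (r + \<eta>) x *\<^sub>R u x)) \<longlonglongrightarrow> integral {r..r + \<eta>} u"
    if r: "0 < r" "r + \<eta> < T" for r
  proof -
    have "(\<lambda>n. integral {0..T} (\<lambda>x. bump (real (Suc n)) r (r + \<eta>) x *\<^sub>R u x)) \<longlonglongrightarrow>
        integral {0..T} (\<lambda>x. indicat_real {r<..<r + \<eta>} x *\<^sub>R u x)"
      by (rule bint_dominated_convergence(2)[OF u continuous_on_bump, of _ _ _ 1])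
         (auto simp: bump_bounds simp del: of_nat_Suc intro: bump_tendsto)
    also have "integral {0..T} (\<lambda>x. indicat_real {r<..<r + \<eta>} x *\<^sub>R u x) =
        integral {0..T} (\<lambda>x. if x \<in> {r..r + \<eta>} then u x else 0)"
      by (rule integral_spike[of "{r, r + \<eta>}"]) (auto simp: indicator_def)
    also have "\<dots> = integral {r..r + \<eta>} u"
      using r st by (simp only: integral_restrict_Int) (auto intro!: arg_cong2[of _ _ _ _ integral])
    finally show ?thesis .
  qed
  have bi: "(\<lambda>x. bump (real (Suc n)) r (r + \<eta>) x *\<^sub>R u x) integrable_on {0..T}" for n r
    by (intro bint_integrable bint_scaleR u continuous_on_bump)
  have "integral {0..T} (\<lambda>x. bump (real (Suc n)) s (s + \<eta>) x *\<^sub>R u x) -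
      integral {0..T} (\<lambda>x. bump (real (Suc n)) t (t + \<eta>) x *\<^sub>R u x) = - integral {0..T} (\<lambda>x. ?\<psi> n x *\<^sub>R v x)" for n
  proof -
    have "test_function T (?\<psi> n)" using st by (intro test_function_trapezoid) auto
    then obtain I where I: "((\<lambda>t. deriv (?\<psi> n) t *\<^sub>R u t) has_integral I) {0..T}"
      "((\<lambda>t. ?\<psi> n t *\<^sub>R v t) has_integral - I) {0..T}"
      using w unfolding weak_pair_def by blast
    have "I = integral {0..T} (\<lambda>x. (bump (real (Suc n)) s (s + \<eta>) x - bump (real (Suc n)) t (t + \<eta>) x) *\<^sub>R u x)"
      using I(1) st by (subst (asm) trapezoid_test_deriv) (auto dest: integral_unique)
    also have "\<dots> = integral {0..T} (\<lambda>x. bump (real (Suc n)) s (s + \<eta>) x *\<^sub>R u x) -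
      integral {0..T} (\<lambda>x. bump (real (Suc n)) t (t + \<eta>) x *\<^sub>R u x)"
      unfolding scaleR_diff_left by (rule integral_diff[OF bi bi])
    finally show ?thesis using integral_unique[OF I(2)] by simp
  qed
  moreover have "(\<lambda>n. integral {0..T} (\<lambda>x. ?\<psi> n x *\<^sub>R v x)) \<longlonglongrightarrow>
      integral {0..T} (\<lambda>x. (max 0 (min \<eta> (x - s)) - max 0 (min \<eta> (x - t))) *\<^sub>R v x)"
  proof (rule bint_dominated_convergence(2)[OF v])
    fix n
    have ramp_cont: "continuous_on UNIV (ramp (real (Suc n)) s (s + \<eta>))"
      using ramp_DERIV[of "real (Suc n)" s] st by (intro DERIV_continuous_on) auto
    show "continuous_on {0..T} (?\<psi> n)"
      unfolding trapezoid_test_def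
      by (intro continuous_on_diff continuous_on_compose2[OF ramp_cont]) (auto intro!: continuous_intros)
    fix x
    have 1: "ramp (real (Suc n)) s (s + \<eta>) y \<in> {0..\<eta>}" for y
    proof -
      have b: "0 \<le> ramp (real (Suc n)) s (s + \<eta>) z" for z
        unfolding ramp_def by (rule integral_nonneg) (auto intro: integrable_continuous_real continuous_on_bump bump_bounds)
      have "ramp (real (Suc n)) s (s + \<eta>) y \<le> ramp (real (Suc n)) s (s + \<eta>) (s + \<eta>)"
        using ramp_mono[of y "s + \<eta>"] ramp_high[of "real (Suc n)" s "s + \<eta>" y] st by (cases "y \<le> s + \<eta>") auto
      also have "\<dots> = integral {s..s + \<eta>} (bump (real (Suc n)) s (s + \<eta>))"
      proof -
        have "ramp (real (Suc n)) s (s + \<eta>) s = 0" using st by (intro ramp_low) auto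
        moreover have "integral {0..s} (bump (real (Suc n)) s (s + \<eta>)) + integral {s..s + \<eta>} (bump (real (Suc n)) s (s + \<eta>))
            = integral {0..s + \<eta>} (bump (real (Suc n)) s (s + \<eta>))"
          using st by (intro Henstock_Kurzweil_Integration.integral_combine) (auto intro: integrable_continuous_real continuous_on_bump)
        ultimately show ?thesis by (simp add: ramp_def)
      qed
      also have "\<dots> \<le> integral {s..s + \<eta>} (\<lambda>_. 1)"
        by (intro integral_le) (auto intro: integrable_continuous_real continuous_on_bump bump_bounds)
      also have "\<dots> = \<eta>" using st by simp
      finally show ?thesis using b by simp
    qed
    show "\<bar>?\<psi> n x\<bar> \<le> \<eta>"
      unfolding trapezoid_test_def using 1[of x] 1[of "x - (t - s)"] by auto
  next
    fix x assume x: "x \<in> {0..T}"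
    have "(\<lambda>n. ramp (real (Suc n)) s (s + \<eta>) (x - (t - s))) \<longlonglongrightarrow> max 0 (min \<eta> (x - t))"
    proof (cases "0 \<le> x - (t - s)")
      case True
      then show ?thesis using ramp_tendsto[of s "s + \<eta>" "x - (t - s)"] st by (simp add: algebra_simps)
    next
      case False
      then show ?thesis using st by (simp add: ramp_low)
    qed
    then show "(\<lambda>n. ?\<psi> n x) \<longlonglongrightarrow> max 0 (min \<eta> (x - s)) - max 0 (min \<eta> (x - t))"
      unfolding trapezoid_test_def
      using ramp_tendsto[of s "s + \<eta>" x] x st by (intro tendsto_diff) (auto simp: algebra_simps)
  qed
  ultimately have "(\<lambda>n. integral {0..T} (\<lambda>x. bump (real (Suc n)) s (s + \<eta>) x *\<^sub>R u x) -
      integral {0..T} (\<lambda>x. bump (real (Suc n)) t (t + \<eta>) x *\<^sub>R u x)) \<longlonglongrightarrow>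
      - integral {0..T} (\<lambda>x. (max 0 (min \<eta> (x - s)) - max 0 (min \<eta> (x - t))) *\<^sub>R v x)"
    using tendsto_minus by auto
  moreover have "(\<lambda>n. integral {0..T} (\<lambda>x. bump (real (Suc n)) s (s + \<eta>) x *\<^sub>R u x) -
      integral {0..T} (\<lambda>x. bump (real (Suc n)) t (t + \<eta>) x *\<^sub>R u x)) \<longlonglongrightarrow> integral {s..s + \<eta>} u - integral {t..t + \<eta>} u"
    by (intro tendsto_diff int_bump) (use st in auto)
  ultimately have "- integral {0..T} (\<lambda>x. (max 0 (min \<eta> (x - s)) - max 0 (min \<eta> (x - t))) *\<^sub>R v x)
    = integral {s..s + \<eta>} u - integral {t..t + \<eta>} u"
    by (rule LIMSEQ_unique)
  then show ?thesis by (simp add: minus_equation_iff[of "integral {0..T} _"])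
qed


lemma weak_pair_steklov_tendsto:
  fixes u v :: "real \<Rightarrow> 'b::banach"
  assumes w: "weak_pair T u v" and u: "bint 0 T u" and v: "bint 0 T v"
    and st: "0 < s" "s \<le> t" "t < T" and \<eta>: "\<eta> \<longlonglongrightarrow> 0" "\<And>n. \<eta> n > 0"
  shows "(\<lambda>n. steklov (\<eta> n) u t - steklov (\<eta> n) u s) \<longlonglongrightarrow> integral {s..t} v"
proof -
  let ?\<psi> = "\<lambda>n x. (1 / \<eta> n) * (max 0 (min (\<eta> n) (x - s)) - max 0 (min (\<eta> n) (x - t)))"
  have ev: "\<forall>\<^sub>F n in sequentially. \<eta> n < T - t"
    using st by (intro order_tendstoD(2)[OF \<eta>(1)]) simp
  have "(\<lambda>n. integral {0..T} (\<lambda>x. ?\<psi> n x *\<^sub>R v x)) \<longlonglongrightarrow> integral {0..T} (\<lambda>x. indicat_real {s<..t} x *\<^sub>R v x)"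
  proof (rule bint_dominated_convergence(2)[OF v, where C = 1])
    show "continuous_on {0..T} (?\<psi> n)" for n by (intro continuous_intros)
    show "\<bar>?\<psi> n x\<bar> \<le> 1" for n x
    proof -
      have "\<bar>max 0 (min (\<eta> n) (x - s)) - max 0 (min (\<eta> n) (x - t))\<bar> \<le> \<eta> n"
        using \<eta>(2)[of n] by (auto simp: max_def min_def)
      then show ?thesis using \<eta>(2)[of n] by (simp add: abs_mult field_simps)
    qed
    show "(\<lambda>n. ?\<psi> n x) \<longlonglongrightarrow> indicat_real {s<..t} x" for x
    proof -
      have lim: "(\<lambda>n. (1 / \<eta> n) * max 0 (min (\<eta> n) y)) \<longlonglongrightarrow> (if y > 0 then 1 else 0)" for y
      proof (cases "y > 0")
        case True
        have "\<forall>\<^sub>F n in sequentially. \<eta> n < y" by (rule order_tendstoD(2)[OF \<eta>(1) True])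
        then have "\<forall>\<^sub>F n in sequentially. (1 / \<eta> n) * max 0 (min (\<eta> n) y) = 1"
        proof eventually_elim
          case (elim n)
          then show ?case using \<eta>(2)[of n] True by (simp add: min_def max_def)
        qed
        then show ?thesis using True by (simp add: tendsto_eventually)
      next
        case False
        then have "(1 / \<eta> n) * max 0 (min (\<eta> n) y) = 0" for n by (auto simp: min_def max_def)
        then show ?thesis using False by simp
      qed
      have "(\<lambda>n. (1 / \<eta> n) * max 0 (min (\<eta> n) (x - s)) - (1 / \<eta> n) * max 0 (min (\<eta> n) (x - t)))
          \<longlonglongrightarrow> (if x - s > 0 then 1 else 0) - (if x - t > 0 then 1 else 0)"
        by (intro tendsto_diff lim)
      also have "(if x - s > 0 then 1 else 0) - (if x - t > 0 then 1 else 0) = indicat_real {s<..t} x"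
        using st by (auto simp: indicator_def)
      finally show ?thesis by (simp add: right_diff_distrib)
    qed
  qed
  also have "integral {0..T} (\<lambda>x. indicat_real {s<..t} x *\<^sub>R v x) = integral {0..T} (\<lambda>x. if x \<in> {s..t} then v x else 0)"
    by (rule integral_spike[of "{s}"]) (auto simp: indicator_def)
  also have "\<dots> = integral {s..t} v"
    using st by (simp only: integral_restrict_Int) (auto intro!: arg_cong2[of _ _ _ _ integral])
  finally have lim: "(\<lambda>n. integral {0..T} (\<lambda>x. ?\<psi> n x *\<^sub>R v x)) \<longlonglongrightarrow> integral {s..t} v" .
  show ?thesis
  proof (rule Lim_transform_eventually[OF lim])
    show "\<forall>\<^sub>F n in sequentially. integral {0..T} (\<lambda>x. ?\<psi> n x *\<^sub>R v x) = steklov (\<eta> n) u t - steklov (\<eta> n) u s"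
      using ev
    proof eventually_elim
      case (elim n)
      then have "integral {t..t + \<eta> n} u - integral {s..s + \<eta> n} u =
        integral {0..T} (\<lambda>x. (max 0 (min (\<eta> n) (x - s)) - max 0 (min (\<eta> n) (x - t))) *\<^sub>R v x)"
        by (intro weak_pair_trapezoid[OF w u v st(1,2) \<eta>(2)]) simp
      then show ?case
        unfolding steklov_def scaleR_scaleR[symmetric] integral_cmul by (simp flip: scaleR_diff_right)
    qed
  qed
qed

text \<open>A substitute for Lebesgue's differentiation theorem: convergence in \<open>L\<^sup>1\<close> implies convergence almost
  everywhere along a subsequence.\<close>

lemma steklov_AE_subseq:
  fixes u :: "real \<Rightarrow> 'b::banach"
  assumes u: "bint 0 T u" and T: "T > 0"
  shows "\<exists>\<eta> N. \<eta> \<longlonglongrightarrow> 0 \<and> (\<forall>n::nat. \<eta> n > 0) \<and> negligible N \<and>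
    (\<forall>t\<in>{0<..<T} - N. (\<lambda>n. steklov (\<eta> n) u t) \<longlonglongrightarrow> u t)"
proof -
  define \<eta>0 where "\<eta>0 n = T / real (n + 2)" for n
  have \<eta>0: "\<eta>0 \<longlonglongrightarrow> 0" "\<And>n. \<eta>0 n > 0" "\<And>n. \<eta>0 n < T"
  proof -
    have "(\<lambda>n. T * (1 / real (n + 2))) \<longlonglongrightarrow> T * 0"
      using LIMSEQ_ignore_initial_segment[OF lim_1_over_n, of 2] by (intro tendsto_mult tendsto_const)
    then show "\<eta>0 \<longlonglongrightarrow> 0" by (simp add: \<eta>0_def[abs_def])
    show "\<eta>0 n > 0" for n using T by (simp add: \<eta>0_def)
    show "\<eta>0 n < T" for n
    proof -
      have "T * 1 < T * real (n + 2)" using T by (intro mult_strict_left_mono) auto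
      then show ?thesis by (simp add: \<eta>0_def field_simps)
    qed
  qed
  have f0: "filterlim \<eta>0 (at_right 0) sequentially"
    unfolding filterlim_at using \<eta>0(1) order_less_imp_not_eq2[OF \<eta>0(2)] \<eta>0(2) by simp
  define k where "k n t = (if t \<in> {0..T - \<eta>0 n} then norm (steklov (\<eta>0 n) u t - u t) else 0)" for n t
  have b: "bint 0 (T - \<eta>0 n) (\<lambda>t. steklov (\<eta>0 n) u t - u t)" for n
    using \<eta>0(2)[of n] \<eta>0(3)[of n] T
    by (intro bint_diff bint_continuous continuous_on_steklov bint_integrable u bint_subinterval[OF u]) (auto intro: less_imp_le)
  have hk: "(k n has_integral integral {0..T - \<eta>0 n} (\<lambda>t. norm (steklov (\<eta>0 n) u t - u t))) {0..T}" for n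
    unfolding k_def using \<eta>0(2)[of n]
    by (subst has_integral_restrict) (auto intro: integrable_integral bint_norm[OF b])
  have ki: "integrable (lebesgue_on {0..T}) (k n)" for n
    using hk[of n]
    by (intro absolutely_integrable_imp_integrable nonnegative_absolutely_integrable_1) (auto simp: k_def integrable_on_def)
  have kint: "(\<integral>t. norm (k n t) \<partial>lebesgue_on {0..T}) = integral {0..T - \<eta>0 n} (\<lambda>t. norm (steklov (\<eta>0 n) u t - u t))" for n
  proof -
    have "norm (k n t) = k n t" for t by (simp add: k_def)
    then show ?thesis using lebesgue_integral_eq_integral[OF ki[of n]] integral_unique[OF hk[of n]] by simp
  qed
  have "(\<lambda>n. \<integral>t. norm (k n t) \<partial>lebesgue_on {0..T}) \<longlonglongrightarrow> 0"
  proof (rule tendstoI)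
    fix e :: real assume "e > 0"
    from filterlim_iff[THEN iffD1, OF f0, rule_format, OF steklov_tendsto_L1[OF u T this]]
    show "\<forall>\<^sub>F n in sequentially. dist (\<integral>t. norm (k n t) \<partial>lebesgue_on {0..T}) 0 < e"
    proof eventually_elim
      case (elim n)
      have "0 \<le> (\<integral>t. norm (k n t) \<partial>lebesgue_on {0..T})" by (rule integral_nonneg_AE) simp
      then show ?case using elim unfolding kint by simp
    qed
  qed
  from tendsto_L1_AE_subseq[OF ki this] obtain r where r: "strict_mono (r::nat\<Rightarrow>nat)"
    and "AE t in lebesgue_on {0..T}. (\<lambda>n. k (r n) t) \<longlonglongrightarrow> 0" by blast
  then obtain N where N: "negligible N" and klim: "\<And>t. t \<in> {0..T} - N \<Longrightarrow> (\<lambda>n. k (r n) t) \<longlonglongrightarrow> 0"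
    unfolding AE_lebesgue_on_iff_negligible by blast
  define \<eta> where "\<eta> n = \<eta>0 (r n)" for n
  have \<eta>: "\<eta> \<longlonglongrightarrow> 0" "\<And>n. \<eta> n > 0"
    using LIMSEQ_subseq_LIMSEQ[OF \<eta>0(1) r] \<eta>0(2) by (auto simp: \<eta>_def[abs_def] o_def)
  have slim: "(\<lambda>n. steklov (\<eta> n) u t) \<longlonglongrightarrow> u t" if t: "0 < t" "t < T" "t \<notin> N" for t
  proof -
    have "\<forall>\<^sub>F n in sequentially. \<eta> n < T - t" using t by (intro order_tendstoD(2)[OF \<eta>(1)]) simp
    then have "\<forall>\<^sub>F n in sequentially. k (r n) t = norm (steklov (\<eta> n) u t - u t)"
      by eventually_elim (use t in \<open>auto simp: k_def \<eta>_def\<close>)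
    then have "(\<lambda>n. norm (steklov (\<eta> n) u t - u t)) \<longlonglongrightarrow> 0"
      by (rule Lim_transform_eventually[OF klim, rotated]) (use t in auto)
    then show ?thesis by (simp add: tendsto_norm_zero_iff LIM_zero_iff)
  qed
  show ?thesis using \<eta> N slim by (intro exI[of _ \<eta>] exI[of _ N]) auto
qed

lemma weak_pair_primitive:
  fixes u v :: "real \<Rightarrow> 'b::banach"
  assumes w: "weak_pair T u v" and u: "bint 0 T u" and v: "bint 0 T v" and T: "T > 0"
  shows "\<exists>c. AE t in lebesgue_on {0..T}. u t = c + integral {0..t} v"
proof -
  obtain \<eta> N where \<eta>: "\<eta> \<longlonglongrightarrow> 0" "\<And>n::nat. \<eta> n > 0" and N: "negligible N"
    and slim: "\<And>t. 0 < t \<Longrightarrow> t < T \<Longrightarrow> t \<notin> N \<Longrightarrow> (\<lambda>n. steklov (\<eta> n) u t) \<longlonglongrightarrow> u t"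
    using steklov_AE_subseq[OF u T] by force
  have diff: "u t - u s = integral {s..t} v" if "0 < s" "s \<le> t" "t < T" "s \<notin> N" "t \<notin> N" for s t
  proof (rule LIMSEQ_unique)
    show "(\<lambda>n. steklov (\<eta> n) u t - steklov (\<eta> n) u s) \<longlonglongrightarrow> u t - u s"
      using that by (intro tendsto_diff slim) auto
    show "(\<lambda>n. steklov (\<eta> n) u t - steklov (\<eta> n) u s) \<longlonglongrightarrow> integral {s..t} v"
      using that by (intro weak_pair_steklov_tendsto[OF w u v] \<eta>) auto
  qed
  have "\<not> {0<..<T} \<subseteq> N"
    using N T negligible_subset[of N "{0<..<T}"] negligible_iff_null_sets[of "{0<..<T}"] by auto
  then obtain s0 where "s0 \<in> {0<..<T}" and s0: "s0 \<notin> N" by blast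
  then have s0: "0 < s0" "s0 < T" "s0 \<notin> N" by auto
  have vi: "v integrable_on {0..T}" by (rule bint_integrable[OF v])
  have split: "integral {0..t} v = integral {0..s} v + integral {s..t} v" if "0 \<le> s" "s \<le> t" "t \<le> T" for s t
    using that by (intro Henstock_Kurzweil_Integration.integral_combine[symmetric] integrable_on_subinterval[OF vi]) auto
  have "u t = (u s0 - integral {0..s0} v) + integral {0..t} v" if "t \<in> {0..T} - (N \<union> {0, T})" for t
  proof (cases "s0 \<le> t")
    case True
    then show ?thesis using diff[of s0 t] split[of s0 t] that s0 by (simp add: algebra_simps)
  next
    case False
    then show ?thesis using diff[of t s0] split[of t s0] that s0 by (simp add: algebra_simps)
  qed
  moreover have "negligible (N \<union> {0, T})" using N by auto
  ultimately show ?thesis unfolding AE_lebesgue_on_iff_negligible by blast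
qed

lemma continuous_AE_eq:
  fixes u v :: "real \<Rightarrow> 'b::real_normed_vector"
  assumes uv: "continuous_on {0..T} u" "continuous_on {0..T} v"
    and ae: "AE t in lebesgue_on {0..T}. u t = v t" and T: "0 < T" and t: "t \<in> {0..T}"
  shows "u t = v t"
proof (rule ccontr)
  assume "u t \<noteq> v t"
  define k where "k s = norm (u s - v s)" for s
  have k: "continuous_on {0..T} k" unfolding k_def by (intro continuous_intros uv)
  have "k t > 0" using \<open>u t \<noteq> v t\<close> by (simp add: k_def)
  then obtain d where d: "d > 0" "\<And>s. s \<in> {0..T} \<Longrightarrow> dist s t < d \<Longrightarrow> dist (k s) (k t) < k t"
    using k t unfolding continuous_on_iff by metis
  obtain N where N: "negligible N" "\<And>s. s \<in> {0..T} - N \<Longrightarrow> u s = v s"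
    using ae unfolding AE_lebesgue_on_iff_negligible by blast
  define a where "a = max 0 (t - d / 2)"
  define b where "b = min T (t + d / 2)"
  have ab: "a < b" using d(1) t T unfolding a_def b_def by auto
  have "{a..b} \<subseteq> N"
  proof
    fix s assume "s \<in> {a..b}"
    then have s: "s \<in> {0..T}" "dist s t < d" using d(1) t unfolding a_def b_def by (auto simp: dist_real_def)
    have "k s \<noteq> 0" using d(2)[OF s] \<open>k t > 0\<close> by (auto simp: dist_real_def)
    then show "s \<in> N" using N(2)[of s] s(1) by (auto simp: k_def)
  qed
  then have "negligible {a..b}" using N(1) negligible_subset by blast
  then show False using ab negligible_interval(1)[of a b] by simp
qed

lemma crep_eqI:
  fixes u v :: "real \<Rightarrow> 'b::real_normed_vector"
  assumes v: "continuous_on {0..T} v" "AE t in lebesgue_on {0..T}. v t = u t" and T: "0 < T"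
  shows continuous_on_crep: "continuous_on {0..T} (crep T u)"
    and crep_AE: "AE t in lebesgue_on {0..T}. crep T u t = u t"
    and crep_eq: "\<And>t. t \<in> {0..T} \<Longrightarrow> crep T u t = v t"
proof -
  have *: "continuous_on {0..T} (crep T u) \<and> (AE t in lebesgue_on {0..T}. crep T u t = u t)"
    unfolding crep_def by (rule someI[of _ v]) (use v in auto)
  then show 1: "continuous_on {0..T} (crep T u)" and 2: "AE t in lebesgue_on {0..T}. crep T u t = u t" by auto
  have "AE t in lebesgue_on {0..T}. crep T u t = v t" using 2 v(2) by eventually_elim simp
  from continuous_AE_eq[OF 1 v(1) this T] show "\<And>t. t \<in> {0..T} \<Longrightarrow> crep T u t = v t" .
qed

lemma H1_imp:
  fixes u :: "real \<Rightarrow> 'b::banach"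
  assumes "H1 T u" and T: "T > 0"
  shows H1_L2: "L2 T u" and H1_wderiv_L2: "L2 T (wderiv T u)"
    and H1_continuous_crep: "continuous_on {0..T} (crep T u)"
    and H1_crep_AE: "AE t in lebesgue_on {0..T}. crep T u t = u t"
    and H1_crep_diff: "\<And>s t. 0 \<le> s \<Longrightarrow> s \<le> t \<Longrightarrow> t \<le> T \<Longrightarrow> crep T u t - crep T u s = integral {s..t} (wderiv T u)"
proof -
  show u: "L2 T u" using assms unfolding H1_def by blast
  have w: "L2 T (wderiv T u) \<and> is_weak_deriv T u (wderiv T u)"
    using assms(1) someI_ex[of "\<lambda>v. L2 T v \<and> is_weak_deriv T u v"] unfolding H1_def wderiv_def by blast
  then show v: "L2 T (wderiv T u)" by blast
  obtain c where c: "AE t in lebesgue_on {0..T}. u t = c + integral {0..t} (wderiv T u)"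
    using weak_pair_primitive[OF is_weak_deriv_imp_weak_pair L2_bint[OF u] L2_bint[OF v] T] w by blast
  let ?v = "\<lambda>t. c + integral {0..t} (wderiv T u)"
  have vi: "wderiv T u integrable_on {0..T}" by (rule bint_integrable[OF L2_bint[OF v]])
  have cont: "continuous_on {0..T} ?v" by (intro continuous_intros indefinite_integral_continuous_1 vi)
  have ae: "AE t in lebesgue_on {0..T}. ?v t = u t" using c by eventually_elim simp
  show "continuous_on {0..T} (crep T u)" "AE t in lebesgue_on {0..T}. crep T u t = u t"
    using continuous_on_crep[OF cont ae T] crep_AE[OF cont ae T] by auto
  show "crep T u t - crep T u s = integral {s..t} (wderiv T u)" if st: "0 \<le> s" "s \<le> t" "t \<le> T" for s t
  proof -
    have "integral {0..s} (wderiv T u) + integral {s..t} (wderiv T u) = integral {0..t} (wderiv T u)"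
      using st by (intro Henstock_Kurzweil_Integration.integral_combine integrable_on_subinterval[OF vi]) auto
    then show ?thesis
      using crep_eq[OF cont ae T, of s] crep_eq[OF cont ae T, of t] st by (simp add: algebra_simps)
  qed
qed

section \<open>Gronwall's inequality for one-sided derivatives\<close>

text \<open>Otherwise \<open>\<Psi> t - \<Psi> 0 - e t\<close> is positive at the end for some \<open>e > 0\<close>, and the last point where it is not
  positive contradicts the bound for the right increments.\<close>

lemma dini_nonincreasing:
  fixes \<Psi> :: "real \<Rightarrow> real"
  assumes \<tau>: "0 \<le> \<tau>" and c: "continuous_on {0..\<tau>} \<Psi>"
    and dini: "\<And>t e. 0 \<le> t \<Longrightarrow> t < \<tau> \<Longrightarrow> e > 0 \<Longrightarrow> \<forall>\<^sub>F h in at_right 0. \<Psi> (t + h) \<le> \<Psi> t + e * h"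
  shows "\<Psi> \<tau> \<le> \<Psi> 0"
proof (rule ccontr)
  assume "\<not> \<Psi> \<tau> \<le> \<Psi> 0"
  then have gt: "\<Psi> 0 < \<Psi> \<tau>" by simp
  then have \<tau>0: "\<tau> > 0" using \<tau> by (cases "\<tau> = 0") auto
  define e where "e = (\<Psi> \<tau> - \<Psi> 0) / (2 * \<tau>)"
  have e: "e > 0" "e * \<tau> < \<Psi> \<tau> - \<Psi> 0" unfolding e_def using gt \<tau>0 by (auto simp: field_simps)
  define D where "D t = \<Psi> t - \<Psi> 0 - e * t" for t
  have Dc: "continuous_on {0..\<tau>} D" unfolding D_def by (intro continuous_intros c)
  let ?Z = "{t \<in> {0..\<tau>}. D t \<le> 0}"
  have "?Z = {0..\<tau>} \<inter> D -` {..0}" by auto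
  then have "closed ?Z" using continuous_closed_preimage[OF Dc, of "{..0}"] by simp
  moreover have "bounded ?Z" by (rule bounded_subset[of "{0..\<tau>}"]) auto
  ultimately have "compact ?Z" by (simp add: compact_eq_bounded_closed)
  moreover have "0 \<in> ?Z" using \<tau> by (simp add: D_def)
  ultimately obtain \<sigma> where \<sigma>: "\<sigma> \<in> ?Z" "\<And>t. t \<in> ?Z \<Longrightarrow> t \<le> \<sigma>"
    using compact_attains_sup[of ?Z] by blast
  have "\<sigma> \<noteq> \<tau>" using \<sigma>(1) e(2) by (auto simp: D_def)
  then have \<sigma>\<tau>: "0 \<le> \<sigma>" "\<sigma> < \<tau>" using \<sigma>(1) by auto
  have "\<forall>\<^sub>F h in at_right 0. \<Psi> (\<sigma> + h) \<le> \<Psi> \<sigma> + e * h \<and> 0 < h \<and> h < \<tau> - \<sigma>"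
    using dini[OF \<sigma>\<tau> e(1)] by (rule eventually_conj) (use \<sigma>\<tau> in \<open>auto intro!: eventually_at_rightI[of 0 "\<tau> - \<sigma>"]\<close>)
  then obtain h where h: "\<Psi> (\<sigma> + h) \<le> \<Psi> \<sigma> + e * h" "0 < h" "h < \<tau> - \<sigma>"
    using eventually_happens'[OF trivial_limit_at_right_real] by blast
  then have "D (\<sigma> + h) \<le> D \<sigma>" by (simp add: D_def algebra_simps)
  then have "\<sigma> + h \<in> ?Z" using \<sigma>(1) h by auto
  then show False using \<sigma>(2) h(2) by fastforce
qed

lemma right_derivative_eventually_le:
  assumes "(R has_real_derivative d) (at_right (t::real))" "d < d'"
  shows "\<forall>\<^sub>F h in at_right 0. R (t + h) \<le> R t + d' * h"
proof -
  have "((\<lambda>y. (R y - R t) / (y - t)) \<longlongrightarrow> d) (at_right t)"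
    using assms(1) unfolding has_field_derivative_iff by simp
  then have "\<forall>\<^sub>F y in at_right t. (R y - R t) / (y - t) < d'"
    by (rule order_tendstoD(2)) (rule assms)
  then have "\<forall>\<^sub>F h in at_right 0. (R (h + t) - R t) / (h + t - t) < d'"
    by (simp add: eventually_at_to_0[of _ t] at_right_to_0[of t] eventually_filtermap)
  moreover have "\<forall>\<^sub>F h in at_right 0. (h::real) > 0" by (simp add: eventually_at_right_less)
  ultimately show ?thesis
    by eventually_elim (simp add: field_simps)
qed

text \<open>Gronwall's inequality for functions that have no derivative, only an upper bound for their right increments.
  The dissipation \<open>l\<close> stays on the left.\<close>

lemma gronwall_dini:
  fixes \<phi> k l :: "real \<Rightarrow> real"
  assumes \<tau>: "0 \<le> \<tau>" and \<mu>: "0 \<le> \<mu>"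
    and cont: "continuous_on {0..\<tau>} \<phi>" "continuous_on {0..\<tau>} k" "continuous_on {0..\<tau>} l"
    and nonneg: "\<And>t. t \<in> {0..\<tau>} \<Longrightarrow> 0 \<le> k t" "\<And>t. t \<in> {0..\<tau>} \<Longrightarrow> 0 \<le> l t"
    and dini: "\<And>t e. 0 \<le> t \<Longrightarrow> t < \<tau> \<Longrightarrow> e > 0 \<Longrightarrow>
      \<forall>\<^sub>F h in at_right 0. \<phi> (t + h) \<le> \<phi> t + h * (\<mu> * \<phi> t + k t - l t + e)"
  shows "\<phi> \<tau> + integral {0..\<tau>} l \<le> exp (\<mu> * \<tau>) * (\<phi> 0 + integral {0..\<tau>} k)"
proof -
  define w where "w s = exp (- \<mu> * s) * (l s - k s)" for s
  have wc: "continuous_on {0..\<tau>} w" unfolding w_def by (intro continuous_intros cont)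
  define J where "J t = integral {0..t} w" for t
  have J': "(J has_real_derivative w t) (at t within {0..\<tau>})" if "t \<in> {0..\<tau>}" for t
    unfolding J_def by (rule integral_has_real_derivative[OF wc that])
  define \<Psi> where "\<Psi> t = exp (- \<mu> * t) * \<phi> t + J t" for t
  have "\<Psi> \<tau> \<le> \<Psi> 0"
  proof (rule dini_nonincreasing[OF \<tau>])
    show "continuous_on {0..\<tau>} \<Psi>"
      unfolding \<Psi>_def J_def by (intro continuous_intros cont indefinite_integral_continuous_1 integrable_continuous_real wc)
    fix t e :: real assume t: "0 \<le> t" "t < \<tau>" and e: "e > 0"
    define m where "m = \<mu> * \<phi> t + k t - l t + e / 2"
    define R where "R s = exp (- \<mu> * s) * (\<phi> t + (s - t) * m) + J s" for s
    have Jr: "(J has_real_derivative w t) (at_right t)"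
      using J'[of t] t at_within_Icc_at_right[of t \<tau>]
      by (metis (no_types, lifting) DERIV_subset atLeastAtMost_iff atLeastatMost_subset_iff less_imp_le order_refl)
    have "(R has_real_derivative (- \<mu> * exp (- \<mu> * t) * \<phi> t + exp (- \<mu> * t) * m + w t)) (at_right t)"
      unfolding R_def by (auto intro!: derivative_eq_intros Jr)
    moreover have "- \<mu> * exp (- \<mu> * t) * \<phi> t + exp (- \<mu> * t) * m + w t < e"
    proof -
      have "- \<mu> * exp (- \<mu> * t) * \<phi> t + exp (- \<mu> * t) * m + w t = exp (- \<mu> * t) * (e / 2)"
        unfolding m_def w_def by (simp add: algebra_simps)
      also have "\<dots> \<le> 1 * (e / 2)" using \<mu> t e by (intro mult_right_mono) auto
      finally show ?thesis using e by simp
    qed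
    ultimately have "\<forall>\<^sub>F h in at_right 0. R (t + h) \<le> R t + e * h"
      by (rule right_derivative_eventually_le)
    with dini[OF t half_gt_zero[OF e]]
    show "\<forall>\<^sub>F h in at_right 0. \<Psi> (t + h) \<le> \<Psi> t + e * h"
    proof eventually_elim
      case (elim h)
      have "exp (- \<mu> * (t + h)) * \<phi> (t + h) \<le> exp (- \<mu> * (t + h)) * (\<phi> t + h * m)"
        using elim(1) unfolding m_def by (intro mult_left_mono) auto
      moreover have "R (t + h) = exp (- \<mu> * (t + h)) * (\<phi> t + h * m) + J (t + h)" "R t = \<Psi> t"
        by (simp_all add: R_def \<Psi>_def)
      ultimately show ?case using elim(2) unfolding \<Psi>_def by linarith
    qed
  qed
  then have 1: "exp (- \<mu> * \<tau>) * \<phi> \<tau> + J \<tau> \<le> \<phi> 0" by (simp add: \<Psi>_def J_def)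
  have li: "l integrable_on {0..\<tau>}" and ki: "k integrable_on {0..\<tau>}"
    by (auto intro: integrable_continuous_real cont)
  have eli: "(\<lambda>s. exp (- \<mu> * s) * l s) integrable_on {0..\<tau>}" and eki: "(\<lambda>s. exp (- \<mu> * s) * k s) integrable_on {0..\<tau>}"
    by (auto intro!: integrable_continuous_real continuous_intros cont)
  have "J \<tau> = integral {0..\<tau>} (\<lambda>s. exp (- \<mu> * s) * l s) - integral {0..\<tau>} (\<lambda>s. exp (- \<mu> * s) * k s)"
    unfolding J_def w_def right_diff_distrib by (rule integral_diff[OF eli eki])
  moreover have "exp (- \<mu> * \<tau>) * integral {0..\<tau>} l \<le> integral {0..\<tau>} (\<lambda>s. exp (- \<mu> * s) * l s)"
    unfolding integral_mult_right[symmetric] using \<mu> nonneg(2)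
    by (intro integral_le integrable_on_mult_right li eli mult_right_mono) (auto intro: mult_left_mono)
  moreover have "integral {0..\<tau>} (\<lambda>s. exp (- \<mu> * s) * k s) \<le> integral {0..\<tau>} k"
    using \<mu> nonneg(1) by (intro integral_le ki eki mult_left_le_one_le) auto
  ultimately have "exp (- \<mu> * \<tau>) * (\<phi> \<tau> + integral {0..\<tau>} l) \<le> \<phi> 0 + integral {0..\<tau>} k"
    using 1 by (simp add: distrib_left)
  then have "exp (\<mu> * \<tau>) * (exp (- \<mu> * \<tau>) * (\<phi> \<tau> + integral {0..\<tau>} l)) \<le> exp (\<mu> * \<tau>) * (\<phi> 0 + integral {0..\<tau>} k)"
    by (rule mult_left_mono) simp
  then show ?thesis by (simp add: mult.assoc[symmetric] exp_add[symmetric])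
qed

section \<open>Parabolic regularity\<close>

text \<open>The limit system after elimination of \<open>m\<close> and of the constraint: \<open>Y\<close> is the kernel of \<open>B\<close> and \<open>L\<close> is the elliptic
  operator \<open>K\<^sup>* D\<^sup>-\<^sup>1 K\<close>, while \<open>A\<close> acts in the pivot space.\<close>

locale parabolic =
  fixes \<iota> :: "'p::{real_inner,banach} \<Rightarrow>\<^sub>L 'h::{real_inner,banach}"
    and A :: "'h \<Rightarrow>\<^sub>L ('h \<Rightarrow>\<^sub>L real)"
    and L :: "'p \<Rightarrow> ('p \<Rightarrow>\<^sub>L real)" and Y :: "'p set" and \<alpha> T :: real
  assumes L: "bounded_linear L" and Y: "subspace Y" "closed Y"
    and \<alpha>: "0 < \<alpha>" and coercive: "\<And>q. q \<in> Y \<Longrightarrow> \<alpha> * (norm q)\<^sup>2 \<le> L q q"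
    and T: "0 < T"
begin

lemma A_upper: "\<bar>A x y\<bar> \<le> norm A * norm x * norm y"
proof -
  have "\<bar>A x y\<bar> \<le> norm (A x) * norm y" using norm_blinfun[of "A x" y] by simp
  also have "\<dots> \<le> norm A * norm x * norm y" by (intro mult_right_mono norm_blinfun) simp
  finally show ?thesis .
qed

lemma young: "2 * (a * b) \<le> a\<^sup>2 / c + c * b\<^sup>2" if "c > (0::real)"
proof -
  have "0 \<le> (a - c * b)\<^sup>2 / c" using that by simp
  also have "\<dots> = a\<^sup>2 / c + c * b\<^sup>2 - 2 * (a * b)"
    using that by (simp add: power2_diff power2_eq_square field_simps)
  finally show ?thesis by simp
qed

text \<open>The equation is tested with its solution. The functional \<open>\<Gamma>\<close> is absorbed by the ellipticity of \<open>L\<close> and the constant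
  \<open>\<rho>\<close> by the exponential growth, at a rate \<open>\<kappa>\<close> that is adapted to the length of the interval.\<close>

lemma energy:
  fixes w :: "real \<Rightarrow> 'p" and \<Gamma> :: "real \<Rightarrow> ('p \<Rightarrow>\<^sub>L real)"
  assumes \<tau>: "0 \<le> \<tau>" and \<kappa>: "0 < \<kappa>"
    and w: "continuous_on {0..\<tau>} w" "\<And>t. t \<in> {0..\<tau>} \<Longrightarrow> w t \<in> Y"
    and w': "\<And>t. t \<in> {0..\<tau>} \<Longrightarrow> ((\<lambda>t. \<iota> (w t)) has_vector_derivative W' t) (at t within {0..\<tau>})"
    and \<Gamma>: "continuous_on {0..\<tau>} \<Gamma>"
    and eq: "\<And>t q. t \<in> {0..\<tau>} \<Longrightarrow> q \<in> Y \<Longrightarrow>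
        W' t \<bullet> \<iota> q + A (\<iota> (w t)) (\<iota> q) + L (w t) q = \<Gamma> t q + \<rho> \<bullet> \<iota> q"
  shows "(norm (\<iota> (w \<tau>)))\<^sup>2 + \<alpha> * integral {0..\<tau>} (\<lambda>t. (norm (w t))\<^sup>2)
    \<le> exp ((2 * norm A + \<kappa>) * \<tau>) * ((norm (\<iota> (w 0)))\<^sup>2 + integral {0..\<tau>} (\<lambda>t. (norm (\<Gamma> t))\<^sup>2 / \<alpha> + (norm \<rho>)\<^sup>2 / \<kappa>))"
proof -
  define \<phi> where "\<phi> t = (norm (\<iota> (w t)))\<^sup>2" for t
  have "\<phi> \<tau> + integral {0..\<tau>} (\<lambda>t. \<alpha> * (norm (w t))\<^sup>2)
    \<le> exp ((2 * norm A + \<kappa>) * \<tau>) * (\<phi> 0 + integral {0..\<tau>} (\<lambda>t. (norm (\<Gamma> t))\<^sup>2 / \<alpha> + (norm \<rho>)\<^sup>2 / \<kappa>))"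
  proof (rule gronwall_dini[OF \<tau>])
    show "continuous_on {0..\<tau>} \<phi>" unfolding \<phi>_def by (intro continuous_intros w)
    show "continuous_on {0..\<tau>} (\<lambda>t. (norm (\<Gamma> t))\<^sup>2 / \<alpha> + (norm \<rho>)\<^sup>2 / \<kappa>)"
      using \<alpha> \<kappa> by (intro continuous_intros \<Gamma>) auto
    show "continuous_on {0..\<tau>} (\<lambda>t. \<alpha> * (norm (w t))\<^sup>2)" by (intro continuous_intros w)
    fix t e :: real assume t: "0 \<le> t" "t < \<tau>" and e: "e > 0"
    then have t': "t \<in> {0..\<tau>}" by simp
    let ?x = "\<iota> (w t)"
    have "((\<lambda>t. \<iota> (w t)) has_vector_derivative W' t) (at_right t)"
      using has_vector_derivative_within_subset[OF w'[OF t'], of "{t..\<tau>}"] t at_within_Icc_at_right[of t \<tau>] by simp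
    from bounded_bilinear.has_vector_derivative[OF bounded_bilinear_inner this this]
    have "((\<lambda>t. \<iota> (w t) \<bullet> \<iota> (w t)) has_real_derivative 2 * (?x \<bullet> W' t)) (at_right t)"
      unfolding has_real_derivative_iff_has_vector_derivative by (simp add: inner_commute)
    then have D: "(\<phi> has_real_derivative 2 * (?x \<bullet> W' t)) (at_right t)"
      unfolding \<phi>_def power2_norm_eq_inner .
    have "2 * (?x \<bullet> W' t) = 2 * \<Gamma> t (w t) + 2 * (\<rho> \<bullet> ?x) - 2 * A ?x ?x - 2 * L (w t) (w t)"
      using eq[OF t' w(2)[OF t']] by (simp add: inner_commute)
    also have "\<dots> \<le> 2 * (norm (\<Gamma> t) * norm (w t)) + 2 * (norm \<rho> * norm ?x) + 2 * (norm A * norm ?x * norm ?x) - 2 * (\<alpha> * (norm (w t))\<^sup>2)"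
      using norm_blinfun[of "\<Gamma> t" "w t"] norm_cauchy_schwarz[of \<rho> ?x] A_upper[of ?x ?x] coercive[OF w(2)[OF t']]
      by (simp add: abs_le_iff)
    also have "\<dots> \<le> (2 * norm A + \<kappa>) * \<phi> t + ((norm (\<Gamma> t))\<^sup>2 / \<alpha> + (norm \<rho>)\<^sup>2 / \<kappa>) - \<alpha> * (norm (w t))\<^sup>2"
      using young[OF \<alpha>, of "norm (\<Gamma> t)" "norm (w t)"] young[OF \<kappa>, of "norm \<rho>" "norm ?x"]
      unfolding \<phi>_def by (simp add: algebra_simps power2_eq_square)
    finally have "2 * (?x \<bullet> W' t) < (2 * norm A + \<kappa>) * \<phi> t + ((norm (\<Gamma> t))\<^sup>2 / \<alpha> + (norm \<rho>)\<^sup>2 / \<kappa>) - \<alpha> * (norm (w t))\<^sup>2 + e"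
      using e by simp
    from right_derivative_eventually_le[OF D this]
    show "\<forall>\<^sub>F h in at_right 0. \<phi> (t + h) \<le> \<phi> t + h * ((2 * norm A + \<kappa>) * \<phi> t + ((norm (\<Gamma> t))\<^sup>2 / \<alpha> + (norm \<rho>)\<^sup>2 / \<kappa>) - \<alpha> * (norm (w t))\<^sup>2 + e)"
      by (simp add: mult.commute)
  qed (use \<alpha> \<kappa> in auto)
  then show ?thesis by (simp add: \<phi>_def)
qed


text \<open>Coefficients independent of time commute with Steklov averages, so the averages of a weak solution
  solve the equation classically.\<close>

lemma steklov_solution:
  fixes u :: "real \<Rightarrow> 'p" and U :: "real \<Rightarrow> 'h" and G :: "real \<Rightarrow> ('p \<Rightarrow>\<^sub>L real)"
  assumes u: "bint 0 T u" "\<And>t. t \<in> {0..T} \<Longrightarrow> u t \<in> Y" and U: "continuous_on {0..T} U"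
    and ae: "AE t in lebesgue_on {0..T}. U t = \<iota> (u t)" and G: "continuous_on {0..T} G"
    and eq: "\<And>s t q. 0 \<le> s \<Longrightarrow> s \<le> t \<Longrightarrow> t \<le> T \<Longrightarrow> q \<in> Y \<Longrightarrow>
      (U t - U s) \<bullet> \<iota> q = integral {s..t} (\<lambda>r. G r q - A (U r) (\<iota> q) - L (u r) q)"
    and \<eta>: "0 < \<eta>" and t: "t \<in> {0..T - \<eta>}"
  shows steklov_in: "steklov \<eta> u t \<in> Y"
    and steklov_embed: "\<iota> (steklov \<eta> u t) = steklov \<eta> U t"
    and steklov_eq: "\<And>q. q \<in> Y \<Longrightarrow> ((1 / \<eta>) *\<^sub>R (U (t + \<eta>) - U t)) \<bullet> \<iota> q + A (\<iota> (steklov \<eta> u t)) (\<iota> q)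
        + L (steklov \<eta> u t) q = steklov \<eta> G t q"
proof -
  have sub: "{t..t + \<eta>} \<subseteq> {0..T}" using t \<eta> by auto
  have ui: "u integrable_on {t..t + \<eta>}" by (intro bint_integrable bint_subinterval[OF u(1)] sub)
  have Ui: "U integrable_on {t..t + \<eta>}" and Gi: "G integrable_on {t..t + \<eta>}"
    by (intro integrable_continuous_real continuous_on_subset[OF U] continuous_on_subset[OF G] sub)+
  have "orth_proj Y (steklov \<eta> u t) = steklov \<eta> (\<lambda>s. orth_proj Y (u s)) t"
    by (rule steklov_linear[OF bounded_linear_orth_proj[OF Y] ui, symmetric])
  also have "\<dots> = steklov \<eta> u t"
    unfolding steklov_def using u(2) sub by (intro arg_cong2[where f = scaleR] refl integral_cong orth_proj_id[OF Y]) auto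
  finally show "steklov \<eta> u t \<in> Y" using orth_proj_in[OF Y, of "steklov \<eta> u t"] by simp
  obtain N where N: "negligible N" "\<And>s. s \<in> {0..T} - N \<Longrightarrow> U s = \<iota> (u s)"
    using ae unfolding AE_lebesgue_on_iff_negligible by blast
  have "steklov \<eta> U t = steklov \<eta> (\<lambda>s. \<iota> (u s)) t"
    unfolding steklov_def by (intro arg_cong2[where f = scaleR] refl integral_spike[OF N(1)]) (use N(2) sub in auto)
  then show emb: "\<iota> (steklov \<eta> u t) = steklov \<eta> U t"
    using steklov_linear[OF blinfun.bounded_linear_right ui, of \<iota>] by simp
  fix q assume q: "q \<in> Y"
  have blA: "bounded_linear (\<lambda>x. A x (\<iota> q))"
    by (rule bounded_linear_compose[OF blinfun.bounded_linear_left blinfun.bounded_linear_right])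
  have blL: "bounded_linear (\<lambda>x. L x q)"
    by (rule bounded_linear_compose[OF blinfun.bounded_linear_left L])
  have i1: "(\<lambda>r. G r q) integrable_on {t..t + \<eta>}" using integrable_linear[OF Gi blinfun.bounded_linear_left, of q] by (simp add: o_def)
  have i2: "(\<lambda>r. A (U r) (\<iota> q)) integrable_on {t..t + \<eta>}" using integrable_linear[OF Ui blA] by (simp add: o_def)
  have i3: "(\<lambda>r. L (u r) q) integrable_on {t..t + \<eta>}" using integrable_linear[OF ui blL] by (simp add: o_def)
  have "((1 / \<eta>) *\<^sub>R (U (t + \<eta>) - U t)) \<bullet> \<iota> q = steklov \<eta> (\<lambda>r. G r q - A (U r) (\<iota> q) - L (u r) q) t"
    unfolding steklov_def using eq[of t "t + \<eta>" q] t \<eta> q by simp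
  also have "\<dots> = steklov \<eta> (\<lambda>r. G r q) t - steklov \<eta> (\<lambda>r. A (U r) (\<iota> q)) t - steklov \<eta> (\<lambda>r. L (u r) q) t"
    by (simp add: steklov_diff integrable_diff i1 i2 i3)
  also have "\<dots> = steklov \<eta> G t q - A (steklov \<eta> U t) (\<iota> q) - L (steklov \<eta> u t) q"
    using steklov_linear[OF blinfun.bounded_linear_left Gi, of q] steklov_linear[OF blA Ui] steklov_linear[OF blL ui] by simp
  finally show "((1 / \<eta>) *\<^sub>R (U (t + \<eta>) - U t)) \<bullet> \<iota> q + A (\<iota> (steklov \<eta> u t)) (\<iota> q)
        + L (steklov \<eta> u t) q = steklov \<eta> G t q" by (simp add: emb)
qed

end

text \<open>The condition on \<open>ps\<close> says that the time derivative of the solution at time zero, as given by the equation, is an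
  element of \<open>'h\<close>. The number \<open>N\<close> stands for the square integral of the derivative of \<open>G\<close>, which enters through
  differences only.\<close>

locale compatible_solution = parabolic \<iota> A L Y \<alpha> T
  for \<iota> :: "'p::{real_inner,banach} \<Rightarrow>\<^sub>L 'h::{real_inner,banach}"
    and A :: "'h \<Rightarrow>\<^sub>L ('h \<Rightarrow>\<^sub>L real)" and L :: "'p \<Rightarrow> ('p \<Rightarrow>\<^sub>L real)" and Y \<alpha> T +
  fixes u :: "real \<Rightarrow> 'p" and U :: "real \<Rightarrow> 'h" and G :: "real \<Rightarrow> ('p \<Rightarrow>\<^sub>L real)"
    and u0 :: 'p and ps :: 'h and N :: real
  assumes u: "bint 0 T u" "\<And>t. t \<in> {0..T} \<Longrightarrow> u t \<in> Y" and U: "continuous_on {0..T} U"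
    and ae: "AE t in lebesgue_on {0..T}. U t = \<iota> (u t)" and G: "continuous_on {0..T} G"
    and eq: "\<And>s t q. 0 \<le> s \<Longrightarrow> s \<le> t \<Longrightarrow> t \<le> T \<Longrightarrow> q \<in> Y \<Longrightarrow>
      (U t - U s) \<bullet> \<iota> q = integral {s..t} (\<lambda>r. G r q - A (U r) (\<iota> q) - L (u r) q)"
    and u0: "u0 \<in> Y" "U 0 = \<iota> u0"
    and ps: "\<And>q. q \<in> Y \<Longrightarrow> G 0 q - A (\<iota> u0) (\<iota> q) - L u0 q = ps \<bullet> \<iota> q"
    and N: "0 \<le> N" "\<And>s t. 0 \<le> s \<Longrightarrow> s \<le> t \<Longrightarrow> t \<le> T \<Longrightarrow> (norm (G t - G s))\<^sup>2 \<le> (t - s) * N"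
      "\<And>\<delta>. 0 \<le> \<delta> \<Longrightarrow> \<delta> \<le> T \<Longrightarrow> integral {0..T - \<delta>} (\<lambda>t. (norm (G (t + \<delta>) - G t))\<^sup>2) \<le> \<delta>\<^sup>2 * N"
begin

lemma sol:
  assumes "0 < \<eta>" "t \<in> {0..T - \<eta>}"
  shows "steklov \<eta> u t \<in> Y"
    and "\<iota> (steklov \<eta> u t) = steklov \<eta> U t"
    and "\<And>q. q \<in> Y \<Longrightarrow> ((1 / \<eta>) *\<^sub>R (U (t + \<eta>) - U t)) \<bullet> \<iota> q + A (\<iota> (steklov \<eta> u t)) (\<iota> q)
        + L (steklov \<eta> u t) q = steklov \<eta> G t q"
  by (rule steklov_solution[of u U G \<eta> t]; (rule u(1) U ae G assms | erule u(2) | (rule eq; assumption) | assumption))+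

lemma ui: "u integrable_on {0..T}" by (rule bint_integrable[OF u(1)])
lemma Gi: "G integrable_on {0..T}" by (rule integrable_continuous_real[OF G])

lemma steklov_U_deriv:
  assumes "0 < \<eta>" "t \<in> {0..\<tau>}" "\<tau> \<le> T - \<eta>"
  shows "((\<lambda>t. \<iota> (steklov \<eta> u t)) has_vector_derivative (1 / \<eta>) *\<^sub>R (U (t + \<eta>) - U t)) (at t within {0..\<tau>})"
proof -
  have "(steklov \<eta> U has_vector_derivative (1 / \<eta>) *\<^sub>R (U (t + \<eta>) - U t)) (at t within {0..\<tau>})"
    by (rule has_vector_derivative_within_subset[OF steklov_has_vector_derivative[OF U assms(1)]]) (use assms in auto)
  then show ?thesis
    by (rule has_vector_derivative_transform[rotated 2]) (use assms in \<open>auto intro!: sol(2)\<close>)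
qed

lemma norm_G_diff: "0 \<le> s \<Longrightarrow> s \<le> T \<Longrightarrow> 0 \<le> t \<Longrightarrow> t \<le> T \<Longrightarrow> norm (G t - G s) \<le> sqrt (\<bar>t - s\<bar> * N)"
proof (cases "s \<le> t")
  case True
  assume "0 \<le> s" "s \<le> T" "0 \<le> t" "t \<le> T"
  then show ?thesis using N(2)[of s t] True by (intro real_le_rsqrt) simp
next
  case False
  assume "0 \<le> s" "s \<le> T" "0 \<le> t" "t \<le> T"
  then show ?thesis using N(2)[of t s] False by (intro real_le_rsqrt) (simp add: norm_minus_commute)
qed

lemma norm_steklov_G_diff:
  assumes \<eta>: "0 < \<eta>" and t: "t \<in> {0..T - \<eta>}" and s: "s \<in> {0..T}" and d: "\<And>r. r \<in> {t..t + \<eta>} \<Longrightarrow> \<bar>r - s\<bar> \<le> d"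
  shows "norm (steklov \<eta> G t - G s) \<le> sqrt (d * N)"
proof -
  have i: "G integrable_on {t..t + \<eta>}" by (rule integrable_on_subinterval[OF Gi]) (use t \<eta> in auto)
  show ?thesis
    unfolding steklov_const_diff[OF \<eta> i]
  proof (rule norm_steklov_le[OF \<eta>])
    show "(\<lambda>s'. G s' - G s) integrable_on {t..t + \<eta>}" by (intro integrable_diff i integrable_const_ivl)
    fix r assume r: "r \<in> {t..t + \<eta>}"
    have "norm (G r - G s) \<le> sqrt (\<bar>r - s\<bar> * N)" using r t s \<eta> by (intro norm_G_diff) auto
    also have "\<dots> \<le> sqrt (d * N)" using d[OF r] N(1) by (intro real_sqrt_le_mono mult_right_mono) auto
    finally show "norm (G r - G s) \<le> sqrt (d * N)" .
  qed
qed

definition "ca = exp (2 * norm A * T + 1)"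

text \<open>The compatibility condition makes the solution leave its initial value at bounded speed. The energy
  estimate is applied on \<open>[0, \<delta>]\<close> with the weight \<open>1 / \<delta>\<close>, so that the exponential factor stays bounded.\<close>

lemma initial_speed:
  assumes \<delta>: "0 < \<delta>" "\<delta> < T"
  shows "(norm (U \<delta> - U 0))\<^sup>2 \<le> \<delta>\<^sup>2 * (ca * (N / \<alpha> + (norm ps)\<^sup>2))"
proof -
  have "\<forall>\<^sub>F \<eta> in at_right 0. (norm (steklov \<eta> U \<delta> - U 0))\<^sup>2 \<le>
      ca * ((norm (steklov \<eta> U 0 - U 0))\<^sup>2 + \<delta> * ((\<delta> + \<eta>) * N / \<alpha> + \<delta> * (norm ps)\<^sup>2))"
  proof (rule eventually_at_rightI[of 0 "T - \<delta>"])
    fix \<eta> assume "\<eta> \<in> {0<..<T - \<delta>}"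
    then have \<eta>: "0 < \<eta>" "\<delta> < T - \<eta>" by auto
    define w where "w t = steklov \<eta> u t - u0" for t
    define \<Gamma> where "\<Gamma> t = steklov \<eta> G t - G 0" for t
    have iw: "\<iota> (w t) = steklov \<eta> U t - U 0" if "t \<in> {0..\<delta>}" for t
      using sol(2)[OF \<eta>(1), of t] that \<eta> \<delta> u0 by (simp add: w_def blinfun.diff_right)
    interpret L: bounded_linear L by (rule L)
    have "(norm (\<iota> (w \<delta>)))\<^sup>2 + \<alpha> * integral {0..\<delta>} (\<lambda>t. (norm (w t))\<^sup>2)
      \<le> exp ((2 * norm A + 1 / \<delta>) * \<delta>) * ((norm (\<iota> (w 0)))\<^sup>2 + integral {0..\<delta>} (\<lambda>t. (norm (\<Gamma> t))\<^sup>2 / \<alpha> + (norm ps)\<^sup>2 / (1 / \<delta>)))"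
    proof (rule energy)
      show "continuous_on {0..\<delta>} w" unfolding w_def using \<eta>
        by (intro continuous_intros continuous_on_subset[OF continuous_on_steklov[OF ui, of \<eta>]]) auto
      show "continuous_on {0..\<delta>} \<Gamma>" unfolding \<Gamma>_def using \<eta>
        by (intro continuous_intros continuous_on_subset[OF continuous_on_steklov[OF Gi, of \<eta>]]) auto
      fix t assume t: "t \<in> {0..\<delta>}"
      then have t': "t \<in> {0..T - \<eta>}" using \<eta> by auto
      show "w t \<in> Y" unfolding w_def using sol(1)[OF \<eta>(1) t'] u0 Y(1) by (simp add: subspace_diff)
      show "((\<lambda>t. \<iota> (w t)) has_vector_derivative (1 / \<eta>) *\<^sub>R (U (t + \<eta>) - U t)) (at t within {0..\<delta>})"
        unfolding w_def blinfun.diff_right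
        using has_vector_derivative_diff[OF steklov_U_deriv[OF \<eta>(1) t] has_vector_derivative_const, of "\<iota> u0"] \<eta> by simp
      show "((1 / \<eta>) *\<^sub>R (U (t + \<eta>) - U t)) \<bullet> \<iota> q + A (\<iota> (w t)) (\<iota> q) + L (w t) q = \<Gamma> t q + ps \<bullet> \<iota> q" if "q \<in> Y" for q
        using sol(3)[OF \<eta>(1) t' that] ps[OF that]
        by (simp add: w_def \<Gamma>_def L.diff blinfun.diff_right blinfun.diff_left)
    qed (use \<delta> in auto)
    moreover have "exp ((2 * norm A + 1 / \<delta>) * \<delta>) \<le> ca"
      using \<delta> by (simp add: ca_def distrib_right mult_left_mono)
    moreover have "integral {0..\<delta>} (\<lambda>t. (norm (\<Gamma> t))\<^sup>2 / \<alpha> + (norm ps)\<^sup>2 / (1 / \<delta>))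
        \<le> integral {0..\<delta>} (\<lambda>t. (\<delta> + \<eta>) * N / \<alpha> + \<delta> * (norm ps)\<^sup>2)"
    proof (rule integral_le)
      show "(\<lambda>t. (norm (\<Gamma> t))\<^sup>2 / \<alpha> + (norm ps)\<^sup>2 / (1 / \<delta>)) integrable_on {0..\<delta>}"
        unfolding \<Gamma>_def using \<eta> \<alpha> \<delta>
        by (intro integrable_continuous_real continuous_intros continuous_on_subset[OF continuous_on_steklov[OF Gi, of \<eta>]]) auto
      fix t assume t: "t \<in> {0..\<delta>}"
      have "norm (\<Gamma> t) \<le> sqrt ((\<delta> + \<eta>) * N)"
        unfolding \<Gamma>_def using t \<eta> \<delta> by (intro norm_steklov_G_diff) auto
      then have "(norm (\<Gamma> t))\<^sup>2 \<le> (\<delta> + \<eta>) * N"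
        using power_mono[of "norm (\<Gamma> t)" "sqrt ((\<delta> + \<eta>) * N)" 2] \<delta> \<eta> N(1) by simp
      then show "(norm (\<Gamma> t))\<^sup>2 / \<alpha> + (norm ps)\<^sup>2 / (1 / \<delta>) \<le> (\<delta> + \<eta>) * N / \<alpha> + \<delta> * (norm ps)\<^sup>2"
        using \<alpha> by (simp add: divide_right_mono)
    qed (rule integrable_const_ivl)
    moreover have "0 \<le> \<alpha> * integral {0..\<delta>} (\<lambda>t. (norm (w t))\<^sup>2)"
      unfolding w_def using \<alpha> \<eta>
      by (intro mult_nonneg_nonneg integral_nonneg integrable_continuous_real continuous_intros
          continuous_on_subset[OF continuous_on_steklov[OF ui, of \<eta>]]) auto
    moreover have "0 \<le> integral {0..\<delta>} (\<lambda>t. (norm (\<Gamma> t))\<^sup>2 / \<alpha> + (norm ps)\<^sup>2 / (1 / \<delta>))"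
      unfolding \<Gamma>_def using \<eta> \<alpha> \<delta>
      by (intro integral_nonneg integrable_continuous_real continuous_intros
         continuous_on_subset[OF continuous_on_steklov[OF Gi, of \<eta>]]) auto
    moreover have "integral {0..\<delta>} (\<lambda>t. (\<delta> + \<eta>) * N / \<alpha> + \<delta> * (norm ps)\<^sup>2) = \<delta> * ((\<delta> + \<eta>) * N / \<alpha> + \<delta> * (norm ps)\<^sup>2)"
      using \<delta> by simp
    ultimately have "(norm (\<iota> (w \<delta>)))\<^sup>2 \<le> ca * ((norm (\<iota> (w 0)))\<^sup>2 + \<delta> * ((\<delta> + \<eta>) * N / \<alpha> + \<delta> * (norm ps)\<^sup>2))"
      by (smt (verit) exp_ge_zero mult_mono zero_le_power2)
    then show "(norm (steklov \<eta> U \<delta> - U 0))\<^sup>2 \<le>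
      ca * ((norm (steklov \<eta> U 0 - U 0))\<^sup>2 + \<delta> * ((\<delta> + \<eta>) * N / \<alpha> + \<delta> * (norm ps)\<^sup>2))"
      using iw[of 0] iw[of \<delta>] \<delta> by simp
  qed (use \<delta> in auto)
  moreover have "((\<lambda>\<eta>. (norm (steklov \<eta> U \<delta> - U 0))\<^sup>2) \<longlongrightarrow> (norm (U \<delta> - U 0))\<^sup>2) (at_right 0)"
    by (intro tendsto_intros steklov_tendsto[OF U]) (use \<delta> in auto)
  moreover have "((\<lambda>\<eta>. ca * ((norm (steklov \<eta> U 0 - U 0))\<^sup>2 + \<delta> * ((\<delta> + \<eta>) * N / \<alpha> + \<delta> * (norm ps)\<^sup>2)))
      \<longlongrightarrow> ca * ((norm (U 0 - U 0))\<^sup>2 + \<delta> * ((\<delta> + 0) * N / \<alpha> + \<delta> * (norm ps)\<^sup>2))) (at_right 0)"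
    by (intro tendsto_intros steklov_tendsto[OF U]) (use T \<alpha> in auto)
  ultimately have "(norm (U \<delta> - U 0))\<^sup>2 \<le> ca * ((norm (U 0 - U 0))\<^sup>2 + \<delta> * ((\<delta> + 0) * N / \<alpha> + \<delta> * (norm ps)\<^sup>2))"
    by (intro tendsto_le[OF trivial_limit_at_right_real])
  then show ?thesis by (simp add: power2_eq_square algebra_simps)
qed

definition "cb = exp ((2 * norm A + 1) * T)"

text \<open>\<open>M\<close> is the bound for the square integral of the time derivative of the solution.\<close>

definition "M = cb / \<alpha> * (ca * (N / \<alpha> + (norm ps)\<^sup>2) + 2 * N / \<alpha>)"

lemma M_nonneg: "0 \<le> M"
  unfolding M_def ca_def cb_def using \<alpha> N(1) by (intro mult_nonneg_nonneg add_nonneg_nonneg) auto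

text \<open>Energy estimate for the difference quotients of the averages. Only the right-hand side is estimated by
  its modulus of continuity; the resulting error vanishes with the averaging parameter.\<close>

lemma steklov_difference_bound:
  assumes \<delta>: "0 < \<delta>" "0 \<le> \<tau>" "\<tau> + \<delta> < T" and e: "0 < e"
  shows "\<forall>\<^sub>F \<eta> in at_right 0. integral {0..\<tau>} (\<lambda>t. (norm (steklov \<eta> u (t + \<delta>) - steklov \<eta> u t))\<^sup>2) \<le> \<delta>\<^sup>2 * M + e"
proof -
  define E where "E \<eta> = cb / \<alpha> * ((norm (steklov \<eta> U \<delta> - steklov \<eta> U 0))\<^sup>2 + (2 * (\<delta>\<^sup>2 * N) + \<tau> * (8 * (\<eta> * N))) / \<alpha>)" for \<eta>
  have "(E \<longlongrightarrow> cb / \<alpha> * ((norm (U \<delta> - U 0))\<^sup>2 + (2 * (\<delta>\<^sup>2 * N) + \<tau> * (8 * (0 * N))) / \<alpha>)) (at_right 0)"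
    unfolding E_def by (intro tendsto_intros steklov_tendsto[OF U]) (use \<delta> T \<alpha> in auto)
  moreover have "cb / \<alpha> * ((norm (U \<delta> - U 0))\<^sup>2 + (2 * (\<delta>\<^sup>2 * N) + \<tau> * (8 * (0 * N))) / \<alpha>) \<le> \<delta>\<^sup>2 * M"
  proof -
    have "cb / \<alpha> * ((norm (U \<delta> - U 0))\<^sup>2 + (2 * (\<delta>\<^sup>2 * N) + \<tau> * (8 * (0 * N))) / \<alpha>)
        \<le> cb / \<alpha> * (\<delta>\<^sup>2 * (ca * (N / \<alpha> + (norm ps)\<^sup>2)) + 2 * (\<delta>\<^sup>2 * N) / \<alpha>)"
      using initial_speed[of \<delta>] \<delta> \<alpha> by (intro mult_left_mono) (auto simp: cb_def)
    also have "\<dots> = \<delta>\<^sup>2 * M" unfolding M_def by (simp add: algebra_simps)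
    finally show ?thesis .
  qed
  ultimately have E: "\<forall>\<^sub>F \<eta> in at_right 0. E \<eta> < \<delta>\<^sup>2 * M + e"
    using e by (intro order_tendstoD(2)) auto
  have "\<forall>\<^sub>F \<eta> in at_right 0. 0 < \<eta> \<and> \<eta> < T - (\<tau> + \<delta>)"
    using \<delta> by (intro eventually_at_rightI[of 0 "T - (\<tau> + \<delta>)"]) auto
  with E show ?thesis
  proof eventually_elim
    case (elim \<eta>)
    then have \<eta>: "0 < \<eta>" "\<tau> + \<delta> < T - \<eta>" by auto
    define w where "w t = steklov \<eta> u (t + \<delta>) - steklov \<eta> u t" for t
    define \<Gamma> where "\<Gamma> t = steklov \<eta> G (t + \<delta>) - steklov \<eta> G t" for t
    interpret L: bounded_linear L by (rule L)
    have su: "continuous_on {0..T - \<eta>} (steklov \<eta> u)" and sG: "continuous_on {0..T - \<eta>} (steklov \<eta> G)"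
      using continuous_on_steklov[OF ui, of \<eta>] continuous_on_steklov[OF Gi, of \<eta>] \<eta> by auto
    have wc: "continuous_on {0..\<tau>} w" and \<Gamma>c: "continuous_on {0..\<tau>} \<Gamma>" unfolding w_def \<Gamma>_def
      by (intro continuous_on_diff continuous_on_compose2[OF su] continuous_on_compose2[OF sG] continuous_intros;
          use \<eta> \<delta> in auto)+
    have "(norm (\<iota> (w \<tau>)))\<^sup>2 + \<alpha> * integral {0..\<tau>} (\<lambda>t. (norm (w t))\<^sup>2)
      \<le> exp ((2 * norm A + 1) * \<tau>) * ((norm (\<iota> (w 0)))\<^sup>2 + integral {0..\<tau>} (\<lambda>t. (norm (\<Gamma> t))\<^sup>2 / \<alpha> + (norm (0::'h))\<^sup>2 / 1))"
    proof (rule energy[OF \<delta>(2) _ wc _ _ \<Gamma>c])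
      fix t assume t: "t \<in> {0..\<tau>}"
      then have t1: "t \<in> {0..T - \<eta>}" and t2: "t + \<delta> \<in> {0..T - \<eta>}" using \<eta> \<delta> by auto
      show "w t \<in> Y" unfolding w_def by (intro subspace_diff Y sol(1) \<eta> t1 t2)
      show "((\<lambda>t. \<iota> (w t)) has_vector_derivative
          (1 / \<eta>) *\<^sub>R (U (t + \<delta> + \<eta>) - U (t + \<delta>)) - (1 / \<eta>) *\<^sub>R (U (t + \<eta>) - U t)) (at t within {0..\<tau>})"
        unfolding w_def blinfun.diff_right
      proof (intro has_vector_derivative_diff steklov_U_deriv \<eta> t)
        have "((\<lambda>t. \<iota> (steklov \<eta> u t)) \<circ> (\<lambda>t. t + \<delta>) has_vector_derivative
            1 *\<^sub>R ((1 / \<eta>) *\<^sub>R (U (t + \<delta> + \<eta>) - U (t + \<delta>)))) (at t within {0..\<tau>})"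
        proof (rule vector_diff_chain_within)
          show "((\<lambda>t. t + \<delta>) has_vector_derivative 1) (at t within {0..\<tau>})"
            by (auto intro!: derivative_eq_intros)
          show "((\<lambda>t. \<iota> (steklov \<eta> u t)) has_vector_derivative (1 / \<eta>) *\<^sub>R (U (t + \<delta> + \<eta>) - U (t + \<delta>)))
              (at (t + \<delta>) within (\<lambda>t. t + \<delta>) ` {0..\<tau>})"
            by (rule has_vector_derivative_within_subset[OF steklov_U_deriv[OF \<eta>(1), of _ "\<tau> + \<delta>"]]) (use t \<eta> \<delta> in auto)
        qed
        then show "((\<lambda>t. \<iota> (steklov \<eta> u (t + \<delta>))) has_vector_derivative
            (1 / \<eta>) *\<^sub>R (U (t + \<delta> + \<eta>) - U (t + \<delta>))) (at t within {0..\<tau>})"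
          by (simp add: o_def)
      qed (use \<eta> \<delta> in auto)
      show "((1 / \<eta>) *\<^sub>R (U (t + \<delta> + \<eta>) - U (t + \<delta>)) - (1 / \<eta>) *\<^sub>R (U (t + \<eta>) - U t)) \<bullet> \<iota> q
          + A (\<iota> (w t)) (\<iota> q) + L (w t) q = \<Gamma> t q + 0 \<bullet> \<iota> q" if "q \<in> Y" for q
        using sol(3)[OF \<eta>(1) t1 that] sol(3)[OF \<eta>(1) t2 that]
        by (simp add: w_def \<Gamma>_def L.diff blinfun.diff_right blinfun.diff_left inner_diff_left algebra_simps)
    qed simp
    moreover have "integral {0..\<tau>} (\<lambda>t. (norm (\<Gamma> t))\<^sup>2 / \<alpha> + (norm (0::'h))\<^sup>2 / 1) \<le> (2 * (\<delta>\<^sup>2 * N) + \<tau> * (8 * (\<eta> * N))) / \<alpha>"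
    proof -
      have gi: "(\<lambda>t. (norm (G (t + \<delta>) - G t))\<^sup>2) integrable_on {0..T - \<delta>}"
        by (intro integrable_continuous_real continuous_intros continuous_on_compose2[OF G]) (use \<delta> in auto)
      have gi': "(\<lambda>t. (norm (G (t + \<delta>) - G t))\<^sup>2) integrable_on {0..\<tau>}"
        by (rule integrable_on_subinterval[OF gi]) (use \<delta> in auto)
      have "integral {0..\<tau>} (\<lambda>t. (norm (\<Gamma> t))\<^sup>2) \<le> integral {0..\<tau>} (\<lambda>t. 2 * (norm (G (t + \<delta>) - G t))\<^sup>2 + 8 * (\<eta> * N))"
      proof (rule integral_le)
        show "(\<lambda>t. (norm (\<Gamma> t))\<^sup>2) integrable_on {0..\<tau>}" by (intro integrable_continuous_real continuous_intros \<Gamma>c)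
        show "(\<lambda>t. 2 * (norm (G (t + \<delta>) - G t))\<^sup>2 + 8 * (\<eta> * N)) integrable_on {0..\<tau>}"
          by (intro integrable_add integrable_on_mult_right gi' integrable_const_ivl)
        fix t assume t: "t \<in> {0..\<tau>}"
        define x where "x = norm (G (t + \<delta>) - G t)"
        define y where "y = sqrt (\<eta> * N)"
        have 1: "norm (steklov \<eta> G (t + \<delta>) - G (t + \<delta>)) \<le> y" unfolding y_def
          by (rule norm_steklov_G_diff) (use t \<eta> \<delta> in auto)
        have 2: "norm (steklov \<eta> G t - G t) \<le> y" unfolding y_def
          by (rule norm_steklov_G_diff) (use t \<eta> \<delta> in auto)
        have \<Gamma>t: "\<Gamma> t = (steklov \<eta> G (t + \<delta>) - G (t + \<delta>)) + (G (t + \<delta>) - G t) - (steklov \<eta> G t - G t)"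
          by (simp add: \<Gamma>_def)
        have "norm (\<Gamma> t) \<le> x + 2 * y"
          using 1 2 norm_triangle_ineq4[of "(steklov \<eta> G (t + \<delta>) - G (t + \<delta>)) + (G (t + \<delta>) - G t)" "steklov \<eta> G t - G t"]
            norm_triangle_ineq[of "steklov \<eta> G (t + \<delta>) - G (t + \<delta>)" "G (t + \<delta>) - G t"]
          unfolding x_def \<Gamma>t by linarith
        then have "(norm (\<Gamma> t))\<^sup>2 \<le> (x + 2 * y)\<^sup>2" by (intro power_mono) auto
        also have "\<dots> \<le> 2 * x\<^sup>2 + 8 * y\<^sup>2" using zero_le_power2[of "x - 2 * y"] by (simp add: power2_eq_square algebra_simps)
        also have "y\<^sup>2 = \<eta> * N" using \<eta> N(1) by (simp add: y_def)
        finally show "(norm (\<Gamma> t))\<^sup>2 \<le> 2 * (norm (G (t + \<delta>) - G t))\<^sup>2 + 8 * (\<eta> * N)" by (simp add: x_def)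
      qed
      also have "\<dots> = 2 * integral {0..\<tau>} (\<lambda>t. (norm (G (t + \<delta>) - G t))\<^sup>2) + \<tau> * (8 * (\<eta> * N))"
        using \<delta> by (subst integral_add) (auto intro: integrable_on_mult_right gi')
      also have "integral {0..\<tau>} (\<lambda>t. (norm (G (t + \<delta>) - G t))\<^sup>2) \<le> integral {0..T - \<delta>} (\<lambda>t. (norm (G (t + \<delta>) - G t))\<^sup>2)"
        using \<delta> by (intro integral_subset_le gi gi') auto
      also have "\<dots> \<le> \<delta>\<^sup>2 * N" using \<delta> by (intro N(3)) auto
      finally have "integral {0..\<tau>} (\<lambda>t. (norm (\<Gamma> t))\<^sup>2) \<le> 2 * (\<delta>\<^sup>2 * N) + \<tau> * (8 * (\<eta> * N))" by simp
      then show ?thesis using \<alpha> by (simp add: divide_right_mono)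
    qed
    moreover have "exp ((2 * norm A + 1) * \<tau>) \<le> cb" unfolding cb_def using \<delta> by (simp add: mult_left_mono)
    moreover have "0 \<le> integral {0..\<tau>} (\<lambda>t. (norm (\<Gamma> t))\<^sup>2 / \<alpha> + (norm (0::'h))\<^sup>2 / 1)"
      using \<alpha> by (intro integral_nonneg integrable_continuous_real continuous_intros \<Gamma>c) auto
    ultimately have "\<alpha> * integral {0..\<tau>} (\<lambda>t. (norm (w t))\<^sup>2) \<le>
        cb * ((norm (\<iota> (w 0)))\<^sup>2 + (2 * (\<delta>\<^sup>2 * N) + \<tau> * (8 * (\<eta> * N))) / \<alpha>)"
      by (smt (verit) exp_ge_zero mult_mono zero_le_power2)
    also have "\<dots> = \<alpha> * E \<eta>"
    proof -
      have "\<iota> (w 0) = steklov \<eta> U \<delta> - steklov \<eta> U 0"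
        using sol(2)[OF \<eta>(1), of 0] sol(2)[OF \<eta>(1), of \<delta>] \<eta> \<delta> by (simp add: w_def blinfun.diff_right)
      then show ?thesis using \<alpha> by (simp add: E_def)
    qed
    finally have "integral {0..\<tau>} (\<lambda>t. (norm (w t))\<^sup>2) \<le> E \<eta>" using \<alpha> by simp
    then show ?case using elim unfolding w_def by simp
  qed
qed

lemma steklov_shift_difference:
  assumes \<delta>: "0 < \<delta>" and st: "0 \<le> s" "s \<le> t" "t + \<delta> \<le> T"
  shows "steklov \<delta> u t - steklov \<delta> u s = (1 / \<delta>) *\<^sub>R integral {s..t} (\<lambda>r. u (r + \<delta>) - u r)"
proof -
  have i: "u integrable_on {a..b}" if "{a..b} \<subseteq> {0..T}" for a b by (rule integrable_on_subinterval[OF ui that])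
  have "integral {s..t} (\<lambda>r. u (r + \<delta>) - u r) = integral {s + \<delta>..t + \<delta>} u - integral {s..t} u"
    using st \<delta> by (subst integral_diff) (auto intro!: integrable_shift_interval i simp: integral_shift_interval)
  moreover have 1: "integral {s..s + \<delta>} u + integral {s + \<delta>..t + \<delta>} u = integral {s..t + \<delta>} u"
    using st \<delta> by (auto intro!: Henstock_Kurzweil_Integration.integral_combine i)
  moreover have 2: "integral {s..t} u + integral {t..t + \<delta>} u = integral {s..t + \<delta>} u"
    using st \<delta> by (auto intro!: Henstock_Kurzweil_Integration.integral_combine i)
  moreover have "integral {s + \<delta>..t + \<delta>} u = integral {s..t + \<delta>} u - integral {s..s + \<delta>} u"
    by (simp flip: 1)
  moreover have "integral {s..t} u = integral {s..t + \<delta>} u - integral {t..t + \<delta>} u"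
    by (simp flip: 2)
  ultimately have "integral {s..t} (\<lambda>r. u (r + \<delta>) - u r) = integral {t..t + \<delta>} u - integral {s..s + \<delta>} u"
    by simp
  then show ?thesis by (simp add: steklov_def scaleR_diff_right)
qed

text \<open>The averages of \<open>u\<close> are Hoelder continuous uniformly in the averaging parameter: their difference is
  the integral of a difference quotient of \<open>u\<close>, which is the \<open>L\<^sup>1\<close> limit of the quotients bounded above.\<close>

lemma steklov_Hoelder:
  assumes \<delta>: "0 < \<delta>" and st: "0 \<le> s" "s \<le> t" "t + \<delta> < T"
  shows "norm (steklov \<delta> u t - steklov \<delta> u s) \<le> sqrt ((t - s) * M)"
proof -
  define X where "X = integral {s..t} (\<lambda>r. norm (u (r + \<delta>) - u r))"
  have sub: "bint c d u" if "{c..d} \<subseteq> {0..T}" for c d by (rule bint_subinterval[OF u(1) that])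
  have shift: "bint c d (\<lambda>r. v (r + \<delta>))" if v: "bint (c + \<delta>) (d + \<delta>) v" for c d and v :: "real \<Rightarrow> 'p"
  proof -
    obtain S F where S: "negligible S" and F: "\<And>n::nat. continuous_on UNIV (F n)"
      and lim: "\<And>x. x \<notin> S \<Longrightarrow> (\<lambda>n. F n x) \<longlonglongrightarrow> (if x \<in> {c + \<delta>..d + \<delta>} then v x else 0)"
      using v unfolding bint_def measurable_on_def by blast
    have "negligible ((\<lambda>x. - \<delta> + x) ` S)" by (rule negligible_translation[OF S])
    moreover have "continuous_on UNIV (\<lambda>x. F n (x + \<delta>))" for n
      by (intro continuous_on_compose2[OF F]) (auto intro!: continuous_intros)
    moreover have "(\<lambda>n. F n (x + \<delta>)) \<longlonglongrightarrow> (if x \<in> {c..d} then v (x + \<delta>) else 0)" if "x \<notin> (\<lambda>x. - \<delta> + x) ` S" for x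
    proof -
      have "x + \<delta> \<notin> S" using that by (auto simp: image_iff)
      from lim[OF this] show ?thesis by simp
    qed
    ultimately have "(\<lambda>r. v (r + \<delta>)) measurable_on {c..d}"
      unfolding measurable_on_def
      by (intro exI[of _ "(\<lambda>x. - \<delta> + x) ` S"] exI[of _ "\<lambda>n x. F n (x + \<delta>)"]) simp
    then show ?thesis using v integrable_shift_interval[of "\<lambda>t. norm (v t)" c \<delta> d] unfolding bint_def by simp
  qed
  have du: "bint s t (\<lambda>r. u (r + \<delta>) - u r)"
    by (intro bint_diff shift sub) (use st \<delta> in auto)
  have XF: "X \<le> sqrt ((t - s) * (\<delta>\<^sup>2 * M + e)) + 2 * e" if e: "e > 0" for e
  proof -
    have "\<forall>\<^sub>F \<eta> in at_right 0. 0 < \<eta> \<and> \<eta> < T - (t + \<delta>)"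
      using st by (intro eventually_at_rightI[of 0 "T - (t + \<delta>)"]) auto
    with steklov_difference_bound[OF \<delta>, of t e] steklov_tendsto_L1[OF u(1) T e]
    have "\<forall>\<^sub>F \<eta> in at_right 0. 0 < \<eta> \<and> \<eta> < T - (t + \<delta>) \<and>
        integral {0..t} (\<lambda>t. (norm (steklov \<eta> u (t + \<delta>) - steklov \<eta> u t))\<^sup>2) \<le> \<delta>\<^sup>2 * M + e \<and>
        bint 0 (T - \<eta>) (\<lambda>t. steklov \<eta> u t - u t) \<and> integral {0..T - \<eta>} (\<lambda>t. norm (steklov \<eta> u t - u t)) < e"
      using st e by (simp add: eventually_conj_iff)
    then obtain \<eta> where \<eta>: "0 < \<eta>" "\<eta> < T - (t + \<delta>)"
        and b1: "integral {0..t} (\<lambda>t. (norm (steklov \<eta> u (t + \<delta>) - steklov \<eta> u t))\<^sup>2) \<le> \<delta>\<^sup>2 * M + e"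
        and b2: "bint 0 (T - \<eta>) (\<lambda>t. steklov \<eta> u t - u t)" and b3: "integral {0..T - \<eta>} (\<lambda>t. norm (steklov \<eta> u t - u t)) < e"
      using eventually_happens'[OF trivial_limit_at_right_real] by blast
    define d where "d r = steklov \<eta> u (r + \<delta>) - steklov \<eta> u r" for r
    define k where "k r = norm (steklov \<eta> u r - u r)" for r
    have ki: "k integrable_on {0..T - \<eta>}" unfolding k_def by (rule bint_norm[OF b2])
    have ki1: "k integrable_on {s..t}" and ki2: "k integrable_on {s + \<delta>..t + \<delta>}"
      by (rule integrable_on_subinterval[OF ki]; use st \<delta> \<eta> in auto)+
    have dc: "continuous_on {0..t} d"
      unfolding d_def using \<eta> st \<delta>
      by (intro continuous_on_diff continuous_on_compose2[OF continuous_on_steklov[OF ui, of \<eta>]] continuous_intros) auto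
    have d1: "(\<lambda>r. norm (d r)) integrable_on {s..t}" and d2: "(\<lambda>r. (norm (d r))\<^sup>2) integrable_on {s..t}"
      and d3: "(\<lambda>r. (norm (d r))\<^sup>2) integrable_on {0..t}"
      using st by (auto intro!: integrable_continuous_real continuous_intros continuous_on_subset[OF dc])
    have "X \<le> integral {s..t} (\<lambda>r. norm (d r) + (k (r + \<delta>) + k r))"
      unfolding X_def
    proof (rule integral_le)
      show "(\<lambda>r. norm (u (r + \<delta>) - u r)) integrable_on {s..t}" by (rule bint_norm[OF du])
      show "(\<lambda>r. norm (d r) + (k (r + \<delta>) + k r)) integrable_on {s..t}"
        by (intro integrable_add d1 ki1 integrable_shift_interval ki2)
      show "norm (u (r + \<delta>) - u r) \<le> norm (d r) + (k (r + \<delta>) + k r)" for r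
      proof -
        have "u (r + \<delta>) - u r = d r - ((steklov \<eta> u (r + \<delta>) - u (r + \<delta>)) - (steklov \<eta> u r - u r))"
          by (simp add: d_def)
        then show ?thesis
          using norm_triangle_ineq4[of "d r" "(steklov \<eta> u (r + \<delta>) - u (r + \<delta>)) - (steklov \<eta> u r - u r)"]
            norm_triangle_ineq4[of "steklov \<eta> u (r + \<delta>) - u (r + \<delta>)" "steklov \<eta> u r - u r"] unfolding k_def by simp
      qed
    qed
    also have "\<dots> = integral {s..t} (\<lambda>r. norm (d r)) + (integral {s + \<delta>..t + \<delta>} k + integral {s..t} k)"
      by (simp add: integral_add d1 ki1 integrable_shift_interval[OF ki2] integrable_add integral_shift_interval)
    also have "integral {s..t} (\<lambda>r. norm (d r)) \<le> sqrt ((t - s) * (\<delta>\<^sup>2 * M + e))"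
    proof (rule real_le_rsqrt)
      have "(integral {s..t} (\<lambda>r. norm (d r)))\<^sup>2 \<le> (t - s) * integral {s..t} (\<lambda>r. (norm (d r))\<^sup>2)"
        by (rule integral_Cauchy_Schwarz_one[OF d1 d2 st(2)])
      also have "integral {s..t} (\<lambda>r. (norm (d r))\<^sup>2) \<le> integral {0..t} (\<lambda>r. (norm (d r))\<^sup>2)"
        using st by (intro integral_subset_le d2 d3) auto
      also have "\<dots> \<le> \<delta>\<^sup>2 * M + e" using b1 unfolding d_def .
      finally show "(integral {s..t} (\<lambda>r. norm (d r)))\<^sup>2 \<le> (t - s) * (\<delta>\<^sup>2 * M + e)" using st by (simp add: mult_left_mono)
    qed
    also have "integral {s + \<delta>..t + \<delta>} k \<le> integral {0..T - \<eta>} k"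
      using st \<delta> \<eta> by (intro integral_subset_le ki ki2) (auto simp: k_def)
    also have "integral {s..t} k \<le> integral {0..T - \<eta>} k"
      using st \<delta> \<eta> by (intro integral_subset_le ki ki1) (auto simp: k_def)
    finally show ?thesis using b3 unfolding k_def[symmetric] by simp
  qed
  have "((\<lambda>e. sqrt ((t - s) * (\<delta>\<^sup>2 * M + e)) + 2 * e) \<longlongrightarrow> sqrt ((t - s) * (\<delta>\<^sup>2 * M + 0)) + 2 * 0) (at_right 0)"
    by (intro tendsto_intros)
  moreover have "\<forall>\<^sub>F e in at_right 0. X \<le> sqrt ((t - s) * (\<delta>\<^sup>2 * M + e)) + 2 * e"
    by (rule eventually_at_rightI[of 0 1]) (use XF in auto)
  ultimately have "X \<le> sqrt ((t - s) * (\<delta>\<^sup>2 * M + 0)) + 2 * 0"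
    by (intro tendsto_lowerbound[OF _ _ trivial_limit_at_right_real])
  also have "\<dots> = \<delta> * sqrt ((t - s) * M)" using \<delta> by (simp add: real_sqrt_mult)
  finally have "X \<le> \<delta> * sqrt ((t - s) * M)" .
  then have "(1 / \<delta>) * X \<le> (1 / \<delta>) * (\<delta> * sqrt ((t - s) * M))" using \<delta> by (intro mult_left_mono) auto
  also have "\<dots> = sqrt ((t - s) * M)" using \<delta> by simp
  finally have "(1 / \<delta>) * X \<le> sqrt ((t - s) * M)" .
  moreover have "norm (steklov \<delta> u t - steklov \<delta> u s) \<le> (1 / \<delta>) * X"
    using steklov_shift_difference[of \<delta> s t] bint_integral_norm_le[OF du] \<delta> st unfolding X_def
    by (simp add: divide_right_mono)
  ultimately show ?thesis by linarith
qed

text \<open>The Hoelder bound passes to the limit outside a null set, so \<open>u\<close> extends to a continuous function.\<close>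

lemma continuous_representative:
  obtains V where "continuous_on {0..T} V" "AE t in lebesgue_on {0..T}. V t = u t" "\<And>t. t \<in> {0..T} \<Longrightarrow> V t \<in> Y"
    "\<And>t. t \<in> {0..T} \<Longrightarrow> U t = \<iota> (V t)"
proof -
  obtain \<eta> S where \<eta>: "\<eta> \<longlonglongrightarrow> 0" "\<And>n::nat. \<eta> n > 0" and S: "negligible S"
    and lim: "\<And>t. t \<in> {0<..<T} - S \<Longrightarrow> (\<lambda>n. steklov (\<eta> n) u t) \<longlonglongrightarrow> u t"
    using steklov_AE_subseq[OF u(1) T] by blast
  define X where "X = {0<..<T} - S"
  have H: "norm (u t - u s) \<le> sqrt ((t - s) * M)" if st: "s \<in> X" "t \<in> X" "s \<le> t" for s t
  proof (rule tendsto_upperbound)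
    show "(\<lambda>n. norm (steklov (\<eta> n) u t - steklov (\<eta> n) u s)) \<longlonglongrightarrow> norm (u t - u s)"
      using st unfolding X_def by (intro tendsto_intros lim)
    have "\<forall>\<^sub>F n in sequentially. \<eta> n < T - t"
      using st unfolding X_def by (intro order_tendstoD(2)[OF \<eta>(1)]) auto
    then show "\<forall>\<^sub>F n in sequentially. norm (steklov (\<eta> n) u t - steklov (\<eta> n) u s) \<le> sqrt ((t - s) * M)"
    proof eventually_elim
      case (elim n)
      then show ?case using st \<eta>(2)[of n] unfolding X_def by (intro steklov_Hoelder) auto
    qed
  qed simp
  have H': "dist (u s) (u t) \<le> sqrt (\<bar>t - s\<bar> * M)" if "s \<in> X" "t \<in> X" for s t
    using H[of s t] H[of t s] that by (cases "s \<le> t") (auto simp: dist_norm norm_minus_commute)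
  have unif: "uniformly_continuous_on X u"
    unfolding uniformly_continuous_on_def
  proof (intro allI impI)
    fix e :: real assume e: "e > 0"
    define d where "d = e\<^sup>2 / (M + 1)"
    have d: "d > 0" unfolding d_def using e M_nonneg by simp
    have "dist (u t) (u s) < e" if "s \<in> X" "t \<in> X" "dist t s < d" for s t
    proof -
      have "\<bar>s - t\<bar> * M \<le> d * M" using that M_nonneg by (intro mult_right_mono) (auto simp: dist_real_def)
      also have "\<dots> < d * (M + 1)" using d by simp
      also have "\<dots> = e\<^sup>2" unfolding d_def using M_nonneg by simp
      finally have "sqrt (\<bar>s - t\<bar> * M) < e" using e by (intro real_less_lsqrt) (auto simp: M_nonneg)
      then show ?thesis using H'[OF that(2,1)] by simp
    qed
    then show "\<exists>d>0. \<forall>x\<in>X. \<forall>x'\<in>X. dist x' x < d \<longrightarrow> dist (u x') (u x) < e" using d by blast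
  qed
  obtain V where V: "uniformly_continuous_on (closure X) V" "\<And>x. x \<in> X \<Longrightarrow> u x = V x"
    using uniformly_continuous_on_extension_on_closure[OF unif] by metis
  have cl: "{0..T} \<subseteq> closure X"
  proof -
    have "{0<..<T} \<subseteq> closure X"
    proof
      fix x assume x: "x \<in> {0<..<T}"
      show "x \<in> closure X"
      proof (rule ccontr)
        assume "x \<notin> closure X"
        then have "open ({0<..<T} - closure X)" "{0<..<T} - closure X \<noteq> {}" using x by auto
        then have "\<not> negligible ({0<..<T} - closure X)" by (rule open_not_negligible)
        moreover have "{0<..<T} - closure X \<subseteq> S" using closure_subset[of X] unfolding X_def by blast
        ultimately show False using negligible_subset[OF S] by blast
      qed
    qed
    then have "closure {0<..<T} \<subseteq> closure X" by (intro closure_minimal) auto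
    then show ?thesis using T by simp
  qed
  have Vc: "continuous_on {0..T} V"
    using uniformly_continuous_imp_continuous[OF V(1)] cl continuous_on_subset by blast
  have neg: "negligible (S \<union> {0, T})" using S by auto
  have VX: "V t = u t" if "t \<in> {0..T} - (S \<union> {0, T})" for t using V(2)[of t] that unfolding X_def by auto
  have Vu: "AE t in lebesgue_on {0..T}. V t = u t"
    unfolding AE_lebesgue_on_iff_negligible using neg VX by blast
  have UV: "U t = \<iota> (V t)" if "t \<in> {0..T}" for t
  proof (rule continuous_AE_eq[OF U _ _ T that])
    show "continuous_on {0..T} (\<lambda>t. \<iota> (V t))" by (intro continuous_intros Vc)
    show "AE t in lebesgue_on {0..T}. U t = \<iota> (V t)" using ae Vu by eventually_elim simp
  qed
  have VY: "V t \<in> Y" if "t \<in> {0..T}" for t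
  proof -
    have "orth_proj Y (V t) = V t"
    proof (rule continuous_AE_eq[OF _ Vc _ T that])
      show "continuous_on {0..T} (\<lambda>t. orth_proj Y (V t))"
        by (intro bounded_linear.continuous_on[OF bounded_linear_orth_proj[OF Y]] Vc)
      show "AE t in lebesgue_on {0..T}. orth_proj Y (V t) = V t"
        unfolding AE_lebesgue_on_iff_negligible
        using neg VX u(2) by (intro exI[of _ "S \<union> {0, T}"]) (auto intro: orth_proj_id[OF Y])
    qed
    then show ?thesis using orth_proj_in[OF Y, of "V t"] by simp
  qed
  show ?thesis by (rule that[OF Vc Vu VY UV])
qed

text \<open>The bound for the averages passes to the limit on shorter intervals first, because the averages look forward
  in time.\<close>

lemma difference_quotient_bound:
  assumes V: "continuous_on {0..T} V" "AE t in lebesgue_on {0..T}. V t = u t" and \<delta>: "0 < \<delta>" "\<delta> < T"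
  shows "integral {0..T - \<delta>} (\<lambda>t. (norm (V (t + \<delta>) - V t))\<^sup>2) \<le> \<delta>\<^sup>2 * M"
proof -
  obtain S where S: "negligible S" "\<And>t. t \<in> {0..T} - S \<Longrightarrow> V t = u t"
    using V(2) unfolding AE_lebesgue_on_iff_negligible by blast
  obtain C where "\<forall>x\<in>V ` {0..T}. norm x \<le> C"
    using compact_imp_bounded[OF compact_continuous_image[OF V(1) compact_Icc]] unfolding bounded_iff by blast
  then have C: "\<And>t. t \<in> {0..T} \<Longrightarrow> norm (V t) \<le> C" by blast
  have Vi: "V integrable_on {0..T}" by (rule integrable_continuous_real[OF V(1)])
  have su: "steklov \<eta> u t = steklov \<eta> V t" if "0 < \<eta>" "t \<in> {0..T - \<eta>}" for \<eta> t
    unfolding steklov_def by (intro arg_cong2[where f = scaleR] refl integral_spike[OF S(1)]) (use S(2) that in auto)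
  have "integral {0..\<tau>} (\<lambda>t. (norm (V (t + \<delta>) - V t))\<^sup>2) \<le> \<delta>\<^sup>2 * M" if \<tau>: "0 \<le> \<tau>" "\<tau> < T - \<delta>" for \<tau>
  proof -
    define \<eta> where "\<eta> n = (T - \<delta> - \<tau>) / real (n + 2)" for n
    have \<eta>: "\<eta> \<longlonglongrightarrow> 0" "\<And>n. \<eta> n > 0" "\<And>n. \<eta> n < T - \<delta> - \<tau>"
    proof -
      have "(\<lambda>n. (T - \<delta> - \<tau>) * (1 / real (n + 2))) \<longlonglongrightarrow> (T - \<delta> - \<tau>) * 0"
        using LIMSEQ_ignore_initial_segment[OF lim_1_over_n, of 2] by (intro tendsto_mult tendsto_const)
      then show "\<eta> \<longlonglongrightarrow> 0" by (simp add: \<eta>_def[abs_def])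
      show "\<eta> n > 0" for n using \<tau> by (simp add: \<eta>_def)
      show "\<eta> n < T - \<delta> - \<tau>" for n
      proof -
        have "(T - \<delta> - \<tau>) * 1 < (T - \<delta> - \<tau>) * real (n + 2)" using \<tau> by (intro mult_strict_left_mono) auto
        then show ?thesis by (simp add: \<eta>_def divide_less_eq)
      qed
    qed
    have f0: "filterlim \<eta> (at_right 0) sequentially"
      unfolding filterlim_at using \<eta>(1) order_less_imp_not_eq2[OF \<eta>(2)] \<eta>(2) by simp
    let ?D = "\<lambda>n t. (norm (steklov (\<eta> n) V (t + \<delta>) - steklov (\<eta> n) V t))\<^sup>2"
    have "(\<lambda>n. integral {0..\<tau>} (?D n)) \<longlonglongrightarrow> integral {0..\<tau>} (\<lambda>t. (norm (V (t + \<delta>) - V t))\<^sup>2)"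
    proof (rule dominated_convergence(2)[where h = "\<lambda>_. (2 * C)\<^sup>2"])
      fix n
      have sc: "continuous_on {0..T - \<eta> n} (steklov (\<eta> n) V)"
        by (rule continuous_on_steklov[OF Vi]) (use \<eta>(2)[of n] in simp)
      show "?D n integrable_on {0..\<tau>}"
        using \<eta>(3)[of n] \<delta> \<tau>
        by (intro integrable_continuous_real continuous_intros continuous_on_compose2[OF sc]) auto
      show "norm (?D n t) \<le> (2 * C)\<^sup>2" if t: "t \<in> {0..\<tau>}" for t
      proof -
        have "norm (steklov (\<eta> n) V r) \<le> C" if "r \<in> {0..\<tau> + \<delta>}" for r
          using \<eta>(2,3)[of n] that
          by (intro norm_steklov_le integrable_on_subinterval[OF Vi] C) auto
        from this[of t] this[of "t + \<delta>"] have "norm (steklov (\<eta> n) V (t + \<delta>) - steklov (\<eta> n) V t) \<le> 2 * C"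
          using t \<delta> norm_triangle_ineq4[of "steklov (\<eta> n) V (t + \<delta>)" "steklov (\<eta> n) V t"] by simp
        from power_mono[OF this norm_ge_zero, of 2] show ?thesis by simp
      qed
      show "(\<lambda>n. ?D n t) \<longlonglongrightarrow> (norm (V (t + \<delta>) - V t))\<^sup>2" if "t \<in> {0..\<tau>}" for t
        using that \<tau> \<delta>
        by (intro tendsto_intros filterlim_compose[OF steklov_tendsto[OF V(1)] f0]) auto
    qed (rule integrable_const_ivl)
    moreover have "\<forall>\<^sub>F n in sequentially. integral {0..\<tau>} (?D n) \<le> \<delta>\<^sup>2 * M + e" if "e > 0" for e
    proof -
      have "\<forall>\<^sub>F n in sequentially. integral {0..\<tau>} (\<lambda>t. (norm (steklov (\<eta> n) u (t + \<delta>) - steklov (\<eta> n) u t))\<^sup>2) \<le> \<delta>\<^sup>2 * M + e"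
        using filterlim_iff[THEN iffD1, OF f0, rule_format, OF steklov_difference_bound[OF \<delta>(1) \<tau>(1) _ that]] \<tau> by simp
      then show ?thesis
      proof eventually_elim
        case (elim n)
        have "integral {0..\<tau>} (?D n) = integral {0..\<tau>} (\<lambda>t. (norm (steklov (\<eta> n) u (t + \<delta>) - steklov (\<eta> n) u t))\<^sup>2)"
          using \<eta>(3)[of n] \<eta>(2)[of n] \<delta> by (intro integral_cong) (simp add: su)
        then show ?case using elim by simp
      qed
    qed
    ultimately have "integral {0..\<tau>} (\<lambda>t. (norm (V (t + \<delta>) - V t))\<^sup>2) \<le> \<delta>\<^sup>2 * M + e" if "e > 0" for e
      using that by (intro tendsto_upperbound[OF _ _ sequentially_bot])
    then show ?thesis by (rule field_le_epsilon)
  qed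
  moreover have "continuous_on {0..T - \<delta>} (\<lambda>\<tau>. integral {0..\<tau>} (\<lambda>t. (norm (V (t + \<delta>) - V t))\<^sup>2))"
    using \<delta> by (intro indefinite_integral_continuous_1 integrable_continuous_real continuous_intros continuous_on_compose2[OF V(1)]) auto
  ultimately show ?thesis
    using continuous_le_on_closure[of "{0..<T - \<delta>}" "\<lambda>\<tau>. integral {0..\<tau>} (\<lambda>t. (norm (V (t + \<delta>) - V t))\<^sup>2)" "T - \<delta>" "\<delta>\<^sup>2 * M"] \<delta>
    by simp
qed

end

section \<open>Semigroups and mild solutions\<close>

text \<open>By the Baire category theorem one of the sets of points with orbits bounded by a fixed number contains a ball.\<close>

lemma uniform_boundedness:
  fixes F :: "nat \<Rightarrow> 'a::banach \<Rightarrow> 'b::real_normed_vector"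
  assumes F: "\<And>n. bounded_linear (F n)" and pw: "\<And>x. \<exists>C. \<forall>n. norm (F n x) \<le> C"
  shows "\<exists>C. \<forall>n x. norm (F n x) \<le> C * norm x"
proof -
  define E where "E k = {x. \<forall>n. norm (F n x) \<le> real k}" for k :: nat
  have Ec: "closed (E k)" for k
  proof -
    have "E k = (\<Inter>n. {x. norm (F n x) \<le> real k})" unfolding E_def by auto
    moreover have "closed {x. norm (F n x) \<le> real k}" for n
      by (intro closed_Collect_le continuous_on_norm linear_continuous_on[OF F] continuous_on_const)
    ultimately show ?thesis by auto
  qed
  have mc: "Met_TC.mcomplete TYPE('a)"
    unfolding Met_TC.mcomplete_def by (auto dest: Cauchy_convergent simp: convergent_def)
  have "\<exists>k. interior (E k) \<noteq> {}"
  proof (rule ccontr)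
    assume "\<not> (\<exists>k. interior (E k) \<noteq> {})"
    then have "Met_TC.mtopology interior_of \<Union>(range E) = {}"
      using Ec by (intro Met_TC.metric_Baire_category_alt mc) auto
    moreover have "\<Union>(range E) = UNIV"
    proof -
      have "\<exists>k. x \<in> E k" for x
      proof -
        obtain C where C: "\<forall>n. norm (F n x) \<le> C" using pw by blast
        obtain k :: nat where "C \<le> real k" using real_arch_simple by blast
        then have "x \<in> E k" using C unfolding E_def by (auto intro: order_trans)
        then show ?thesis by blast
      qed
      then show ?thesis by auto
    qed
    ultimately show False by simp
  qed
  then obtain k x0 where "x0 \<in> interior (E k)" by blast
  then obtain r where r: "r > 0" "cball x0 r \<subseteq> E k" unfolding mem_interior_cball by blast
  have "norm (F n x) \<le> (2 * real k / r) * norm x" for n x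
  proof (cases "x = 0")
    case True
    then show ?thesis using linear_0[OF bounded_linear.linear[OF F[of n]]] by simp
  next
    case False
    interpret f: bounded_linear "F n" by (rule F)
    define y where "y = (r / norm x) *\<^sub>R x"
    have "norm y = r" unfolding y_def using False r(1) by simp
    then have "x0 + y \<in> E k" "x0 \<in> E k" using r by (auto simp: subset_iff dist_norm)
    then have "norm (F n (x0 + y)) \<le> real k" "norm (F n x0) \<le> real k" unfolding E_def by auto
    moreover have "F n y = F n (x0 + y) - F n x0" by (simp add: f.add)
    ultimately have "norm (F n y) \<le> 2 * real k"
      using norm_triangle_ineq4[of "F n (x0 + y)" "F n x0"] by simp
    moreover have "norm (F n y) = (r / norm x) * norm (F n x)"
      unfolding y_def f.scaleR using r(1) by simp
    ultimately show ?thesis using r(1) False by (simp add: field_simps)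
  qed
  then show ?thesis by blast
qed

text \<open>Composition with the orthogonal projection extends a semigroup on a closed subspace to the whole space; the
  projection is \<open>S 0\<close>.\<close>

locale projected_semigroup =
  fixes S :: "real \<Rightarrow> 'e::{real_inner,banach} \<Rightarrow> 'e"
  assumes bl: "\<And>t. 0 \<le> t \<Longrightarrow> bounded_linear (S t)"
    and comp: "\<And>s t x. 0 \<le> s \<Longrightarrow> 0 \<le> t \<Longrightarrow> S (s + t) x = S s (S t x)"
    and cont0: "\<And>x. ((\<lambda>t. S t x) \<longlongrightarrow> S 0 x) (at_right 0)"
begin

lemma S_add: "0 \<le> t \<Longrightarrow> S t (x + y) = S t x + S t y"
  using bl linear_add[OF bounded_linear.linear] by blast
lemma S_diff: "0 \<le> t \<Longrightarrow> S t (x - y) = S t x - S t y"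
  using bl linear_diff[OF bounded_linear.linear] by blast
lemma S_scaleR: "0 \<le> t \<Longrightarrow> S t (c *\<^sub>R x) = c *\<^sub>R S t x"
  using bl linear_scale[OF bounded_linear.linear] by blast
lemma S_0_S [simp]: "0 \<le> t \<Longrightarrow> S 0 (S t x) = S t x"
  using comp[of 0 t x] by simp
lemma S_S_0 [simp]: "0 \<le> t \<Longrightarrow> S t (S 0 x) = S t x"
  using comp[of t 0 x] by simp

lemma near_zero:
  assumes "e > 0"
  shows "\<exists>b>0. \<forall>h. 0 \<le> h \<and> h < b \<longrightarrow> norm (S h x - S 0 x) < e"
proof -
  have "\<forall>\<^sub>F h in at_right 0. dist (S h x) (S 0 x) < e" by (rule tendstoD[OF cont0 assms])
  then obtain b where b: "b > 0" "\<forall>h>0. h < b \<longrightarrow> dist (S h x) (S 0 x) < e"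
    unfolding eventually_at_right_field by auto
  have "norm (S h x - S 0 x) < e" if "0 \<le> h" "h < b" for h
    using b(2) that assms by (cases "h = 0") (auto simp: dist_norm)
  then show ?thesis using b(1) by blast
qed

text \<open>Otherwise the operators at a sequence of times tending to zero would be unbounded, although their orbits
  converge.\<close>

lemma bounded_near_zero: "\<exists>d>0. \<exists>C. \<forall>t\<in>{0..d}. \<forall>x. norm (S t x) \<le> C * norm x"
proof (rule ccontr)
  assume *: "\<not> ?thesis"
  have "\<exists>t\<in>{0..1 / real (Suc n)}. \<exists>x. \<not> norm (S t x) \<le> real n * norm x" for n
    using * by (metis zero_less_Suc of_nat_0_less_iff zero_less_divide_1_iff)
  then obtain t where t: "\<And>n. t n \<in> {0..1 / real (Suc n)}" "\<And>n. \<exists>x. \<not> norm (S (t n) x) \<le> real n * norm x"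
    by metis
  have t0: "t \<longlonglongrightarrow> 0"
    by (rule tendsto_sandwich[of "\<lambda>_. 0" _ _ "\<lambda>n. 1 / real (Suc n)"])
       (use t(1) in \<open>auto intro!: always_eventually LIMSEQ_inverse_real_of_nat[unfolded inverse_eq_divide] simp del: of_nat_Suc\<close>)
  have "\<exists>C. \<forall>n. norm (S (t n) x) \<le> C" for x
  proof -
    have "(\<lambda>n. S (t n) x) \<longlonglongrightarrow> S 0 x"
    proof (rule tendstoI)
      fix e :: real assume "e > 0"
      then obtain b where b: "b > 0" "\<And>h. 0 \<le> h \<Longrightarrow> h < b \<Longrightarrow> norm (S h x - S 0 x) < e"
        using near_zero by blast
      have "\<forall>\<^sub>F n in sequentially. t n < b" by (rule order_tendstoD(2)[OF t0 b(1)])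
      then show "\<forall>\<^sub>F n in sequentially. dist (S (t n) x) (S 0 x) < e"
        by eventually_elim (use b(2) t(1) in \<open>auto simp: dist_norm\<close>)
    qed
    then have "Bseq (\<lambda>n. S (t n) x)" by (intro convergent_imp_Bseq convergentI)
    then show ?thesis unfolding Bseq_def by blast
  qed
  then obtain C where C: "\<And>n x. norm (S (t n) x) \<le> C * norm x"
    using uniform_boundedness[of "\<lambda>n. S (t n)"] bl t(1) by (metis atLeastAtMost_iff)
  obtain n :: nat where n: "C \<le> real n" using real_arch_simple by blast
  have "norm (S (t n) x) \<le> real n * norm x" for x
    using C[of n x] mult_right_mono[OF n, of "norm x"] by simp
  then show False using t(2)[of n] by blast
qed

lemma bounded_on_interval: "\<exists>C\<ge>1. \<forall>t\<in>{0..T}. \<forall>x. norm (S t x) \<le> C * norm x"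
proof -
  obtain d C where d: "d > 0" and C: "\<And>t x. t \<in> {0..d} \<Longrightarrow> norm (S t x) \<le> C * norm x"
    using bounded_near_zero by blast
  have step: "\<exists>C\<ge>1. \<forall>t\<in>{0..real n * d}. \<forall>x. norm (S t x) \<le> C * norm x" for n
  proof (induction n)
    case 0
    have "norm (S t x) \<le> max 1 C * norm x" if "t \<in> {0..real 0 * d}" for t x
      using C[of t x] that d mult_right_mono[of C "max 1 C" "norm x"] by simp
    then show ?case by (intro exI[of _ "max 1 C"]) auto
  next
    case (Suc n)
    then obtain C' where C': "C' \<ge> 1" "\<And>t x. t \<in> {0..real n * d} \<Longrightarrow> norm (S t x) \<le> C' * norm x" by blast
    define C'' where "C'' = C' * max 1 C"
    have ge: "1 * 1 \<le> C' * max 1 C" using C'(1) by (intro mult_mono) auto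
    have "norm (S t x) \<le> C'' * norm x" if t: "t \<in> {0..real (Suc n) * d}" for t x
    proof (cases "t \<le> d")
      case True
      have "C \<le> C''"
      proof -
        have "1 * max 1 C \<le> C' * max 1 C" using C'(1) by (intro mult_right_mono) auto
        then show ?thesis unfolding C''_def by simp
      qed
      then show ?thesis using C[of t x] t True mult_right_mono[of C C'' "norm x"] by simp
    next
      case False
      have "norm (S (t - d) (S d x)) \<le> C' * norm (S d x)"
        using t False by (intro C'(2)) (auto simp: algebra_simps)
      also have "norm (S d x) \<le> max 1 C * norm x"
        using C[of d x] d mult_right_mono[of C "max 1 C" "norm x"] by simp
      finally show ?thesis
        using comp[of "t - d" d x] False d C'(1) unfolding C''_def by (simp add: mult_ac mult_left_mono)
    qed
    then show ?case using ge unfolding C''_def by (intro exI[of _ "C' * max 1 C"]) auto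
  qed
  obtain n :: nat where "T / d \<le> real n" using real_arch_simple by blast
  then have "T \<le> real n * d" using d by (simp add: field_simps)
  moreover obtain C'' where "C'' \<ge> 1" "\<forall>t\<in>{0..real n * d}. \<forall>x. norm (S t x) \<le> C'' * norm x" using step by blast
  ultimately show ?thesis by (intro exI[of _ C'']) auto
qed

lemma continuous_orbit: "continuous_on {0..T} (\<lambda>t. S t x)"
  unfolding continuous_on_iff
proof (intro ballI allI impI)
  fix t e :: real assume t: "t \<in> {0..T}" and e: "e > 0"
  obtain C where C: "C \<ge> 1" "\<And>t x. t \<in> {0..T} \<Longrightarrow> norm (S t x) \<le> C * norm x" using bounded_on_interval[of T] by blast
  obtain b where b: "b > 0" "\<And>h. 0 \<le> h \<Longrightarrow> h < b \<Longrightarrow> norm (S h x - S 0 x) < e / C"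
    using near_zero[of "e / C" x] e C(1) by auto
  have *: "norm (S r x - S s x) < e" if "0 \<le> s" "s \<le> r" "r \<le> T" "r - s < b" for r s
  proof -
    have "S r x - S s x = S s (S (r - s) x - S 0 x)"
      using comp[of s "r - s" x] that by (simp add: S_diff)
    then have "norm (S r x - S s x) \<le> C * norm (S (r - s) x - S 0 x)" using C(2)[of s] that by simp
    also have "\<dots> < C * (e / C)" using b(2)[of "r - s"] that C(1) by (intro mult_strict_left_mono) auto
    finally show ?thesis using C(1) by simp
  qed
  have "dist (S s x) (S t x) < e" if "s \<in> {0..T}" "dist s t < b" for s
    using *[of s t] *[of t s] that t by (cases "s \<le> t") (auto simp: dist_norm dist_real_def norm_minus_commute)
  then show "\<exists>d>0. \<forall>s\<in>{0..T}. dist s t < d \<longrightarrow> dist (S s x) (S t x) < e" using b(1) by blast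
qed

lemma continuous_on_S_compose:
  fixes f :: "'a::topological_space \<Rightarrow> real"
  assumes f: "continuous_on A f" "\<And>a. a \<in> A \<Longrightarrow> f a \<in> {0..T}" and g: "continuous_on A g"
  shows "continuous_on A (\<lambda>a. S (f a) (g a))"
  unfolding continuous_on_def
proof
  fix a assume a: "a \<in> A"
  obtain C where C: "C \<ge> 1" "\<And>t x. t \<in> {0..T} \<Longrightarrow> norm (S t x) \<le> C * norm x" using bounded_on_interval[of T] by blast
  have 1: "((\<lambda>b. C * norm (g b - g a)) \<longlongrightarrow> C * norm (g a - g a)) (at a within A)"
    using g a unfolding continuous_on_def by (intro tendsto_intros) auto
  have "continuous_on A (\<lambda>b. S (f b) (g a))"
    by (rule continuous_on_compose2[OF continuous_orbit[of T] f(1)]) (use f(2) in auto)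
  then have 2: "((\<lambda>b. norm (S (f b) (g a) - S (f a) (g a))) \<longlongrightarrow> norm (S (f a) (g a) - S (f a) (g a))) (at a within A)"
    using a unfolding continuous_on_def by (intro tendsto_intros) auto
  have "\<forall>\<^sub>F b in at a within A. norm (S (f b) (g b) - S (f a) (g a)) \<le> C * norm (g b - g a) + norm (S (f b) (g a) - S (f a) (g a))"
    unfolding eventually_at_filter
  proof (intro always_eventually allI impI)
    fix b assume "b \<in> A"
    then have b: "f b \<in> {0..T}" using f(2) by blast
    have dec: "S (f b) (g b) - S (f a) (g a) = S (f b) (g b - g a) + (S (f b) (g a) - S (f a) (g a))"
      using b by (simp add: S_diff)
    show "norm (S (f b) (g b) - S (f a) (g a)) \<le> C * norm (g b - g a) + norm (S (f b) (g a) - S (f a) (g a))"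
      unfolding dec
      using norm_triangle_ineq[of "S (f b) (g b - g a)" "S (f b) (g a) - S (f a) (g a)"] C(2)[OF b, of "g b - g a"]
      by linarith
  qed
  then have "((\<lambda>b. S (f b) (g b) - S (f a) (g a)) \<longlongrightarrow> 0) (at a within A)"
    by (rule Lim_null_comparison) (use tendsto_add[OF 1 2] in simp)
  then show "((\<lambda>b. S (f b) (g b)) \<longlongrightarrow> S (f a) (g a)) (at a within A)" by (simp add: LIM_zero_iff)
qed

definition gen :: "'e \<Rightarrow> 'e \<Rightarrow> bool" where
  "gen x y \<longleftrightarrow> S 0 x = x \<and> ((\<lambda>t. (1 / t) *\<^sub>R (S t x - x)) \<longlongrightarrow> y) (at_right 0)"

text \<open>The domain of the generator is dense: averaging an orbit makes it differentiable and moves its initial value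
  by little.\<close>

lemma gen_average:
  assumes x: "S 0 x = x" and r: "r > 0"
  shows "gen (steklov r (\<lambda>s. S s x) 0) ((1 / r) *\<^sub>R (S r x - x))"
proof -
  let ?f = "\<lambda>s. S s x"
  have c: "continuous_on {0..T} ?f" for T by (rule continuous_orbit)
  have i: "?f integrable_on {a..b}" if "0 \<le> a" for a b
    by (intro integrable_continuous_real continuous_on_subset[OF c[of b]]) (use that in auto)
  have Sh: "S h (steklov r ?f 0) = (1 / r) *\<^sub>R integral {h..r + h} ?f" if h: "0 \<le> h" for h
  proof -
    have "S h (steklov r ?f 0) = (1 / r) *\<^sub>R integral {0..r} (\<lambda>s. S h (S s x))"
      unfolding steklov_def using integral_linear[OF i bl[OF h], of 0 r] h by (simp add: S_scaleR o_def)
    also have "integral {0..r} (\<lambda>s. S h (S s x)) = integral {0..r} (\<lambda>s. ?f (s + h))"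
    proof (rule integral_cong)
      fix s assume "s \<in> {0..r}"
      then show "S h (S s x) = S (s + h) x" using comp[of h s x] h by (simp add: add.commute[of s h])
    qed
    also have "\<dots> = integral {0 + h..r + h} ?f" by (rule integral_shift_interval)
    finally show ?thesis by simp
  qed
  have S0: "S 0 (steklov r ?f 0) = steklov r ?f 0" using Sh[of 0] by (simp add: steklov_def)
  have "\<forall>\<^sub>F h in at_right 0. (1 / r) *\<^sub>R (steklov h ?f r - steklov h ?f 0) = (1 / h) *\<^sub>R (S h (steklov r ?f 0) - steklov r ?f 0)"
  proof (rule eventually_at_rightI[of 0 r])
    fix h assume "h \<in> {0<..<r}"
    then have h: "0 < h" "h < r" by auto
    have 1: "integral {0..h} ?f + integral {h..r + h} ?f = integral {0..r + h} ?f"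
      and 2: "integral {0..r} ?f + integral {r..r + h} ?f = integral {0..r + h} ?f"
      using h by (auto intro!: Henstock_Kurzweil_Integration.integral_combine i)
    have "integral {h..r + h} ?f = integral {0..r + h} ?f - integral {0..h} ?f" by (simp flip: 1)
    moreover have "integral {r..r + h} ?f = integral {0..r + h} ?f - integral {0..r} ?f" by (simp flip: 2)
    ultimately have "integral {h..r + h} ?f - integral {0..r} ?f = integral {r..r + h} ?f - integral {0..h} ?f" by simp
    moreover have "S h (steklov r ?f 0) - steklov r ?f 0 = (1 / r) *\<^sub>R (integral {h..r + h} ?f - integral {0..r} ?f)"
      unfolding Sh[OF less_imp_le[OF h(1)]] by (simp add: steklov_def scaleR_diff_right)
    ultimately have "(1 / h) *\<^sub>R (S h (steklov r ?f 0) - steklov r ?f 0) = (1 / h) *\<^sub>R ((1 / r) *\<^sub>R (integral {r..r + h} ?f - integral {0..h} ?f))"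
      by simp
    then show "(1 / r) *\<^sub>R (steklov h ?f r - steklov h ?f 0) = (1 / h) *\<^sub>R (S h (steklov r ?f 0) - steklov r ?f 0)"
      by (simp add: steklov_def[of h] mult.commute flip: scaleR_diff_right)
  qed (use r in auto)
  moreover have "((\<lambda>h. (1 / r) *\<^sub>R (steklov h ?f r - steklov h ?f 0)) \<longlongrightarrow> (1 / r) *\<^sub>R (S r x - S 0 x)) (at_right 0)"
    by (intro tendsto_intros steklov_tendsto[OF c[of "r + 1"]]) (use r in auto)
  ultimately have "((\<lambda>h. (1 / h) *\<^sub>R (S h (steklov r ?f 0) - steklov r ?f 0)) \<longlongrightarrow> (1 / r) *\<^sub>R (S r x - S 0 x)) (at_right 0)"
    by (rule Lim_transform_eventually[rotated])
  then show ?thesis unfolding gen_def using S0 x by simp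
qed

lemma square_growth:
  fixes a :: "'a::real_inner" and v :: "real \<Rightarrow> 'a"
  assumes "(v \<longlongrightarrow> b) (at_right 0)" and "(w \<longlongrightarrow> a) (at_right 0)"
  shows "((\<lambda>h. ((norm (w h + h *\<^sub>R v h))\<^sup>2 - (norm (w h))\<^sup>2) / h) \<longlongrightarrow> 2 * (a \<bullet> b)) (at_right (0::real))"
proof -
  have "((\<lambda>h. 2 * (w h \<bullet> v h) + h * (v h \<bullet> v h)) \<longlongrightarrow> 2 * (a \<bullet> b) + 0 * (b \<bullet> b)) (at_right 0)"
    by (intro tendsto_intros assms)
  moreover have "\<forall>\<^sub>F h in at_right 0. 2 * (w h \<bullet> v h) + h * (v h \<bullet> v h) = ((norm (w h + h *\<^sub>R v h))\<^sup>2 - (norm (w h))\<^sup>2) / h"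
  proof (rule eventually_at_rightI[of 0 1])
    fix h :: real assume "h \<in> {0<..<1}"
    then have h: "h > 0" by simp
    have "(norm (w h + h *\<^sub>R v h))\<^sup>2 - (norm (w h))\<^sup>2 = h * (2 * (w h \<bullet> v h) + h * (v h \<bullet> v h))"
      by (simp only: power2_norm_eq_inner)
         (simp add: inner_simps inner_commute[of "v h" "w h"] algebra_simps)
    then show "2 * (w h \<bullet> v h) + h * (v h \<bullet> v h) = ((norm (w h + h *\<^sub>R v h))\<^sup>2 - (norm (w h))\<^sup>2) / h" using h by simp
  qed simp
  ultimately show ?thesis by (auto intro: Lim_transform_eventually)
qed

lemma eventually_le_of_quotient:
  fixes \<phi> :: "real \<Rightarrow> real"
  assumes "((\<lambda>h. (\<phi> h - c) / h) \<longlongrightarrow> d) (at_right 0)" "d < d'"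
  shows "\<forall>\<^sub>F h in at_right 0. \<phi> h \<le> c + h * d'"
proof -
  have "\<forall>\<^sub>F h in at_right (0::real). h > 0" by (simp add: eventually_at_right_less)
  with order_tendstoD(2)[OF assms] show ?thesis
    by eventually_elim (simp add: field_simps)
qed

end

text \<open>The quadratic form of the generator is bounded by a function \<open>Q\<close> whose continuity and quadratic growth allow the
  passage from the domain of the generator to the whole space.\<close>

locale dissipative_semigroup = projected_semigroup S
  for S :: "real \<Rightarrow> 'e::{real_inner,banach} \<Rightarrow> 'e" +
  fixes Q :: "'e \<Rightarrow> real" and Cq :: real
  assumes gen_Q: "\<And>x y. gen x y \<Longrightarrow> x \<bullet> y \<le> Q x"
    and Q_cont: "continuous_on UNIV Q" and Q_bound: "\<And>x. \<bar>Q x\<bar> \<le> Cq * (norm x)\<^sup>2"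
begin

lemma continuous_Q: "continuous_on A f \<Longrightarrow> continuous_on A (\<lambda>a. Q (f a))"
  by (rule continuous_on_compose2[OF Q_cont]) auto

lemma energy_domain:
  assumes xy: "gen x y" and t: "0 \<le> t"
  shows "(norm (S t x))\<^sup>2 \<le> (norm x)\<^sup>2 + 2 * integral {0..t} (\<lambda>s. Q (S s x))"
proof -
  have x: "S 0 x = x" using xy by (simp add: gen_def)
  have qc: "continuous_on {0..t'} (\<lambda>s. Q (S s x))" for t' by (intro continuous_Q continuous_orbit)
  have qi: "(\<lambda>s. Q (S s x)) integrable_on {a..b}" if "0 \<le> a" for a b
    by (intro integrable_continuous_real continuous_on_subset[OF qc[of b]]) (use that in auto)
  define \<Psi> where "\<Psi> s = (norm (S s x))\<^sup>2 - 2 * integral {0..s} (\<lambda>r. Q (S r x))" for s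
  have "\<Psi> t \<le> \<Psi> 0"
  proof (rule dini_nonincreasing[OF t])
    show "continuous_on {0..t} \<Psi>"
      unfolding \<Psi>_def by (intro continuous_intros continuous_orbit indefinite_integral_continuous_1 qi) simp
    fix s e :: real assume s: "0 \<le> s" "s < t" and e: "e > 0"
    define v where "v h = (1 / h) *\<^sub>R (S (s + h) x - S s x)" for h
    have "((\<lambda>h. S s ((1 / h) *\<^sub>R (S h x - x))) \<longlongrightarrow> S s y) (at_right 0)"
      using xy unfolding gen_def by (intro bounded_linear.tendsto[OF bl[OF s(1)]]) simp
    moreover have "\<forall>\<^sub>F h in at_right 0. S s ((1 / h) *\<^sub>R (S h x - x)) = v h"
      by (rule eventually_at_rightI[of 0 1]) (use s comp in \<open>auto simp: v_def S_scaleR S_diff\<close>)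
    ultimately have v: "(v \<longlongrightarrow> S s y) (at_right 0)" by (rule Lim_transform_eventually)
    have "gen (S s x) (S s y)"
      unfolding gen_def
    proof
      show "((\<lambda>h. (1 / h) *\<^sub>R (S h (S s x) - S s x)) \<longlongrightarrow> S s y) (at_right 0)"
        by (rule Lim_transform_eventually[OF v], rule eventually_at_rightI[of 0 1])
           (use s comp in \<open>auto simp: v_def add.commute[of s]\<close>)
    qed (use s in simp)
    then have le: "S s x \<bullet> S s y \<le> Q (S s x)" by (rule gen_Q)
    have 1: "((\<lambda>h. ((norm (S (s + h) x))\<^sup>2 - (norm (S s x))\<^sup>2) / h) \<longlongrightarrow> 2 * (S s x \<bullet> S s y)) (at_right 0)"
      by (rule Lim_transform_eventually[OF square_growth[OF v tendsto_const]], rule eventually_at_rightI[of 0 1])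
         (auto simp: v_def)
    have 2: "((\<lambda>h. 2 * steklov h (\<lambda>r. Q (S r x)) s) \<longlongrightarrow> 2 * Q (S s x)) (at_right 0)"
      by (intro tendsto_intros steklov_tendsto[OF qc[of t]]) (use s in auto)
    have "((\<lambda>h. (\<Psi> (s + h) - \<Psi> s) / h) \<longlongrightarrow> 2 * (S s x \<bullet> S s y) - 2 * Q (S s x)) (at_right 0)"
    proof (rule Lim_transform_eventually[OF tendsto_diff[OF 1 2]], rule eventually_at_rightI[of 0 1])
      fix h :: real assume "h \<in> {0<..<1}"
      then have h: "h > 0" by simp
      have eq: "integral {0..s} (\<lambda>r. Q (S r x)) + integral {s..s + h} (\<lambda>r. Q (S r x)) = integral {0..s + h} (\<lambda>r. Q (S r x))"
        using s h by (intro Henstock_Kurzweil_Integration.integral_combine qi) auto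
      then show "((norm (S (s + h) x))\<^sup>2 - (norm (S s x))\<^sup>2) / h - 2 * steklov h (\<lambda>r. Q (S r x)) s = (\<Psi> (s + h) - \<Psi> s) / h"
        unfolding \<Psi>_def steklov_def eq[symmetric] by (simp add: diff_divide_distrib add_divide_distrib)
    qed simp
    from eventually_le_of_quotient[OF this, of e] le e
    show "\<forall>\<^sub>F h in at_right 0. \<Psi> (s + h) \<le> \<Psi> s + e * h" by (simp add: mult.commute)
  qed
  then show ?thesis using x by (simp add: \<Psi>_def)
qed

text \<open>On the domain of the generator the inequality is the integrated derivative of the squared norm. It keeps its
  meaning for every initial value, and both sides are continuous.\<close>

lemma energy_inequality:
  assumes x: "S 0 x = x" and t: "0 \<le> t"
  shows "(norm (S t x))\<^sup>2 \<le> (norm x)\<^sup>2 + 2 * integral {0..t} (\<lambda>s. Q (S s x))"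
proof -
  define xn where "xn n = steklov (1 / real (Suc n)) (\<lambda>s. S s x) 0" for n
  obtain C where C: "C \<ge> 1" "\<And>s x. s \<in> {0..t + 1} \<Longrightarrow> norm (S s x) \<le> C * norm x" using bounded_on_interval[of "t + 1"] by blast
  have f0: "filterlim (\<lambda>n. 1 / real (Suc n)) (at_right 0) sequentially"
    unfolding filterlim_at by (auto intro!: LIMSEQ_inverse_real_of_nat[unfolded inverse_eq_divide] simp del: of_nat_Suc)
  have lim: "xn \<longlonglongrightarrow> x"
    using filterlim_compose[OF steklov_tendsto[OF continuous_orbit[of 1 x]] f0, of 0] x by (simp add: xn_def[abs_def])
  have xb: "norm (xn n) \<le> C * norm x" for n
    unfolding xn_def
  proof (rule norm_steklov_le)
    show "(\<lambda>s. S s x) integrable_on {0..0 + 1 / real (Suc n)}"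
      by (intro integrable_continuous_real continuous_orbit[of "0 + 1 / real (Suc n)"])
    fix s assume "s \<in> {0..0 + 1 / real (Suc n)}"
    moreover have "1 / real (Suc n) \<le> 1" by simp
    ultimately have "0 \<le> s" "s \<le> t + 1" using t unfolding atLeastAtMost_iff by linarith+
    then show "norm (S s x) \<le> C * norm x" by (intro C(2)) simp
  qed simp
  have Slim: "(\<lambda>n. S s (xn n)) \<longlonglongrightarrow> S s x" if "0 \<le> s" for s
    by (rule bounded_linear.tendsto[OF bl[OF that] lim])
  have "(\<lambda>n. integral {0..t} (\<lambda>s. Q (S s (xn n)))) \<longlonglongrightarrow> integral {0..t} (\<lambda>s. Q (S s x))"
  proof (rule dominated_convergence(2)[where h = "\<lambda>_. \<bar>Cq\<bar> * (C * (C * norm x))\<^sup>2"])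
    show "(\<lambda>s. Q (S s (xn n))) integrable_on {0..t}" for n
      by (intro integrable_continuous_real continuous_Q continuous_orbit)
    show "norm (Q (S s (xn n))) \<le> \<bar>Cq\<bar> * (C * (C * norm x))\<^sup>2" if "s \<in> {0..t}" for n s
    proof -
      have "norm (S s (xn n)) \<le> C * norm (xn n)" using that by (intro C(2)) auto
      also have "\<dots> \<le> C * (C * norm x)" using C(1) xb by (intro mult_left_mono) auto
      finally have "(norm (S s (xn n)))\<^sup>2 \<le> (C * (C * norm x))\<^sup>2" by (intro power_mono) auto
      then have "\<bar>Cq\<bar> * (norm (S s (xn n)))\<^sup>2 \<le> \<bar>Cq\<bar> * (C * (C * norm x))\<^sup>2" by (intro mult_left_mono) auto
      moreover have "\<bar>Q (S s (xn n))\<bar> \<le> \<bar>Cq\<bar> * (norm (S s (xn n)))\<^sup>2"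
        using Q_bound[of "S s (xn n)"] mult_right_mono[OF abs_ge_self[of Cq], of "(norm (S s (xn n)))\<^sup>2"] by simp
      ultimately show ?thesis by simp
    qed
    show "(\<lambda>n. Q (S s (xn n))) \<longlonglongrightarrow> Q (S s x)" if "s \<in> {0..t}" for s
    proof -
      have "isCont Q (S s x)" using Q_cont by (simp add: continuous_on_eq_continuous_at)
      then show ?thesis by (rule isCont_tendsto_compose[OF _ Slim]) (use that in simp)
    qed
  qed (rule integrable_const_ivl)
  then have "(\<lambda>n. (norm (xn n))\<^sup>2 + 2 * integral {0..t} (\<lambda>s. Q (S s (xn n)))) \<longlonglongrightarrow> (norm x)\<^sup>2 + 2 * integral {0..t} (\<lambda>s. Q (S s x))"
    by (intro tendsto_intros lim)
  moreover have "(\<lambda>n. (norm (S t (xn n)))\<^sup>2) \<longlonglongrightarrow> (norm (S t x))\<^sup>2"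
    by (intro tendsto_intros Slim t)
  moreover have "(norm (S t (xn n)))\<^sup>2 \<le> (norm (xn n))\<^sup>2 + 2 * integral {0..t} (\<lambda>s. Q (S s (xn n)))" for n
    by (rule energy_domain[OF _ t]) (auto simp: xn_def intro!: gen_average[OF x])
  ultimately show ?thesis by (intro LIMSEQ_le) auto
qed

end

context projected_semigroup
begin

definition mild :: "'e \<Rightarrow> (real \<Rightarrow> 'e) \<Rightarrow> real \<Rightarrow> 'e" where
  "mild x0 F t = S t x0 + integral {0..t} (\<lambda>s. S (t - s) (F s))"

lemma integrable_mild:
  assumes F: "continuous_on {0..T} F" and "0 \<le> a" "b \<le> t" "b \<le> T"
  shows "(\<lambda>s. S (t - s) (F s)) integrable_on {a..b}"
  by (intro integrable_continuous_real continuous_on_S_compose[where T = t] continuous_intros continuous_on_subset[OF F])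
     (use assms in auto)

lemma mild_step:
  assumes F: "continuous_on {0..T} F" and t: "0 \<le> t" "0 \<le> h" "t + h \<le> T"
  shows "mild x0 F (t + h) = S h (mild x0 F t) + integral {t..t + h} (\<lambda>s. S (t + h - s) (F s))"
proof -
  have i1: "(\<lambda>s. S (t - s) (F s)) integrable_on {0..t}" using t by (intro integrable_mild[OF F]) auto
  have "S h (integral {0..t} (\<lambda>s. S (t - s) (F s))) = integral {0..t} (\<lambda>s. S h (S (t - s) (F s)))"
    using integral_linear[OF i1 bl[OF t(2)]] by (simp add: o_def)
  also have "\<dots> = integral {0..t} (\<lambda>s. S (t + h - s) (F s))"
  proof (rule integral_cong)
    fix s assume "s \<in> {0..t}"
    then show "S h (S (t - s) (F s)) = S (t + h - s) (F s)"
      using comp[of h "t - s" "F s"] t by (simp add: algebra_simps)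
  qed
  finally have "S h (integral {0..t} (\<lambda>s. S (t - s) (F s))) + integral {t..t + h} (\<lambda>s. S (t + h - s) (F s))
      = integral {0..t + h} (\<lambda>s. S (t + h - s) (F s))"
    using t Henstock_Kurzweil_Integration.integral_combine[OF _ _ integrable_mild[OF F, of 0 "t + h" "t + h"], of t] by simp
  moreover have "S (t + h) x0 = S h (S t x0)" using comp[of h t x0] t by (simp add: add.commute)
  ultimately show ?thesis unfolding mild_def using t by (simp add: S_add)
qed

lemma S_0_mild:
  assumes F: "continuous_on {0..T} F" and t: "0 \<le> t" "t \<le> T"
  shows "S 0 (mild x0 F t) = mild x0 F t"
  using mild_step[OF F, of t 0 x0] t by simp

text \<open>A mild solution has no derivative in general, because the orbit of its current value has none. What is left
  after this orbit is subtracted is differentiable from the right.\<close>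

lemma mild_right_increment:
  assumes F: "continuous_on {0..T} F" and t: "0 \<le> t" "t < T"
  shows "((\<lambda>h. (1 / h) *\<^sub>R (mild x0 F (t + h) - S h (mild x0 F t))) \<longlongrightarrow> S 0 (F t)) (at_right 0)"
proof (rule tendstoI)
  fix e :: real assume e: "e > 0"
  obtain C where C: "C \<ge> 1" "\<And>s x. s \<in> {0..T} \<Longrightarrow> norm (S s x) \<le> C * norm x" using bounded_on_interval[of T] by blast
  obtain d1 where d1: "d1 > 0" "\<And>s. s \<in> {0..T} \<Longrightarrow> dist s t < d1 \<Longrightarrow> dist (F s) (F t) < e / (4 * C)"
  proof -
    have "e / (4 * C) > 0" "t \<in> {0..T}" using e C(1) t by auto
    then show ?thesis using F that unfolding continuous_on_iff by blast
  qed
  obtain d2 where d2: "d2 > 0" "\<And>h. 0 \<le> h \<Longrightarrow> h < d2 \<Longrightarrow> norm (S h (F t) - S 0 (F t)) < e / 4"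
  proof -
    have "e / 4 > 0" using e by simp
    from near_zero[OF this, of "F t"] show ?thesis using that by blast
  qed
  show "\<forall>\<^sub>F h in at_right 0. dist ((1 / h) *\<^sub>R (mild x0 F (t + h) - S h (mild x0 F t))) (S 0 (F t)) < e"
  proof (rule eventually_at_rightI[of 0 "min (min d1 d2) (T - t)"])
    fix h assume "h \<in> {0<..<min (min d1 d2) (T - t)}"
    then have h: "0 < h" "h < d1" "h < d2" "t + h < T" by auto
    define f where "f s = S (t + h - s) (F s)" for s
    have fi: "f integrable_on {t..t + h}" unfolding f_def using h t by (intro integrable_mild[OF F]) auto
    have "(1 / h) *\<^sub>R (mild x0 F (t + h) - S h (mild x0 F t)) = steklov h f t"
      unfolding mild_step[OF F t(1) less_imp_le[OF h(1)] less_imp_le[OF h(4)]] steklov_def f_def by simp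
    moreover have "norm (steklov h f t - S 0 (F t)) \<le> e / 2"
      unfolding steklov_const_diff[OF h(1) fi]
    proof (rule norm_steklov_le[OF h(1)])
      show "(\<lambda>s. f s - S 0 (F t)) integrable_on {t..t + h}" by (intro integrable_diff fi integrable_const_ivl)
      fix s assume s: "s \<in> {t..t + h}"
      have dec: "f s - S 0 (F t) = S (t + h - s) (F s - F t) + (S (t + h - s) (F t) - S 0 (F t))"
        using s by (simp add: f_def S_diff)
      have "norm (S (t + h - s) (F s - F t)) \<le> e / 4"
      proof -
        have "norm (S (t + h - s) (F s - F t)) \<le> C * norm (F s - F t)" using s t h by (intro C(2)) auto
        also have "\<dots> \<le> C * (e / (4 * C))"
          using d1(2)[of s] s t h C(1) by (intro mult_left_mono) (auto simp: dist_norm dist_real_def)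
        finally show ?thesis using C(1) by simp
      qed
      moreover have "norm (S (t + h - s) (F t) - S 0 (F t)) < e / 4" using s h by (intro d2(2)) auto
      ultimately show "norm (f s - S 0 (F t)) \<le> e / 2"
        unfolding dec
        using norm_triangle_ineq[of "S (t + h - s) (F s - F t)" "S (t + h - s) (F t) - S 0 (F t)"] by linarith
    qed
    ultimately show "dist ((1 / h) *\<^sub>R (mild x0 F (t + h) - S h (mild x0 F t))) (S 0 (F t)) < e"
      using e by (simp add: dist_norm)
  qed (use d1 d2 t in auto)
qed

lemma continuous_mild:
  assumes F: "continuous_on {0..T} F"
  shows "continuous_on {0..T} (mild x0 F)"
proof -
  obtain C where C: "C \<ge> 1" "\<And>s x. s \<in> {0..T} \<Longrightarrow> norm (S s x) \<le> C * norm x" using bounded_on_interval[of T] by blast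
  obtain B where "\<forall>x\<in>F ` {0..T}. norm x \<le> B"
    using compact_imp_bounded[OF compact_continuous_image[OF F compact_Icc]] unfolding bounded_iff by blast
  then have B: "norm (F s) \<le> B" if "s \<in> {0..T}" for s using that by blast
  define I where "I t = integral {0..t} (\<lambda>s. S s (F (t - s)))" for t
  have fi: "(\<lambda>s. S s (F (t - s))) integrable_on {a..b}" if "0 \<le> a" "b \<le> t" "t \<le> T" for a b t
    by (intro integrable_continuous_real continuous_on_S_compose[where T = T] continuous_intros continuous_on_compose2[OF F])
       (use that in auto)
  have I_eq: "integral {0..t} (\<lambda>s. S (t - s) (F s)) = I t" for t
  proof -
    have "integral {0..t} (\<lambda>s. S (t - s) (F s)) = integral {-t..-0} (\<lambda>s. S (t - (- s)) (F (- s)))"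
      using Henstock_Kurzweil_Integration.integral_reflect_real[of t 0 "\<lambda>s. S (t - s) (F s)"] by simp
    also have "\<dots> = integral {-t..0} (\<lambda>s. (\<lambda>r. S r (F (t - r))) (s + t))" by (simp add: add.commute)
    also have "\<dots> = integral {-t + t..0 + t} (\<lambda>r. S r (F (t - r)))" by (rule integral_shift_interval)
    finally show ?thesis by (simp add: I_def)
  qed
  have "continuous_on {0..T} I"
    unfolding continuous_on_iff
  proof (intro ballI allI impI)
    fix t e :: real assume t: "t \<in> {0..T}" and e: "e > 0"
    have T: "0 \<le> T" using t by simp
    define r where "r = e / (4 * C * (T + 1))"
    have r: "r > 0" "T * (C * r) \<le> e / 4"
    proof -
      show "r > 0" unfolding r_def using e C(1) T by simp
      have "T * (C * r) \<le> (T + 1) * (C * r)" using \<open>r > 0\<close> C(1) by (intro mult_right_mono) auto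
      also have "\<dots> = e / 4"
      proof -
        have "T1 * (C * (e / (4 * C * T1))) = e / 4" if "T1 > 0" for T1 using C(1) that by simp
        from this[of "T + 1"] show ?thesis unfolding r_def using T by simp
      qed
      finally show "T * (C * r) \<le> e / 4" .
    qed
    have "uniformly_continuous_on {0..T} F" using compact_uniformly_continuous[OF F] by simp
    then obtain d1 where d1: "d1 > 0" "\<And>a b. a \<in> {0..T} \<Longrightarrow> b \<in> {0..T} \<Longrightarrow> dist a b < d1 \<Longrightarrow> dist (F a) (F b) < r"
      unfolding uniformly_continuous_on_def using r(1) by metis
    define d where "d = min d1 (e / (4 * C * (\<bar>B\<bar> + 1)))"
    have d: "d > 0" unfolding d_def using d1 e C(1) by simp
    have *: "norm (I b - I a) < e" if ab: "0 \<le> a" "a \<le> b" "b \<le> T" "b - a < d" for a b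
    proof -
      have "I b = integral {0..a} (\<lambda>s. S s (F (b - s))) + integral {a..b} (\<lambda>s. S s (F (b - s)))"
        unfolding I_def using ab by (intro Henstock_Kurzweil_Integration.integral_combine[symmetric] fi) auto
      then have "I b - I a = integral {0..a} (\<lambda>s. S s (F (b - s)) - S s (F (a - s))) + integral {a..b} (\<lambda>s. S s (F (b - s)))"
        unfolding I_def using ab by (subst integral_diff) (auto intro!: fi)
      moreover have "norm (integral {0..a} (\<lambda>s. S s (F (b - s)) - S s (F (a - s)))) \<le> integral {0..a} (\<lambda>_. C * r)"
      proof (rule integral_norm_bound_integral)
        show "(\<lambda>s. S s (F (b - s)) - S s (F (a - s))) integrable_on {0..a}" using ab by (intro integrable_diff fi) auto
        fix s assume s: "s \<in> {0..a}"
        have "norm (S s (F (b - s) - F (a - s))) \<le> C * norm (F (b - s) - F (a - s))" using s ab by (intro C(2)) auto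
        also have "\<dots> \<le> C * r"
          using d1(2)[of "b - s" "a - s"] s ab C(1) unfolding d_def
          by (intro mult_left_mono) (auto simp: dist_norm dist_real_def)
        finally show "norm (S s (F (b - s)) - S s (F (a - s))) \<le> C * r" using s by (simp add: S_diff)
      qed (rule integrable_const_ivl)
      moreover have "integral {0..a} (\<lambda>_. C * r) \<le> e / 4"
      proof -
        have "a * (C * r) \<le> T * (C * r)" using ab C(1) r(1) by (intro mult_right_mono) auto
        moreover have "integral {0..a} (\<lambda>_. C * r) = a * (C * r)" using ab by (simp add: mult_ac)
        ultimately show ?thesis using r(2) by linarith
      qed
      moreover have "norm (integral {a..b} (\<lambda>s. S s (F (b - s)))) \<le> integral {a..b} (\<lambda>_. C * (\<bar>B\<bar> + 1))"
      proof (rule integral_norm_bound_integral)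
        show "(\<lambda>s. S s (F (b - s))) integrable_on {a..b}" using ab by (intro fi) auto
        fix s assume s: "s \<in> {a..b}"
        have "norm (S s (F (b - s))) \<le> C * norm (F (b - s))" using s ab by (intro C(2)) auto
        also have "\<dots> \<le> C * (\<bar>B\<bar> + 1)" using B[of "b - s"] s ab C(1) by (intro mult_left_mono) auto
        finally show "norm (S s (F (b - s))) \<le> C * (\<bar>B\<bar> + 1)" .
      qed (rule integrable_const_ivl)
      moreover have "integral {a..b} (\<lambda>_. C * (\<bar>B\<bar> + 1)) \<le> e / 4"
      proof -
        have "(b - a) * (C * (\<bar>B\<bar> + 1)) \<le> (e / (4 * C * (\<bar>B\<bar> + 1))) * (C * (\<bar>B\<bar> + 1))"
          using ab(4) C(1) unfolding d_def by (intro mult_right_mono) auto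
        also have "\<dots> = e / 4"
        proof -
          have "e / (4 * C * k) * (C * k) = e / 4" if "k > 0" for k using C(1) that by simp
          from this[of "\<bar>B\<bar> + 1"] show ?thesis by simp
        qed
        finally have "(b - a) * (C * (\<bar>B\<bar> + 1)) \<le> e / 4" .
        moreover have "integral {a..b} (\<lambda>_. k) = (b - a) * k" for k :: real using ab by simp
        ultimately show ?thesis by (simp only:)
      qed
      ultimately show ?thesis
        using e norm_triangle_ineq[of "integral {0..a} (\<lambda>s. S s (F (b - s)) - S s (F (a - s)))" "integral {a..b} (\<lambda>s. S s (F (b - s)))"]
        by simp
    qed
    have "dist (I s) (I t) < e" if "s \<in> {0..T}" "dist s t < d" for s
      using *[of s t] *[of t s] that t by (cases "s \<le> t") (auto simp: dist_norm dist_real_def norm_minus_commute)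
    then show "\<exists>d>0. \<forall>s\<in>{0..T}. dist s t < d \<longrightarrow> dist (I s) (I t) < e" using d by blast
  qed
  then show ?thesis unfolding mild_def I_eq by (intro continuous_on_add continuous_orbit)
qed

text \<open>This estimate reduces an integrable right-hand side to continuous ones, for which the right derivative
  above exists.\<close>

lemma mild_approx:
  assumes x: "((\<lambda>s. S (t - s) (F s)) has_integral (x - S t x0)) {0..t}"
    and t: "0 \<le> t" "t \<le> T" and Ft: "continuous_on {0..T} Ft" and d: "bint 0 T (\<lambda>s. F s - Ft s)"
    and C: "C \<ge> 1" "\<And>s x. s \<in> {0..T} \<Longrightarrow> norm (S s x) \<le> C * norm x"
  shows "norm (x - mild x0 Ft t) \<le> C * integral {0..T} (\<lambda>s. norm (F s - Ft s))"
proof -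
  have i: "(\<lambda>s. S (t - s) (Ft s)) integrable_on {0..t}" using t by (intro integrable_mild[OF Ft]) auto
  have "((\<lambda>s. S (t - s) (F s) - S (t - s) (Ft s)) has_integral (x - mild x0 Ft t)) {0..t}"
    using has_integral_diff[OF x integrable_integral[OF i]] by (simp add: mild_def algebra_simps)
  moreover have "norm (integral {0..t} (\<lambda>s. S (t - s) (F s) - S (t - s) (Ft s))) \<le> integral {0..t} (\<lambda>s. C * norm (F s - Ft s))"
  proof (rule integral_norm_bound_integral)
    show "(\<lambda>s. S (t - s) (F s) - S (t - s) (Ft s)) integrable_on {0..t}" using calculation by blast
    show "(\<lambda>s. C * norm (F s - Ft s)) integrable_on {0..t}"
      using t by (intro integrable_on_mult_right bint_norm bint_subinterval[OF d]) auto
    fix s assume "s \<in> {0..t}"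
    then show "norm (S (t - s) (F s) - S (t - s) (Ft s)) \<le> C * norm (F s - Ft s)"
      using C(2)[of "t - s" "F s - Ft s"] t by (simp add: S_diff)
  qed
  ultimately have "norm (x - mild x0 Ft t) \<le> integral {0..t} (\<lambda>s. C * norm (F s - Ft s))" by (simp add: integral_unique)
  also have "\<dots> = C * integral {0..t} (\<lambda>s. norm (F s - Ft s))" by simp
  also have "\<dots> \<le> C * integral {0..T} (\<lambda>s. norm (F s - Ft s))"
    using t C(1) by (intro mult_left_mono integral_subset_le bint_norm bint_subinterval[OF d] d) auto
  finally show ?thesis .
qed

end

text \<open>Two averages commute; the difference quotient of step \<open>h\<close> of the average over \<open>\<delta>\<close> is thus an average of difference
  quotients of step \<open>\<delta>\<close>, which converges as \<open>h\<close> tends to zero.\<close>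

lemma steklov_increment:
  fixes y :: "real \<Rightarrow> 'b::banach"
  assumes y: "y integrable_on {0..T}" and "0 \<le> s" "0 < h" "0 < \<delta>" "s + h + \<delta> \<le> T"
  shows "(1 / \<delta>) *\<^sub>R (steklov h y (s + \<delta>) - steklov h y s) = (1 / h) *\<^sub>R (steklov \<delta> y (s + h) - steklov \<delta> y s)"
proof -
  have i: "y integrable_on {a..b}" if "{a..b} \<subseteq> {0..T}" for a b by (rule integrable_on_subinterval[OF y that])
  have 1: "integral {s..s + h} y + integral {s + h..s + h + \<delta>} y = integral {s..s + h + \<delta>} y"
    using assms by (intro Henstock_Kurzweil_Integration.integral_combine i) auto
  have 2: "integral {s..s + \<delta>} y + integral {s + \<delta>..s + h + \<delta>} y = integral {s..s + h + \<delta>} y"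
    using assms by (intro Henstock_Kurzweil_Integration.integral_combine i) auto
  have "integral {s + \<delta>..s + \<delta> + h} y - integral {s..s + h} y = integral {s + h..s + h + \<delta>} y - integral {s..s + \<delta>} y"
  proof -
    have "integral {s + h..s + h + \<delta>} y = integral {s..s + h + \<delta>} y - integral {s..s + h} y" by (simp flip: 1)
    moreover have "integral {s + \<delta>..s + h + \<delta>} y = integral {s..s + h + \<delta>} y - integral {s..s + \<delta>} y" by (simp flip: 2)
    moreover have "integral {s + \<delta>..s + \<delta> + h} y = integral {s + \<delta>..s + h + \<delta>} y" by (simp add: add_ac)
    ultimately show ?thesis by simp
  qed
  then show ?thesis unfolding steklov_def by (simp add: mult.commute flip: scaleR_diff_right)
qed

text \<open>Comparison of a mild solution \<open>x\<close> with a function \<open>y\<close> whose averages solve the equation strongly up to a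
  residual \<open>r\<close>. The mild solution is approximated by mild solutions with continuous right-hand side, for
  which the upper right derivative of \<open>|x - y|\<^sup>2\<close> can be computed although neither term is differentiable.\<close>

lemma (in dissipative_semigroup) comparison:
  fixes x y F :: "real \<Rightarrow> 'e" and r :: "real \<Rightarrow> real \<Rightarrow> 'e" and k :: "real \<Rightarrow> real \<Rightarrow> real" and l :: "'e \<Rightarrow> real"
  assumes T: "0 < T" and F: "bint 0 T F" "\<And>t. t \<in> {0..T} \<Longrightarrow> S 0 (F t) = F t"
    and x: "\<And>t. t \<in> {0..T} \<Longrightarrow> ((\<lambda>s. S (t - s) (F s)) has_integral (x t - S t x0)) {0..t}"
    and y: "continuous_on {0..T} y"
    and gen_y: "\<And>\<delta> t. 0 < \<delta> \<Longrightarrow> t \<in> {0..T - \<delta>} \<Longrightarrow>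
      gen (steklov \<delta> y t) ((1 / \<delta>) *\<^sub>R (y (t + \<delta>) - y t) - steklov \<delta> F t - r \<delta> t)"
    and l: "continuous_on UNIV l" "\<And>v. 0 \<le> l v" "\<And>v. l v \<le> Cl * (norm v)\<^sup>2"
    and k: "\<And>\<delta>. 0 < \<delta> \<Longrightarrow> continuous_on {0..T - \<delta>} (k \<delta>)" "\<And>\<delta> t. 0 \<le> k \<delta> t"
    and \<mu>: "0 \<le> \<mu>" "\<And>v \<delta> t. 0 < \<delta> \<Longrightarrow> t \<in> {0..T - \<delta>} \<Longrightarrow> 2 * Q v - 2 * (v \<bullet> r \<delta> t) \<le> \<mu> * (norm v)\<^sup>2 - l v + k \<delta> t"
    and Kc: "\<And>\<delta>. 0 < \<delta> \<Longrightarrow> \<delta> < T \<Longrightarrow> integral {0..T - \<delta>} (k \<delta>) \<le> Kc"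
  shows comparison_continuous: "continuous_on {0..T} x"
    and comparison_bound: "\<And>t. t \<in> {0..T} \<Longrightarrow>
      (norm (x t - y t))\<^sup>2 + integral {0..t} (\<lambda>s. l (x s - y s)) \<le> exp (\<mu> * t) * ((norm (x 0 - y 0))\<^sup>2 + Kc)"
proof -
  obtain C where C: "C \<ge> 1" "\<And>s x. s \<in> {0..T} \<Longrightarrow> norm (S s x) \<le> C * norm x" using bounded_on_interval[of T] by blast
  have "\<exists>v. continuous_on UNIV v \<and> bint 0 T (\<lambda>t. F t - v t) \<and> integral {0..T} (\<lambda>t. norm (F t - v t)) < 1 / real (Suc n)" for n
    by (rule bint_approx_continuous[OF F(1)]) simp
  then obtain Ft where Ft: "\<And>n. continuous_on UNIV (Ft n)" "\<And>n. bint 0 T (\<lambda>t. F t - Ft n t)"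
    "\<And>n. integral {0..T} (\<lambda>t. norm (F t - Ft n t)) < 1 / real (Suc n)" by metis
  have FtT: "continuous_on {0..T} (Ft n)" for n by (rule continuous_on_subset[OF Ft(1)]) simp
  define xt where "xt n = mild x0 (Ft n)" for n
  have xt_c: "continuous_on {0..T} (xt n)" for n unfolding xt_def by (rule continuous_mild[OF FtT])
  have xt_d: "norm (x s - xt n s) \<le> C * (1 / real (Suc n))" if s: "s \<in> {0..T}" for n s
  proof -
    have "norm (x s - xt n s) \<le> C * integral {0..T} (\<lambda>t. norm (F t - Ft n t))"
      unfolding xt_def using s by (intro mild_approx[OF x[OF s] _ _ FtT Ft(2) C]) auto
    also have "\<dots> \<le> C * (1 / real (Suc n))" using Ft(3)[of n] C(1) by (intro mult_left_mono) auto
    finally show ?thesis .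
  qed
  have inv0: "(\<lambda>n. c * (1 / real (Suc n))) \<longlonglongrightarrow> 0" for c
    using tendsto_mult[OF tendsto_const[of c] LIMSEQ_inverse_real_of_nat[unfolded inverse_eq_divide]] by simp
  have xt_lim: "(\<lambda>n. xt n s) \<longlonglongrightarrow> x s" if "s \<in> {0..T}" for s
  proof -
    have "(\<lambda>n. xt n s - x s) \<longlonglongrightarrow> 0"
      by (rule Lim_null_comparison[OF _ inv0[of C]]) (use xt_d[OF that] in \<open>simp add: norm_minus_commute\<close>)
    then show ?thesis by (simp add: LIM_zero_iff)
  qed
  show xc: "continuous_on {0..T} x"
  proof (rule uniform_limit_theorem)
    show "\<forall>\<^sub>F n in sequentially. continuous_on {0..T} (xt n)" by (intro always_eventually allI xt_c)
    show "uniform_limit {0..T} xt x sequentially"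
    proof (rule uniform_limitI)
      fix e :: real assume "e > 0"
      then have "\<forall>\<^sub>F n in sequentially. C * (1 / real (Suc n)) < e" by (rule order_tendstoD(2)[OF inv0])
      then show "\<forall>\<^sub>F n in sequentially. \<forall>s\<in>{0..T}. dist (xt n s) (x s) < e"
      proof eventually_elim
        case (elim n)
        then show ?case using xt_d[of _ n] by (fastforce simp: dist_norm norm_minus_commute simp del: of_nat_Suc)
      qed
    qed
  qed simp
  have bdd: "\<exists>B. \<forall>s\<in>{0..T}. norm (w s) \<le> B" if "continuous_on {0..T} w" for w :: "real \<Rightarrow> 'e"
    using compact_imp_bounded[OF compact_continuous_image[OF that compact_Icc]] unfolding bounded_iff by blast
  obtain Bx where Bx: "\<And>s. s \<in> {0..T} \<Longrightarrow> norm (x s) \<le> Bx" using bdd[OF xc] by blast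
  obtain By where By: "\<And>s. s \<in> {0..T} \<Longrightarrow> norm (y s) \<le> By" using bdd[OF y] by blast
  define Z where "Z = Bx + C + By"
  have Fi: "F integrable_on {0..T}" and yi: "y integrable_on {0..T}"
    by (rule bint_integrable[OF F(1)], rule integrable_continuous_real[OF y])
  have main: "(norm (x t - y t))\<^sup>2 + integral {0..t} (\<lambda>s. l (x s - y s)) \<le> exp (\<mu> * t) * ((norm (x 0 - y 0))\<^sup>2 + Kc)"
    if t: "0 \<le> t" "t < T" for t
  proof -
    have ex: "\<exists>\<delta>. 0 < \<delta> \<and> \<delta> < min (T - t) (1 / real (Suc n)) \<and> bint 0 (T - \<delta>) (\<lambda>s. steklov \<delta> F s - F s) \<and>
        integral {0..T - \<delta>} (\<lambda>s. norm (steklov \<delta> F s - F s)) < 1 / real (Suc n)" for n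
    proof -
      have "\<forall>\<^sub>F \<delta> in at_right 0. 0 < \<delta> \<and> \<delta> < min (T - t) (1 / real (Suc n))"
        using t by (intro eventually_at_rightI[of 0 "min (T - t) (1 / real (Suc n))"]) auto
      moreover have "\<forall>\<^sub>F \<delta> in at_right 0. \<delta> < T \<and> bint 0 (T - \<delta>) (\<lambda>s. steklov \<delta> F s - F s) \<and>
        integral {0..T - \<delta>} (\<lambda>s. norm (steklov \<delta> F s - F s)) < 1 / real (Suc n)"
        by (rule steklov_tendsto_L1[OF F(1) T]) simp
      ultimately have "\<forall>\<^sub>F \<delta> in at_right 0. (\<delta> < T \<and> bint 0 (T - \<delta>) (\<lambda>s. steklov \<delta> F s - F s) \<and>
        integral {0..T - \<delta>} (\<lambda>s. norm (steklov \<delta> F s - F s)) < 1 / real (Suc n)) \<and> 0 < \<delta> \<and> \<delta> < min (T - t) (1 / real (Suc n))"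
        by (rule eventually_conj[rotated])
      from eventually_happens'[OF trivial_limit_at_right_real this] show ?thesis by blast
    qed
    from choice[OF allI[OF ex]] obtain \<delta> where all: "\<forall>n. 0 < \<delta> n \<and> \<delta> n < min (T - t) (1 / real (Suc n)) \<and>
        bint 0 (T - \<delta> n) (\<lambda>s. steklov (\<delta> n) F s - F s) \<and>
        integral {0..T - \<delta> n} (\<lambda>s. norm (steklov (\<delta> n) F s - F s)) < 1 / real (Suc n)"
      by (rule exE)
    note \<delta> = all[THEN spec, THEN conjunct1] all[THEN spec, THEN conjunct2, THEN conjunct1, THEN less_le_trans, OF min.cobounded1]
      all[THEN spec, THEN conjunct2, THEN conjunct1, THEN less_le_trans, OF min.cobounded2]
    note \<delta>b = all[THEN spec, THEN conjunct2, THEN conjunct2, THEN conjunct1]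
    note \<delta>i = all[THEN spec, THEN conjunct2, THEN conjunct2, THEN conjunct2]
    have \<delta>0: "filterlim \<delta> (at_right 0) sequentially"
    proof -
      have "\<delta> \<longlonglongrightarrow> 0"
        by (rule tendsto_sandwich[OF _ _ tendsto_const inv0[of 1]])
           (use \<delta>(1,3) in \<open>auto intro!: always_eventually less_imp_le simp del: of_nat_Suc\<close>)
      then show ?thesis unfolding filterlim_at using order_less_imp_not_eq2[OF \<delta>(1)] \<delta>(1) by simp
    qed
    define \<zeta> where "\<zeta> n s = xt n s - steklov (\<delta> n) y s" for n s
    define \<rho> where "\<rho> n s = S 0 (Ft n s) - steklov (\<delta> n) F s" for n s
    have sub: "{0..t} \<subseteq> {0..T - \<delta> n}" for n using \<delta>(2)[of n] by auto
    have syc: "continuous_on {0..T - \<delta> n} (steklov (\<delta> n) y)" and sFc: "continuous_on {0..T - \<delta> n} (steklov (\<delta> n) F)" for n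
      by (intro continuous_on_steklov yi Fi less_imp_le \<delta>)+
    have \<zeta>c: "continuous_on {0..t} (\<zeta> n)" for n unfolding \<zeta>_def
      by (intro continuous_on_diff continuous_on_subset[OF xt_c] continuous_on_subset[OF syc sub]) (use t in auto)
    have \<rho>c: "continuous_on {0..t} (\<rho> n)" for n unfolding \<rho>_def
      by (intro continuous_on_diff bounded_linear.continuous_on[OF bl] continuous_on_subset[OF Ft(1)] continuous_on_subset[OF sFc sub]) auto
    have \<zeta>Z: "norm (\<zeta> n s) \<le> Z" if s: "s \<in> {0..t}" for n s
    proof -
      have "norm (steklov (\<delta> n) y s) \<le> By"
        using s \<delta>(1)[of n] \<delta>(2)[of n] by (intro norm_steklov_le integrable_on_subinterval[OF yi] By) auto
      moreover have "norm (xt n s) \<le> Bx + C"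
      proof -
        have "C * (1 / real (Suc n)) \<le> C * 1" using C(1) by (intro mult_left_mono) auto
        then have "norm (x s - xt n s) \<le> C" using xt_d[of s n] s t by simp
        moreover have "xt n s = x s - (x s - xt n s)" by simp
        ultimately show ?thesis
          using norm_triangle_ineq4[of "x s" "x s - xt n s"] Bx[of s] s t by simp
      qed
      ultimately show ?thesis
        using norm_triangle_ineq4[of "xt n s" "steklov (\<delta> n) y s"] by (simp add: \<zeta>_def Z_def)
    qed
    have lc: "continuous_on A (\<lambda>a. l (f a))" if "continuous_on A f" for A and f :: "real \<Rightarrow> 'e"
      by (rule continuous_on_compose2[OF l(1) that]) simp
    have kc: "continuous_on {0..t} (k (\<delta> n))" for n by (rule continuous_on_subset[OF k(1)[OF \<delta>(1)] sub])
    have Z0: "0 \<le> Z" using order_trans[OF norm_ge_zero \<zeta>Z[of 0 0]] t by simp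
    have gr: "(norm (\<zeta> n t))\<^sup>2 + integral {0..t} (\<lambda>s. l (\<zeta> n s))
        \<le> exp (\<mu> * t) * ((norm (\<zeta> n 0))\<^sup>2 + integral {0..t} (\<lambda>s. k (\<delta> n) s + 2 * Z * norm (\<rho> n s)))" for n
    proof (rule gronwall_dini[OF t(1) \<mu>(1)])
      show "continuous_on {0..t} (\<lambda>s. (norm (\<zeta> n s))\<^sup>2)" by (intro continuous_intros \<zeta>c)
      show "continuous_on {0..t} (\<lambda>s. k (\<delta> n) s + 2 * Z * norm (\<rho> n s))" by (intro continuous_intros \<rho>c kc)
      show "continuous_on {0..t} (\<lambda>s. l (\<zeta> n s))" by (rule lc[OF \<zeta>c])
      fix s e :: real assume s: "0 \<le> s" "s < t" and e: "e > 0"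
      let ?\<delta> = "\<delta> n" and ?w = "\<zeta> n s"
      have s': "s \<in> {0..T - ?\<delta>}" "s \<in> {0..t}" "s < T - ?\<delta>" "s < T" using s t \<delta>(1,2)[of n] by auto
      define ys where "ys = steklov ?\<delta> y s"
      define dy where "dy = (1 / ?\<delta>) *\<^sub>R (y (s + ?\<delta>) - y s)"
      note g = gen_y[OF \<delta>(1) s'(1), folded ys_def dy_def]
      have w0: "S 0 ?w = ?w"
      proof -
        have "S 0 ys = ys" using g by (simp add: gen_def)
        then show ?thesis using S_0_mild[OF FtT, of s x0 n] s' s by (simp add: \<zeta>_def xt_def S_diff ys_def)
      qed
      \<comment> \<open>the increment of \<open>\<zeta>\<close> relative to the evolution of its current value\<close>
      define v where "v h = (1 / h) *\<^sub>R (\<zeta> n (s + h) - S h ?w)" for h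
      have v1: "((\<lambda>h. (1 / h) *\<^sub>R (xt n (s + h) - S h (xt n s))) \<longlongrightarrow> S 0 (Ft n s)) (at_right 0)"
        unfolding xt_def by (rule mild_right_increment[OF FtT s(1) s'(4)])
      have v2: "((\<lambda>h. (1 / h) *\<^sub>R (steklov ?\<delta> y (s + h) - ys)) \<longlongrightarrow> dy) (at_right 0)"
      proof -
        have "((\<lambda>h. (1 / ?\<delta>) *\<^sub>R (steklov h y (s + ?\<delta>) - steklov h y s)) \<longlongrightarrow> dy) (at_right 0)"
          unfolding dy_def by (intro tendsto_intros steklov_tendsto[OF y]) (use s' s(1) \<delta>(1)[of n] in auto)
        moreover have "\<forall>\<^sub>F h in at_right 0. (1 / ?\<delta>) *\<^sub>R (steklov h y (s + ?\<delta>) - steklov h y s) = (1 / h) *\<^sub>R (steklov ?\<delta> y (s + h) - ys)"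
          unfolding ys_def
          by (rule eventually_at_rightI[of 0 "T - ?\<delta> - s"]) (use s' s(1) \<delta>(1)[of n] in \<open>auto intro!: steklov_increment[OF yi]\<close>)
        ultimately show ?thesis by (rule Lim_transform_eventually)
      qed
      have v3: "((\<lambda>h. (1 / h) *\<^sub>R (S h ys - ys)) \<longlongrightarrow> dy - steklov ?\<delta> F s - r ?\<delta> s) (at_right 0)"
        using g by (simp add: gen_def)
      have "((\<lambda>h. (1 / h) *\<^sub>R (xt n (s + h) - S h (xt n s)) - (1 / h) *\<^sub>R (steklov ?\<delta> y (s + h) - ys) + (1 / h) *\<^sub>R (S h ys - ys))
          \<longlongrightarrow> S 0 (Ft n s) - dy + (dy - steklov ?\<delta> F s - r ?\<delta> s)) (at_right 0)"
        by (intro tendsto_add tendsto_diff v1 v2 v3)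
      moreover have "\<forall>\<^sub>F h in at_right 0. (1 / h) *\<^sub>R (xt n (s + h) - S h (xt n s)) - (1 / h) *\<^sub>R (steklov ?\<delta> y (s + h) - ys) + (1 / h) *\<^sub>R (S h ys - ys) = v h"
        by (rule eventually_at_rightI[of 0 1])
           (auto simp: v_def \<zeta>_def ys_def S_diff simp flip: scaleR_diff_right scaleR_add_right)
      ultimately have "(v \<longlongrightarrow> S 0 (Ft n s) - dy + (dy - steklov ?\<delta> F s - r ?\<delta> s)) (at_right 0)"
        by (rule Lim_transform_eventually)
      also have "S 0 (Ft n s) - dy + (dy - steklov ?\<delta> F s - r ?\<delta> s) = \<rho> n s - r ?\<delta> s" by (simp add: \<rho>_def)
      finally have v: "(v \<longlongrightarrow> \<rho> n s - r ?\<delta> s) (at_right 0)" .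
      have Sw: "((\<lambda>h. S h ?w) \<longlongrightarrow> ?w) (at_right 0)" using cont0[of ?w] w0 by simp
      have 1: "((\<lambda>h. ((norm (\<zeta> n (s + h)))\<^sup>2 - (norm (S h ?w))\<^sup>2) / h) \<longlongrightarrow> 2 * (?w \<bullet> (\<rho> n s - r ?\<delta> s))) (at_right 0)"
        by (rule Lim_transform_eventually[OF square_growth[OF v Sw]], rule eventually_at_rightI[of 0 1])
           (auto simp: v_def)
      have qc: "continuous_on {0..1} (\<lambda>h. Q (S h ?w))" by (intro continuous_Q continuous_orbit)
      have 2: "((\<lambda>h. 2 * steklov h (\<lambda>h. Q (S h ?w)) 0) \<longlongrightarrow> 2 * Q (S 0 ?w)) (at_right 0)"
        by (intro tendsto_intros steklov_tendsto[OF qc]) auto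
      have lim: "((\<lambda>h. ((norm (\<zeta> n (s + h)))\<^sup>2 - (norm (S h ?w))\<^sup>2) / h + 2 * steklov h (\<lambda>h. Q (S h ?w)) 0) \<longlongrightarrow>
          2 * (?w \<bullet> (\<rho> n s - r ?\<delta> s)) + 2 * Q ?w) (at_right 0)"
        using tendsto_add[OF 1 2] w0 by simp
      have "2 * (?w \<bullet> (\<rho> n s - r ?\<delta> s)) + 2 * Q ?w \<le> \<mu> * (norm ?w)\<^sup>2 + (k ?\<delta> s + 2 * Z * norm (\<rho> n s)) - l ?w"
      proof -
        have "?w \<bullet> \<rho> n s \<le> norm ?w * norm (\<rho> n s)" by (rule norm_cauchy_schwarz)
        also have "\<dots> \<le> Z * norm (\<rho> n s)" by (intro mult_right_mono \<zeta>Z s') simp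
        finally show ?thesis using \<mu>(2)[OF \<delta>(1) s'(1), of ?w] by (simp add: inner_diff_right)
      qed
      then have "2 * (?w \<bullet> (\<rho> n s - r ?\<delta> s)) + 2 * Q ?w < \<mu> * (norm ?w)\<^sup>2 + (k ?\<delta> s + 2 * Z * norm (\<rho> n s)) - l ?w + e"
        using e by simp
      from order_tendstoD(2)[OF lim this] eventually_at_right_less[of 0]
      show "\<forall>\<^sub>F h in at_right 0. (norm (\<zeta> n (s + h)))\<^sup>2 \<le> (norm ?w)\<^sup>2 +
          h * (\<mu> * (norm ?w)\<^sup>2 + (k ?\<delta> s + 2 * Z * norm (\<rho> n s)) - l ?w + e)"
      proof eventually_elim
        case (elim h)
        define R where "R = \<mu> * (norm ?w)\<^sup>2 + (k ?\<delta> s + 2 * Z * norm (\<rho> n s)) - l ?w + e"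
        have "(norm (S h ?w))\<^sup>2 \<le> (norm ?w)\<^sup>2 + 2 * integral {0..h} (\<lambda>h. Q (S h ?w))"
          using elim(2) by (intro energy_inequality w0) simp
        moreover have "(norm (\<zeta> n (s + h)))\<^sup>2 - (norm (S h ?w))\<^sup>2 + 2 * integral {0..h} (\<lambda>h. Q (S h ?w)) \<le> h * R"
          using elim unfolding R_def[symmetric] steklov_def by (simp add: field_simps)
        ultimately show ?case unfolding R_def[symmetric] by linarith
      qed
    qed (use k(2) l(2) Z0 in \<open>auto intro!: add_nonneg_nonneg\<close>)
    have kbound: "integral {0..t} (\<lambda>s. k (\<delta> n) s + 2 * Z * norm (\<rho> n s)) \<le> Kc + 2 * Z * (C + 1) * (1 / real (Suc n))" for n
    proof -
      have ki: "k (\<delta> n) integrable_on {0..t}" and ki': "k (\<delta> n) integrable_on {0..T - \<delta> n}"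
        by (intro integrable_continuous_real kc, intro integrable_continuous_real k(1) \<delta>(1))
      have \<rho>i: "(\<lambda>s. norm (\<rho> n s)) integrable_on {0..t}" by (intro integrable_continuous_real continuous_intros \<rho>c)
      have tT: "{0..t} \<subseteq> {0..T}" using t by auto
      have b1: "(\<lambda>s. norm (F s - Ft n s)) integrable_on {0..t}" by (intro bint_norm bint_subinterval[OF Ft(2) tT])
      have b2: "(\<lambda>s. norm (steklov (\<delta> n) F s - F s)) integrable_on {0..t}" by (intro bint_norm bint_subinterval[OF \<delta>b sub])
      have "integral {0..t} (k (\<delta> n)) \<le> integral {0..T - \<delta> n} (k (\<delta> n))"
        by (intro integral_subset_le sub ki ki' ballI k(2))
      also have "\<dots> \<le> Kc" using \<delta>(1)[of n] \<delta>(2)[of n] t by (intro Kc) auto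
      finally have 1: "integral {0..t} (k (\<delta> n)) \<le> Kc" .
      have "integral {0..t} (\<lambda>s. norm (\<rho> n s)) \<le> integral {0..t} (\<lambda>s. C * norm (F s - Ft n s) + norm (steklov (\<delta> n) F s - F s))"
      proof (rule integral_le[OF \<rho>i])
        show "(\<lambda>s. C * norm (F s - Ft n s) + norm (steklov (\<delta> n) F s - F s)) integrable_on {0..t}"
          by (intro integrable_add integrable_on_mult_right b1 b2)
        fix s assume s: "s \<in> {0..t}"
        have "\<rho> n s = - (S 0 (F s - Ft n s)) - (steklov (\<delta> n) F s - F s)"
          using F(2)[of s] s t by (simp add: \<rho>_def S_diff)
        then show "norm (\<rho> n s) \<le> C * norm (F s - Ft n s) + norm (steklov (\<delta> n) F s - F s)"
          using norm_triangle_ineq4[of "- (S 0 (F s - Ft n s))" "steklov (\<delta> n) F s - F s"] C(2)[of 0 "F s - Ft n s"] T by simp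
      qed
      also have "\<dots> = C * integral {0..t} (\<lambda>s. norm (F s - Ft n s)) + integral {0..t} (\<lambda>s. norm (steklov (\<delta> n) F s - F s))"
        by (simp add: integral_add integrable_on_mult_right b1 b2)
      also have "\<dots> \<le> C * (1 / real (Suc n)) + 1 / real (Suc n)"
      proof (intro add_mono mult_left_mono)
        have "integral {0..t} (\<lambda>s. norm (F s - Ft n s)) \<le> integral {0..T} (\<lambda>s. norm (F s - Ft n s))"
          by (intro integral_subset_le tT b1 bint_norm Ft(2)) simp
        then show "integral {0..t} (\<lambda>s. norm (F s - Ft n s)) \<le> 1 / real (Suc n)" using Ft(3)[of n] by linarith
        have "integral {0..t} (\<lambda>s. norm (steklov (\<delta> n) F s - F s)) \<le> integral {0..T - \<delta> n} (\<lambda>s. norm (steklov (\<delta> n) F s - F s))"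
          by (intro integral_subset_le sub b2 bint_norm \<delta>b) simp
        then show "integral {0..t} (\<lambda>s. norm (steklov (\<delta> n) F s - F s)) \<le> 1 / real (Suc n)" using \<delta>i[of n] by linarith
      qed (use C in simp)
      also have "\<dots> = (C + 1) * (1 / real (Suc n))" by (simp only: distrib_right mult_1)
      finally have "2 * Z * integral {0..t} (\<lambda>s. norm (\<rho> n s)) \<le> 2 * Z * ((C + 1) * (1 / real (Suc n)))"
        using Z0 by (intro mult_left_mono) auto
      then show ?thesis using 1 by (simp add: integral_add ki integrable_on_mult_right \<rho>i mult.assoc)
    qed
    have \<zeta>lim: "(\<lambda>n. \<zeta> n s) \<longlonglongrightarrow> x s - y s" if "s \<in> {0..t}" for s
      unfolding \<zeta>_def using that t
      by (intro tendsto_diff xt_lim filterlim_compose[OF steklov_tendsto[OF y] \<delta>0]) auto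
    have "(\<lambda>n. integral {0..t} (\<lambda>s. l (\<zeta> n s))) \<longlonglongrightarrow> integral {0..t} (\<lambda>s. l (x s - y s))"
    proof (rule dominated_convergence(2)[where h = "\<lambda>_. \<bar>Cl\<bar> * Z\<^sup>2"])
      show "(\<lambda>s. l (\<zeta> n s)) integrable_on {0..t}" for n by (intro integrable_continuous_real lc \<zeta>c)
      show "norm (l (\<zeta> n s)) \<le> \<bar>Cl\<bar> * Z\<^sup>2" if "s \<in> {0..t}" for n s
      proof -
        have "Cl * (norm (\<zeta> n s))\<^sup>2 \<le> \<bar>Cl\<bar> * Z\<^sup>2"
          using \<zeta>Z[OF that, of n] by (intro mult_mono power_mono) auto
        then show ?thesis using l(2,3)[of "\<zeta> n s"] by simp
      qed
      show "(\<lambda>n. l (\<zeta> n s)) \<longlonglongrightarrow> l (x s - y s)" if "s \<in> {0..t}" for s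
      proof -
        have "isCont l (x s - y s)" using l(1) by (simp add: continuous_on_eq_continuous_at)
        then show ?thesis using \<zeta>lim[OF that] by (rule isCont_tendsto_compose)
      qed
    qed (rule integrable_const_ivl)
    then have L: "(\<lambda>n. (norm (\<zeta> n t))\<^sup>2 + integral {0..t} (\<lambda>s. l (\<zeta> n s))) \<longlonglongrightarrow>
        (norm (x t - y t))\<^sup>2 + integral {0..t} (\<lambda>s. l (x s - y s))"
      using t by (intro tendsto_intros \<zeta>lim) auto
    have R: "(\<lambda>n. exp (\<mu> * t) * ((norm (\<zeta> n 0))\<^sup>2 + (Kc + 2 * Z * (C + 1) * (1 / real (Suc n))))) \<longlonglongrightarrow>
        exp (\<mu> * t) * ((norm (x 0 - y 0))\<^sup>2 + (Kc + 0))"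
      using t by (intro tendsto_intros inv0 \<zeta>lim) auto
    have "(norm (\<zeta> n t))\<^sup>2 + integral {0..t} (\<lambda>s. l (\<zeta> n s))
        \<le> exp (\<mu> * t) * ((norm (\<zeta> n 0))\<^sup>2 + (Kc + 2 * Z * (C + 1) * (1 / real (Suc n))))" for n
      by (rule order_trans[OF gr]) (intro mult_left_mono add_left_mono kbound, simp)
    then have "(norm (x t - y t))\<^sup>2 + integral {0..t} (\<lambda>s. l (x s - y s)) \<le> exp (\<mu> * t) * ((norm (x 0 - y 0))\<^sup>2 + (Kc + 0))"
      using LIMSEQ_le[OF L R] by blast
    then show ?thesis by simp
  qed
  fix t assume t: "t \<in> {0..T}"
  have lc: "continuous_on {0..T} (\<lambda>s. l (x s - y s))"
    by (rule continuous_on_compose2[OF l(1)]) (auto intro: continuous_intros xc y)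
  define f where "f t = (norm (x t - y t))\<^sup>2 + integral {0..t} (\<lambda>s. l (x s - y s)) - exp (\<mu> * t) * ((norm (x 0 - y 0))\<^sup>2 + Kc)" for t
  have fc: "continuous_on {0..T} f"
    unfolding f_def by (intro continuous_intros xc y indefinite_integral_continuous_1 integrable_continuous_real lc)
  have cl: "closure {0..<T} = {0..T}" using T by simp
  have "f t \<le> 0"
  proof (rule continuous_le_on_closure[where f = f and S = "{0..<T}"])
    show "continuous_on (closure {0..<T}) f" unfolding cl by (rule fc)
    show "t \<in> closure {0..<T}" unfolding cl by (rule t)
    show "f s \<le> 0" if "s \<in> {0..<T}" for s using main[of s] that by (simp add: f_def)
  qed
  then show "(norm (x t - y t))\<^sup>2 + integral {0..t} (\<lambda>s. l (x s - y s)) \<le> exp (\<mu> * t) * ((norm (x 0 - y 0))\<^sup>2 + Kc)"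
    by (simp add: f_def)
qed

section \<open>Regularity of the limit solution\<close>

definition H1_primitive :: "real \<Rightarrow> (real \<Rightarrow> 'b::banach) \<Rightarrow> (real \<Rightarrow> 'b) \<Rightarrow> bool" where
  "H1_primitive T U w \<longleftrightarrow> bint 0 T w \<and> (\<lambda>t. (norm (w t))\<^sup>2) integrable_on {0..T} \<and>
     (\<forall>s t. 0 \<le> s \<longrightarrow> s \<le> t \<longrightarrow> t \<le> T \<longrightarrow> U t - U s = integral {s..t} w)"

lemma square_integrableI:
  assumes "bint a b u" "k integrable_on {a..b}" "\<And>t. t \<in> {a..b} \<Longrightarrow> (norm (u t))\<^sup>2 \<le> k t"
  shows "(\<lambda>t. (norm (u t))\<^sup>2) integrable_on {a..b}"
proof (rule measurable_bounded_by_integrable_imp_integrable_real[OF _ assms(2)])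
  have "(\<lambda>t. norm (u t)) \<in> borel_measurable (lebesgue_on {a..b})"
    using assms(1) unfolding bint_def by (intro measurable_on_norm_borel) auto
  then show "(\<lambda>t. (norm (u t))\<^sup>2) \<in> borel_measurable (lebesgue_on {a..b})" by simp
qed (use assms(3) in auto)

lemma prim_integrable: "H1_primitive T U w \<Longrightarrow> 0 \<le> s \<Longrightarrow> t \<le> T \<Longrightarrow> w integrable_on {s..t}"
  unfolding H1_primitive_def by (auto intro!: bint_integrable bint_subinterval[of 0 T])

lemma prim_diff_eq: "H1_primitive T U w \<Longrightarrow> 0 \<le> s \<Longrightarrow> s \<le> t \<Longrightarrow> t \<le> T \<Longrightarrow> U t - U s = integral {s..t} w"
  unfolding H1_primitive_def by blast

lemma prim_continuous: "H1_primitive T U w \<Longrightarrow> continuous_on {0..T} U"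
  unfolding H1_primitive_def by (rule primitive_continuous[of T w U]) blast+

lemma prim_integral_diff_sq_le:
  "H1_primitive T U w \<Longrightarrow> 0 \<le> \<delta> \<Longrightarrow> \<delta> \<le> T \<Longrightarrow>
    integral {0..T - \<delta>} (\<lambda>t. (norm (U (t + \<delta>) - U t))\<^sup>2) \<le> \<delta>\<^sup>2 * integral {0..T} (\<lambda>r. (norm (w r))\<^sup>2)"
  unfolding H1_primitive_def by (rule primitive_integral_diff_sq_le[of T w U]) blast+

lemma prim_diff_sq_le:
  "H1_primitive T U w \<Longrightarrow> 0 \<le> s \<Longrightarrow> s \<le> t \<Longrightarrow> t \<le> T \<Longrightarrow>
    (norm (U t - U s))\<^sup>2 \<le> (t - s) * integral {0..T} (\<lambda>r. (norm (w r))\<^sup>2)"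
  unfolding H1_primitive_def by (rule primitive_diff_sq_le'[of T w U]) blast+

lemma prim_linear:
  assumes f: "bounded_linear f" and U: "H1_primitive T U w"
  shows "H1_primitive T (\<lambda>t. f (U t)) (\<lambda>t. f (w t))"
proof -
  interpret f: bounded_linear f by (rule f)
  obtain C where C: "\<And>x. norm (f x) \<le> norm x * C" using f.bounded by blast
  have w: "bint 0 T w" "(\<lambda>t. (norm (w t))\<^sup>2) integrable_on {0..T}" using U by (auto simp: H1_primitive_def)
  have "(\<lambda>t. (norm (f (w t)))\<^sup>2) integrable_on {0..T}"
  proof (rule square_integrableI[OF bint_linear[OF f w(1)] integrable_on_mult_left[OF w(2), of "C\<^sup>2"]])
    show "(norm (f (w t)))\<^sup>2 \<le> (norm (w t))\<^sup>2 * C\<^sup>2" for t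
      using power_mono[OF C[of "w t"] norm_ge_zero, of 2] by (simp add: power_mult_distrib)
  qed
  moreover have "f (U t) - f (U s) = integral {s..t} (\<lambda>t. f (w t))" if st: "0 \<le> s" "s \<le> t" "t \<le> T" for s t
    using prim_diff_eq[OF U st] integral_linear[OF prim_integrable[OF U st(1,3)] f]
    by (simp add: o_def flip: f.diff)
  ultimately show ?thesis using bint_linear[OF f w(1)] unfolding H1_primitive_def by blast
qed

lemma prim_add:
  assumes U: "H1_primitive T U w" and V: "H1_primitive T V z"
  shows "H1_primitive T (\<lambda>t. U t + V t) (\<lambda>t. w t + z t)"
proof -
  have w: "bint 0 T w" "(\<lambda>t. (norm (w t))\<^sup>2) integrable_on {0..T}" using U by (auto simp: H1_primitive_def)
  have z: "bint 0 T z" "(\<lambda>t. (norm (z t))\<^sup>2) integrable_on {0..T}" using V by (auto simp: H1_primitive_def)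
  have "(\<lambda>t. (norm (w t + z t))\<^sup>2) integrable_on {0..T}"
  proof (rule square_integrableI[OF bint_add[OF w(1) z(1)]])
    show "(\<lambda>t. 2 * (norm (w t))\<^sup>2 + 2 * (norm (z t))\<^sup>2) integrable_on {0..T}"
      by (intro integrable_add integrable_on_mult_right w z)
    show "(norm (w t + z t))\<^sup>2 \<le> 2 * (norm (w t))\<^sup>2 + 2 * (norm (z t))\<^sup>2" for t
    proof -
      have "(norm (w t + z t))\<^sup>2 \<le> (norm (w t) + norm (z t))\<^sup>2" by (intro power_mono norm_triangle_ineq) simp
      also have "\<dots> \<le> 2 * (norm (w t))\<^sup>2 + 2 * (norm (z t))\<^sup>2"
        using zero_le_power2[of "norm (w t) - norm (z t)"] by (simp add: power2_eq_square algebra_simps)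
      finally show ?thesis .
    qed
  qed
  moreover have "(U t + V t) - (U s + V s) = integral {s..t} (\<lambda>t. w t + z t)" if st: "0 \<le> s" "s \<le> t" "t \<le> T" for s t
  proof -
    have "integral {s..t} (\<lambda>t. w t + z t) = (U t - U s) + (V t - V s)"
      using prim_diff_eq[OF U st] prim_diff_eq[OF V st]
      by (simp add: integral_add[OF prim_integrable[OF U st(1,3)] prim_integrable[OF V st(1,3)]])
    then show ?thesis by simp
  qed
  ultimately show ?thesis using bint_add[OF w(1) z(1)] unfolding H1_primitive_def by blast
qed

lemma prim_diff:
  assumes U: "H1_primitive T U w" and V: "H1_primitive T V z"
  shows "H1_primitive T (\<lambda>t. U t - V t) (\<lambda>t. w t - z t)"
  using prim_add[OF U prim_linear[OF bounded_linear_minus[OF bounded_linear_ident] V]] by simp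

lemma H1_prim:
  fixes u :: "real \<Rightarrow> 'b::banach"
  assumes u: "H1 T u" and T: "0 < T"
  shows "H1_primitive T (crep T u) (wderiv T u)"
  using H1_crep_diff[OF u T] L2_bint[OF H1_wderiv_L2[OF u T]] L2_integrable[OF H1_wderiv_L2[OF u T]]
  unfolding H1_primitive_def by blast

lemma prim_cong_AE:
  assumes U: "H1_primitive T U w" and v: "continuous_on {0..T} v" "AE t in lebesgue_on {0..T}. v t = w t"
  shows "\<And>s t. 0 \<le> s \<Longrightarrow> s \<le> t \<Longrightarrow> t \<le> T \<Longrightarrow> U t - U s = integral {s..t} v"
proof -
  fix s t :: real assume st: "0 \<le> s" "s \<le> t" "t \<le> T"
  obtain N where N: "negligible N" "\<And>t. t \<in> {0..T} - N \<Longrightarrow> v t = w t"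
    using v(2) unfolding AE_lebesgue_on_iff_negligible by blast
  have "integral {s..t} v = integral {s..t} w" by (rule integral_spike[OF N(1)]) (use N(2) st in auto)
  then show "U t - U s = integral {s..t} v" using prim_diff_eq[OF U st] by simp
qed

lemma bint_LINT:
  fixes u :: "real \<Rightarrow> real"
  assumes "bint a b u"
  shows "(LINT t|lebesgue_on {a..b}. u t) = integral {a..b} u"
proof -
  have "u absolutely_integrable_on {a..b}"
    using assms bint_integrable[OF assms] unfolding absolutely_integrable_on_def bint_def by simp
  then show ?thesis by (intro lebesgue_integral_eq_integral absolutely_integrable_imp_integrable) auto
qed

lemma weak_pair_continuous:
  fixes u v :: "real \<Rightarrow> 'b::banach"
  assumes w: "weak_pair T u v" and u: "continuous_on {0..T} u" and v: "bint 0 T v" and T: "T > 0"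
    and st: "0 \<le> s" "s \<le> t" "t \<le> T"
  shows "u t - u s = integral {s..t} v"
proof -
  obtain c where c: "AE t in lebesgue_on {0..T}. u t = c + integral {0..t} v"
    using weak_pair_primitive[OF w bint_continuous[OF u] v T] by blast
  have vi: "v integrable_on {0..T}" by (rule bint_integrable[OF v])
  have "continuous_on {0..T} (\<lambda>t. c + integral {0..t} v)"
    by (intro continuous_intros indefinite_integral_continuous_1 vi)
  from continuous_AE_eq[OF u this c T] have eq: "u t = c + integral {0..t} v" if "t \<in> {0..T}" for t using that by blast
  have "integral {0..s} v + integral {s..t} v = integral {0..t} v"
    using st by (intro Henstock_Kurzweil_Integration.integral_combine integrable_on_subinterval[OF vi]) auto
  then show ?thesis using eq[of s] eq[of t] st by (simp add: algebra_simps)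
qed

lemma test_function_continuous:
  assumes "test_function T \<phi>"
  shows "continuous_on A \<phi>" "continuous_on A (deriv \<phi>)"
proof -
  have d: "(deriv ^^ k) \<phi> differentiable (at x)" for k x using assms unfolding test_function_def by blast
  show "continuous_on A \<phi>" "continuous_on A (deriv \<phi>)"
    using d[of 0] d[of 1] by (auto intro!: continuous_at_imp_continuous_on differentiable_imp_continuous_within)
qed

lemma sum_power2_4: "(a + b + c + d)\<^sup>2 \<le> 4 * (a\<^sup>2 + b\<^sup>2 + c\<^sup>2 + (d::real)\<^sup>2)"
proof -
  have "0 \<le> (a - b)\<^sup>2 + (a - c)\<^sup>2 + (a - d)\<^sup>2 + (b - c)\<^sup>2 + (b - d)\<^sup>2 + (c - d)\<^sup>2" by simp
  then show ?thesis by (simp add: power2_eq_square algebra_simps)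
qed

lemma bounded_linear_le:
  assumes "bounded_linear f"
  shows "\<exists>C\<ge>0. \<forall>x. norm (f x) \<le> C * norm x"
  using bounded_linear.nonneg_bounded[OF assms] by (metis mult.commute)

lemma bounded_linear_blinfun_compose_right:
  "bounded_linear (\<lambda>x. x o\<^sub>L g)"
  by (rule bounded_bilinear.bounded_linear_left[OF bounded_bilinear_blinfun_compose])

text \<open>Tested with a fixed element, the equation says that a continuous scalar function has a weak derivative, so
  it can be integrated between any two times.\<close>

lemma limit_solution_weak_eq:
  fixes \<iota> :: "'p::{real_inner,banach} \<Rightarrow>\<^sub>L 'h::{real_inner,banach}"
    and B :: "'p \<Rightarrow>\<^sub>L ('q::{real_inner,banach} \<Rightarrow>\<^sub>L real)" and K :: "'p \<Rightarrow>\<^sub>L ('m::{real_inner,banach} \<Rightarrow>\<^sub>L real)"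
  assumes T: "0 < T" and g: "W T B g"
    and sol: "limit_solution \<iota> A K D B T f g h p_in p0 m0" and q: "q \<in> Pker B"
    and st: "0 \<le> s" "s \<le> t" "t \<le> T"
  shows "(p0 t - p0 s) \<bullet> \<iota> q =
      integral {s..t} (\<lambda>r. crep T (\<lambda>t. ker_restrict B (g t)) r q - A (p0 r) (\<iota> q) + K q (m0 r))"
    and "bint 0 T (\<lambda>r. crep T (\<lambda>t. ker_restrict B (g t)) r q - A (p0 r) (\<iota> q) + K q (m0 r))"
proof -
  let ?gr = "crep T (\<lambda>t. ker_restrict B (g t))"
  let ?v = "\<lambda>r. ?gr r q - A (p0 r) (\<iota> q) + K q (m0 r)"
  have g1: "H1 T (\<lambda>t. ker_restrict B (g t))" using g by (simp add: W_def)
  have p0: "continuous_on {0..T} p0" and m0: "bint 0 T m0"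
    using sol L2_bint unfolding limit_solution_def by auto
  have blA: "bounded_linear (\<lambda>x. A x (\<iota> q))"
    by (rule bounded_linear_compose[OF blinfun.bounded_linear_left blinfun.bounded_linear_right])
  have b1: "bint 0 T (\<lambda>r. ?gr r q)"
    by (rule bint_linear[OF blinfun.bounded_linear_left bint_continuous[OF H1_continuous_crep[OF g1 T]]])
  have b2: "bint 0 T (\<lambda>r. A (p0 r) (\<iota> q))" by (rule bint_linear[OF blA bint_continuous[OF p0]])
  have b3: "bint 0 T (\<lambda>r. K q (m0 r))" by (rule bint_linear[OF blinfun.bounded_linear_right m0])
  show v: "bint 0 T ?v" by (intro bint_add bint_diff b1 b2 b3)
  obtain N where N: "negligible N" "\<And>t. t \<in> {0..T} - N \<Longrightarrow> ?gr t = ker_restrict B (g t)"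
    using H1_crep_AE[OF g1 T] unfolding AE_lebesgue_on_iff_negligible by blast
  have weak: "weak_pair T (\<lambda>t. p0 t \<bullet> \<iota> q) ?v"
    unfolding weak_pair_def
  proof (intro allI impI)
    fix \<phi> assume \<phi>: "test_function T \<phi>"
    note c = test_function_continuous[OF \<phi>]
    have i1: "bint 0 T (\<lambda>t. (p0 t \<bullet> \<iota> q) * deriv \<phi> t)"
      by (intro bint_continuous continuous_intros p0 c)
    have i2: "bint 0 T (\<lambda>t. (A (p0 t) (\<iota> q) - dual_op K (m0 t) q) * \<phi> t)"
      using bint_scaleR[OF c(1) bint_diff[OF b2 b3]] by (simp add: mult.commute)
    have i3': "bint 0 T (\<lambda>t. ?gr t q * \<phi> t)" using bint_scaleR[OF c(1) b1] by (simp add: mult.commute)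
    have gq: "g t q * \<phi> t = ?gr t q * \<phi> t" if "t \<in> {0..T} - N" for t
      using N(2)[OF that] ker_restrict_Pker[OF q, of "g t"] by simp
    have i3: "bint 0 T (\<lambda>t. g t q * \<phi> t)" by (rule bint_spike[OF i3' N(1) gq])
    have g_eq: "integral {0..T} (\<lambda>t. g t q * \<phi> t) = integral {0..T} (\<lambda>t. ?gr t q * \<phi> t)"
      by (rule integral_spike[OF N(1)]) (rule gq[symmetric])
    have "- (LINT t|lebesgue_on {0..T}. (p0 t \<bullet> \<iota> q) * deriv \<phi> t)
        + (LINT t|lebesgue_on {0..T}. (A (p0 t) (\<iota> q) - dual_op K (m0 t) q) * \<phi> t)
        = (LINT t|lebesgue_on {0..T}. g t q * \<phi> t)"
      using sol q \<phi> unfolding limit_solution_def by blast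
    then have e: "- integral {0..T} (\<lambda>t. (p0 t \<bullet> \<iota> q) * deriv \<phi> t)
        + integral {0..T} (\<lambda>t. (A (p0 t) (\<iota> q) - dual_op K (m0 t) q) * \<phi> t) = integral {0..T} (\<lambda>t. ?gr t q * \<phi> t)"
      unfolding bint_LINT[OF i1] bint_LINT[OF i2] bint_LINT[OF i3] g_eq .
    define I where "I = integral {0..T} (\<lambda>t. (p0 t \<bullet> \<iota> q) * deriv \<phi> t)"
    have "((\<lambda>t. deriv \<phi> t *\<^sub>R (p0 t \<bullet> \<iota> q)) has_integral I) {0..T}"
      using integrable_integral[OF bint_integrable[OF i1]] by (simp add: I_def mult.commute)
    moreover have "((\<lambda>t. ?gr t q * \<phi> t - (A (p0 t) (\<iota> q) - dual_op K (m0 t) q) * \<phi> t) has_integral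
        integral {0..T} (\<lambda>t. ?gr t q * \<phi> t) - integral {0..T} (\<lambda>t. (A (p0 t) (\<iota> q) - dual_op K (m0 t) q) * \<phi> t)) {0..T}"
      by (intro has_integral_diff integrable_integral bint_integrable i2 i3')
    then have "((\<lambda>t. \<phi> t *\<^sub>R ?v t) has_integral - I) {0..T}"
      using e by (simp add: I_def algebra_simps)
    ultimately show "\<exists>I. ((\<lambda>t. deriv \<phi> t *\<^sub>R (p0 t \<bullet> \<iota> q)) has_integral I) {0..T} \<and> ((\<lambda>t. \<phi> t *\<^sub>R ?v t) has_integral - I) {0..T}"
      by blast
  qed
  have "continuous_on {0..T} (\<lambda>t. p0 t \<bullet> \<iota> q)" by (intro continuous_intros p0)
  from weak_pair_continuous[OF weak this v T st]
  show "(p0 t - p0 s) \<bullet> \<iota> q = integral {s..t} ?v" by (simp add: inner_diff_left)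
qed


text \<open>After subtraction of the lifted constraint and elimination of \<open>m\<^sub>0\<close> the limit system is a parabolic problem on
  the kernel of \<open>B\<close>, and the assumption on \<open>p\<^sup>*\<close> is the compatibility of its initial value. The bound for \<open>m\<^sub>0\<close>
  follows from the one for \<open>p\<^sub>0\<close> because \<open>m\<^sub>0 = D\<^sup>-\<^sup>1 (f - K p\<^sub>0)\<close>.\<close>

lemma limit_regularity:
  fixes \<iota> :: "'p::{real_inner,banach} \<Rightarrow>\<^sub>L 'h::{real_inner,banach}" and A :: "'h \<Rightarrow>\<^sub>L ('h \<Rightarrow>\<^sub>L real)"
    and K :: "'p \<Rightarrow>\<^sub>L ('m::{real_inner,banach} \<Rightarrow>\<^sub>L real)" and D :: "'m \<Rightarrow>\<^sub>L ('m \<Rightarrow>\<^sub>L real)"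
    and B :: "'p \<Rightarrow>\<^sub>L ('q::{real_inner,banach} \<Rightarrow>\<^sub>L real)" and c\<^sub>D T :: real
  assumes adm: "admissible \<iota> A K D B c\<^sub>D" and T: "0 < T"
  shows "\<exists>C\<ge>0. \<forall>f g h p_in pstar p0 m0.
    H1 T f \<and> W T B g \<and> H2 T h \<and> B p_in = crep T h 0 \<and> limit_solution \<iota> A K D B T f g h p_in p0 m0 \<and>
    (\<forall>q\<in>Pker B. pstar \<bullet> \<iota> q =
           crep T (\<lambda>t. ker_restrict B (g t)) 0 q
           - (Lop K D p_in q + A (\<iota> p_in) (\<iota> q))
           - \<iota> (right_inv B (crep T (wderiv T h) 0)) \<bullet> \<iota> q
           + dual_op K (inv (blinfun_apply D) (blinfun_inner_right (crep T f 0))) q) \<longrightarrow>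
    (\<exists>V M. continuous_on {0..T} V \<and> continuous_on {0..T} M \<and> (AE t in lebesgue_on {0..T}. M t = m0 t) \<and>
      (\<forall>t\<in>{0..T}. p0 t = \<iota> (V t) \<and> B (V t) = crep T h t \<and> K (V t) + D (M t) = blinfun_inner_right (crep T f t)) \<and>
      (\<forall>\<delta>. 0 < \<delta> \<longrightarrow> \<delta> < T \<longrightarrow> integral {0..T - \<delta>} (\<lambda>t. (norm (M (t + \<delta>) - M t))\<^sup>2)
          \<le> \<delta>\<^sup>2 * (C * ((norm pstar)\<^sup>2 + H1_sqnorm T f + W_sqnorm T B g + H2_sqnorm T h))))"
proof -
  define Y where "Y = Pker B"
  define L where "L = Lop K D"
  define Di where "Di = inv (blinfun_apply D)"
  define R where "R = right_inv B"
  have D: "0 < c\<^sub>D" "\<And>m. c\<^sub>D * (norm m)\<^sup>2 \<le> D m m" using adm by (auto simp: admissible_def)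
  obtain cK where cK: "cK > 0" "\<And>q. q \<in> Y \<Longrightarrow> cK * norm q \<le> norm (K q)" using adm by (auto simp: admissible_def Y_def)
  obtain \<alpha> where \<alpha>: "\<alpha> > 0" "\<And>q. q \<in> Y \<Longrightarrow> \<alpha> * (norm q)\<^sup>2 \<le> L q q"
    using Lop_coercive[OF D cK] unfolding L_def by blast
  have BR: "\<And>\<mu>. B (R \<mu>) = \<mu>" and blR: "bounded_linear R"
    using right_inv adm unfolding R_def admissible_def by blast+
  have blL: "bounded_linear L" unfolding L_def by (rule bounded_linear_Lop[OF D])
  have blDi: "bounded_linear Di" and DDi: "\<And>\<xi>. D (Di \<xi>) = \<xi>" and DiD: "\<And>x. Di (D x) = x"
    unfolding Di_def by (rule lax_milgram_bounded[OF D], rule lax_milgram_inv[OF D], rule lax_milgram_inv_eq[OF D])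
  interpret Rl: bounded_linear R by (rule blR)
  interpret Ll: bounded_linear L by (rule blL)
  interpret Dil: bounded_linear Di by (rule blDi)
  interpret par: parabolic \<iota> A L Y \<alpha> T
    by unfold_locales (use blL \<alpha> T in \<open>auto simp: Y_def subspace_Pker closed_Pker\<close>)
  define \<Lambda>A where "\<Lambda>A x = A (\<iota> x) o\<^sub>L \<iota>" for x
  define \<Lambda>I where "\<Lambda>I x = blinfun_inner_right (\<iota> x) o\<^sub>L \<iota>" for x
  define \<Lambda>F where "\<Lambda>F x = dual_op K (Di (blinfun_inner_right x))" for x
  have blA: "bounded_linear \<Lambda>A" unfolding \<Lambda>A_def[abs_def]
    by (intro bounded_linear_compose[OF bounded_linear_blinfun_compose_right]
        bounded_linear_compose[OF blinfun.bounded_linear_right] blinfun.bounded_linear_right)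
  have blI: "bounded_linear \<Lambda>I" unfolding \<Lambda>I_def[abs_def]
    by (intro bounded_linear_compose[OF bounded_linear_blinfun_compose_right]
        bounded_linear_compose[OF bounded_linear_blinfun_inner_right] blinfun.bounded_linear_right)
  have blF: "bounded_linear \<Lambda>F" unfolding \<Lambda>F_def[abs_def]
    by (intro bounded_linear_compose[OF bounded_linear_dual_op] bounded_linear_compose[OF blDi] bounded_linear_blinfun_inner_right)
  have bl1: "bounded_linear (\<lambda>x. \<Lambda>A (R x) + L (R x))" and bl2: "bounded_linear (\<lambda>x. \<Lambda>I (R x))"
    by (intro bounded_linear_add bounded_linear_compose[OF blA blR] bounded_linear_compose[OF blL blR] bounded_linear_compose[OF blI blR])+
  obtain C1 where C1: "C1 \<ge> 0" "\<And>x. norm (\<Lambda>A (R x) + L (R x)) \<le> C1 * norm x" using bounded_linear_le[OF bl1] by blast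
  obtain C2 where C2: "C2 \<ge> 0" "\<And>x. norm (\<Lambda>I (R x)) \<le> C2 * norm x" using bounded_linear_le[OF bl2] by blast
  obtain C3 where C3: "C3 \<ge> 0" "\<And>x. norm (\<Lambda>F x) \<le> C3 * norm x" using bounded_linear_le[OF blF] by blast
  define \<kappa> where "\<kappa> = 1 + C1 + C2 + C3"
  have bl5: "bounded_linear (\<lambda>x. Di (blinfun_inner_right x))" and bl6: "bounded_linear (\<lambda>x. Di (K x))" and bl7: "bounded_linear (\<lambda>x. Di (K (R x)))"
    by (intro bounded_linear_compose[OF blDi] bounded_linear_blinfun_inner_right blinfun.bounded_linear_right
       bounded_linear_compose[OF blinfun.bounded_linear_right] blR)+
  obtain C5 where C5: "C5 \<ge> 0" "\<And>x. norm (Di (blinfun_inner_right x)) \<le> C5 * norm x" using bounded_linear_le[OF bl5] by blast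
  obtain C6 where C6: "C6 \<ge> 0" "\<And>x. norm (Di (K x)) \<le> C6 * norm x" using bounded_linear_le[OF bl6] by blast
  obtain C7 where C7: "C7 \<ge> 0" "\<And>x. norm (Di (K (R x))) \<le> C7 * norm x" using bounded_linear_le[OF bl7] by blast
  define \<kappa>2 where "\<kappa>2 = C5 + C6 + C7"
  define ca where "ca = exp (2 * norm A * T + 1)"
  define cb where "cb = exp ((2 * norm A + 1) * T)"
  define cM where "cM = cb / \<alpha> * (ca * (4 * \<kappa>\<^sup>2 / \<alpha> + 1) + 2 * (4 * \<kappa>\<^sup>2) / \<alpha>)"
  define C where "C = 4 * \<kappa>2\<^sup>2 * (2 + cM)"
  have cM: "0 \<le> cM" unfolding cM_def ca_def cb_def using \<alpha>(1) by (intro mult_nonneg_nonneg add_nonneg_nonneg) auto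
  show ?thesis
  proof (intro exI[of _ C] conjI allI impI)
    show "0 \<le> C" unfolding C_def using cM by simp
    fix f :: "real \<Rightarrow> 'm" and g :: "real \<Rightarrow> ('p \<Rightarrow>\<^sub>L real)" and h :: "real \<Rightarrow> ('q \<Rightarrow>\<^sub>L real)"
      and p_in pstar p0 m0
    assume "H1 T f \<and> W T B g \<and> H2 T h \<and> B p_in = crep T h 0 \<and> limit_solution \<iota> A K D B T f g h p_in p0 m0 \<and>
      (\<forall>q\<in>Pker B. pstar \<bullet> \<iota> q = crep T (\<lambda>t. ker_restrict B (g t)) 0 q
           - (Lop K D p_in q + A (\<iota> p_in) (\<iota> q)) - \<iota> (right_inv B (crep T (wderiv T h) 0)) \<bullet> \<iota> q
           + dual_op K (inv (blinfun_apply D) (blinfun_inner_right (crep T f 0))) q)"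
    then have f: "H1 T f" and g: "W T B g" and h: "H2 T h" and p_in: "B p_in = crep T h 0"
      and sol: "limit_solution \<iota> A K D B T f g h p_in p0 m0"
      and pstar: "\<And>q. q \<in> Y \<Longrightarrow> pstar \<bullet> \<iota> q = crep T (\<lambda>t. ker_restrict B (g t)) 0 q
           - (L p_in q + A (\<iota> p_in) (\<iota> q)) - \<iota> (R (crep T (wderiv T h) 0)) \<bullet> \<iota> q + \<Lambda>F (crep T f 0) q"
      unfolding Y_def L_def R_def Di_def \<Lambda>F_def by auto
    define X where "X = (norm pstar)\<^sup>2 + H1_sqnorm T f + W_sqnorm T B g + H2_sqnorm T h"
    have g1: "H1 T (\<lambda>t. ker_restrict B (g t))" using g by (simp add: W_def)
    have h1: "H1 T h" and h2: "H1 T (wderiv T h)" using h by (auto simp: H2_def)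
    define fr where "fr = crep T f"
    define gr where "gr = crep T (\<lambda>t. ker_restrict B (g t))"
    define hr where "hr = crep T h"
    define h1r where "h1r = crep T (wderiv T h)"
    define wf where "wf = wderiv T f"
    define wg where "wg = wderiv T (\<lambda>t. ker_restrict B (g t))"
    define wh1 where "wh1 = wderiv T h"
    define wh2 where "wh2 = wderiv T (wderiv T h)"
    have pf: "H1_primitive T fr wf" and pg: "H1_primitive T gr wg" and ph1: "H1_primitive T hr wh1" and ph2: "H1_primitive T h1r wh2"
      unfolding fr_def gr_def hr_def h1r_def wf_def wg_def wh1_def wh2_def by (rule H1_prim[OF _ T], fact)+
    have iwf: "integral {0..T} (\<lambda>t. (norm (wf t))\<^sup>2) = L2_sqnorm T wf"
      and iwg: "integral {0..T} (\<lambda>t. (norm (wg t))\<^sup>2) = L2_sqnorm T wg"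
      and iwh1: "integral {0..T} (\<lambda>t. (norm (wh1 t))\<^sup>2) = L2_sqnorm T wh1"
      and iwh2: "integral {0..T} (\<lambda>t. (norm (wh2 t))\<^sup>2) = L2_sqnorm T wh2"
      unfolding wf_def wg_def wh1_def wh2_def
      using L2_sqnorm_eq[OF H1_wderiv_L2[OF f T]] L2_sqnorm_eq[OF H1_wderiv_L2[OF g1 T]]
        L2_sqnorm_eq[OF H1_wderiv_L2[OF h1 T]] L2_sqnorm_eq[OF H1_wderiv_L2[OF h2 T]] by simp_all
    have X_sum: "(norm pstar)\<^sup>2 + L2_sqnorm T wf + L2_sqnorm T wg + L2_sqnorm T wh1 + L2_sqnorm T wh2 \<le> X"
      using L2_sqnorm_nonneg[of T f] L2_sqnorm_nonneg[of T g] L2_sqnorm_nonneg[of T h]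
      unfolding X_def H1_sqnorm_def W_sqnorm_def H2_sqnorm_def wf_def wg_def wh1_def wh2_def by linarith
    have X_ge: "L2_sqnorm T wf \<le> X" "L2_sqnorm T wh1 \<le> X" "(norm pstar)\<^sup>2 \<le> X" "0 \<le> X"
      "L2_sqnorm T wf + L2_sqnorm T wg + L2_sqnorm T wh1 + L2_sqnorm T wh2 \<le> X"
      using X_sum L2_sqnorm_nonneg[of T wf] L2_sqnorm_nonneg[of T wg] L2_sqnorm_nonneg[of T wh1] L2_sqnorm_nonneg[of T wh2]
        zero_le_power2[of "norm pstar"] by linarith+
    define b where "b t = R (hr t)" for t
    define b1 where "b1 t = R (h1r t)" for t
    have pb: "H1_primitive T b (\<lambda>t. R (wh1 t))" unfolding b_def by (rule prim_linear[OF blR ph1])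
    have bc: "continuous_on {0..T} b" by (rule prim_continuous[OF pb])
    have b1c: "continuous_on {0..T} b1"
      unfolding b1_def by (intro Rl.continuous_on prim_continuous[OF ph2])
    have b_diff: "b t - b s = integral {s..t} b1" if "0 \<le> s" "s \<le> t" "t \<le> T" for s t
    proof (rule prim_cong_AE[OF pb b1c _ that])
      show "AE t in lebesgue_on {0..T}. b1 t = R (wh1 t)"
        using H1_crep_AE[OF h2 T] unfolding b1_def h1r_def wh1_def by eventually_elim simp
    qed
    \<comment> \<open>the right-hand side of the parabolic problem for \<open>p\<^sub>0 - b\<close> and its derivative\<close>
    define G where "G t = gr t - (\<Lambda>A (R (hr t)) + L (R (hr t))) - \<Lambda>I (R (h1r t)) + \<Lambda>F (fr t)" for t
    define G' where "G' t = wg t - (\<Lambda>A (R (wh1 t)) + L (R (wh1 t))) - \<Lambda>I (R (wh2 t)) + \<Lambda>F (wf t)" for t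
    have pG: "H1_primitive T G G'" unfolding G_def G'_def
      by (intro prim_add prim_diff pg prim_linear[OF bl1 ph1] prim_linear[OF bl2 ph2] prim_linear[OF blF pf])
    define N where "N = 4 * \<kappa>\<^sup>2 * X"
    have G'N: "integral {0..T} (\<lambda>t. (norm (G' t))\<^sup>2) \<le> N"
    proof -
      have "integral {0..T} (\<lambda>t. (norm (G' t))\<^sup>2) \<le> integral {0..T} (\<lambda>t. 4 * \<kappa>\<^sup>2 * ((norm (wg t))\<^sup>2 + (norm (wh1 t))\<^sup>2 + (norm (wh2 t))\<^sup>2 + (norm (wf t))\<^sup>2))"
      proof (rule integral_le)
        show "(\<lambda>t. (norm (G' t))\<^sup>2) integrable_on {0..T}" using pG by (simp add: H1_primitive_def)
        show "(\<lambda>t. 4 * \<kappa>\<^sup>2 * ((norm (wg t))\<^sup>2 + (norm (wh1 t))\<^sup>2 + (norm (wh2 t))\<^sup>2 + (norm (wf t))\<^sup>2)) integrable_on {0..T}"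
          using pg ph1 ph2 pf unfolding H1_primitive_def by (intro integrable_on_mult_right integrable_add) auto
        fix t
        have "norm (G' t) \<le> 1 * norm (wg t) + C1 * norm (wh1 t) + C2 * norm (wh2 t) + C3 * norm (wf t)"
          unfolding G'_def
          using norm_triangle_ineq[of "wg t - (\<Lambda>A (R (wh1 t)) + L (R (wh1 t))) - \<Lambda>I (R (wh2 t))" "\<Lambda>F (wf t)"]
            norm_triangle_ineq4[of "wg t - (\<Lambda>A (R (wh1 t)) + L (R (wh1 t)))" "\<Lambda>I (R (wh2 t))"]
            norm_triangle_ineq4[of "wg t" "\<Lambda>A (R (wh1 t)) + L (R (wh1 t))"] C1(2)[of "wh1 t"] C2(2)[of "wh2 t"] C3(2)[of "wf t"]
          by linarith
        also have "\<dots> \<le> \<kappa> * norm (wg t) + \<kappa> * norm (wh1 t) + \<kappa> * norm (wh2 t) + \<kappa> * norm (wf t)"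
          using C1(1) C2(1) C3(1) unfolding \<kappa>_def by (intro add_mono mult_right_mono) auto
        also have "\<dots> = \<kappa> * (norm (wg t) + norm (wh1 t) + norm (wh2 t) + norm (wf t))" by (simp add: algebra_simps)
        finally have "(norm (G' t))\<^sup>2 \<le> (\<kappa> * (norm (wg t) + norm (wh1 t) + norm (wh2 t) + norm (wf t)))\<^sup>2"
          by (intro power_mono) auto
        also have "\<dots> \<le> \<kappa>\<^sup>2 * (4 * ((norm (wg t))\<^sup>2 + (norm (wh1 t))\<^sup>2 + (norm (wh2 t))\<^sup>2 + (norm (wf t))\<^sup>2))"
          unfolding power_mult_distrib by (intro mult_left_mono sum_power2_4) simp
        finally show "(norm (G' t))\<^sup>2 \<le> 4 * \<kappa>\<^sup>2 * ((norm (wg t))\<^sup>2 + (norm (wh1 t))\<^sup>2 + (norm (wh2 t))\<^sup>2 + (norm (wf t))\<^sup>2)"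
          by (simp only: mult.left_commute mult.assoc)
      qed
      also have "\<dots> = 4 * \<kappa>\<^sup>2 * (L2_sqnorm T wg + L2_sqnorm T wh1 + L2_sqnorm T wh2 + L2_sqnorm T wf)"
      proof -
        have "((\<lambda>t. 4 * \<kappa>\<^sup>2 * ((norm (wg t))\<^sup>2 + (norm (wh1 t))\<^sup>2 + (norm (wh2 t))\<^sup>2 + (norm (wf t))\<^sup>2)) has_integral
            4 * \<kappa>\<^sup>2 * (L2_sqnorm T wg + L2_sqnorm T wh1 + L2_sqnorm T wh2 + L2_sqnorm T wf)) {0..T}"
          unfolding iwf[symmetric] iwg[symmetric] iwh1[symmetric] iwh2[symmetric]
          using pg ph1 ph2 pf unfolding H1_primitive_def by (intro has_integral_mult_right has_integral_add integrable_integral) auto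
        then show ?thesis by (rule integral_unique)
      qed
      also have "\<dots> \<le> N" unfolding N_def using X_ge(5) by (intro mult_left_mono) auto
      finally show ?thesis .
    qed
    have N0: "0 \<le> N" unfolding N_def using X_ge(4) by simp
    obtain v where v: "L2 T v" "AE t in lebesgue_on {0..T}. p0 t = \<iota> (v t)"
        "AE t in lebesgue_on {0..T}. K (v t) + D (m0 t) = blinfun_inner_right (f t)"
        "AE t in lebesgue_on {0..T}. B (v t) = h t"
      and p0: "continuous_on {0..T} p0" "p0 0 = \<iota> p_in" and m0: "L2 T m0"
      using sol unfolding limit_solution_def by blast
    define u where "u t = orth_proj Y (v t - b t)" for t
    define U where "U t = p0 t - \<iota> (b t)" for t
    have hrh: "AE t in lebesgue_on {0..T}. hr t = h t" unfolding hr_def by (rule H1_crep_AE[OF h1 T])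
    have frf: "AE t in lebesgue_on {0..T}. fr t = f t" unfolding fr_def by (rule H1_crep_AE[OF f T])
    have uvb: "AE t in lebesgue_on {0..T}. u t = v t - b t"
      using v(4) hrh
    proof eventually_elim
      case (elim t)
      then have "v t - b t \<in> Y" by (simp add: Y_def Pker_def b_def BR blinfun.diff_right)
      then show ?case unfolding u_def by (intro orth_proj_id par.Y)
    qed
    have u: "bint 0 T u" unfolding u_def
      by (intro bint_linear[OF bounded_linear_orth_proj[OF par.Y]] bint_diff L2_bint v(1) bint_continuous bc)
    have uY: "u t \<in> Y" for t unfolding u_def by (intro orth_proj_in par.Y)
    have Uc: "continuous_on {0..T} U" unfolding U_def by (intro continuous_intros p0 bc)
    have Uu: "AE t in lebesgue_on {0..T}. U t = \<iota> (u t)"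
      using uvb v(2) by eventually_elim (simp add: U_def blinfun.diff_right)
    have m0_eq: "AE t in lebesgue_on {0..T}. m0 t = Di (blinfun_inner_right (fr t)) - Di (K (u t + b t))"
      using v(3) uvb frf
    proof eventually_elim
      case (elim t)
      then have "D (m0 t) = blinfun_inner_right (fr t) - K (u t + b t)" by (simp add: algebra_simps)
      then have "Di (D (m0 t)) = Di (blinfun_inner_right (fr t) - K (u t + b t))" by simp
      then show ?case by (simp add: DiD Dil.diff)
    qed
    have eq: "(U t - U s) \<bullet> \<iota> q = integral {s..t} (\<lambda>r. G r q - A (U r) (\<iota> q) - L (u r) q)"
      if st: "0 \<le> s" "s \<le> t" "t \<le> T" and q: "q \<in> Y" for s t q
    proof -
      have q': "q \<in> Pker B" using q by (simp add: Y_def)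
      let ?v = "\<lambda>r. gr r q - A (p0 r) (\<iota> q) + K q (m0 r)"
      note w = limit_solution_weak_eq[OF T g sol q', folded gr_def]
      have sub: "{s..t} \<subseteq> {0..T}" using st by auto
      have b1i: "b1 integrable_on {s..t}" by (intro integrable_continuous_real continuous_on_subset[OF b1c sub])
      have bl: "bounded_linear (\<lambda>x. \<iota> x \<bullet> \<iota> q)"
        by (rule bounded_linear_compose[OF bounded_linear_inner_left blinfun.bounded_linear_right])
      have ib: "\<iota> (b t - b s) \<bullet> \<iota> q = integral {s..t} (\<lambda>r. \<iota> (b1 r) \<bullet> \<iota> q)"
        using integral_linear[OF b1i bl] unfolding b_diff[OF st] by (simp add: o_def)
      have b1i': "(\<lambda>r. \<iota> (b1 r) \<bullet> \<iota> q) integrable_on {s..t}" using integrable_linear[OF b1i bl] by (simp add: o_def)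
      have "(U t - U s) \<bullet> \<iota> q = (p0 t - p0 s) \<bullet> \<iota> q - \<iota> (b t - b s) \<bullet> \<iota> q"
        by (simp add: U_def inner_diff_left blinfun.diff_right)
      also have "\<dots> = integral {s..t} (\<lambda>r. ?v r - \<iota> (b1 r) \<bullet> \<iota> q)"
        unfolding ib w(1)[OF st]
        by (intro integral_diff[symmetric] b1i' bint_integrable bint_subinterval[OF w(2)[OF st] sub])
      also have "\<dots> = integral {s..t} (\<lambda>r. G r q - A (U r) (\<iota> q) - L (u r) q)"
      proof -
        obtain S where S: "negligible S" "\<And>t. t \<in> {0..T} - S \<Longrightarrow> m0 t = Di (blinfun_inner_right (fr t)) - Di (K (u t + b t))"
          using m0_eq unfolding AE_lebesgue_on_iff_negligible by blast
        show ?thesis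
        proof (rule integral_spike[OF S(1)])
          fix r assume r: "r \<in> {s..t} - S"
          have m: "m0 r = Di (blinfun_inner_right (fr r)) - Di (K (u r + b r))" using S(2)[of r] r sub by auto
          have L_eq: "L x q = K q (Di (K x))" for x by (simp add: L_def Lop_apply Di_def)
          have "K q (m0 r) = \<Lambda>F (fr r) q - L (u r) q - L (b r) q"
            unfolding m \<Lambda>F_def L_eq by (simp add: blinfun.diff_right blinfun.add_right Dil.add Dil.diff)
          then show "G r q - A (U r) (\<iota> q) - L (u r) q = ?v r - \<iota> (b1 r) \<bullet> \<iota> q"
            by (simp add: G_def U_def \<Lambda>A_def \<Lambda>I_def b_def b1_def blinfun.diff_right blinfun.diff_left blinfun.add_left)
        qed
      qed
      finally show ?thesis .
    qed
    define u0 where "u0 = p_in - b 0"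
    have u0: "u0 \<in> Y" using p_in by (simp add: u0_def Y_def Pker_def b_def hr_def BR blinfun.diff_right)
    have U0: "U 0 = \<iota> u0" by (simp add: U_def u0_def p0 blinfun.diff_right)
    have ps: "G 0 q - A (\<iota> u0) (\<iota> q) - L u0 q = pstar \<bullet> \<iota> q" if q: "q \<in> Y" for q
      unfolding pstar[OF q]
      by (simp add: G_def u0_def \<Lambda>A_def \<Lambda>I_def b_def gr_def hr_def h1r_def fr_def Ll.diff
          blinfun.diff_right blinfun.diff_left blinfun.add_left)
    interpret CS: compatible_solution \<iota> A L Y \<alpha> T u U G u0 pstar N
    proof unfold_locales
      show "continuous_on {0..T} G" by (rule prim_continuous[OF pG])
      show "(norm (G t - G s))\<^sup>2 \<le> (t - s) * N" if "0 \<le> s" "s \<le> t" "t \<le> T" for s t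
        using prim_diff_sq_le[OF pG that] mult_left_mono[OF G'N, of "t - s"] that by simp
      show "integral {0..T - \<delta>} (\<lambda>t. (norm (G (t + \<delta>) - G t))\<^sup>2) \<le> \<delta>\<^sup>2 * N" if "0 \<le> \<delta>" "\<delta> \<le> T" for \<delta>
        using prim_integral_diff_sq_le[OF pG that] mult_left_mono[OF G'N zero_le_power2[of \<delta>]] by linarith
    qed (rule u uY Uc Uu eq u0 U0 ps N0, (assumption+)?)+
    have M_le: "CS.M \<le> cM * X"
    proof -
      have "CS.M = cb / \<alpha> * (ca * (N / \<alpha> + (norm pstar)\<^sup>2) + 2 * N / \<alpha>)"
        unfolding CS.M_def CS.ca_def CS.cb_def ca_def cb_def ..
      also have "\<dots> \<le> cb / \<alpha> * (ca * (N / \<alpha> + X) + 2 * N / \<alpha>)"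
        using X_ge(3) \<alpha>(1) by (intro mult_left_mono add_mono) (auto simp: ca_def cb_def)
      also have "\<dots> = cM * X" unfolding cM_def N_def by (simp add: algebra_simps)
      finally show ?thesis .
    qed
    obtain V where V: "continuous_on {0..T} V" "AE t in lebesgue_on {0..T}. V t = u t" "\<And>t. t \<in> {0..T} \<Longrightarrow> V t \<in> Y"
      "\<And>t. t \<in> {0..T} \<Longrightarrow> U t = \<iota> (V t)" using CS.continuous_representative by blast
    define Vp where "Vp t = V t + b t" for t
    define M where "M t = Di (blinfun_inner_right (fr t)) - Di (K (Vp t))" for t
    have frc: "continuous_on {0..T} fr" by (rule prim_continuous[OF pf])
    have Vpc: "continuous_on {0..T} Vp" unfolding Vp_def by (intro continuous_intros V bc)
    have Mc: "continuous_on {0..T} M" unfolding M_def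
      by (intro continuous_on_diff bounded_linear.continuous_on[OF bl5] bounded_linear.continuous_on[OF bl6] frc Vpc)
    have Mm0: "AE t in lebesgue_on {0..T}. M t = m0 t"
      using m0_eq V(2) by eventually_elim (simp add: M_def Vp_def)
    have pt: "p0 t = \<iota> (Vp t) \<and> B (Vp t) = crep T h t \<and> K (Vp t) + D (M t) = blinfun_inner_right (crep T f t)" if t: "t \<in> {0..T}" for t
    proof (intro conjI)
      show "p0 t = \<iota> (Vp t)" using V(4)[OF t] by (simp add: U_def Vp_def blinfun.add_right algebra_simps)
      show "B (Vp t) = crep T h t" using V(3)[OF t] by (simp add: Vp_def Y_def Pker_def b_def BR hr_def blinfun.add_right)
      show "K (Vp t) + D (M t) = blinfun_inner_right (crep T f t)" by (simp add: M_def blinfun.diff_right DDi fr_def)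
    qed
    have Mdiff: "integral {0..T - \<delta>} (\<lambda>t. (norm (M (t + \<delta>) - M t))\<^sup>2) \<le> \<delta>\<^sup>2 * (C * X)" if \<delta>: "0 < \<delta>" "\<delta> < T" for \<delta>
    proof -
      let ?f = "\<lambda>t. (norm (fr (t + \<delta>) - fr t))\<^sup>2" and ?v = "\<lambda>t. (norm (V (t + \<delta>) - V t))\<^sup>2" and ?h = "\<lambda>t. (norm (hr (t + \<delta>) - hr t))\<^sup>2"
      have ci: "(\<lambda>t. (norm (w (t + \<delta>) - w t))\<^sup>2) integrable_on {0..T - \<delta>}" if "continuous_on {0..T} w" for w :: "real \<Rightarrow> 'z::banach"
        using \<delta> by (intro integrable_continuous_real continuous_intros continuous_on_compose2[OF that]) auto
      have hrc: "continuous_on {0..T} hr" by (rule prim_continuous[OF ph1])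
      have i1: "?f integrable_on {0..T - \<delta>}" and i2: "?v integrable_on {0..T - \<delta>}" and i3: "?h integrable_on {0..T - \<delta>}"
        and i4: "(\<lambda>t. (norm (M (t + \<delta>) - M t))\<^sup>2) integrable_on {0..T - \<delta>}"
        using \<delta> by (intro integrable_continuous_real continuous_intros continuous_on_compose2[OF frc] continuous_on_compose2[OF V(1)]
          continuous_on_compose2[OF hrc] continuous_on_compose2[OF Mc]; auto)+
      have "integral {0..T - \<delta>} (\<lambda>t. (norm (M (t + \<delta>) - M t))\<^sup>2) \<le> integral {0..T - \<delta>} (\<lambda>t. 4 * \<kappa>2\<^sup>2 * (?f t + ?v t + ?h t))"
      proof (rule integral_le[OF i4])
        show "(\<lambda>t. 4 * \<kappa>2\<^sup>2 * (?f t + ?v t + ?h t)) integrable_on {0..T - \<delta>}"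
          by (intro integrable_on_mult_right integrable_add i1 i2 i3)
        fix t
        define x where "x = norm (fr (t + \<delta>) - fr t)"
        define y where "y = norm (V (t + \<delta>) - V t)"
        define z where "z = norm (hr (t + \<delta>) - hr t)"
        have "M (t + \<delta>) - M t = Di (blinfun_inner_right (fr (t + \<delta>) - fr t)) - Di (K (V (t + \<delta>) - V t)) - Di (K (R (hr (t + \<delta>) - hr t)))"
          unfolding M_def Vp_def b_def
          by (simp add: blinfun.diff_right blinfun.add_right Dil.add Dil.diff Rl.diff linear_diff[OF bounded_linear.linear[OF bounded_linear_blinfun_inner_right]])
        then have "norm (M (t + \<delta>) - M t) \<le> norm (Di (blinfun_inner_right (fr (t + \<delta>) - fr t))) + norm (Di (K (V (t + \<delta>) - V t))) + norm (Di (K (R (hr (t + \<delta>) - hr t))))"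
          using norm_triangle_ineq4[of "Di (blinfun_inner_right (fr (t + \<delta>) - fr t)) - Di (K (V (t + \<delta>) - V t))" "Di (K (R (hr (t + \<delta>) - hr t)))"]
            norm_triangle_ineq4[of "Di (blinfun_inner_right (fr (t + \<delta>) - fr t))" "Di (K (V (t + \<delta>) - V t))"] by simp
        also have "\<dots> \<le> C5 * x + C6 * y + C7 * z" unfolding x_def y_def z_def by (intro add_mono C5 C6 C7)
        also have "\<dots> \<le> \<kappa>2 * x + \<kappa>2 * y + \<kappa>2 * z"
          using C5(1) C6(1) C7(1) unfolding \<kappa>2_def x_def y_def z_def by (intro add_mono mult_right_mono) auto
        also have "\<dots> = \<kappa>2 * (x + y + z + 0)" by (simp add: algebra_simps)
        finally have "(norm (M (t + \<delta>) - M t))\<^sup>2 \<le> (\<kappa>2 * (x + y + z + 0))\<^sup>2" by (intro power_mono) auto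
        also have "\<dots> \<le> \<kappa>2\<^sup>2 * (4 * (x\<^sup>2 + y\<^sup>2 + z\<^sup>2 + 0\<^sup>2))" unfolding power_mult_distrib by (intro mult_left_mono sum_power2_4) simp
        finally show "(norm (M (t + \<delta>) - M t))\<^sup>2 \<le> 4 * \<kappa>2\<^sup>2 * (?f t + ?v t + ?h t)"
          unfolding x_def y_def z_def by (simp add: algebra_simps)
      qed
      also have "\<dots> = 4 * \<kappa>2\<^sup>2 * (integral {0..T - \<delta>} ?f + integral {0..T - \<delta>} ?v + integral {0..T - \<delta>} ?h)"
        by (intro integral_unique has_integral_mult_right has_integral_add integrable_integral i1 i2 i3)
      also have "\<dots> \<le> 4 * \<kappa>2\<^sup>2 * (\<delta>\<^sup>2 * X + \<delta>\<^sup>2 * (cM * X) + \<delta>\<^sup>2 * X)"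
      proof (intro mult_left_mono add_mono)
        show "integral {0..T - \<delta>} ?f \<le> \<delta>\<^sup>2 * X"
          using prim_integral_diff_sq_le[OF pf, of \<delta>] mult_left_mono[OF X_ge(1) zero_le_power2[of \<delta>]] \<delta> unfolding iwf by linarith
        show "integral {0..T - \<delta>} ?h \<le> \<delta>\<^sup>2 * X"
          using prim_integral_diff_sq_le[OF ph1, of \<delta>] mult_left_mono[OF X_ge(2) zero_le_power2[of \<delta>]] \<delta> unfolding iwh1 by linarith
        show "integral {0..T - \<delta>} ?v \<le> \<delta>\<^sup>2 * (cM * X)"
          using CS.difference_quotient_bound[OF V(1,2) \<delta>] mult_left_mono[OF M_le zero_le_power2[of \<delta>]] by linarith
      qed simp
      also have "\<dots> = \<delta>\<^sup>2 * (C * X)" unfolding C_def by (simp add: algebra_simps)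
      finally show ?thesis .
    qed
    show "\<exists>V M. continuous_on {0..T} V \<and> continuous_on {0..T} M \<and> (AE t in lebesgue_on {0..T}. M t = m0 t) \<and>
      (\<forall>t\<in>{0..T}. p0 t = \<iota> (V t) \<and> B (V t) = crep T h t \<and> K (V t) + D (M t) = blinfun_inner_right (crep T f t)) \<and>
      (\<forall>\<delta>. 0 < \<delta> \<longrightarrow> \<delta> < T \<longrightarrow> integral {0..T - \<delta>} (\<lambda>t. (norm (M (t + \<delta>) - M t))\<^sup>2)
          \<le> \<delta>\<^sup>2 * (C * ((norm pstar)\<^sup>2 + H1_sqnorm T f + W_sqnorm T B g + H2_sqnorm T h)))"
      using Vpc Mc Mm0 pt Mdiff unfolding X_def by blast
  qed
qed

section \<open>The error estimate\<close>

lemma steklov_Pair: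
  fixes u :: "real \<Rightarrow> 'a::banach" and v :: "real \<Rightarrow> 'b::banach"
  assumes u: "u integrable_on {t..t + \<eta>}" and v: "v integrable_on {t..t + \<eta>}"
  shows "steklov \<eta> (\<lambda>s. (u s, v s)) t = (steklov \<eta> u t, steklov \<eta> v t)"
proof -
  have uv: "(\<lambda>s. (u s, v s)) integrable_on {t..t + \<eta>}"
    using integrable_add[OF integrable_linear[OF u bounded_linear_Pair[OF bounded_linear_ident bounded_linear_zero]]
        integrable_linear[OF v bounded_linear_Pair[OF bounded_linear_zero bounded_linear_ident]]]
    by (simp add: o_def)
  show ?thesis
    using steklov_linear[OF bounded_linear_fst uv] steklov_linear[OF bounded_linear_snd uv]
    by (intro prod_eqI) simp_all
qed

lemma steklov_cong_AE:
  assumes "AE s in lebesgue_on {0..T}. u s = v s" and "{t..t + \<eta>} \<subseteq> {0..T}"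
  shows "steklov \<eta> u t = steklov \<eta> v t"
proof -
  obtain N where N: "negligible N" "\<And>t. t \<in> {0..T} - N \<Longrightarrow> u t = v t"
    using assms(1) unfolding AE_lebesgue_on_iff_negligible by blast
  show ?thesis unfolding steklov_def
    by (intro arg_cong2[where f = scaleR] refl integral_spike[OF N(1)]) (use N(2) assms(2) in fastforce)
qed

lemma steklov_derivative:
  assumes "H1_primitive T U w" "0 \<le> t" "0 < \<delta>" "t + \<delta> \<le> T"
  shows "steklov \<delta> w t = (1 / \<delta>) *\<^sub>R (U (t + \<delta>) - U t)"
  using prim_diff_eq[OF assms(1,2), of "t + \<delta>"] assms(3,4) by (simp add: steklov_def)

lemma power2_norm_prod: "(norm z)\<^sup>2 = (norm (fst z))\<^sup>2 + (norm (snd z))\<^sup>2"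
  for z :: "'a::real_inner \<times> 'b::real_inner"
  by (simp add: power2_norm_eq_inner inner_prod_def)

lemma C0_semigroup_on_0: "C0_semigroup_on X S \<Longrightarrow> x \<in> X \<Longrightarrow> S 0 x = x"
  unfolding C0_semigroup_on_def by simp

lemma projected_semigroup_of_C0_semigroup:
  fixes S :: "real \<Rightarrow> 'e::{real_inner,banach} \<Rightarrow> 'e"
  assumes S: "C0_semigroup_on X S" and P: "bounded_linear P" "\<And>x. P x \<in> X" "\<And>x. x \<in> X \<Longrightarrow> P x = x"
  shows "projected_semigroup (\<lambda>t x. S t (P x))"
    and "projected_semigroup.gen (\<lambda>t x. S t (P x)) x y \<longleftrightarrow> (x, y) \<in> generator_on X S"
proof -
  interpret P: bounded_linear P by (rule P)
  have inX: "S t x \<in> X" if "0 \<le> t" "x \<in> X" for t x using S that unfolding C0_semigroup_on_def by simp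
  have Sadd: "S t (x + y) = S t x + S t y" if "0 \<le> t" "x \<in> X" "y \<in> X" for t x y
    using S that unfolding C0_semigroup_on_def by simp
  have Sscale: "S t (a *\<^sub>R x) = a *\<^sub>R S t x" if "0 \<le> t" "x \<in> X" for t a x
    using S that unfolding C0_semigroup_on_def by simp
  note S0 = C0_semigroup_on_0[OF S]
  have Scomp: "S (s + t) x = S s (S t x)" if "0 \<le> s" "0 \<le> t" "x \<in> X" for s t x
    using S that unfolding C0_semigroup_on_def by simp
  have Slim: "((\<lambda>t. S t x) \<longlongrightarrow> x) (at_right 0)" if "x \<in> X" for x
    using S that unfolding C0_semigroup_on_def by simp
  show ps: "projected_semigroup (\<lambda>t x. S t (P x))"
  proof (rule projected_semigroup.intro)
    fix t :: real assume t: "0 \<le> t"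
    obtain C where C: "\<And>x. x \<in> X \<Longrightarrow> norm (S t x) \<le> C * norm x"
      using S t unfolding C0_semigroup_on_def by meson
    obtain C' where C': "\<And>x. norm (P x) \<le> norm x * C'" using P.bounded by blast
    show "bounded_linear (\<lambda>x. S t (P x))"
    proof (rule bounded_linear_intro[where K = "\<bar>C\<bar> * C'"])
      show "S t (P (x + y)) = S t (P x) + S t (P y)" for x y
        unfolding P.add by (intro Sadd t P(2))
      show "S t (P (r *\<^sub>R x)) = r *\<^sub>R S t (P x)" for r x
        unfolding P.scaleR by (intro Sscale t P(2))
      show "norm (S t (P x)) \<le> norm x * (\<bar>C\<bar> * C')" for x
      proof -
        have "norm (S t (P x)) \<le> C * norm (P x)" by (rule C[OF P(2)])
        also have "\<dots> \<le> \<bar>C\<bar> * norm (P x)" by (intro mult_right_mono) auto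
        also have "\<dots> \<le> \<bar>C\<bar> * (norm x * C')" by (intro mult_left_mono C') auto
        finally show ?thesis by (simp add: mult_ac)
      qed
    qed
  next
    fix s t :: real and x assume "0 \<le> s" "0 \<le> t"
    then show "S (s + t) (P x) = S s (P (S t (P x)))"
      using Scomp[of s t "P x"] P(2)[of x] P(3)[OF inX[of t "P x"]] by simp
  next
    fix x
    show "((\<lambda>t. S t (P x)) \<longlongrightarrow> S 0 (P x)) (at_right 0)"
      using Slim[OF P(2)] S0[OF P(2)] by simp
  qed
  show "projected_semigroup.gen (\<lambda>t x. S t (P x)) x y \<longleftrightarrow> (x, y) \<in> generator_on X S"
  proof
    assume "projected_semigroup.gen (\<lambda>t x. S t (P x)) x y"
    then have x: "S 0 (P x) = x" and lim: "((\<lambda>t. (1 / t) *\<^sub>R (S t (P x) - x)) \<longlongrightarrow> y) (at_right 0)"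
      unfolding projected_semigroup.gen_def[OF ps] by auto
    have xX: "x \<in> X" using x S0[OF P(2)[of x]] P(2)[of x] by simp
    \<comment> \<open>the range of the projection is closed, so it contains the limit\<close>
    have "((\<lambda>t. P ((1 / t) *\<^sub>R (S t (P x) - x))) \<longlongrightarrow> P y) (at_right 0)" by (rule P.tendsto[OF lim])
    moreover have "\<forall>\<^sub>F t in at_right 0. P ((1 / t) *\<^sub>R (S t (P x) - x)) = (1 / t) *\<^sub>R (S t (P x) - x)"
      by (rule eventually_at_rightI[of 0 1]) (use P(3) inX P(2) xX in \<open>auto simp: P.scaleR P.diff\<close>)
    ultimately have "((\<lambda>t. (1 / t) *\<^sub>R (S t (P x) - x)) \<longlongrightarrow> P y) (at_right 0)" by (rule Lim_transform_eventually)
    then have "y = P y" by (rule tendsto_unique[OF trivial_limit_at_right_real lim])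
    then have "y \<in> X" using P(2)[of y] by simp
    then show "(x, y) \<in> generator_on X S" using xX lim P(3)[OF xX] unfolding generator_on_def by simp
  next
    assume "(x, y) \<in> generator_on X S"
    then show "projected_semigroup.gen (\<lambda>t x. S t (P x)) x y"
      using P(3)[of x] S0[of x] unfolding projected_semigroup.gen_def[OF ps] generator_on_def by simp
  qed
qed

text \<open>The two terms with \<open>K\<close> cancel. What remains is the form of \<open>D\<close>, which has a sign, and the form of \<open>A\<close>, which is bounded.\<close>

lemma A_graph_dissipative:
  fixes \<iota> :: "'p::{real_inner,banach} \<Rightarrow>\<^sub>L 'h::{real_inner,banach}" and A :: "'h \<Rightarrow>\<^sub>L ('h \<Rightarrow>\<^sub>L real)"
    and K :: "'p \<Rightarrow>\<^sub>L ('m::{real_inner,banach} \<Rightarrow>\<^sub>L real)" and D :: "'m \<Rightarrow>\<^sub>L ('m \<Rightarrow>\<^sub>L real)" and B :: "'p \<Rightarrow>\<^sub>L ('q::{real_inner,banach} \<Rightarrow>\<^sub>L real)"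
  assumes D: "\<And>m. c\<^sub>D * (norm m)\<^sup>2 \<le> D m m" and \<gamma>: "\<gamma> > 0" and xy: "(x, y) \<in> A_graph \<iota> A K D B \<gamma>"
  shows "x \<bullet> ((1 / \<gamma>) *\<^sub>R y) \<le> norm A * (norm (fst x))\<^sup>2 - c\<^sub>D / \<gamma>\<^sup>2 * (norm (snd x))\<^sup>2"
proof -
  obtain q n n' where x: "x = (\<iota> q, n)" and q: "q \<in> Pker B" and n': "n' \<in> Hker \<iota> B" "\<forall>q'\<in>Pker B. n' \<bullet> \<iota> q' = dual_op K n q'"
    and y: "y = (riesz_rep (Hker \<iota> B) (\<lambda>w. - \<gamma> * A (\<iota> q) w + n' \<bullet> w), riesz_rep UNIV (\<lambda>\<mu>. - K q \<mu> - (1 / \<gamma>) * D n \<mu>))"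
    using xy unfolding A_graph_def by blast
  have bl1: "bounded_linear (\<lambda>w. - \<gamma> * A (\<iota> q) w + n' \<bullet> w)"
    by (intro bounded_linear_add bounded_linear_inner_right bounded_linear_const_mult blinfun.bounded_linear_right)
  have bl2: "bounded_linear (\<lambda>\<mu>. - K q \<mu> - (1 / \<gamma>) * D n \<mu>)"
    by (intro bounded_linear_sub bounded_linear_minus bounded_linear_const_mult blinfun.bounded_linear_right)
  have 1: "\<iota> q \<bullet> fst y = - \<gamma> * A (\<iota> q) (\<iota> q) + K q n"
    using riesz_rep_inner[OF subspace_Hker closed_Hker bl1 image_Pker_Hker[OF q]] n'(2) q
    by (simp add: y inner_commute)
  have 2: "n \<bullet> snd y = - K q n - (1 / \<gamma>) * D n n"
    using riesz_rep_inner[OF subspace_UNIV closed_UNIV bl2, of n] by (simp add: y inner_commute)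
  have "x \<bullet> ((1 / \<gamma>) *\<^sub>R y) = (1 / \<gamma>) * (\<iota> q \<bullet> fst y + n \<bullet> snd y)"
    by (simp add: x inner_prod_def distrib_left)
  also have "\<dots> = - A (\<iota> q) (\<iota> q) - (1 / \<gamma>\<^sup>2) * D n n"
    unfolding 1 2 using \<gamma> by (simp add: field_simps power2_eq_square)
  also have "\<dots> \<le> norm A * (norm (\<iota> q))\<^sup>2 - (1 / \<gamma>\<^sup>2) * (c\<^sub>D * (norm n)\<^sup>2)"
  proof (intro diff_mono mult_left_mono D)
    have "\<bar>A (\<iota> q) (\<iota> q)\<bar> \<le> norm (A (\<iota> q)) * norm (\<iota> q)" using norm_blinfun[of "A (\<iota> q)" "\<iota> q"] by simp
    also have "\<dots> \<le> norm A * norm (\<iota> q) * norm (\<iota> q)" by (intro mult_right_mono norm_blinfun) simp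
    finally show "- A (\<iota> q) (\<iota> q) \<le> norm A * (norm (\<iota> q))\<^sup>2" by (simp add: power2_eq_square mult.assoc)
  qed simp
  finally show ?thesis by (simp add: x)
qed

text \<open>Riesz representation and orthogonal projection exhibit the right-hand side as a linear image of the data,
  so that it is integrable and averages pass through it.\<close>

lemma shifted_rhs_eq:
  fixes \<iota> :: "'p::{real_inner,banach} \<Rightarrow>\<^sub>L 'h::{real_inner,banach}" and B :: "'p \<Rightarrow>\<^sub>L ('q::{real_inner,banach} \<Rightarrow>\<^sub>L real)"
    and K :: "'p \<Rightarrow>\<^sub>L ('m::{real_inner,banach} \<Rightarrow>\<^sub>L real)" and A :: "'h \<Rightarrow>\<^sub>L ('h \<Rightarrow>\<^sub>L real)"
  shows "shifted_rhs \<iota> A K B T \<epsilon> f h pb mb t =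
    ((1 / sqrt \<epsilon>) *\<^sub>R orth_proj (Hker \<iota> B) (norm A *\<^sub>R \<iota> (pb t) - \<iota> (wderiv T pb t)
        - riesz (A (\<iota> (right_inv B (h t)))) - \<iota> (right_inv B (wderiv T h t))),
     (1 / \<epsilon>) *\<^sub>R (f t - riesz (K (right_inv B (h t)))) - wderiv T mb t)"
  unfolding shifted_rhs_def
proof (intro arg_cong2[where f = Pair] riesz_rep_eqI subspace_Hker subspace_UNIV UNIV_I)
  let ?H = "Hker \<iota> B"
  note sc = subspace_Hker[of \<iota> B] closed_Hker[of \<iota> B]
  show "(1 / sqrt \<epsilon>) *\<^sub>R orth_proj ?H (norm A *\<^sub>R \<iota> (pb t) - \<iota> (wderiv T pb t)
        - riesz (A (\<iota> (right_inv B (h t)))) - \<iota> (right_inv B (wderiv T h t))) \<in> ?H"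
    by (intro subspace_scale sc orth_proj_in)
qed (simp_all add: orth_proj_inner[OF subspace_Hker closed_Hker] inner_diff_left riesz_inner algebra_simps)

text \<open>If \<open>z\<close> represents the functional \<open>K\<^sup>* n\<close> on the kernel of \<open>B\<close>, its projection is the element required by the domain,
  and \<open>A\<close> may be subtracted before the projection.\<close>

lemma A_graph_memI:
  fixes \<iota> :: "'p::{real_inner,banach} \<Rightarrow>\<^sub>L 'h::{real_inner,banach}" and B :: "'p \<Rightarrow>\<^sub>L ('q::{real_inner,banach} \<Rightarrow>\<^sub>L real)"
    and K :: "'p \<Rightarrow>\<^sub>L ('m::{real_inner,banach} \<Rightarrow>\<^sub>L real)" and D :: "'m \<Rightarrow>\<^sub>L ('m \<Rightarrow>\<^sub>L real)" and A :: "'h \<Rightarrow>\<^sub>L ('h \<Rightarrow>\<^sub>L real)"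
  assumes d: "d \<in> Pker B" and \<epsilon>: "\<epsilon> > 0" and z: "\<And>q. q \<in> Pker B \<Longrightarrow> K q n = z \<bullet> \<iota> q"
  shows "(((1 / sqrt \<epsilon>) *\<^sub>R \<iota> d, n),
      (1 / sqrt \<epsilon>) *\<^sub>R orth_proj (Hker \<iota> B) (z - riesz (A (\<iota> d))), - (1 / \<epsilon>) *\<^sub>R riesz (K d + D n))
    \<in> {(x, (1 / sqrt \<epsilon>) *\<^sub>R y) |x y. (x, y) \<in> A_graph \<iota> A K D B (sqrt \<epsilon>)}"
proof -
  let ?H = "Hker \<iota> B"
  note sc = subspace_Hker[of \<iota> B] closed_Hker[of \<iota> B]
  have se: "sqrt \<epsilon> > 0" "sqrt \<epsilon> * sqrt \<epsilon> = \<epsilon>" using \<epsilon> by auto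
  define q where "q = (1 / sqrt \<epsilon>) *\<^sub>R d"
  define n' where "n' = orth_proj ?H z"
  have q: "q \<in> Pker B" unfolding q_def by (intro subspace_scale subspace_Pker d)
  have \<iota>q: "\<iota> q = (1 / sqrt \<epsilon>) *\<^sub>R \<iota> d" by (simp add: q_def blinfun.scaleR_right)
  have 1: "riesz_rep ?H (\<lambda>w. - sqrt \<epsilon> * A (\<iota> q) w + n' \<bullet> w) = orth_proj ?H (z - riesz (A (\<iota> d)))"
  proof (rule riesz_rep_eqI[OF sc(1) orth_proj_in[OF sc]])
    fix w assume w: "w \<in> ?H"
    show "orth_proj ?H (z - riesz (A (\<iota> d))) \<bullet> w = - sqrt \<epsilon> * A (\<iota> q) w + n' \<bullet> w"
      using se(1) by (simp add: orth_proj_inner[OF sc w] n'_def inner_diff_left riesz_inner \<iota>q blinfun.scaleR_right blinfun.scaleR_left)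
  qed
  have 2: "riesz_rep UNIV (\<lambda>\<mu>. - K q \<mu> - (1 / sqrt \<epsilon>) * D n \<mu>) = - (1 / sqrt \<epsilon>) *\<^sub>R riesz (K d + D n)"
    by (rule riesz_rep_eqI)
       (auto simp: riesz_inner q_def blinfun.scaleR_right blinfun.scaleR_left blinfun.add_left distrib_left diff_divide_distrib add_divide_distrib)
  have "n' \<in> ?H" unfolding n'_def by (rule orth_proj_in[OF sc])
  moreover have "\<forall>q'\<in>Pker B. n' \<bullet> \<iota> q' = dual_op K n q'"
    unfolding n'_def by (auto simp: orth_proj_inner[OF sc image_Pker_Hker] z)
  ultimately have "((\<iota> q, n), (orth_proj ?H (z - riesz (A (\<iota> d))), - (1 / sqrt \<epsilon>) *\<^sub>R riesz (K d + D n))) \<in> A_graph \<iota> A K D B (sqrt \<epsilon>)"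
    unfolding A_graph_def 1[symmetric] 2[symmetric] using q by blast
  moreover have "(1 / sqrt \<epsilon>) *\<^sub>R (orth_proj ?H (z - riesz (A (\<iota> d))), - (1 / sqrt \<epsilon>) *\<^sub>R riesz (K d + D n)) =
      ((1 / sqrt \<epsilon>) *\<^sub>R orth_proj ?H (z - riesz (A (\<iota> d))), - (1 / \<epsilon>) *\<^sub>R riesz (K d + D n))"
    using se(2) by simp
  ultimately show ?thesis unfolding \<iota>q[symmetric] by (smt (verit, best) mem_Collect_eq)
qed

lemma bint_shifted_rhs:
  fixes \<iota> :: "'p::{real_inner,banach} \<Rightarrow>\<^sub>L 'h::{real_inner,banach}" and A :: "'h \<Rightarrow>\<^sub>L ('h \<Rightarrow>\<^sub>L real)"
    and K :: "'p \<Rightarrow>\<^sub>L ('m::{real_inner,banach} \<Rightarrow>\<^sub>L real)" and B :: "'p \<Rightarrow>\<^sub>L ('q::{real_inner,banach} \<Rightarrow>\<^sub>L real)"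
  assumes T: "0 < T" and B: "0 < inf_sup_const B" and f: "H1 T f" and h: "H1 T h" and pb: "H1 T pb" and mb: "H1 T mb"
  shows "bint 0 T (shifted_rhs \<iota> A K B T \<epsilon> f h pb mb)"
proof -
  note blR = bounded_linear_right_inv[OF B]
  note u = L2_bint[OF H1_L2[OF f T]] L2_bint[OF H1_L2[OF h T]] L2_bint[OF H1_L2[OF pb T]]
    L2_bint[OF H1_wderiv_L2[OF h T]] L2_bint[OF H1_wderiv_L2[OF pb T]] L2_bint[OF H1_wderiv_L2[OF mb T]]
  have R: "bint 0 T (\<lambda>s. right_inv B (h s))" "bint 0 T (\<lambda>s. right_inv B (wderiv T h s))"
    by (intro bint_linear[OF blR] u)+
  note bl = blinfun.bounded_linear_right
  have "bint 0 T (\<lambda>s. norm A *\<^sub>R \<iota> (pb s) - \<iota> (wderiv T pb s)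
        - riesz (A (\<iota> (right_inv B (h s)))) - \<iota> (right_inv B (wderiv T h s)))"
    by (intro bint_diff bint_linear[OF bounded_linear_scaleR_right] bint_linear[OF bl[of \<iota>]]
        bint_linear[OF bounded_linear_riesz] bint_linear[OF bl[of A]] u R)
  from bint_linear[OF bounded_linear_scaleR_right bint_linear[OF bounded_linear_orth_proj[OF subspace_Hker closed_Hker] this]]
  have 1: "bint 0 T (\<lambda>s. c *\<^sub>R orth_proj (Hker \<iota> B) (norm A *\<^sub>R \<iota> (pb s) - \<iota> (wderiv T pb s)
        - riesz (A (\<iota> (right_inv B (h s)))) - \<iota> (right_inv B (wderiv T h s))))" for c .
  have 2: "bint 0 T (\<lambda>s. (1 / \<epsilon>) *\<^sub>R (f s - riesz (K (right_inv B (h s)))) - wderiv T mb s)"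
    by (intro bint_diff bint_linear[OF bounded_linear_scaleR_right] bint_linear[OF bounded_linear_riesz]
        bint_linear[OF bl[of K]] u R)
  show ?thesis using bint_Pair[OF 1 2] unfolding shifted_rhs_eq[abs_def] .
qed

definition difference_quotient :: "real \<Rightarrow> (real \<Rightarrow> 'b::real_vector) \<Rightarrow> real \<Rightarrow> 'b" where
  "difference_quotient \<delta> u t = (1 / \<delta>) *\<^sub>R (u (t + \<delta>) - u t)"

text \<open>The limit equations say that, up to the residual \<open>(0, m\<^sub>0')\<close>, the shifted limit solution solves the evolution
  equation of the mild solution. In this regularity the statement makes sense only for moving averages, for
  which \<open>m\<^sub>0'\<close> becomes a difference quotient.\<close>

lemma limit_solution_averages:
  fixes \<iota> :: "'p::{real_inner,banach} \<Rightarrow>\<^sub>L 'h::{real_inner,banach}" and A :: "'h \<Rightarrow>\<^sub>L ('h \<Rightarrow>\<^sub>L real)"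
    and K :: "'p \<Rightarrow>\<^sub>L ('m::{real_inner,banach} \<Rightarrow>\<^sub>L real)" and D :: "'m \<Rightarrow>\<^sub>L ('m \<Rightarrow>\<^sub>L real)"
    and B :: "'p \<Rightarrow>\<^sub>L ('q::{real_inner,banach} \<Rightarrow>\<^sub>L real)"
  assumes T: "0 < T" and inf_sup: "0 < inf_sup_const B" and f: "H1 T f" and g: "W T B g" and h: "H1 T h"
    and sol: "limit_solution \<iota> A K D B T f g h p_in p0 m0"
    and shift: "is_shift \<iota> A K D B T g pb mb" and \<epsilon>: "0 < \<epsilon>"
    and V: "continuous_on {0..T} V" and M: "continuous_on {0..T} M" "AE t in lebesgue_on {0..T}. M t = m0 t"
    and p0V: "\<And>t. t \<in> {0..T} \<Longrightarrow> p0 t = \<iota> (V t)" and BV: "\<And>t. t \<in> {0..T} \<Longrightarrow> B (V t) = crep T h t"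
    and KV: "\<And>t. t \<in> {0..T} \<Longrightarrow> K (V t) + D (M t) = blinfun_inner_right (crep T f t)"
    and \<delta>: "0 < \<delta>" and t: "t \<in> {0..T - \<delta>}"
  defines "y \<equiv> \<lambda>t. ((1 / sqrt \<epsilon>) *\<^sub>R (p0 t - \<iota> (pb t) - \<iota> (right_inv B (crep T h t))), M t - mb t)"
  shows "(steklov \<delta> y t, (1 / \<delta>) *\<^sub>R (y (t + \<delta>) - y t) - steklov \<delta> (shifted_rhs \<iota> A K B T \<epsilon> f h pb mb) t
      - (0, (1 / \<delta>) *\<^sub>R (M (t + \<delta>) - M t)))
    \<in> {(x, (1 / sqrt \<epsilon>) *\<^sub>R y) |x y. (x, y) \<in> A_graph \<iota> A K D B (sqrt \<epsilon>)}"
proof -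
  let ?s = "\<lambda>u. steklov \<delta> u t" and ?Q = "\<lambda>u. difference_quotient \<delta> u t" and ?H = "Hker \<iota> B"
  define R where "R = right_inv B"
  define b where "b s = R (crep T h s)" for s
  have blR: "bounded_linear R" and BR: "\<And>\<mu>. B (R \<mu>) = \<mu>"
    unfolding R_def by (rule bounded_linear_right_inv[OF inf_sup], rule B_right_inv[OF inf_sup])
  interpret R: bounded_linear R by (rule blR)
  interpret Pr: bounded_linear "orth_proj ?H" by (rule bounded_linear_orth_proj[OF subspace_Hker closed_Hker])
  interpret rz: bounded_linear "riesz :: ('h \<Rightarrow>\<^sub>L real) \<Rightarrow> 'h" by (rule bounded_linear_riesz)
  interpret rz': bounded_linear "riesz :: ('m \<Rightarrow>\<^sub>L real) \<Rightarrow> 'm" by (rule bounded_linear_riesz)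
  note bl = blinfun.bounded_linear_right
  have sub: "{t..t + \<delta>} \<subseteq> {0..T}" and tT: "0 \<le> t" "t + \<delta> \<le> T" "t \<in> {0..T}" "t + \<delta> \<in> {0..T}" using t \<delta> by auto
  have ib: "bint 0 T u \<Longrightarrow> u integrable_on {t..t + \<delta>}" for u :: "real \<Rightarrow> 'z::banach"
    using bint_subinterval[OF _ sub] bint_integrable by blast
  have st_cong: "?s u = ?s v" if "\<And>s. s \<in> {0..T} \<Longrightarrow> u s = v s" for u v :: "real \<Rightarrow> 'z::banach"
    by (rule steklov_cong_AE[OF _ sub]) (use that in \<open>auto intro: AE_I2\<close>)
  have st_lin: "?s (\<lambda>s. F (u s)) = F (?s u)" if "bounded_linear F" "bint 0 T u" for F :: "'y::banach \<Rightarrow> 'z::banach" and u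
    by (rule steklov_linear[OF that(1) ib[OF that(2)]])
  have st_diff: "?s (\<lambda>s. u s - v s) = ?s u - ?s v" if "bint 0 T u" "bint 0 T v" for u v :: "real \<Rightarrow> 'z::banach"
    by (rule steklov_diff[OF ib[OF that(1)] ib[OF that(2)]])
  have st_add: "?s (\<lambda>s. u s + v s) = ?s u + ?s v" if "bint 0 T u" "bint 0 T v" for u v :: "real \<Rightarrow> 'z::banach"
    by (rule steklov_add[OF ib[OF that(1)] ib[OF that(2)]])
  have pb: "H1 T pb" "continuous_on {0..T} pb" and mb: "H1 T mb" "continuous_on {0..T} mb"
    and pbY: "\<And>s. s \<in> {0..T} \<Longrightarrow> pb s \<in> Pker B"
    and sh: "AE s in lebesgue_on {0..T}. (\<forall>q\<in>Pker B. A (\<iota> (pb s)) (\<iota> q) + norm A * (\<iota> (pb s) \<bullet> \<iota> q) - dual_op K (mb s) q = g s q) \<and>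
        K (pb s) + D (mb s) = 0"
    using shift unfolding is_shift_def by auto
  have g1: "H1 T (\<lambda>t. ker_restrict B (g t))" using g by (simp add: W_def)
  define hr where "hr = crep T h"
  have hr: "continuous_on {0..T} hr" "AE s in lebesgue_on {0..T}. hr s = h s"
    unfolding hr_def by (rule H1_continuous_crep[OF h T], rule H1_crep_AE[OF h T])
  have fr: "continuous_on {0..T} (crep T f)" "AE s in lebesgue_on {0..T}. crep T f s = f s"
    by (rule H1_continuous_crep[OF f T], rule H1_crep_AE[OF f T])
  have bc: "continuous_on {0..T} b" unfolding b_def hr_def[symmetric] by (intro R.continuous_on hr)
  \<comment> \<open>Averages of weak derivatives are difference quotients.\<close>
  have d_pb: "?s (wderiv T pb) = ?Q pb" and d_mb: "?s (wderiv T mb) = ?Q mb"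
    using steklov_derivative[OF H1_prim[OF pb(1) T] tT(1) \<delta> tT(2)] steklov_derivative[OF H1_prim[OF mb(1) T] tT(1) \<delta> tT(2)]
      crep_eq[OF pb(2) AE_I2 T] crep_eq[OF mb(2) AE_I2 T] tT
    by (simp_all add: difference_quotient_def)
  have d_h: "?s (wderiv T h) = ?Q hr"
    using steklov_derivative[OF H1_prim[OF h T] tT(1) \<delta> tT(2)] by (simp add: difference_quotient_def hr_def)
  have h_eq: "?s h = ?s hr" and f_eq: "?s f = ?s (crep T f)"
    using steklov_cong_AE[OF hr(2) sub] steklov_cong_AE[OF fr(2) sub] by simp_all
  note bi = bint_continuous[OF V] bint_continuous[OF M(1)] bint_continuous[OF pb(2)] bint_continuous[OF mb(2)]
    bint_continuous[OF bc] bint_continuous[OF hr(1)] bint_continuous[OF fr(1)]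
    L2_bint[OF H1_L2[OF f T]] L2_bint[OF H1_L2[OF h T]]
    L2_bint[OF H1_wderiv_L2[OF h T]] L2_bint[OF H1_wderiv_L2[OF pb(1) T]] L2_bint[OF H1_wderiv_L2[OF mb(1) T]]
  note biR = bint_linear[OF blR bi(9)] bint_linear[OF blR bi(10)]
  define w where "w s = V s - pb s - b s" for s
  define d where "d = ?s w"
  define n where "n = ?s M - ?s mb"
  have bw: "bint 0 T w" unfolding w_def by (intro bint_diff bi)
  have d_eq: "d = ?s V - ?s pb - ?s b"
    unfolding d_def w_def[abs_def] by (simp add: st_diff bint_diff bi)
  have b_eq: "?s b = R (?s hr)" unfolding b_def[abs_def] hr_def[symmetric] by (rule st_lin[OF blR bi(6)])
  have wY: "B (w s) = 0" if "s \<in> {0..T}" for s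
    using BV[OF that] pbY[OF that] by (simp add: w_def b_def BR Pker_def blinfun.diff_right)
  have dY: "d \<in> Pker B"
  proof -
    have "B d = ?s (\<lambda>s. B (w s))" unfolding d_def by (rule st_lin[OF bl bw, symmetric])
    also have "\<dots> = ?s (\<lambda>s. 0)" by (rule st_cong[OF wY])
    finally show ?thesis by (simp add: Pker_def steklov_def)
  qed
  have QwY: "?Q w \<in> Pker B" using wY[OF tT(3)] wY[OF tT(4)]
    by (simp add: difference_quotient_def Pker_def blinfun.scaleR_right blinfun.diff_right)
  have y_eq: "y s = ((1 / sqrt \<epsilon>) *\<^sub>R \<iota> (w s), M s - mb s)" if "s \<in> {0..T}" for s
    using p0V[OF that] by (simp add: y_def w_def b_def R_def blinfun.diff_right)
  have blc: "bounded_linear (\<lambda>x. c *\<^sub>R \<iota> x)" for c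
    by (rule bounded_linear_compose[OF bounded_linear_scaleR_right bl])
  have st_y: "?s y = ((1 / sqrt \<epsilon>) *\<^sub>R \<iota> d, n)"
  proof -
    have "?s y = ?s (\<lambda>s. ((1 / sqrt \<epsilon>) *\<^sub>R \<iota> (w s), M s - mb s))" by (rule st_cong[OF y_eq])
    also have "\<dots> = (?s (\<lambda>s. (1 / sqrt \<epsilon>) *\<^sub>R \<iota> (w s)), ?s (\<lambda>s. M s - mb s))"
      by (intro steklov_Pair ib bint_linear[OF blc bw] bint_diff bi)
    finally show ?thesis using st_lin[OF blc bw, of "1 / sqrt \<epsilon>"] by (simp add: d_def n_def st_diff bi)
  qed
  have Q_y: "?Q y = ((1 / sqrt \<epsilon>) *\<^sub>R \<iota> (?Q w), ?Q M - ?Q mb)"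
    using y_eq[OF tT(3)] y_eq[OF tT(4)]
    by (simp add: difference_quotient_def blinfun.scaleR_right blinfun.diff_right algebra_simps)
  define e where "e = norm A *\<^sub>R \<iota> (?s pb) - \<iota> (?Q pb) - riesz (A (\<iota> (?s b))) - \<iota> (?Q b)"
  have Q_b: "?Q b = R (?Q hr)" by (simp add: difference_quotient_def b_def hr_def R.scaleR R.diff)
  have st_F: "?s (shifted_rhs \<iota> A K B T \<epsilon> f h pb mb) =
     ((1 / sqrt \<epsilon>) *\<^sub>R orth_proj ?H e, (1 / \<epsilon>) *\<^sub>R (?s (crep T f) - riesz (K (?s b))) - ?Q mb)"
  proof -
    let ?e = "\<lambda>s. norm A *\<^sub>R \<iota> (pb s) - \<iota> (wderiv T pb s) - riesz (A (\<iota> (R (h s)))) - \<iota> (R (wderiv T h s))"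
    let ?k = "\<lambda>s. f s - riesz (K (R (h s)))"
    have blA: "bounded_linear (\<lambda>x. riesz (A (\<iota> (R x))))" and blK: "bounded_linear (\<lambda>x. riesz (K (R x)))"
      and bl\<iota>: "bounded_linear (\<lambda>x. \<iota> (R x))"
      by (intro bounded_linear_compose[OF bounded_linear_riesz] bounded_linear_compose[OF bl] blR)+
    have blP: "bounded_linear (\<lambda>x. c *\<^sub>R orth_proj ?H x)" for c
      by (rule bounded_linear_compose[OF bounded_linear_scaleR_right Pr.bounded_linear_axioms])
    note b1 = bint_linear[OF blc bi(3)] bint_linear[OF bl bi(11)] bint_linear[OF blA bi(9)] bint_linear[OF bl\<iota> bi(10)]
    have be: "bint 0 T ?e" by (intro bint_diff b1)
    have bk: "bint 0 T ?k" by (intro bint_diff bi bint_linear[OF blK])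
    have e_eq: "?s ?e = e"
      unfolding e_def Q_b b_eq h_eq[symmetric] d_h[symmetric] d_pb[symmetric]
      by (simp only: st_diff bint_diff b1 st_lin[OF blc bi(3)] st_lin[OF bl bi(11)] st_lin[OF blA bi(9)] st_lin[OF bl\<iota> bi(10)])
    have k_eq: "?s ?k = ?s (crep T f) - riesz (K (?s b))"
      unfolding b_eq h_eq[symmetric] f_eq[symmetric]
      by (simp only: st_diff bint_linear[OF blK] bi st_lin[OF blK bi(9)])
    have "?s (shifted_rhs \<iota> A K B T \<epsilon> f h pb mb) = ?s (\<lambda>s. ((1 / sqrt \<epsilon>) *\<^sub>R orth_proj ?H (?e s), (1 / \<epsilon>) *\<^sub>R ?k s - wderiv T mb s))"
      unfolding shifted_rhs_eq[abs_def] R_def ..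
    also have "\<dots> = (?s (\<lambda>s. (1 / sqrt \<epsilon>) *\<^sub>R orth_proj ?H (?e s)), ?s (\<lambda>s. (1 / \<epsilon>) *\<^sub>R ?k s - wderiv T mb s))"
      by (intro steklov_Pair ib bint_linear[OF blP be] bint_diff bint_linear[OF bounded_linear_scaleR_right bk] bi)
    also have "?s (\<lambda>s. (1 / sqrt \<epsilon>) *\<^sub>R orth_proj ?H (?e s)) = (1 / sqrt \<epsilon>) *\<^sub>R orth_proj ?H e"
      unfolding st_lin[OF blP be] e_eq ..
    also have "?s (\<lambda>s. (1 / \<epsilon>) *\<^sub>R ?k s - wderiv T mb s) = (1 / \<epsilon>) *\<^sub>R ?s ?k - ?Q mb"
      unfolding d_mb[symmetric] st_lin[OF bounded_linear_scaleR_right bk, symmetric]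
      by (rule st_diff[OF bint_linear[OF bounded_linear_scaleR_right bk] bi(12)])
    finally show ?thesis unfolding k_eq .
  qed
  \<comment> \<open>The evolution equation of the limit system, averaged, is the condition for the domain of the generator.\<close>
  define z where "z = ?Q p0 + riesz (A (\<iota> (?s V - ?s pb))) - norm A *\<^sub>R \<iota> (?s pb)"
  have z: "K q n = z \<bullet> \<iota> q" if q: "q \<in> Pker B" for q
  proof -
    let ?gr = "crep T (\<lambda>t. ker_restrict B (g t))"
    have blA: "bounded_linear (\<lambda>x. riesz (A (\<iota> x)) \<bullet> \<iota> q)" and bli: "bounded_linear (\<lambda>x. (norm A *\<^sub>R \<iota> x) \<bullet> \<iota> q)"
      by (intro bounded_linear_compose[OF bounded_linear_inner_left] blc bounded_linear_compose[OF bounded_linear_riesz]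
          bounded_linear_compose[OF bl] bl)+
    let ?v = "\<lambda>s. K q (M s - mb s) - riesz (A (\<iota> (V s - pb s))) \<bullet> \<iota> q + (norm A *\<^sub>R \<iota> (pb s)) \<bullet> \<iota> q"
    have bV: "bint 0 T (\<lambda>s. V s - pb s)" and bM: "bint 0 T (\<lambda>s. M s - mb s)" by (intro bint_diff bi)+
    have "?Q p0 \<bullet> \<iota> q = (1 / \<delta>) *\<^sub>R ((p0 (t + \<delta>) - p0 t) \<bullet> \<iota> q)" by (simp add: difference_quotient_def)
    also have "\<dots> = ?s (\<lambda>s. ?gr s q - A (p0 s) (\<iota> q) + K q (m0 s))"
      using limit_solution_weak_eq(1)[OF T g sol q tT(1) _ tT(2)] \<delta> by (simp add: steklov_def)
    also have "\<dots> = ?s ?v"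
    proof (rule steklov_cong_AE[OF _ sub])
      show "AE s in lebesgue_on {0..T}. ?gr s q - A (p0 s) (\<iota> q) + K q (m0 s) = ?v s"
        using sh H1_crep_AE[OF g1 T] M(2) AE_space[of "lebesgue_on {0..T}"]
      proof eventually_elim
        case (elim s)
        have "?gr s q = A (\<iota> (pb s)) (\<iota> q) + norm A * (\<iota> (pb s) \<bullet> \<iota> q) - K q (mb s)"
          using elim q ker_restrict_Pker[OF q, of "g s"] by simp
        moreover have "p0 s = \<iota> (V s)" using elim by (intro p0V) simp
        ultimately show ?case
          using elim(3) by (simp add: riesz_inner blinfun.diff_right blinfun.diff_left)
      qed
    qed
    also have "\<dots> = K q n - riesz (A (\<iota> (?s V - ?s pb))) \<bullet> \<iota> q + (norm A *\<^sub>R \<iota> (?s pb)) \<bullet> \<iota> q"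
      using st_lin[OF bl bM, of "K q"] st_lin[OF blA bV] st_lin[OF bli bi(3)]
        st_diff[OF bint_linear[OF bl bM, of "K q"] bint_linear[OF blA bV]]
        st_add[OF bint_diff[OF bint_linear[OF bl bM, of "K q"] bint_linear[OF blA bV]] bint_linear[OF bli bi(3)]]
        st_diff[OF bi(2,4)] st_diff[OF bi(1,3)]
      by (simp only: n_def)
    finally show ?thesis by (simp add: z_def inner_add_left inner_diff_left)
  qed
  have Qp0: "?Q p0 - \<iota> (?Q pb) - \<iota> (?Q b) = \<iota> (?Q w)"
    using p0V[OF tT(3)] p0V[OF tT(4)] by (simp add: difference_quotient_def w_def blinfun.scaleR_right blinfun.diff_right blinfun.add_right algebra_simps)
  have 1: "\<iota> (?Q w) - orth_proj ?H e = orth_proj ?H (z - riesz (A (\<iota> d)))"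
  proof -
    have "z - riesz (A (\<iota> d)) = \<iota> (?Q w) - e"
      unfolding Qp0[symmetric] z_def e_def d_eq by (simp add: blinfun.diff_right rz.diff)
    then show ?thesis
      using orth_proj_id[OF subspace_Hker closed_Hker image_Pker_Hker[OF QwY], of \<iota>] by (simp add: Pr.diff)
  qed
  have 2: "riesz (K d + D n) = ?s (crep T f) - riesz (K (?s b))"
  proof -
    have bV: "bint 0 T (\<lambda>s. K (V s))" and bM: "bint 0 T (\<lambda>s. D (M s))" and bp: "bint 0 T (\<lambda>s. K (pb s))" and bm: "bint 0 T (\<lambda>s. D (mb s))"
      by (intro bint_linear[OF bl] bi)+
    have "K (?s V) + D (?s M) = ?s (\<lambda>s. K (V s) + D (M s))"
      by (simp only: st_add[OF bV bM] st_lin[OF bl bi(1)] st_lin[OF bl bi(2)])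
    also have "\<dots> = ?s (\<lambda>s. blinfun_inner_right (crep T f s))" by (rule st_cong[OF KV])
    also have "\<dots> = blinfun_inner_right (?s (crep T f))" by (rule st_lin[OF bounded_linear_blinfun_inner_right bi(7)])
    finally have v: "K (?s V) + D (?s M) = blinfun_inner_right (?s (crep T f))" .
    have "K (?s pb) + D (?s mb) = ?s (\<lambda>s. K (pb s) + D (mb s))"
      by (simp only: st_add[OF bp bm] st_lin[OF bl bi(3)] st_lin[OF bl bi(4)])
    also have "\<dots> = ?s (\<lambda>s. 0)" by (rule steklov_cong_AE[OF _ sub]) (use sh in eventually_elim, simp)
    finally have "K (?s pb) + D (?s mb) = 0" by (simp add: steklov_def)
    then have "K d + D n = blinfun_inner_right (?s (crep T f)) - K (?s b)"
      unfolding v[symmetric] d_eq n_def by (simp add: blinfun.diff_right blinfun.add_right algebra_simps)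
    then show ?thesis by (simp add: rz'.diff)
  qed
  have "(1 / \<delta>) *\<^sub>R (y (t + \<delta>) - y t) - ?s (shifted_rhs \<iota> A K B T \<epsilon> f h pb mb) - (0, (1 / \<delta>) *\<^sub>R (M (t + \<delta>) - M t))
      = ((1 / sqrt \<epsilon>) *\<^sub>R orth_proj ?H (z - riesz (A (\<iota> d))), - (1 / \<epsilon>) *\<^sub>R riesz (K d + D n))"
    unfolding 1[symmetric] 2 st_F difference_quotient_def[of \<delta> y t, symmetric] difference_quotient_def[of \<delta> M t, symmetric] Q_y
    by (simp add: scaleR_diff_right)
  then show ?thesis using A_graph_memI[OF dY \<epsilon> z] unfolding st_y by simp
qed

text \<open>In the scaled variables the ellipticity constant of \<open>D\<close> is \<open>c\<^sub>D / \<epsilon>\<close>. The residual is paired with the \<open>m\<close>-component only, so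
  half of this ellipticity absorbs it at the cost of a factor \<open>\<epsilon> / c\<^sub>D\<close>; scaling back gives the second factor \<open>\<epsilon>\<close>.\<close>

lemma singular_limit_error:
  fixes \<iota> :: "'p::{real_inner,banach} \<Rightarrow>\<^sub>L 'h::{real_inner,banach}" and A :: "'h \<Rightarrow>\<^sub>L ('h \<Rightarrow>\<^sub>L real)"
    and K :: "'p \<Rightarrow>\<^sub>L ('m::{real_inner,banach} \<Rightarrow>\<^sub>L real)" and D :: "'m \<Rightarrow>\<^sub>L ('m \<Rightarrow>\<^sub>L real)"
    and B :: "'p \<Rightarrow>\<^sub>L ('q::{real_inner,banach} \<Rightarrow>\<^sub>L real)" and c\<^sub>D T \<epsilon> N :: real
  assumes T: "0 < T" and D: "0 < c\<^sub>D" "\<And>m. c\<^sub>D * (norm m)\<^sup>2 \<le> D m m" and inf_sup: "0 < inf_sup_const B"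
    and f: "H1 T f" and g: "W T B g" and h: "H1 T h" and p_in: "B p_in = crep T h 0"
    and sol: "limit_solution \<iota> A K D B T f g h p_in p0 m0"
    and \<epsilon>: "0 < \<epsilon>" and mild: "eps_mild_solution \<iota> A K D B T \<epsilon> f g h p_in m_in p m"
    and V: "continuous_on {0..T} V" and M: "continuous_on {0..T} M" "AE t in lebesgue_on {0..T}. M t = m0 t"
    and p0V: "\<And>t. t \<in> {0..T} \<Longrightarrow> p0 t = \<iota> (V t)" and BV: "\<And>t. t \<in> {0..T} \<Longrightarrow> B (V t) = crep T h t"
    and KV: "\<And>t. t \<in> {0..T} \<Longrightarrow> K (V t) + D (M t) = blinfun_inner_right (crep T f t)"
    and N: "\<And>\<delta>. 0 < \<delta> \<Longrightarrow> \<delta> < T \<Longrightarrow> integral {0..T - \<delta>} (\<lambda>t. (norm (M (t + \<delta>) - M t))\<^sup>2) \<le> \<delta>\<^sup>2 * N"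
  shows "continuous_on {0..T} (\<lambda>t. m t - M t)"
    and "\<And>t. t \<in> {0..T} \<Longrightarrow> (norm (p t - p0 t))\<^sup>2 + \<epsilon> * (norm (m t - M t))\<^sup>2
        + c\<^sub>D * integral {0..t} (\<lambda>s. (norm (m s - M s))\<^sup>2)
      \<le> exp (2 * norm A * t) * (\<epsilon> * (norm (m_in - M 0))\<^sup>2 + \<epsilon>\<^sup>2 / c\<^sub>D * N)"
proof -
  let ?H = "Hker \<iota> B"
  let ?X = "?H \<times> (UNIV :: 'm set)"
  let ?R = "right_inv B"
  note H = subspace_Hker[of \<iota> B] closed_Hker[of \<iota> B]
  interpret R: bounded_linear ?R by (rule bounded_linear_right_inv[OF inf_sup])
  obtain pb mb where shift: "is_shift \<iota> A K D B T g pb mb"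
    and ms: "is_mild_solution ?X {(x, (1 / sqrt \<epsilon>) *\<^sub>R y) |x y. (x, y) \<in> A_graph \<iota> A K D B (sqrt \<epsilon>)}
          T (shifted_rhs \<iota> A K B T \<epsilon> f h pb mb)
          ((1 / sqrt \<epsilon>) *\<^sub>R \<iota> (p_in - pb 0 - ?R (crep T h 0)), m_in - mb 0)
          (\<lambda>t. ((1 / sqrt \<epsilon>) *\<^sub>R (p t - \<iota> (pb t) - \<iota> (?R (crep T h t))), m t - mb t))"
    using mild unfolding eps_mild_solution_def by blast
  define F where "F = shifted_rhs \<iota> A K B T \<epsilon> f h pb mb"
  define x where "x t = ((1 / sqrt \<epsilon>) *\<^sub>R (p t - \<iota> (pb t) - \<iota> (?R (crep T h t))), m t - mb t)" for t
  define y where "y t = ((1 / sqrt \<epsilon>) *\<^sub>R (p0 t - \<iota> (pb t) - \<iota> (?R (crep T h t))), M t - mb t)" for t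
  define x0 where "x0 = ((1 / sqrt \<epsilon>) *\<^sub>R \<iota> (p_in - pb 0 - ?R (crep T h 0)), m_in - mb 0)"
  have pb: "H1 T pb" "continuous_on {0..T} pb" and mb: "H1 T mb" "continuous_on {0..T} mb"
    and pbY: "\<And>s. s \<in> {0..T} \<Longrightarrow> pb s \<in> Pker B"
    using shift unfolding is_shift_def by auto
  obtain S where S: "C0_semigroup_on ?X S"
    and gen: "generator_on ?X S = {(x, (1 / sqrt \<epsilon>) *\<^sub>R y) |x y. (x, y) \<in> A_graph \<iota> A K D B (sqrt \<epsilon>)}"
    and xS: "\<And>t. t \<in> {0..T} \<Longrightarrow> has_strong_integral (lebesgue_on {0..t}) (\<lambda>s. S (t - s) (F s)) (x t - S t x0)"
    using ms unfolding is_mild_solution_def x_def[abs_def, symmetric] F_def[symmetric] x0_def[symmetric] 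
    by (elim exE conjE) (rule that, assumption, assumption, drule bspec, assumption, erule conjunct2)
  define P where "P z = (orth_proj ?H (fst z), snd z)" for z :: "'h \<times> 'm"
  have P: "bounded_linear P" "\<And>z. P z \<in> ?X" "\<And>z. z \<in> ?X \<Longrightarrow> P z = z"
  proof -
    show "bounded_linear P" unfolding P_def[abs_def]
      by (intro bounded_linear_Pair bounded_linear_snd bounded_linear_compose[OF bounded_linear_orth_proj[OF H] bounded_linear_fst])
    show "P z \<in> ?X" for z using orth_proj_in[OF H] by (simp add: P_def)
    show "P z = z" if "z \<in> ?X" for z using that orth_proj_id[OF H] by (auto simp: P_def)
  qed
  note S0 = C0_semigroup_on_0[OF S]
  define St where "St t z = S t (P z)" for t z
  define Q where "Q z = norm A * (norm (fst z))\<^sup>2 - c\<^sub>D / \<epsilon> * (norm (snd z))\<^sup>2" for z :: "'h \<times> 'm"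
  define Cq where "Cq = norm A + c\<^sub>D / \<epsilon>"
  have c\<epsilon>: "0 < c\<^sub>D / \<epsilon>" using D(1) \<epsilon> by simp
  have psg: "projected_semigroup St" unfolding St_def[abs_def] by (rule projected_semigroup_of_C0_semigroup(1)[OF S P])
  have gen_iff: "projected_semigroup.gen St z z' \<longleftrightarrow>
      (z, z') \<in> {(x, (1 / sqrt \<epsilon>) *\<^sub>R y) |x y. (x, y) \<in> A_graph \<iota> A K D B (sqrt \<epsilon>)}" for z z'
    unfolding gen[symmetric] St_def[abs_def] by (rule projected_semigroup_of_C0_semigroup(2)[OF S P])
  interpret dissipative_semigroup St Q Cq
  proof (rule dissipative_semigroup.intro[OF psg], unfold_locales)
    fix z z' assume "projected_semigroup.gen St z z'"
    then obtain z'' where z': "z' = (1 / sqrt \<epsilon>) *\<^sub>R z''" and G: "(z, z'') \<in> A_graph \<iota> A K D B (sqrt \<epsilon>)"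
      unfolding gen_iff by blast
    have "0 < sqrt \<epsilon>" using \<epsilon> by simp
    from A_graph_dissipative[OF D(2) this G] show "z \<bullet> z' \<le> Q z" using \<epsilon> by (simp add: z' Q_def)
  next
    show "continuous_on UNIV Q" unfolding Q_def[abs_def] by (intro continuous_intros)
    fix z :: "'h \<times> 'm"
    have "\<bar>Q z\<bar> \<le> norm A * (norm (fst z))\<^sup>2 + c\<^sub>D / \<epsilon> * (norm (snd z))\<^sup>2"
      using D(1) \<epsilon> unfolding Q_def by (intro order_trans[OF abs_triangle_ineq4]) (simp add: abs_mult)
    also have "\<dots> \<le> norm A * (norm z)\<^sup>2 + c\<^sub>D / \<epsilon> * (norm z)\<^sup>2"
      using c\<epsilon> by (intro add_mono mult_left_mono) (auto simp: power2_norm_prod)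
    finally show "\<bar>Q z\<bar> \<le> Cq * (norm z)\<^sup>2" by (simp add: Cq_def distrib_right)
  qed
  have FX: "F t \<in> ?X" for t
    unfolding F_def shifted_rhs_eq by (auto intro!: subspace_scale H orth_proj_in)
  have x0X: "x0 \<in> ?X"
  proof -
    have "p_in - pb 0 - ?R (crep T h 0) \<in> Pker B"
      using pbY[of 0] p_in T by (simp add: Pker_def blinfun.diff_right B_right_inv[OF inf_sup])
    then show ?thesis unfolding x0_def by (auto intro!: subspace_scale H image_Pker_Hker)
  qed
  have F: "bint 0 T F" unfolding F_def by (intro bint_shifted_rhs T inf_sup f h pb mb)
  have StF: "St t (F s) = S t (F s)" for t s by (simp add: St_def P(3)[OF FX])
  have Stx0: "St t x0 = S t x0" for t by (simp add: St_def P(3)[OF x0X])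
  have x: "((\<lambda>s. St (t - s) (F s)) has_integral (x t - St t x0)) {0..t}" if "t \<in> {0..T}" for t
    unfolding StF Stx0 by (rule has_strong_integral_imp_has_integral(2)[OF xS[OF that]])
  have "x 0 = S 0 x0" using has_integral_unique[OF x[of 0, unfolded Stx0] has_integral_null_real[of 0 0]] T by simp
  then have x_0: "x 0 = x0" by (simp add: S0[OF x0X])
  have bc: "continuous_on {0..T} (\<lambda>t. ?R (crep T h t))" by (intro R.continuous_on H1_continuous_crep[OF h T])
  have p0: "continuous_on {0..T} p0" "p0 0 = \<iota> p_in" using sol unfolding limit_solution_def by auto
  have y: "continuous_on {0..T} y" unfolding y_def[abs_def] by (intro continuous_intros p0 pb mb bc M)
  define \<rho> where "\<rho> \<delta> t = (1 / \<delta>) *\<^sub>R (M (t + \<delta>) - M t)" for \<delta> t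
  define l where "l z = c\<^sub>D / \<epsilon> * (norm (snd z))\<^sup>2" for z :: "'h \<times> 'm"
  define k where "k \<delta> t = \<epsilon> / c\<^sub>D * (norm (\<rho> \<delta> t))\<^sup>2" for \<delta> t
  have gen_y: "projected_semigroup.gen St (steklov \<delta> y t) ((1 / \<delta>) *\<^sub>R (y (t + \<delta>) - y t) - steklov \<delta> F t - (0, \<rho> \<delta> t))"
    if "0 < \<delta>" "t \<in> {0..T - \<delta>}" for \<delta> t
    unfolding gen_iff \<rho>_def F_def y_def[abs_def]
    by (rule limit_solution_averages[OF T inf_sup f g h sol shift \<epsilon> V M p0V BV KV that])
  have l: "continuous_on UNIV l" "\<And>v. 0 \<le> l v" "\<And>v. l v \<le> c\<^sub>D / \<epsilon> * (norm v)\<^sup>2"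
  proof -
    show "continuous_on UNIV l" unfolding l_def[abs_def] by (intro continuous_intros)
    show "0 \<le> l v" for v using D(1) \<epsilon> by (simp add: l_def)
    show "l v \<le> c\<^sub>D / \<epsilon> * (norm v)\<^sup>2" for v
      unfolding l_def using c\<epsilon> by (intro mult_left_mono) (auto simp: power2_norm_prod)
  qed
  have Mc: "continuous_on {0..T - \<delta>} (\<lambda>t. M (t + \<delta>))" "continuous_on {0..T - \<delta>} M" if "0 < \<delta>" for \<delta>
    using that by (auto intro!: continuous_on_compose2[OF M(1)] continuous_intros continuous_on_subset[OF M(1)])
  have kc: "continuous_on {0..T - \<delta>} (k \<delta>)" if "0 < \<delta>" for \<delta>
    unfolding k_def \<rho>_def by (intro continuous_intros Mc that)
  have k0: "0 \<le> k \<delta> t" for \<delta> t using D(1) \<epsilon> by (simp add: k_def)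
  have \<mu>: "2 * Q v - 2 * (v \<bullet> (0, \<rho> \<delta> t)) \<le> 2 * norm A * (norm v)\<^sup>2 - l v + k \<delta> t" for v \<delta> t
  proof -
    define c where "c = c\<^sub>D / \<epsilon>"
    have c: "0 < c" "\<epsilon> / c\<^sub>D = 1 / c" using c\<epsilon> by (simp_all add: c_def)
    have "0 \<le> (1 / c) * (norm (c *\<^sub>R snd v + \<rho> \<delta> t))\<^sup>2" using c by simp
    also have "\<dots> = c * (norm (snd v))\<^sup>2 + 2 * (snd v \<bullet> \<rho> \<delta> t) + 1 / c * (norm (\<rho> \<delta> t))\<^sup>2"
      unfolding power2_norm_eq_inner using c(1)
      by (simp add: inner_add_left inner_add_right inner_commute field_simps)
    finally have "- (2 * (snd v \<bullet> \<rho> \<delta> t)) \<le> c * (norm (snd v))\<^sup>2 + k \<delta> t" by (simp add: k_def c(2))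
    moreover have "0 \<le> norm A * (2 * (norm (snd v))\<^sup>2)" by simp
    ultimately have "0 \<le> k \<delta> t + (c * (norm (snd v))\<^sup>2 + (2 * (snd v \<bullet> \<rho> \<delta> t) + norm A * (2 * (norm (snd v))\<^sup>2)))"
      by linarith
    then show ?thesis
      unfolding Q_def l_def c_def[symmetric] power2_norm_prod by (simp add: inner_prod_def algebra_simps)
  qed
  have Kc: "integral {0..T - \<delta>} (k \<delta>) \<le> \<epsilon> / c\<^sub>D * N" if "0 < \<delta>" "\<delta> < T" for \<delta>
  proof -
    have "integral {0..T - \<delta>} (k \<delta>) = \<epsilon> / c\<^sub>D * ((1 / \<delta>\<^sup>2) * integral {0..T - \<delta>} (\<lambda>t. (norm (M (t + \<delta>) - M t))\<^sup>2))"
      unfolding k_def \<rho>_def by (simp add: power_mult_distrib power_divide)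
    also have "\<dots> \<le> \<epsilon> / c\<^sub>D * ((1 / \<delta>\<^sup>2) * (\<delta>\<^sup>2 * N))"
      using D(1) \<epsilon> by (intro mult_left_mono N that) auto
    finally show ?thesis using that by simp
  qed
  have SF0: "St 0 (F t) = F t" for t by (simp add: StF S0[OF FX])
  have \<mu>0: "0 \<le> 2 * norm A" by simp
  have xy: "x t - y t = ((1 / sqrt \<epsilon>) *\<^sub>R (p t - p0 t), m t - M t)" for t
    by (simp add: x_def y_def algebra_simps)
  have nxy: "\<epsilon> * (norm (x t - y t))\<^sup>2 = (norm (p t - p0 t))\<^sup>2 + \<epsilon> * (norm (m t - M t))\<^sup>2" for t
    using \<epsilon> by (simp add: xy power2_norm_prod power_mult_distrib power_divide distrib_left)
  have "continuous_on {0..T} x"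
    by (rule comparison_continuous[where F = F and x = x and y = y and l = l and k = k and r = "\<lambda>\<delta> t. (0, \<rho> \<delta> t)",
          OF T F SF0 x y gen_y l kc k0 \<mu>0 \<mu> Kc])
  then have "continuous_on {0..T} (\<lambda>t. snd (x t - y t))" by (intro continuous_intros y)
  then show "continuous_on {0..T} (\<lambda>t. m t - M t)" by (simp add: xy)
  fix t assume t: "t \<in> {0..T}"
  have "(norm (x t - y t))\<^sup>2 + integral {0..t} (\<lambda>s. l (x s - y s))
      \<le> exp (2 * norm A * t) * ((norm (x 0 - y 0))\<^sup>2 + \<epsilon> / c\<^sub>D * N)"
    by (rule comparison_bound[where F = F and x = x and y = y and l = l and k = k and r = "\<lambda>\<delta> t. (0, \<rho> \<delta> t)",
          OF T F SF0 x y gen_y l kc k0 \<mu>0 \<mu> Kc t])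
  then have "\<epsilon> * ((norm (x t - y t))\<^sup>2 + integral {0..t} (\<lambda>s. l (x s - y s)))
      \<le> \<epsilon> * (exp (2 * norm A * t) * ((norm (x 0 - y 0))\<^sup>2 + \<epsilon> / c\<^sub>D * N))"
    using \<epsilon> by (intro mult_left_mono) auto
  moreover have "\<epsilon> * integral {0..t} (\<lambda>s. l (x s - y s)) = c\<^sub>D * integral {0..t} (\<lambda>s. (norm (m s - M s))\<^sup>2)"
    using \<epsilon> by (simp add: l_def xy)
  moreover have "x 0 - y 0 = (0, m_in - M 0)"
    unfolding x_0 x0_def y_def p0(2) by (simp add: blinfun.diff_right)
  ultimately show "(norm (p t - p0 t))\<^sup>2 + \<epsilon> * (norm (m t - M t))\<^sup>2
        + c\<^sub>D * integral {0..t} (\<lambda>s. (norm (m s - M s))\<^sup>2)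
      \<le> exp (2 * norm A * t) * (\<epsilon> * (norm (m_in - M 0))\<^sup>2 + \<epsilon>\<^sup>2 / c\<^sub>D * N)"
    unfolding distrib_left nxy by (simp add: power2_norm_prod power2_eq_square algebra_simps)
qed

theorem theorem4p2:
  shows "\<exists>Cdata :: 'p::{real_inner,banach} \<Rightarrow> 'm::{real_inner,banach} \<Rightarrow>
             real \<Rightarrow> real \<Rightarrow> real \<Rightarrow> real \<Rightarrow> real.
    \<forall>(\<iota> :: 'p \<Rightarrow>\<^sub>L 'h::{real_inner,banach}) (A :: 'h \<Rightarrow>\<^sub>L ('h \<Rightarrow>\<^sub>L real))
      (K :: 'p \<Rightarrow>\<^sub>L ('m \<Rightarrow>\<^sub>L real)) (D :: 'm \<Rightarrow>\<^sub>L ('m \<Rightarrow>\<^sub>L real))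
      (B :: 'p \<Rightarrow>\<^sub>L ('q::{real_inner,banach} \<Rightarrow>\<^sub>L real)) (c\<^sub>D :: real) (T :: real).
      admissible \<iota> A K D B c\<^sub>D \<and> 0 < T \<longrightarrow>
      (\<exists>c>0. \<forall>(f :: real \<Rightarrow> 'm) (g :: real \<Rightarrow> ('p \<Rightarrow>\<^sub>L real)) (h :: real \<Rightarrow> ('q \<Rightarrow>\<^sub>L real))
          (p_in :: 'p) (m_in :: 'm) (pstar :: 'h) (p0 :: real \<Rightarrow> 'h) (m0 :: real \<Rightarrow> 'm)
          (\<epsilon> :: real) (p :: real \<Rightarrow> 'h) (m :: real \<Rightarrow> 'm).
        H1 T f \<and> W T B g \<and> H2 T h \<and>
        B p_in = crep T h 0 \<and>
        pstar \<in> Hker \<iota> B \<and>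
        (\<forall>q\<in>Pker B. pstar \<bullet> \<iota> q =
           crep T (\<lambda>t. ker_restrict B (g t)) 0 q
           - (Lop K D p_in q + A (\<iota> p_in) (\<iota> q))
           - \<iota> (right_inv B (crep T (wderiv T h) 0)) \<bullet> \<iota> q
           + dual_op K (inv (blinfun_apply D) (blinfun_inner_right (crep T f 0))) q) \<and>
        limit_solution \<iota> A K D B T f g h p_in p0 m0 \<and>
        0 < \<epsilon> \<and>
        eps_mild_solution \<iota> A K D B T \<epsilon> f g h p_in m_in p m \<longrightarrow>
        (\<forall>t\<in>{0..T}.
           (norm (p t - p0 t))\<^sup>2 + \<epsilon> * (norm (m t - crep T m0 t))\<^sup>2
           + c\<^sub>D * (LINT s|lebesgue_on {0..t}. (norm (m s - crep T m0 s))\<^sup>2)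
           \<le> c * (\<epsilon> * exp (2 * norm A * t) * (norm (m_in - crep T m0 0))\<^sup>2
                + \<epsilon>\<^sup>2 * exp (4 * norm A * t) *
                  Cdata p_in m_in ((norm pstar)\<^sup>2) (H1_sqnorm T f) (W_sqnorm T B g) (H2_sqnorm T h))))"
proof (intro exI[of _ "\<lambda>_ _ a b c d. a + b + c + d"] allI impI)
  fix \<iota> :: "'p \<Rightarrow>\<^sub>L 'h" and A :: "'h \<Rightarrow>\<^sub>L ('h \<Rightarrow>\<^sub>L real)" and K :: "'p \<Rightarrow>\<^sub>L ('m \<Rightarrow>\<^sub>L real)"
    and D :: "'m \<Rightarrow>\<^sub>L ('m \<Rightarrow>\<^sub>L real)" and B :: "'p \<Rightarrow>\<^sub>L ('q \<Rightarrow>\<^sub>L real)" and c\<^sub>D T :: real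
  assume "admissible \<iota> A K D B c\<^sub>D \<and> 0 < T"
  then have adm: "admissible \<iota> A K D B c\<^sub>D" and T: "0 < T" by auto
  have D: "0 < c\<^sub>D" "\<And>m. c\<^sub>D * (norm m)\<^sup>2 \<le> D m m" and inf_sup: "0 < inf_sup_const B"
    using adm by (auto simp: admissible_def)
  obtain C where C: "0 \<le> C" and reg: "\<forall>f g h p_in pstar p0 m0.
    H1 T f \<and> W T B g \<and> H2 T h \<and> B p_in = crep T h 0 \<and> limit_solution \<iota> A K D B T f g h p_in p0 m0 \<and>
    (\<forall>q\<in>Pker B. pstar \<bullet> \<iota> q =
           crep T (\<lambda>t. ker_restrict B (g t)) 0 q
           - (Lop K D p_in q + A (\<iota> p_in) (\<iota> q))
           - \<iota> (right_inv B (crep T (wderiv T h) 0)) \<bullet> \<iota> q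
           + dual_op K (inv (blinfun_apply D) (blinfun_inner_right (crep T f 0))) q) \<longrightarrow>
    (\<exists>V M. continuous_on {0..T} V \<and> continuous_on {0..T} M \<and> (AE t in lebesgue_on {0..T}. M t = m0 t) \<and>
      (\<forall>t\<in>{0..T}. p0 t = \<iota> (V t) \<and> B (V t) = crep T h t \<and> K (V t) + D (M t) = blinfun_inner_right (crep T f t)) \<and>
      (\<forall>\<delta>. 0 < \<delta> \<longrightarrow> \<delta> < T \<longrightarrow> integral {0..T - \<delta>} (\<lambda>t. (norm (M (t + \<delta>) - M t))\<^sup>2)
          \<le> \<delta>\<^sup>2 * (C * ((norm pstar)\<^sup>2 + H1_sqnorm T f + W_sqnorm T B g + H2_sqnorm T h))))"
    using limit_regularity[OF adm T] by blast
  define c where "c = 1 + C / c\<^sub>D"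
  have c: "0 < c" "1 \<le> c" "C / c\<^sub>D \<le> c" using C D(1) by (auto simp: c_def add_pos_nonneg)
  show "\<exists>c>0. \<forall>(f :: real \<Rightarrow> 'm) (g :: real \<Rightarrow> ('p \<Rightarrow>\<^sub>L real)) (h :: real \<Rightarrow> ('q \<Rightarrow>\<^sub>L real))
          (p_in :: 'p) (m_in :: 'm) (pstar :: 'h) (p0 :: real \<Rightarrow> 'h) (m0 :: real \<Rightarrow> 'm)
          (\<epsilon> :: real) (p :: real \<Rightarrow> 'h) (m :: real \<Rightarrow> 'm).
        H1 T f \<and> W T B g \<and> H2 T h \<and>
        B p_in = crep T h 0 \<and>
        pstar \<in> Hker \<iota> B \<and>
        (\<forall>q\<in>Pker B. pstar \<bullet> \<iota> q =
           crep T (\<lambda>t. ker_restrict B (g t)) 0 q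
           - (Lop K D p_in q + A (\<iota> p_in) (\<iota> q))
           - \<iota> (right_inv B (crep T (wderiv T h) 0)) \<bullet> \<iota> q
           + dual_op K (inv (blinfun_apply D) (blinfun_inner_right (crep T f 0))) q) \<and>
        limit_solution \<iota> A K D B T f g h p_in p0 m0 \<and>
        0 < \<epsilon> \<and>
        eps_mild_solution \<iota> A K D B T \<epsilon> f g h p_in m_in p m \<longrightarrow>
        (\<forall>t\<in>{0..T}.
           (norm (p t - p0 t))\<^sup>2 + \<epsilon> * (norm (m t - crep T m0 t))\<^sup>2
           + c\<^sub>D * (LINT s|lebesgue_on {0..t}. (norm (m s - crep T m0 s))\<^sup>2)
           \<le> c * (\<epsilon> * exp (2 * norm A * t) * (norm (m_in - crep T m0 0))\<^sup>2
                + \<epsilon>\<^sup>2 * exp (4 * norm A * t) *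
                  ((norm pstar)\<^sup>2 + H1_sqnorm T f + W_sqnorm T B g + H2_sqnorm T h)))"
  proof (intro exI[of _ c] conjI c(1) allI impI ballI)
    fix f :: "real \<Rightarrow> 'm" and g :: "real \<Rightarrow> ('p \<Rightarrow>\<^sub>L real)" and h :: "real \<Rightarrow> ('q \<Rightarrow>\<^sub>L real)"
      and p_in :: 'p and m_in :: 'm and pstar :: 'h and p0 :: "real \<Rightarrow> 'h" and m0 :: "real \<Rightarrow> 'm"
      and \<epsilon> :: real and p :: "real \<Rightarrow> 'h" and m :: "real \<Rightarrow> 'm" and t :: real
    assume data: "H1 T f \<and> W T B g \<and> H2 T h \<and> B p_in = crep T h 0 \<and> pstar \<in> Hker \<iota> B \<and>
        (\<forall>q\<in>Pker B. pstar \<bullet> \<iota> q =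
           crep T (\<lambda>t. ker_restrict B (g t)) 0 q
           - (Lop K D p_in q + A (\<iota> p_in) (\<iota> q))
           - \<iota> (right_inv B (crep T (wderiv T h) 0)) \<bullet> \<iota> q
           + dual_op K (inv (blinfun_apply D) (blinfun_inner_right (crep T f 0))) q) \<and>
        limit_solution \<iota> A K D B T f g h p_in p0 m0 \<and> 0 < \<epsilon> \<and>
        eps_mild_solution \<iota> A K D B T \<epsilon> f g h p_in m_in p m"
    assume t: "t \<in> {0..T}"
    define X where "X = (norm pstar)\<^sup>2 + H1_sqnorm T f + W_sqnorm T B g + H2_sqnorm T h"
    have X: "0 \<le> X"
      unfolding X_def H1_sqnorm_def W_sqnorm_def H2_sqnorm_def
      by (intro add_nonneg_nonneg L2_sqnorm_nonneg zero_le_power2)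
    have f: "H1 T f" and g: "W T B g" and h: "H1 T h" and p_in: "B p_in = crep T h 0"
      and sol: "limit_solution \<iota> A K D B T f g h p_in p0 m0" and \<epsilon>: "0 < \<epsilon>"
      and mild: "eps_mild_solution \<iota> A K D B T \<epsilon> f g h p_in m_in p m"
      using data by (auto simp: H2_def)
    have "\<exists>V M. continuous_on {0..T} V \<and> continuous_on {0..T} M \<and> (AE t in lebesgue_on {0..T}. M t = m0 t) \<and>
      (\<forall>t\<in>{0..T}. p0 t = \<iota> (V t) \<and> B (V t) = crep T h t \<and> K (V t) + D (M t) = blinfun_inner_right (crep T f t)) \<and>
      (\<forall>\<delta>. 0 < \<delta> \<longrightarrow> \<delta> < T \<longrightarrow> integral {0..T - \<delta>} (\<lambda>t. (norm (M (t + \<delta>) - M t))\<^sup>2) \<le> \<delta>\<^sup>2 * (C * X))"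
      unfolding X_def by (rule reg[rule_format]) (use data in blast)
    then obtain V M where V: "continuous_on {0..T} V" and M: "continuous_on {0..T} M" "AE t in lebesgue_on {0..T}. M t = m0 t"
      and pt: "\<And>t. t \<in> {0..T} \<Longrightarrow> p0 t = \<iota> (V t)" "\<And>t. t \<in> {0..T} \<Longrightarrow> B (V t) = crep T h t"
        "\<And>t. t \<in> {0..T} \<Longrightarrow> K (V t) + D (M t) = blinfun_inner_right (crep T f t)"
      and N: "\<And>\<delta>. 0 < \<delta> \<Longrightarrow> \<delta> < T \<Longrightarrow> integral {0..T - \<delta>} (\<lambda>t. (norm (M (t + \<delta>) - M t))\<^sup>2) \<le> \<delta>\<^sup>2 * (C * X)"
      by blast
    have est1: "continuous_on {0..T} (\<lambda>s. m s - M s)"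
      by (rule singular_limit_error(1)[OF T D inf_sup f g h p_in sol \<epsilon> mild V M pt N])
    have est2: "(norm (p t - p0 t))\<^sup>2 + \<epsilon> * (norm (m t - M t))\<^sup>2 + c\<^sub>D * integral {0..t} (\<lambda>s. (norm (m s - M s))\<^sup>2)
        \<le> exp (2 * norm A * t) * (\<epsilon> * (norm (m_in - M 0))\<^sup>2 + \<epsilon>\<^sup>2 / c\<^sub>D * (C * X))"
      by (rule singular_limit_error(2)[OF T D inf_sup f g h p_in sol \<epsilon> mild V M _ _ _ _ t]) (use pt N in blast)+
    have M_eq: "crep T m0 s = M s" if "s \<in> {0..T}" for s by (rule crep_eq[OF M T that])
    have "(LINT s|lebesgue_on {0..t}. (norm (m s - crep T m0 s))\<^sup>2) = (LINT s|lebesgue_on {0..t}. (norm (m s - M s))\<^sup>2)"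
      by (rule Bochner_Integration.integral_cong[OF refl]) (use t M_eq in auto)
    also have "\<dots> = integral {0..t} (\<lambda>s. (norm (m s - M s))\<^sup>2)"
      by (intro bint_LINT bint_continuous continuous_intros continuous_on_subset[OF est1]) (use t in auto)
    finally have "(norm (p t - p0 t))\<^sup>2 + \<epsilon> * (norm (m t - crep T m0 t))\<^sup>2
        + c\<^sub>D * (LINT s|lebesgue_on {0..t}. (norm (m s - crep T m0 s))\<^sup>2)
      \<le> exp (2 * norm A * t) * (\<epsilon> * (norm (m_in - crep T m0 0))\<^sup>2 + \<epsilon>\<^sup>2 / c\<^sub>D * (C * X))"
      using est2 M_eq[OF t] M_eq[of 0] T by simp
    also have "\<dots> = 1 * (\<epsilon> * exp (2 * norm A * t) * (norm (m_in - crep T m0 0))\<^sup>2)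
        + (C / c\<^sub>D) * (\<epsilon>\<^sup>2 * exp (2 * norm A * t) * X)" by (simp add: algebra_simps)
    also have "\<dots> \<le> c * (\<epsilon> * exp (2 * norm A * t) * (norm (m_in - crep T m0 0))\<^sup>2) + c * (\<epsilon>\<^sup>2 * exp (4 * norm A * t) * X)"
      using c X \<epsilon> t by (intro add_mono mult_mono) (auto intro: mult_right_mono)
    finally show "(norm (p t - p0 t))\<^sup>2 + \<epsilon> * (norm (m t - crep T m0 t))\<^sup>2
           + c\<^sub>D * (LINT s|lebesgue_on {0..t}. (norm (m s - crep T m0 s))\<^sup>2)
           \<le> c * (\<epsilon> * exp (2 * norm A * t) * (norm (m_in - crep T m0 0))\<^sup>2
                + \<epsilon>\<^sup>2 * exp (4 * norm A * t) *
                  ((norm pstar)\<^sup>2 + H1_sqnorm T f + W_sqnorm T B g + H2_sqnorm T h))"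
      unfolding X_def by (simp add: distrib_left)
  qed
qed

end
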